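(* Let $n\geq3$ and let $S_n$ act on $V=W^*\oplus W$ with basis $\mathcal{B}=\{x_1,\dots,x_n,y_1,\dots,y_n\}$ by the doubled permutation representation. Let $a_1,\dots,a_7,b_1,\dots,b_7,\alpha,\beta,c\in\mathbb{C}$ satisfy $\gamma_1=\cdots=\gamma_{22}=0$ (the polynomials listed in the context). Let $\kappa^L$ (linear) and $\kappa^C$ (constant) be the cochains such that for $1\le i\ne j\le n$ $$\kappa^L(x_i,x_j)=a_1(x_i-x_j)+b_1(y_i-y_j),\qquad \kappa^C(x_i,x_j)=0,$$ $$\kappa^L(y_i,y_j)=a_2(x_i-x_j)+b_2(y_i-y_j),\qquad \kappa^C(y_i,y_j)=0,$$ $$\kappa^L(x_i,y_i)=a_3x_i+a_4x_{[n]}+b_3y_i+b_4y_{[n]},\qquad \kappa^C(x_i,y_i)=\alpha+c\sum_{k\ne i}(ik),$$ $$\kappa^L(x_i,y_j)=a_5x_i+a_6x_j+a_7x_{[n]}+b_5y_i+b_6y_j+b_7y_{[n]},\qquad \kappa^C(x_i,y_j)=\beta-c\,(ij).$$ Then the quotient $\mathcal{H}_{\kappa,t}$ of $T(V)\#S_n[t]$ by the ideal generated by $\{uv-vu-\kappa^L(u,v)t-\kappa^C(u,v)t^2\mid u,v\in\mathcal{B}\}$ is a Lie orbifold algebra over $\mathbb{C}[t]$. In fact, the algebras $\mathcal{H}_{\kappa,1}$ (the specializations at $t=1$) are precisely the Drinfeld orbifold algebras such that $\kappa^L$ is supported only on the identity.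
   Context: For a finite group $G$ acting linearly on a finite-dimensional complex vector space $V$ (action written ${}^{g}v$), and a $\mathbb{C}$-algebra $R$ with $G$-action by automorphisms, $R\#G$ is $R\otimes\mathbb{C}G$ with product $(r\otimes g)(s\otimes h)=r({}^{g}s)\otimes gh$. A 2-cochain is $\kappa=\sum_{g\in G}\kappa_g g$ with components $\kappa_g:\bigwedge^2V\to S(V)$ linear (skew-symmetric bilinear maps; $\kappa(u,v)=\sum_g\kappa_g(u,v)\otimes g$); it is linear if every $\kappa_g$ maps into $V$, constant if every $\kappa_g$ maps into $\mathbb{C}$. It is supported only on the identity if $\kappa_g=0$ for all $g\neq1$. For $\kappa=\kappa^L+\kappa^C$ with $\kappa^L$ linear and $\kappa^C$ constant, $\mathcal{H}_\kappa=T(V)\#G/\langle vw-wv-\kappa^L(v,w)-\kappa^C(v,w)\mid v,w\in V\rangle$ is a Drinfeld orbifold algebra if its associated graded algebra (elements of $V$ in degree one, of $G$ in degree zero) is isomorphic to $S(V)\#G$. In that case $\mathcal{H}_{\kappa,t}=T(V)\#G[t]/\langle vw-wv-\kappa^L(v,w)t-\kappa^C(v,w)t^2\mid v,w\in V\rangle$ is called a Drinfeld orbifold algebra over $\mathbb{C}[t]$; if $\kappa^L$ is supported only on the identity one says Lie orbifold algebra. $W\cong\mathbb{C}^n$ has basis $y_1,\dots,y_n$, $W^*$ has dual basis $x_1,\dots,x_n$, and ${}^{\sigma}y_i=y_{\sigma(i)}$, ${}^{\sigma}x_i=x_{\sigma(i)}$; $x_{[n]}=\sum x_i$, $y_{[n]}=\sum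 y_i$. The 22 polynomials: $\gamma_1=a_1(a_5+a_6+na_7)-b_1a_2-b_5a_6+a_5(b_5+b_6+nb_7)+b_7(a_3-a_5-a_6)$; $\gamma_2=b_1(a_5+a_6+na_7)-b_1b_2+b_1a_5+b_5(b_5-a_1+nb_7)+b_7(b_3-b_5-b_6)$; $\gamma_3=c(b_6-a_1)$; $\gamma_4=-a_2(b_6+b_5+nb_7)-a_2a_1-a_2b_6+a_6(a_6+b_2+na_7)+a_7(a_3-a_6-a_5)$; $\gamma_5=-b_2(b_6+b_5+nb_7)-a_2b_1-a_6b_5+b_6(a_6+a_5+na_7)+a_7(b_3-b_6-b_5)$; $\gamma_6=c(b_2+a_5)$; $\gamma_7=\alpha(a_1-b_6+b_4-b_7)-\beta(a_1-b_3+b_5-(n-1)(b_4-b_7))$; $\gamma_8=a_7(b_3-b_5)-a_4b_6+(b_4-b_7)(a_4+(n-1)a_7+a_6)$; $\gamma_9=a_1(a_3+na_4)+a_5(b_3+nb_4)+b_4(a_3-a_5-a_6)-a_2b_1-b_5a_6$; $\gamma_{10}=-a_1(a_5+a_6+na_7)-a_5(b_5+nb_7)-b_7(a_3-a_5-a_6)+a_2b_1+b_3a_6-a_3b_6$; $\gamma_{11}=b_7(b_3-b_5)-b_4b_6+(b_4-b_7)(a_1+b_4+(n-1)b_7+b_6)-b_1(a_4-a_7)$; $\gamma_{12}=b_1(a_5-b_2+a_3+na_4)-b_5(a_1+b_6-b_3-nb_4)+b_4(b_3-b_5-b_6)$; $\gamma_{13}=b_1(-b_2+a_5+a_3+na_7)+b_5(b_5+nb_7)+b_7(b_3-b_5-b_6)-a_1(b_3-b_6)$;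 $\gamma_{14}=c(2a_1-b_3+b_5-b_6)$; $\gamma_{15}=\alpha(-b_2-a_5+a_4-a_7)+\beta(b_2+a_3-a_6+(n-1)(a_4-a_7))$; $\gamma_{16}=a_7(a_3-a_6)-a_4a_5+(a_4-a_7)(-b_2+a_4+(n-1)a_7+a_5)+a_2(b_4-b_7)$; $\gamma_{17}=-a_2(a_1+b_6+b_3+nb_4)+a_6(b_2-a_5+a_3+na_4)+a_4(a_3-a_5-a_6)$; $\gamma_{18}=a_2(a_1+b_6+b_3+nb_7)-a_6(a_6+na_7)-a_7(a_3-a_5-a_6)-b_2(a_3-a_5)$; $\gamma_{19}=b_7(a_3-a_6)-b_4a_5+(a_4-a_7)(b_4+(n-1)b_7+b_5)$; $\gamma_{20}=-b_2(b_3+nb_4)+b_6(a_3+na_4)+a_4(b_3-b_5-b_6)-a_2b_1-a_6b_5$; $\gamma_{21}=b_2(b_5+b_6+nb_7)-b_6(a_6+na_7)-a_7(b_3-b_5-b_6)+a_2b_1+a_3b_5-b_3a_5$; $\gamma_{22}=c(2b_2+a_3+a_5-a_6)$. *)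

theory Defs
  imports
    "HOL-Analysis.Cartesian_Space"
    "HOL-Library.Poly_Mapping"
    "HOL-Combinatorics.Perm"
    "HOL-Algebra.QuotRing"
    "HOL-Algebra.UnivPoly"
begin

section \<open>Algebras over the complex numbers\<close>

text \<open>
  A complex algebra is a record of type \<open>(complex, 'a) module\<close>: a ring together with a
  scalar multiplication.
\<close>

definition algebra_iso ::
    "(complex, 'a) module \<Rightarrow> (complex, 'b) module \<Rightarrow> ('a \<Rightarrow> 'b) set" where
  "algebra_iso A B =
    {\<phi> \<in> ring_iso A B. \<forall>z. \<forall>a\<in>carrier A. \<phi> (z \<odot>\<^bsub>A\<^esub> a) = z \<odot>\<^bsub>B\<^esub> \<phi> a}"

definition quotient_algebra ::
    "(complex, 'a) module \<Rightarrow> 'a set \<Rightarrow> (complex, 'a set) module" where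
  "quotient_algebra A I =
    \<lparr>carrier = carrier (A Quot I), mult = mult (A Quot I), one = one (A Quot I),
     zero = zero (A Quot I), add = add (A Quot I),
     smult = \<lambda>z X. \<Union>a\<in>X. I +>\<^bsub>A\<^esub> (z \<odot>\<^bsub>A\<^esub> a)\<rparr>"

text \<open>The polynomial algebra \<open>A[t]\<close> with a central indeterminate \<open>t\<close>, as a complex algebra.\<close>

definition polynomial_algebra ::
    "(complex, 'a) module \<Rightarrow> (complex, nat \<Rightarrow> 'a) module" where
  "polynomial_algebra A =
    \<lparr>carrier = carrier (UP A), mult = mult (UP A), one = one (UP A),
     zero = zero (UP A), add = add (UP A),
     smult = \<lambda>z p i. z \<odot>\<^bsub>A\<^esub> p i\<rparr>"

subsection \<open>The associated graded algebra of a filtered algebra\<close>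

text \<open>
  \<open>F m\<close> is the \<open>m\<close>-th piece of an ascending filtration of \<open>A\<close>, and \<open>F (-1) = 0\<close>.
  An element of \<open>\<Oplus>\<^sub>m F m / F (m-1)\<close> is a finitely supported family whose member at \<open>m\<close>
  is a coset of \<open>F (m-1)\<close> in \<open>F m\<close>.
\<close>

definition filt_pred :: "(complex, 'a) module \<Rightarrow> (nat \<Rightarrow> 'a set) \<Rightarrow> nat \<Rightarrow> 'a set" where
  "filt_pred A F m = (case m of 0 \<Rightarrow> {\<zero>\<^bsub>A\<^esub>} | Suc k \<Rightarrow> F k)"

definition assoc_graded ::
    "(complex, 'a) module \<Rightarrow> (nat \<Rightarrow> 'a set) \<Rightarrow> (complex, nat \<Rightarrow> 'a set) module" where
  "assoc_graded A F =
    \<lparr>carrier = {f. (\<forall>m. \<exists>a\<in>F m. f m = filt_pred A F m +>\<^bsub>A\<^esub> a) \<and>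
                   finite {m. f m \<noteq> filt_pred A F m}},
     mult = \<lambda>f h m. \<Union>a\<in>Pi UNIV f. \<Union>b\<in>Pi UNIV h.
                      filt_pred A F m +>\<^bsub>A\<^esub> (\<Oplus>\<^bsub>A\<^esub>i\<in>{..m}. a i \<otimes>\<^bsub>A\<^esub> b (m - i)),
     one = \<lambda>m. filt_pred A F m +>\<^bsub>A\<^esub> (if m = 0 then \<one>\<^bsub>A\<^esub> else \<zero>\<^bsub>A\<^esub>),
     zero = \<lambda>m. filt_pred A F m,
     add = \<lambda>f h m. f m <+>\<^bsub>A\<^esub> h m,
     smult = \<lambda>z f m. \<Union>a\<in>f m. filt_pred A F m +>\<^bsub>A\<^esub> (z \<odot>\<^bsub>A\<^esub> a)\<rparr>"

definition assoc_graded_part ::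
    "(complex, 'a) module \<Rightarrow> (nat \<Rightarrow> 'a set) \<Rightarrow> nat \<Rightarrow> (nat \<Rightarrow> 'a set) set" where
  "assoc_graded_part A F d =
    {f \<in> carrier (assoc_graded A F). \<forall>m. m \<noteq> d \<longrightarrow> f m = filt_pred A F m}"

section \<open>Tensor algebra, symmetric algebra, skew group algebras\<close>

text \<open>
  The vector space is \<open>V = complex ^ 'b\<close>, with basis \<open>axis b 1\<close> for \<open>b :: 'b\<close>. Its tensor algebra
  has as basis the words in the letters \<open>'b\<close>, multiplied by concatenation, and its symmetric
  algebra has as basis the monomials \<open>'b \<Rightarrow>\<^sub>0 nat\<close>; in both cases the product of finitely
  supported functions is the convolution product of \<^theory>\<open>HOL-Library.Poly_Mapping\<close>.
\<close>

datatype 'b tensor_word = TWord (letters: "'b list")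

instantiation tensor_word :: (type) monoid_add
begin

definition zero_tensor_word :: "'b tensor_word" where
  "zero_tensor_word = TWord []"

definition plus_tensor_word :: "'b tensor_word \<Rightarrow> 'b tensor_word \<Rightarrow> 'b tensor_word" where
  "plus_tensor_word u v = TWord (letters u @ letters v)"

instance
  by standard (simp_all add: zero_tensor_word_def plus_tensor_word_def)

end

type_synonym 'b tensor_algebra = "'b tensor_word \<Rightarrow>\<^sub>0 complex"
type_synonym 'b symmetric_algebra = "('b \<Rightarrow>\<^sub>0 nat) \<Rightarrow>\<^sub>0 complex"

definition tensor_vec :: "complex ^ 'b \<Rightarrow> 'b::finite tensor_algebra" where
  "tensor_vec v = (\<Sum>b\<in>UNIV. Poly_Mapping.single (TWord [b]) (v $ b))"

definition sym_vec :: "complex ^ 'b \<Rightarrow> 'b::finite symmetric_algebra" where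
  "sym_vec v = (\<Sum>b\<in>UNIV. Poly_Mapping.single (Poly_Mapping.single b 1) (v $ b))"

text \<open>
  The extensions of a linear action \<open>\<rho>\<close> on \<open>V\<close> to actions by algebra automorphisms.
\<close>

definition tensor_act ::
    "('g \<Rightarrow> complex ^ 'b \<Rightarrow> complex ^ 'b) \<Rightarrow> 'g \<Rightarrow> 'b::finite tensor_algebra \<Rightarrow> 'b tensor_algebra" where
  "tensor_act \<rho> g p =
    (\<Sum>w\<in>Poly_Mapping.keys p. Poly_Mapping.single 0 (Poly_Mapping.lookup p w) *
       prod_list (map (\<lambda>b. tensor_vec (\<rho> g (axis b 1))) (letters w)))"

definition sym_act ::
    "('g \<Rightarrow> complex ^ 'b \<Rightarrow> complex ^ 'b) \<Rightarrow> 'g \<Rightarrow> 'b::finite symmetric_algebra \<Rightarrow> 'b symmetric_algebra" where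
  "sym_act \<rho> g p =
    (\<Sum>m\<in>Poly_Mapping.keys p. Poly_Mapping.single 0 (Poly_Mapping.lookup p m) *
       (\<Prod>b\<in>UNIV. sym_vec (\<rho> g (axis b 1)) ^ Poly_Mapping.lookup m b))"

text \<open>
  \<open>R # G\<close> for a finite group \<open>G\<close>, given as a type \<open>'g\<close>: the function \<open>p\<close> stands for the element
  \<open>\<Sum>\<^sub>g p g \<otimes> g\<close> of \<open>R \<otimes> \<complex>G\<close>. The algebra \<open>R\<close> is one of the algebras above, in which the
  scalar \<open>z\<close> is \<open>Poly_Mapping.single 0 z\<close>.
\<close>

definition skew_group_algebra ::
    "('g::monoid_mult \<Rightarrow> ('m::monoid_add \<Rightarrow>\<^sub>0 complex) \<Rightarrow> ('m \<Rightarrow>\<^sub>0 complex)) \<Rightarrow>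
     (complex, 'g \<Rightarrow> ('m \<Rightarrow>\<^sub>0 complex)) module" where
  "skew_group_algebra act =
    \<lparr>carrier = UNIV,
     mult = \<lambda>p q k. \<Sum>(g, h)\<in>{(g, h). g * h = k}. p g * act g (q h),
     one = \<lambda>k. if k = 1 then 1 else 0,
     zero = \<lambda>k. 0,
     add = \<lambda>p q k. p k + q k,
     smult = \<lambda>z p k. Poly_Mapping.single 0 z * p k\<rparr>"

abbreviation tensor_skew ::
    "('g::monoid_mult \<Rightarrow> complex ^ 'b \<Rightarrow> complex ^ 'b) \<Rightarrow>
     (complex, 'g \<Rightarrow> 'b::finite tensor_algebra) module" where
  "tensor_skew \<rho> \<equiv> skew_group_algebra (tensor_act \<rho>)"

abbreviation sym_skew ::
    "('g::monoid_mult \<Rightarrow> complex ^ 'b \<Rightarrow> complex ^ 'b) \<Rightarrow>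
     (complex, 'g \<Rightarrow> 'b::finite symmetric_algebra) module" where
  "sym_skew \<rho> \<equiv> skew_group_algebra (sym_act \<rho>)"

text \<open>Vectors in degree one, group elements in degree zero.\<close>

definition tensor_skew_filt :: "nat \<Rightarrow> ('g \<Rightarrow> 'b tensor_algebra) set" where
  "tensor_skew_filt m = {p. \<forall>g. \<forall>w\<in>Poly_Mapping.keys (p g). length (letters w) \<le> m}"

definition sym_skew_part :: "nat \<Rightarrow> ('g \<Rightarrow> 'b::finite symmetric_algebra) set" where
  "sym_skew_part d = {p. \<forall>g. \<forall>m\<in>Poly_Mapping.keys (p g). (\<Sum>b\<in>UNIV. Poly_Mapping.lookup m b) = d}"

section \<open>Drinfeld orbifold algebras\<close>

text \<open>
  A linear (respectively constant) cochain \<open>\<kappa>\<close> is given by its components \<open>\<kappa> g\<close>, with values in \<open>V\<close>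
  (respectively in the complex numbers).
\<close>

type_synonym ('g, 'b) linear_cochain = "'g \<Rightarrow> complex ^ 'b \<Rightarrow> complex ^ 'b \<Rightarrow> complex ^ 'b"
type_synonym ('g, 'b) constant_cochain = "'g \<Rightarrow> complex ^ 'b \<Rightarrow> complex ^ 'b \<Rightarrow> complex"

definition linear_cochain :: "('g, 'b::finite) linear_cochain \<Rightarrow> bool" where
  "linear_cochain \<kappa> \<longleftrightarrow>
    (\<forall>g u. Vector_Spaces.linear (*s) (*s) (\<kappa> g u)) \<and> (\<forall>g u v. \<kappa> g u v = - \<kappa> g v u)"

definition constant_cochain :: "('g, 'b::finite) constant_cochain \<Rightarrow> bool" where
  "constant_cochain \<kappa> \<longleftrightarrow>
    (\<forall>g u. Vector_Spaces.linear (*s) (*) (\<kappa> g u)) \<and> (\<forall>g u v. \<kappa> g u v = - \<kappa> g v u)"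

definition supported_on_identity :: "('g::monoid_mult, 'b::finite) linear_cochain \<Rightarrow> bool" where
  "supported_on_identity \<kappa> \<longleftrightarrow> (\<forall>g. g \<noteq> 1 \<longrightarrow> \<kappa> g = (\<lambda>u v. 0))"

definition skew_vec :: "complex ^ 'b \<Rightarrow> 'g::monoid_mult \<Rightarrow> 'b::finite tensor_algebra" where
  "skew_vec v = (\<lambda>g. if g = 1 then tensor_vec v else 0)"

definition linear_value ::
    "('g, 'b::finite) linear_cochain \<Rightarrow> complex ^ 'b \<Rightarrow> complex ^ 'b \<Rightarrow> 'g \<Rightarrow> 'b tensor_algebra" where
  "linear_value \<kappa> u v = (\<lambda>g. tensor_vec (\<kappa> g u v))"

definition constant_value ::
    "('g, 'b::finite) constant_cochain \<Rightarrow> complex ^ 'b \<Rightarrow> complex ^ 'b \<Rightarrow> 'g \<Rightarrow> 'b tensor_algebra" where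
  "constant_value \<kappa> u v = (\<lambda>g. Poly_Mapping.single 0 (\<kappa> g u v))"

definition skew_commutator ::
    "('g::monoid_mult \<Rightarrow> complex ^ 'b \<Rightarrow> complex ^ 'b) \<Rightarrow> complex ^ 'b \<Rightarrow> complex ^ 'b \<Rightarrow>
     'g \<Rightarrow> 'b::finite tensor_algebra" where
  "skew_commutator \<rho> u v =
    (let A = tensor_skew \<rho>
     in (skew_vec u \<otimes>\<^bsub>A\<^esub> skew_vec v) \<ominus>\<^bsub>A\<^esub> (skew_vec v \<otimes>\<^bsub>A\<^esub> skew_vec u))"

definition orbifold_ideal ::
    "('g::monoid_mult \<Rightarrow> complex ^ 'b \<Rightarrow> complex ^ 'b) \<Rightarrow> ('g, 'b) linear_cochain \<Rightarrow>
     ('g, 'b) constant_cochain \<Rightarrow> ('g \<Rightarrow> 'b::finite tensor_algebra) set" where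
  "orbifold_ideal \<rho> \<kappa>L \<kappa>C =
    (let A = tensor_skew \<rho>
     in Idl\<^bsub>A\<^esub> {skew_commutator \<rho> v w \<ominus>\<^bsub>A\<^esub> linear_value \<kappa>L v w
                \<ominus>\<^bsub>A\<^esub> constant_value \<kappa>C v w | v w. True})"

definition orbifold_algebra ::
    "('g::monoid_mult \<Rightarrow> complex ^ 'b \<Rightarrow> complex ^ 'b) \<Rightarrow> ('g, 'b) linear_cochain \<Rightarrow>
     ('g, 'b) constant_cochain \<Rightarrow> (complex, ('g \<Rightarrow> 'b::finite tensor_algebra) set) module" where
  "orbifold_algebra \<rho> \<kappa>L \<kappa>C =
    quotient_algebra (tensor_skew \<rho>) (orbifold_ideal \<rho> \<kappa>L \<kappa>C)"

definition orbifold_filt ::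
    "('g::monoid_mult \<Rightarrow> complex ^ 'b \<Rightarrow> complex ^ 'b) \<Rightarrow> ('g, 'b) linear_cochain \<Rightarrow>
     ('g, 'b) constant_cochain \<Rightarrow> nat \<Rightarrow> ('g \<Rightarrow> 'b::finite tensor_algebra) set set" where
  "orbifold_filt \<rho> \<kappa>L \<kappa>C m =
    (\<lambda>p. orbifold_ideal \<rho> \<kappa>L \<kappa>C +>\<^bsub>tensor_skew \<rho>\<^esub> p) ` tensor_skew_filt m"

definition drinfeld_orbifold ::
    "('g::monoid_mult \<Rightarrow> complex ^ 'b \<Rightarrow> complex ^ 'b) \<Rightarrow> ('g, 'b::finite) linear_cochain \<Rightarrow>
     ('g, 'b) constant_cochain \<Rightarrow> bool" where
  "drinfeld_orbifold \<rho> \<kappa>L \<kappa>C \<longleftrightarrow>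
    (\<exists>\<phi> \<in> algebra_iso
             (assoc_graded (orbifold_algebra \<rho> \<kappa>L \<kappa>C) (orbifold_filt \<rho> \<kappa>L \<kappa>C)) (sym_skew \<rho>).
       \<forall>d. \<phi> ` assoc_graded_part (orbifold_algebra \<rho> \<kappa>L \<kappa>C) (orbifold_filt \<rho> \<kappa>L \<kappa>C) d
           = sym_skew_part d)"

subsection \<open>Drinfeld orbifold algebras over the polynomial ring in \<open>t\<close>\<close>

text \<open>The relations are imposed for \<open>v\<close> and \<open>w\<close> in a given set \<open>B\<close> of vectors.\<close>

definition orbifold_ideal_t ::
    "('g::monoid_mult \<Rightarrow> complex ^ 'b \<Rightarrow> complex ^ 'b) \<Rightarrow> (complex ^ 'b) set \<Rightarrow>
     ('g, 'b) linear_cochain \<Rightarrow> ('g, 'b) constant_cochain \<Rightarrow>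
     (nat \<Rightarrow> 'g \<Rightarrow> 'b::finite tensor_algebra) set" where
  "orbifold_ideal_t \<rho> B \<kappa>L \<kappa>C =
    (let A = tensor_skew \<rho>; P = polynomial_algebra A
     in Idl\<^bsub>P\<^esub> {monom (UP A) (skew_commutator \<rho> v w) 0
                \<ominus>\<^bsub>P\<^esub> monom (UP A) (linear_value \<kappa>L v w) 1
                \<ominus>\<^bsub>P\<^esub> monom (UP A) (constant_value \<kappa>C v w) 2 | v w. v \<in> B \<and> w \<in> B})"

definition orbifold_algebra_t ::
    "('g::monoid_mult \<Rightarrow> complex ^ 'b \<Rightarrow> complex ^ 'b) \<Rightarrow> (complex ^ 'b) set \<Rightarrow>
     ('g, 'b) linear_cochain \<Rightarrow> ('g, 'b) constant_cochain \<Rightarrow>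
     (complex, (nat \<Rightarrow> 'g \<Rightarrow> 'b::finite tensor_algebra) set) module" where
  "orbifold_algebra_t \<rho> B \<kappa>L \<kappa>C =
    quotient_algebra (polynomial_algebra (tensor_skew \<rho>)) (orbifold_ideal_t \<rho> B \<kappa>L \<kappa>C)"

definition lie_orbifold_over_t ::
    "('g::monoid_mult \<Rightarrow> complex ^ 'b \<Rightarrow> complex ^ 'b) \<Rightarrow> ('g, 'b::finite) linear_cochain \<Rightarrow>
     ('g, 'b) constant_cochain \<Rightarrow> (complex, (nat \<Rightarrow> 'g \<Rightarrow> 'b tensor_algebra) set) module \<Rightarrow> bool" where
  "lie_orbifold_over_t \<rho> \<kappa>L \<kappa>C H \<longleftrightarrow>
    linear_cochain \<kappa>L \<and> constant_cochain \<kappa>C \<and> supported_on_identity \<kappa>L \<and>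
    drinfeld_orbifold \<rho> \<kappa>L \<kappa>C \<and> H = orbifold_algebra_t \<rho> UNIV \<kappa>L \<kappa>C"

text \<open>The specialization at \<open>t = 1\<close> is the quotient by the ideal generated by \<open>t - 1\<close>.\<close>

definition specialization ::
    "('g::monoid_mult \<Rightarrow> complex ^ 'b \<Rightarrow> complex ^ 'b) \<Rightarrow> (complex ^ 'b) set \<Rightarrow>
     ('g, 'b) linear_cochain \<Rightarrow> ('g, 'b) constant_cochain \<Rightarrow>
     (complex, (nat \<Rightarrow> 'g \<Rightarrow> 'b::finite tensor_algebra) set set) module" where
  "specialization \<rho> B \<kappa>L \<kappa>C =
    (let A = tensor_skew \<rho>; P = polynomial_algebra A; H = orbifold_algebra_t \<rho> B \<kappa>L \<kappa>C
     in quotient_algebra H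
          (Idl\<^bsub>H\<^esub> {orbifold_ideal_t \<rho> B \<kappa>L \<kappa>C +>\<^bsub>P\<^esub> (monom (UP A) \<one>\<^bsub>A\<^esub> 1 \<ominus>\<^bsub>P\<^esub> \<one>\<^bsub>P\<^esub>)}))"

section \<open>The doubled permutation representation\<close>

text \<open>
  The index set is a finite type \<open>'n\<close> with \<open>n = CARD('n)\<close>, and the symmetric group is \<open>'n perm\<close>.
\<close>

definition xb :: "'n \<Rightarrow> complex ^ ('n::finite + 'n)" where
  "xb i = axis (Inl i) 1"

definition yb :: "'n \<Rightarrow> complex ^ ('n::finite + 'n)" where
  "yb i = axis (Inr i) 1"

definition xy_basis :: "(complex ^ ('n::finite + 'n)) set" where
  "xy_basis = range xb \<union> range yb"

definition x_sum :: "complex ^ ('n::finite + 'n)" where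
  "x_sum = (\<Sum>i\<in>UNIV. xb i)"

definition y_sum :: "complex ^ ('n::finite + 'n)" where
  "y_sum = (\<Sum>i\<in>UNIV. yb i)"

definition doubled_perm_rep ::
    "'n::finite perm \<Rightarrow> complex ^ ('n + 'n) \<Rightarrow> complex ^ ('n + 'n)" where
  "doubled_perm_rep \<sigma> v =
    (\<Sum>i\<in>UNIV. (v $ Inl i) *s xb (Perm.apply \<sigma> i) + (v $ Inr i) *s yb (Perm.apply \<sigma> i))"

text \<open>\<open>grp h\<close> is the group element \<open>h\<close>, and \<open>at_one v\<close> is \<open>v \<otimes> 1\<close>.\<close>

definition grp :: "'g \<Rightarrow> 'g \<Rightarrow> complex" where
  "grp h = (\<lambda>g. if g = h then 1 else 0)"

definition at_one :: "'v::zero \<Rightarrow> 'g::monoid_mult \<Rightarrow> 'v" where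
  "at_one v = (\<lambda>g. if g = 1 then v else 0)"

definition lie_orbifold_cochains ::
    "(nat \<Rightarrow> complex) \<Rightarrow> (nat \<Rightarrow> complex) \<Rightarrow> complex \<Rightarrow> complex \<Rightarrow> complex \<Rightarrow>
     ('n::finite perm, 'n + 'n) linear_cochain \<Rightarrow> ('n perm, 'n + 'n) constant_cochain \<Rightarrow> bool" where
  "lie_orbifold_cochains a b \<alpha> \<beta> c \<kappa>L \<kappa>C \<longleftrightarrow>
    (\<forall>i j. i \<noteq> j \<longrightarrow>
       (\<lambda>g. \<kappa>L g (xb i) (xb j)) = at_one (a 1 *s (xb i - xb j) + b 1 *s (yb i - yb j)) \<and>
       (\<lambda>g. \<kappa>C g (xb i) (xb j)) = (\<lambda>g. 0) \<and>
       (\<lambda>g. \<kappa>L g (yb i) (yb j)) = at_one (a 2 *s (xb i - xb j) + b 2 *s (yb i - yb j)) \<and>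
       (\<lambda>g. \<kappa>C g (yb i) (yb j)) = (\<lambda>g. 0) \<and>
       (\<lambda>g. \<kappa>L g (xb i) (yb i)) =
          at_one (a 3 *s xb i + a 4 *s x_sum + b 3 *s yb i + b 4 *s y_sum) \<and>
       (\<lambda>g. \<kappa>C g (xb i) (yb i)) =
          (\<lambda>g. \<alpha> * grp 1 g + c * (\<Sum>k\<in>UNIV - {i}. grp (Perm.swap i k) g)) \<and>
       (\<lambda>g. \<kappa>L g (xb i) (yb j)) =
          at_one (a 5 *s xb i + a 6 *s xb j + a 7 *s x_sum
                + b 5 *s yb i + b 6 *s yb j + b 7 *s y_sum) \<and>
       (\<lambda>g. \<kappa>C g (xb i) (yb j)) = (\<lambda>g. \<beta> * grp 1 g - c * grp (Perm.swap i j) g))"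

definition gammas ::
    "complex \<Rightarrow> (nat \<Rightarrow> complex) \<Rightarrow> (nat \<Rightarrow> complex) \<Rightarrow> complex \<Rightarrow> complex \<Rightarrow> complex \<Rightarrow> complex list"
where
  "gammas n a b \<alpha> \<beta> c =
    (let a1 = a 1; a2 = a 2; a3 = a 3; a4 = a 4; a5 = a 5; a6 = a 6; a7 = a 7;
         b1 = b 1; b2 = b 2; b3 = b 3; b4 = b 4; b5 = b 5; b6 = b 6; b7 = b 7
     in
       [a1 * (a5 + a6 + n * a7) - b1 * a2 - b5 * a6 + a5 * (b5 + b6 + n * b7) + b7 * (a3 - a5 - a6),
        b1 * (a5 + a6 + n * a7) - b1 * b2 + b1 * a5 + b5 * (b5 - a1 + n * b7) + b7 * (b3 - b5 - b6),
        c * (b6 - a1),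
        -a2 * (b6 + b5 + n * b7) - a2 * a1 - a2 * b6 + a6 * (a6 + b2 + n * a7) + a7 * (a3 - a6 - a5),
        -b2 * (b6 + b5 + n * b7) - a2 * b1 - a6 * b5 + b6 * (a6 + a5 + n * a7) + a7 * (b3 - b6 - b5),
        c * (b2 + a5),
        \<alpha> * (a1 - b6 + b4 - b7) - \<beta> * (a1 - b3 + b5 - (n - 1) * (b4 - b7)),
        a7 * (b3 - b5) - a4 * b6 + (b4 - b7) * (a4 + (n - 1) * a7 + a6),
        a1 * (a3 + n * a4) + a5 * (b3 + n * b4) + b4 * (a3 - a5 - a6) - a2 * b1 - b5 * a6,
        -a1 * (a5 + a6 + n * a7) - a5 * (b5 + n * b7) - b7 * (a3 - a5 - a6) + a2 * b1 + b3 * a6 - a3 * b6,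
        b7 * (b3 - b5) - b4 * b6 + (b4 - b7) * (a1 + b4 + (n - 1) * b7 + b6) - b1 * (a4 - a7),
        b1 * (a5 - b2 + a3 + n * a4) - b5 * (a1 + b6 - b3 - n * b4) + b4 * (b3 - b5 - b6),
        b1 * (-b2 + a5 + a3 + n * a7) + b5 * (b5 + n * b7) + b7 * (b3 - b5 - b6) - a1 * (b3 - b6),
        c * (2 * a1 - b3 + b5 - b6),
        \<alpha> * (-b2 - a5 + a4 - a7) + \<beta> * (b2 + a3 - a6 + (n - 1) * (a4 - a7)),
        a7 * (a3 - a6) - a4 * a5 + (a4 - a7) * (-b2 + a4 + (n - 1) * a7 + a5) + a2 * (b4 - b7),
        -a2 * (a1 + b6 + b3 + n * b4) + a6 * (b2 - a5 + a3 + n * a4) + a4 * (a3 - a5 - a6),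
        a2 * (a1 + b6 + b3 + n * b7) - a6 * (a6 + n * a7) - a7 * (a3 - a5 - a6) - b2 * (a3 - a5),
        b7 * (a3 - a6) - b4 * a5 + (a4 - a7) * (b4 + (n - 1) * b7 + b5),
        -b2 * (b3 + n * b4) + b6 * (a3 + n * a4) + a4 * (b3 - b5 - b6) - a2 * b1 - a6 * b5,
        b2 * (b5 + b6 + n * b7) - b6 * (a6 + n * a7) - a7 * (b3 - b5 - b6) + a2 * b1 + a3 * b5 - b3 * a5,
        c * (2 * b2 + a3 + a5 - a6)])"

end

theory Submission
  imports Defs "HOL-Library.Multiset"
begin

section \<open>Monomial maps and linear functionals on monoid algebras\<close>

lemma poly_mapping_sum_single:
  "p = (\<Sum>m\<in>Poly_Mapping.keys p. Poly_Mapping.single m (Poly_Mapping.lookup p m))"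
proof (rule poly_mapping_eqI)
  fix k
  show "Poly_Mapping.lookup p k =
      Poly_Mapping.lookup (\<Sum>m\<in>Poly_Mapping.keys p. Poly_Mapping.single m (Poly_Mapping.lookup p m)) k"
    by (simp add: lookup_sum lookup_single when_def sum.delta[OF finite_keys] in_keys_iff)
qed

lemma poly_mapping_induct [case_names zero single add]:
  assumes "P 0" and "\<And>m z. P (Poly_Mapping.single m z)" and "\<And>p q. P p \<Longrightarrow> P q \<Longrightarrow> P (p + q)"
  shows "P (p :: 'm \<Rightarrow>\<^sub>0 'z::comm_monoid_add)"
proof -
  have "P (\<Sum>m\<in>A. Poly_Mapping.single m (Poly_Mapping.lookup p m))" if "finite A" for A
    using that by (induction A rule: finite_induct) (auto intro: assms)
  from this[OF finite_keys] show ?thesis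
    using poly_mapping_sum_single[of p] by metis
qed

text \<open>
  The linear extension to the monoid algebra of a function \<open>F\<close> on the monoid.
\<close>

definition lin :: "('m \<Rightarrow> complex) \<Rightarrow> ('m \<Rightarrow>\<^sub>0 complex) \<Rightarrow> complex" where
  "lin F p = (\<Sum>m\<in>Poly_Mapping.keys p. Poly_Mapping.lookup p m * F m)"

lemma lin_superset:
  assumes "finite A" "Poly_Mapping.keys p \<subseteq> A"
  shows "lin F p = (\<Sum>m\<in>A. Poly_Mapping.lookup p m * F m)"
  unfolding lin_def by (rule sum.mono_neutral_left) (use assms in \<open>auto simp: in_keys_iff\<close>)

lemma lin_zero [simp]: "lin F 0 = 0"
  by (simp add: lin_def)

lemma lin_single [simp]: "lin F (Poly_Mapping.single m z) = z * F m"
  by (simp add: lin_superset[of "{m}"] lookup_single)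

lemma lin_add: "lin F (p + q) = lin F p + lin F q"
proof -
  let ?A = "Poly_Mapping.keys p \<union> Poly_Mapping.keys q"
  have "Poly_Mapping.keys (p + q) \<subseteq> ?A" by (rule Poly_Mapping.keys_add)
  then show ?thesis
    by (simp add: lin_superset[of ?A] lookup_add distrib_right sum.distrib)
qed

lemma lin_scale: "lin F (Poly_Mapping.single 0 z * p) = z * lin F p"
  for p :: "'m::monoid_add \<Rightarrow>\<^sub>0 complex"
  by (induction p rule: poly_mapping_induct) (simp_all add: lin_add distrib_left mult_single mult.assoc)

lemma lookup_conv_lin: "Poly_Mapping.lookup p m = lin (\<lambda>k. if k = m then 1 else 0) p"
  by (simp add: lin_def sum.delta[OF finite_keys] in_keys_iff if_distrib cong: if_cong)

text \<open>
  The linear map of monoid algebras that sends the basis element \<open>m\<close> to the basis element \<open>f m\<close>.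
\<close>

definition push :: "('m \<Rightarrow> 'k) \<Rightarrow> ('m \<Rightarrow>\<^sub>0 complex) \<Rightarrow> ('k \<Rightarrow>\<^sub>0 complex)" where
  "push f p = (\<Sum>m\<in>Poly_Mapping.keys p. Poly_Mapping.single (f m) (Poly_Mapping.lookup p m))"

lemma lookup_push: "Poly_Mapping.lookup (push f p) k = lin (\<lambda>m. if f m = k then 1 else 0) p"
  unfolding push_def lin_def lookup_sum
  by (rule sum.cong) (simp_all add: lookup_single)

lemma push_zero [simp]: "push f 0 = 0"
  by (simp add: push_def)

lemma push_add: "push f (p + q) = push f p + push f q"
  by (rule poly_mapping_eqI) (simp add: lookup_push lookup_add lin_add)

lemma push_single [simp]: "push f (Poly_Mapping.single m z) = Poly_Mapping.single (f m) z"
  by (rule poly_mapping_eqI) (simp add: lookup_push lookup_single when_def)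

lemma push_id [simp]: "push (\<lambda>m. m) p = p"
  by (induction p rule: poly_mapping_induct) (simp_all add: push_add)

lemma push_push: "push f (push g p) = push (\<lambda>m. f (g m)) p"
  by (induction p rule: poly_mapping_induct) (simp_all add: push_add)

lemma push_mult:
  fixes p q :: "'m::monoid_add \<Rightarrow>\<^sub>0 complex"
  assumes "\<And>m k. f (m + k) = f m + f k"
  shows "push f (p * q) = push f p * (push f q :: 'k::monoid_add \<Rightarrow>\<^sub>0 complex)"
proof (induction p rule: poly_mapping_induct)
  case (single m z)
  show ?case
    by (induction q rule: poly_mapping_induct)
       (simp_all add: push_add distrib_left mult_single assms)
qed (simp_all add: push_add distrib_right)

lemma push_sum: "push f (\<Sum>i\<in>A. p i) = (\<Sum>i\<in>A. push f (p i))"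
  by (induction A rule: infinite_finite_induct) (simp_all add: push_add)

lemma scalar_commute:
  "Poly_Mapping.single 0 z * p = p * Poly_Mapping.single 0 z"
  for p :: "'m::monoid_add \<Rightarrow>\<^sub>0 complex"
  by (induction p rule: poly_mapping_induct)
     (simp_all add: distrib_left distrib_right mult_single mult.commute)

section \<open>Skew group algebras of finite groups\<close>

locale skew_action =
  fixes act :: "'g::{finite,monoid_mult} \<Rightarrow> ('m::monoid_add \<Rightarrow>\<^sub>0 complex) \<Rightarrow> ('m \<Rightarrow>\<^sub>0 complex)"
  assumes act_add: "act g (p + q) = act g p + act g q"
    and act_mult: "act g (p * q) = act g p * act g q"
    and act_scalar: "act g (Poly_Mapping.single 0 z) = Poly_Mapping.single 0 z"
    and act_one: "act 1 p = p"
    and act_act: "act (g * h) p = act g (act h p)"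
begin

abbreviation "A \<equiv> skew_group_algebra act"

lemma carrier_A [simp]: "carrier A = UNIV"
  and one_A: "\<one>\<^bsub>A\<^esub> = (\<lambda>k. if k = 1 then 1 else 0)"
  and zero_A: "\<zero>\<^bsub>A\<^esub> = (\<lambda>k. 0)"
  and add_A: "p \<oplus>\<^bsub>A\<^esub> q = (\<lambda>k. p k + q k)"
  and smult_A: "z \<odot>\<^bsub>A\<^esub> p = (\<lambda>k. Poly_Mapping.single 0 z * p k)"
  by (simp_all add: skew_group_algebra_def)

lemma mult_A: "p \<otimes>\<^bsub>A\<^esub> q = (\<lambda>k. \<Sum>(g, h)\<in>{(g, h). g * h = k}. p g * act g (q h))"
  by (simp add: skew_group_algebra_def)

lemma mult_A_sum:
  "(p \<otimes>\<^bsub>A\<^esub> q) k = (\<Sum>g\<in>UNIV. \<Sum>h\<in>UNIV. if g * h = k then p g * act g (q h) else 0)"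
proof -
  have "(p \<otimes>\<^bsub>A\<^esub> q) k = (\<Sum>x\<in>{x. fst x * snd x = k}. p (fst x) * act (fst x) (q (snd x)))"
    by (simp add: mult_A case_prod_beta')
  also have "\<dots> = (\<Sum>x\<in>UNIV. if fst x * snd x = k then p (fst x) * act (fst x) (q (snd x)) else 0)"
    by (subst sum.inter_filter[symmetric]) simp_all
  also have "\<dots> = (\<Sum>g\<in>UNIV. \<Sum>h\<in>UNIV. if g * h = k then p g * act g (q h) else 0)"
    by (simp add: sum.cartesian_product case_prod_beta' flip: UNIV_Times_UNIV)
  finally show ?thesis .
qed

lemma act_0 [simp]: "act g 0 = 0"
  using act_add[of g 0 0] by simp

lemma act_sum: "act g (\<Sum>i\<in>S. p i) = (\<Sum>i\<in>S. act g (p i))"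
  by (induction S rule: infinite_finite_induct) (simp_all add: act_add)

lemma act_if: "act g (if P then p else 0) = (if P then act g p else 0)"
  by simp

lemma mult_A_assoc: "(p \<otimes>\<^bsub>A\<^esub> q) \<otimes>\<^bsub>A\<^esub> r = p \<otimes>\<^bsub>A\<^esub> (q \<otimes>\<^bsub>A\<^esub> r)"
proof
  fix k
  have "((p \<otimes>\<^bsub>A\<^esub> q) \<otimes>\<^bsub>A\<^esub> r) k =
      (\<Sum>m\<in>UNIV. \<Sum>l\<in>UNIV. \<Sum>g\<in>UNIV. \<Sum>h\<in>UNIV.
        if g * h = m then if m * l = k then p g * act g (q h) * act m (r l) else 0 else 0)"
    unfolding mult_A_sum[of "p \<otimes>\<^bsub>A\<^esub> q"] mult_A_sum[of p q]
  proof (intro sum.cong refl)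
    fix m l
    show "(if m * l = k then (\<Sum>g\<in>UNIV. \<Sum>h\<in>UNIV. if g * h = m then p g * act g (q h) else 0) * act m (r l) else 0) =
      (\<Sum>g\<in>UNIV. \<Sum>h\<in>UNIV. if g * h = m then if m * l = k then p g * act g (q h) * act m (r l) else 0 else 0)"
      by (cases "m * l = k") (auto simp: sum_distrib_right intro!: sum.cong cong: if_cong)
  qed
  also have "\<dots> = (\<Sum>l\<in>UNIV. \<Sum>g\<in>UNIV. \<Sum>h\<in>UNIV. \<Sum>m\<in>UNIV.
        if g * h = m then if m * l = k then p g * act g (q h) * act m (r l) else 0 else 0)"
    by (rule trans[OF sum.swap], rule sum.cong[OF refl], rule trans[OF sum.swap], rule sum.cong[OF refl],
        rule sum.swap)
  also have "\<dots> = (\<Sum>l\<in>UNIV. \<Sum>g\<in>UNIV. \<Sum>h\<in>UNIV.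
        if g * h * l = k then p g * act g (q h) * act (g * h) (r l) else 0)"
    by simp
  also have "\<dots> = (\<Sum>g\<in>UNIV. \<Sum>h\<in>UNIV. \<Sum>l\<in>UNIV.
        if g * (h * l) = k then p g * act g (q h * act h (r l)) else 0)"
    by (rule trans[OF sum.swap], rule sum.cong[OF refl], rule trans[OF sum.swap])
       (simp add: mult.assoc act_mult act_act cong: if_cong)
  also have "\<dots> = (\<Sum>g\<in>UNIV. \<Sum>h\<in>UNIV. \<Sum>l\<in>UNIV. \<Sum>m\<in>UNIV.
        if h * l = m then if g * m = k then p g * act g (q h * act h (r l)) else 0 else 0)"
    by simp
  also have "\<dots> = (\<Sum>g\<in>UNIV. \<Sum>m\<in>UNIV. \<Sum>h\<in>UNIV. \<Sum>l\<in>UNIV.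
        if h * l = m then if g * m = k then p g * act g (q h * act h (r l)) else 0 else 0)"
    by (rule sum.cong[OF refl], rule sym, rule trans[OF sum.swap], rule sum.cong[OF refl], rule sum.swap)
  also have "\<dots> = (p \<otimes>\<^bsub>A\<^esub> (q \<otimes>\<^bsub>A\<^esub> r)) k"
    unfolding mult_A_sum[of p] mult_A_sum[of q r]
  proof (rule sum.cong[OF refl], rule sum.cong[OF refl])
    fix g m
    show "(\<Sum>h\<in>UNIV. \<Sum>l\<in>UNIV.
          if h * l = m then if g * m = k then p g * act g (q h * act h (r l)) else 0 else 0) =
        (if g * m = k then p g * act g (\<Sum>h\<in>UNIV. \<Sum>l\<in>UNIV. if h * l = m then q h * act h (r l) else 0) else 0)"
      by (cases "g * m = k")
        (auto simp: sum_distrib_left act_sum act_if intro!: sum.cong cong: if_cong)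
  qed
  finally show "((p \<otimes>\<^bsub>A\<^esub> q) \<otimes>\<^bsub>A\<^esub> r) k = (p \<otimes>\<^bsub>A\<^esub> (q \<otimes>\<^bsub>A\<^esub> r)) k" .
qed

lemma mult_A_distrib:
  "(p \<oplus>\<^bsub>A\<^esub> q) \<otimes>\<^bsub>A\<^esub> r = (p \<otimes>\<^bsub>A\<^esub> r) \<oplus>\<^bsub>A\<^esub> (q \<otimes>\<^bsub>A\<^esub> r)"
  "r \<otimes>\<^bsub>A\<^esub> (p \<oplus>\<^bsub>A\<^esub> q) = (r \<otimes>\<^bsub>A\<^esub> p) \<oplus>\<^bsub>A\<^esub> (r \<otimes>\<^bsub>A\<^esub> q)"
  by (simp_all add: mult_A add_A distrib_left distrib_right act_add sum.distrib case_prod_beta')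

lemma ring_A: "ring A"
proof (rule ringI)
  show "abelian_group A"
  proof (rule abelian_groupI)
    fix p assume "p \<in> carrier A"
    have "(\<lambda>k. - p k) \<oplus>\<^bsub>A\<^esub> p = \<zero>\<^bsub>A\<^esub>" by (simp add: add_A zero_A)
    then show "\<exists>q\<in>carrier A. q \<oplus>\<^bsub>A\<^esub> p = \<zero>\<^bsub>A\<^esub>" by auto
  qed (simp_all add: add_A zero_A add.assoc add.commute add.left_commute)
  show "monoid A"
  proof (rule monoidI)
    show "\<one>\<^bsub>A\<^esub> \<otimes>\<^bsub>A\<^esub> p = p" for p
    proof
      fix k
      have "(\<one>\<^bsub>A\<^esub> \<otimes>\<^bsub>A\<^esub> p) k = (\<Sum>g\<in>(UNIV::'g set). if g = 1 then \<Sum>h\<in>UNIV. if h = k then p h else 0 else 0)"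
        unfolding mult_A_sum one_A by (rule sum.cong[OF refl]) (simp add: act_one cong: if_cong)
      then show "(\<one>\<^bsub>A\<^esub> \<otimes>\<^bsub>A\<^esub> p) k = p k" by simp
    qed
    show "p \<otimes>\<^bsub>A\<^esub> \<one>\<^bsub>A\<^esub> = p" for p
    proof
      fix k
      have "(p \<otimes>\<^bsub>A\<^esub> \<one>\<^bsub>A\<^esub>) k = (\<Sum>g\<in>UNIV. \<Sum>h\<in>(UNIV::'g set). if h = 1 then if g = k then p g else 0 else 0)"
        unfolding mult_A_sum one_A
      proof (rule sum.cong[OF refl], rule sum.cong[OF refl])
        fix g h
        show "(if g * h = k then p g * act g (if h = 1 then 1 else 0) else 0) =
            (if h = 1 then if g = k then p g else 0 else 0)"
          using act_scalar[of g 1] by auto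
      qed
      then show "(p \<otimes>\<^bsub>A\<^esub> \<one>\<^bsub>A\<^esub>) k = p k" by simp
    qed
  qed (simp_all add: mult_A_assoc)
qed (simp_all add: mult_A_distrib)

sublocale ring A by (rule ring_A)

lemma uminus_A: "\<ominus>\<^bsub>A\<^esub> p = (\<lambda>k. - p k)"
proof -
  have "(\<lambda>k. - p k) \<oplus>\<^bsub>A\<^esub> p = \<zero>\<^bsub>A\<^esub>" by (simp add: add_A zero_A)
  then show ?thesis by (rule minus_equality) simp_all
qed

lemma minus_A: "p \<ominus>\<^bsub>A\<^esub> q = (\<lambda>k. p k - q k)"
  by (simp add: a_minus_def uminus_A add_A)

lemma smult_mult_A:
  "(z \<odot>\<^bsub>A\<^esub> p) \<otimes>\<^bsub>A\<^esub> q = z \<odot>\<^bsub>A\<^esub> (p \<otimes>\<^bsub>A\<^esub> q)"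
  "p \<otimes>\<^bsub>A\<^esub> (z \<odot>\<^bsub>A\<^esub> q) = z \<odot>\<^bsub>A\<^esub> (p \<otimes>\<^bsub>A\<^esub> q)"
proof -
  show "(z \<odot>\<^bsub>A\<^esub> p) \<otimes>\<^bsub>A\<^esub> q = z \<odot>\<^bsub>A\<^esub> (p \<otimes>\<^bsub>A\<^esub> q)"
    by (simp add: mult_A smult_A sum_distrib_left case_prod_beta' mult.assoc)
  have "x * (Poly_Mapping.single 0 z * y) = Poly_Mapping.single 0 z * (x * y)"
    for x y :: "'m \<Rightarrow>\<^sub>0 complex"
    by (metis mult.assoc scalar_commute)
  then show "p \<otimes>\<^bsub>A\<^esub> (z \<odot>\<^bsub>A\<^esub> q) = z \<odot>\<^bsub>A\<^esub> (p \<otimes>\<^bsub>A\<^esub> q)"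
    by (simp add: mult_A smult_A sum_distrib_left case_prod_beta' act_mult act_scalar)
qed

lemma finsum_A: "finite S \<Longrightarrow> (\<Oplus>\<^bsub>A\<^esub>i\<in>S. f i) = (\<lambda>k. \<Sum>i\<in>S. f i k)"
  by (induction S rule: finite_induct) (simp_all add: zero_A add_A)

end

section \<open>Normal ordering of words\<close>

text \<open>
  A termination measure for sorting: exchanging neighbours \<open>a\<close>, \<open>b\<close> with \<open>f b < f a\<close> lowers the weight
  by \<open>f a - f b\<close>.
\<close>

fun word_weight :: "('b \<Rightarrow> nat) \<Rightarrow> 'b list \<Rightarrow> nat" where
  "word_weight f [] = 0"
| "word_weight f (a # w) = f a * length w + word_weight f w"

lemma word_weight_swap:
  "f b < f a \<Longrightarrow> word_weight f (u @ b # a # v) < word_weight f (u @ a # b # v)"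
  by (induction u) (auto simp: algebra_simps)

definition descent :: "('b \<Rightarrow> nat) \<Rightarrow> 'b list \<Rightarrow> 'b list \<times> 'b \<times> 'b \<times> 'b list" where
  "descent f w = (SOME (u, a, b, v). w = u @ a # b # v \<and> f b < f a)"

lemma descent:
  assumes "\<exists>u a b v. w = u @ a # b # v \<and> f b < f a" and "descent f w = (u, a, b, v)"
  shows "w = u @ a # b # v" "f b < f a"
proof -
  have "\<exists>x. (case x of (u, a, b, v) \<Rightarrow> w = u @ a # b # v \<and> f b < f a)"
    using assms(1) by auto
  from someI_ex[OF this] assms(2) show "w = u @ a # b # v" "f b < f a"
    unfolding descent_def by auto
qed

lemma descent_decreases:
  assumes "(u, a, b, v) = descent f (u' @ a' # b' # v')" "f b' < f a'"
  shows "length u + length v = length u' + length v'"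
    and "word_weight f (u @ b # a # v) < word_weight f (u' @ a' # b' # v')"
proof -
  have "u' @ a' # b' # v' = u @ a # b # v" "f b < f a"
    using descent[of "u' @ a' # b' # v'" f u a b v] assms by auto
  then have "length (u' @ a' # b' # v') = length (u @ a # b # v)"
    "word_weight f (u @ b # a # v) < word_weight f (u' @ a' # b' # v')"
    using word_weight_swap[of f b a u v] by metis+
  then show "length u + length v = length u' + length v'"
    "word_weight f (u @ b # a # v) < word_weight f (u' @ a' # b' # v')"
    by simp_all
qed

text \<open>
  Structure constants: \<open>\<kappa>\<^sup>L\<^sub>1(a, b) = \<Sum>\<^sub>c l a b c \<cdot> c\<close> and \<open>\<kappa>\<^sup>C\<^sub>h(a, b) = C h a b\<close> for letters (basis
  vectors) \<open>a\<close> and \<open>b\<close>, and \<open>\<pi>\<close> is the action of the group on the letters. A linear functional on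
  \<open>T(V)#G\<close> is represented by its values \<open>N w g\<close> on the basis elements \<open>w \<otimes> g\<close>.
\<close>

locale orbifold_structure =
  fixes \<pi> :: "'g::{finite,monoid_mult} \<Rightarrow> 'b::finite \<Rightarrow> 'b"
    and l :: "'b \<Rightarrow> 'b \<Rightarrow> 'b \<Rightarrow> complex"
    and C :: "'g \<Rightarrow> 'b \<Rightarrow> 'b \<Rightarrow> complex"
begin

text \<open>
  The value of the functional \<open>N\<close> on \<open>u \<kappa>(a, b) v g\<close>. The group element \<open>h\<close> in \<open>\<kappa>\<^sup>C(a, b)\<close> stands to
  the left of \<open>v\<close>; moving it to the right replaces each letter of \<open>v\<close> by its image under \<open>h\<close>.
\<close>

definition bracket :: "('b list \<Rightarrow> 'g \<Rightarrow> complex) \<Rightarrow> 'b list \<Rightarrow> 'b \<Rightarrow> 'b \<Rightarrow> 'b list \<Rightarrow> 'g \<Rightarrow> complex" where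
  "bracket N u a b v g =
    (\<Sum>c\<in>UNIV. l a b c * N (u @ c # v) g) + (\<Sum>h\<in>UNIV. C h a b * N (u @ map (\<pi> h) v) (h * g))"

text \<open>
  The functional that equals \<open>s\<close> on sorted words and is determined on all other words by applying
  the relations at one chosen descent. The exchanged word has the same length and smaller weight, the
  words in the bracket are shorter, so the recursion ends.
\<close>

function nf :: "('b \<Rightarrow> nat) \<Rightarrow> ('b list \<Rightarrow> 'g \<Rightarrow> complex) \<Rightarrow> 'b list \<Rightarrow> 'g \<Rightarrow> complex" where
  "nf f s w g =
    (if \<exists>u a b v. w = u @ a # b # v \<and> f b < f a
     then case descent f w of (u, a, b, v) \<Rightarrow>
       nf f s (u @ b # a # v) g
       + ((\<Sum>c\<in>UNIV. l a b c * nf f s (u @ c # v) g)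
          + (\<Sum>h\<in>UNIV. C h a b * nf f s (u @ map (\<pi> h) v) (h * g)))
     else s w g)"
  by auto
termination
  by (relation "measures [\<lambda>(f, s, w, g). length w, \<lambda>(f, s, w, g). word_weight f w]")
     (auto dest: descent_decreases)

declare nf.simps [simp del]

lemma nf_descent:
  assumes "\<exists>u a b v. w = u @ a # b # v \<and> f b < f a"
  obtains u a b v where "w = u @ a # b # v" "f b < f a"
    "\<And>g. nf f s w g = nf f s (u @ b # a # v) g + bracket (nf f s) u a b v g"
proof -
  obtain u a b v where d: "descent f w = (u, a, b, v)" by (metis prod_cases4)
  have "nf f s w g = nf f s (u @ b # a # v) g + bracket (nf f s) u a b v g" for g
    by (subst nf.simps) (simp only: if_P[OF assms] d prod.case bracket_def)
  then show ?thesis by (rule that[OF descent[OF assms d]])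
qed

text \<open>
  On a word of length at most \<open>m\<close> the brackets only evaluate words shorter than \<open>m\<close>, where \<open>s\<close>
  vanishes; so sorting such a word just exchanges letters, which \<open>s\<close> does not notice.
\<close>

lemma nf_initial:
  assumes s_swap: "\<And>u a b v g. s (u @ a # b # v) g = s (u @ b # a # v) g"
    and s_short: "\<And>w g. length w < m \<Longrightarrow> s w g = 0"
  shows "length w \<le> m \<Longrightarrow> nf f s w g = s w g"
proof (induction "(length w, word_weight f w)" arbitrary: w g
    rule: wf_induct_rule[OF wf_lex_prod[OF wf_less_than wf_less_than]])
  case 1
  show ?case
  proof (cases "\<exists>u a b v. w = u @ a # b # v \<and> f b < f a")
    case True
    then obtain u a b v where w: "w = u @ a # b # v" "f b < f a"
      and nf: "\<And>g. nf f s w g = nf f s (u @ b # a # v) g + bracket (nf f s) u a b v g"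
      by (rule nf_descent[where s = s]) blast
    have "nf f s (u @ b # a # v) g = s (u @ b # a # v) g"
      using 1(1)[of "u @ b # a # v" g] 1(2) w word_weight_swap[of f b a u v] by simp
    moreover have "nf f s (u @ c # v) g = 0" for c
      using 1 w s_short by auto
    moreover have "nf f s (u @ map (\<pi> h) v) (h * g) = 0" for h
      using 1 w s_short by auto
    ultimately show ?thesis
      using w(1) nf[of g] s_swap[of u a b v g] by (simp add: bracket_def)
  next
    case False
    then show ?thesis by (subst nf.simps) auto
  qed
qed

end

text \<open>
  The groups of interest are types of class \<open>monoid_mult\<close>, hence the inverse is a parameter.
\<close>

locale permutation_action =
  fixes \<pi> :: "'g::{finite,monoid_mult} \<Rightarrow> 'b::finite \<Rightarrow> 'b" and ginv :: "'g \<Rightarrow> 'g"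
  assumes ginv: "ginv g * g = 1" "g * ginv g = 1"
    and \<pi>_one: "\<pi> 1 a = a"
    and \<pi>_mult: "\<pi> (g * h) a = \<pi> g (\<pi> h a)"

text \<open>
  The last three conditions are the coordinates of the Jacobi identity for \<open>\<kappa>\<^sup>L + \<kappa>\<^sup>C\<close>: its part in
  \<open>V \<otimes> 1\<close> that is quadratic in \<open>\<kappa>\<^sup>L\<close>, its part in \<open>\<complex> \<otimes> h\<close>, and the part in \<open>V \<otimes> h\<close> that arises because
  the commutator of a vector \<open>u\<close> with the group element \<open>h\<close> is \<open>(u - h u) h\<close>.
\<close>

locale lie_orbifold_structure = orbifold_structure \<pi> l C + permutation_action \<pi> ginv
  for \<pi> :: "'g::{finite,monoid_mult} \<Rightarrow> 'b::finite \<Rightarrow> 'b" and l C ginv +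
  assumes l_skew: "l a b c = - l b a c"
    and C_skew: "C h a b = - C h b a"
    and l_invariant: "l (\<pi> g a) (\<pi> g b) (\<pi> g c) = l a b c"
    and C_invariant: "C (g * h * ginv g) (\<pi> g a) (\<pi> g b) = C h a b"
    and jacobi_linear: "(\<Sum>d\<in>UNIV. l b c d * l a d e + l c a d * l b d e + l a b d * l c d e) = 0"
    and jacobi_constant: "(\<Sum>d\<in>UNIV. l b c d * C h a d + l c a d * C h b d + l a b d * C h c d) = 0"
    and jacobi_mixed:
      "C h b c * (of_bool (a = e) - of_bool (\<pi> h a = e)) + C h c a * (of_bool (b = e) - of_bool (\<pi> h b = e))
       + C h a b * (of_bool (c = e) - of_bool (\<pi> h c = e)) = 0"
begin

lemma bracket_skew: "bracket N u a b v g = - bracket N u b a v g"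
  unfolding bracket_def l_skew[of a b] C_skew[of _ a b] by (simp add: sum_negf)

lemma bracket_same: "bracket N u a a v g = 0"
  using bracket_skew[of N u a a v g] by simp

lemma sum_group_conj: "(\<Sum>h\<in>UNIV. F (g * h * ginv g)) = (\<Sum>h\<in>UNIV. F h)" for F :: "'g \<Rightarrow> complex"
proof (rule sum.reindex_bij_witness[where i = "\<lambda>h. ginv g * h * g" and j = "\<lambda>h. g * h * ginv g"])
  show "ginv g * (g * h * ginv g) * g = h" "g * (ginv g * h * g) * ginv g = h" for h
    using ginv by (metis mult.assoc mult_1 mult_1_right)+
qed simp_all

lemma sum_letters: "(\<Sum>c\<in>UNIV. F (\<pi> g c)) = (\<Sum>c\<in>UNIV. F c)" for F :: "'b \<Rightarrow> complex"
  by (rule sum.reindex_bij_witness[where i = "\<pi> (ginv g)" and j = "\<pi> g"])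
     (simp_all add: ginv \<pi>_one flip: \<pi>_mult)

definition relation_at :: "('b list \<Rightarrow> 'g \<Rightarrow> complex) \<Rightarrow> nat \<Rightarrow> bool" where
  "relation_at N n \<longleftrightarrow> (\<forall>u a b v g. length u + length v + 2 = n \<longrightarrow>
     N (u @ a # b # v) g = N (u @ b # a # v) g + bracket N u a b v g)"

lemma relation_atD:
  "relation_at N n \<Longrightarrow> length u + length v + 2 = n \<Longrightarrow>
     N (u @ a # b # v) g - N (u @ b # a # v) g = bracket N u a b v g"
  unfolding relation_at_def by (metis add_diff_cancel_left')

text \<open>
  Invariance lets a group element \<open>h\<close> be moved past a relation: applying \<open>h\<close> to all letters inside the
  bracket is the same as applying it to the result.
\<close>

lemma bracket_translate:
  "bracket N u (\<pi> h a) (\<pi> h b) (map (\<pi> h) v) (h * g) =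
    (\<Sum>c\<in>UNIV. l a b c * N (u @ map (\<pi> h) (c # v)) (h * g))
    + (\<Sum>k\<in>UNIV. C k a b * N (u @ map (\<pi> h) (map (\<pi> k) v)) (h * (k * g)))"
proof -
  have "(\<Sum>c\<in>UNIV. l (\<pi> h a) (\<pi> h b) c * N (u @ c # map (\<pi> h) v) (h * g)) =
      (\<Sum>c\<in>UNIV. l a b c * N (u @ map (\<pi> h) (c # v)) (h * g))"
    by (subst sum_letters[of _ h, symmetric]) (simp add: l_invariant)
  moreover have "h * k * ginv h * (h * g) = h * (k * g)" for k
    using ginv by (metis mult.assoc mult_1_left)
  moreover have "\<pi> (h * k * ginv h) (\<pi> h a) = \<pi> h (\<pi> k a)" for k a
    using ginv by (metis \<pi>_mult \<pi>_one)
  ultimately show ?thesis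
    unfolding bracket_def
    by (subst sum_group_conj[of _ h, symmetric]) (simp add: C_invariant comp_def)
qed

text \<open>
  Two relations at disjoint places commute. On the left \<open>ab\<close> has been replaced by \<open>\<kappa>(a, b)\<close> first, on
  the right \<open>cd\<close> by \<open>\<kappa>(c, d)\<close>; expanding the second replacement leads on both sides to the same double
  sums. A group element from the first place acts on the letters of the second one, so invariance
  is needed.
\<close>

lemma disjoint_relations:
  assumes "\<And>n. n < length u + length m + length v + 4 \<Longrightarrow> relation_at N n"
  shows "bracket N u a b (m @ c # d # v) g - bracket N u a b (m @ d # c # v) g =
    bracket N (u @ a # b # m) c d v g - bracket N (u @ b # a # m) c d v g"
proof -
  have left: "bracket N u a b (m @ c # d # v) g - bracket N u a b (m @ d # c # v) g =
      (\<Sum>e\<in>UNIV. l a b e * bracket N (u @ e # m) c d v g)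
      + (\<Sum>h\<in>UNIV. C h a b * bracket N (u @ map (\<pi> h) m) (\<pi> h c) (\<pi> h d) (map (\<pi> h) v) (h * g))"
  proof -
    have "N (u @ e # m @ c # d # v) g - N (u @ e # m @ d # c # v) g = bracket N (u @ e # m) c d v g" for e
      using relation_atD[OF assms, of "length u + length m + length v + 3" "u @ e # m" v] by simp
    moreover have "N (u @ map (\<pi> h) m @ \<pi> h c # \<pi> h d # map (\<pi> h) v) (h * g)
        - N (u @ map (\<pi> h) m @ \<pi> h d # \<pi> h c # map (\<pi> h) v) (h * g)
        = bracket N (u @ map (\<pi> h) m) (\<pi> h c) (\<pi> h d) (map (\<pi> h) v) (h * g)" for h
      using relation_atD[OF assms, of "length u + length m + length v + 2" "u @ map (\<pi> h) m" "map (\<pi> h) v"]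
      by simp
    ultimately show ?thesis
      unfolding bracket_def[of N u a b]
      by (simp add: algebra_simps flip: sum_subtractf) (simp flip: right_diff_distrib sum.distrib)
  qed
  have right: "bracket N (u @ a # b # m) c d v g - bracket N (u @ b # a # m) c d v g =
      (\<Sum>e\<in>UNIV. l c d e * bracket N u a b (m @ e # v) g)
      + (\<Sum>k\<in>UNIV. C k c d * bracket N u a b (m @ map (\<pi> k) v) (k * g))"
  proof -
    have "N (u @ a # b # m @ e # v) g - N (u @ b # a # m @ e # v) g = bracket N u a b (m @ e # v) g" for e
      using relation_atD[OF assms, of "length u + length m + length v + 3" u "m @ e # v"] by simp
    moreover have "N (u @ a # b # m @ map (\<pi> k) v) (k * g) - N (u @ b # a # m @ map (\<pi> k) v) (k * g)
        = bracket N u a b (m @ map (\<pi> k) v) (k * g)" for k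
      using relation_atD[OF assms, of "length u + length m + length v + 2" u "m @ map (\<pi> k) v"] by simp
    ultimately show ?thesis
      unfolding bracket_def[of N "u @ a # b # m"] bracket_def[of N "u @ b # a # m"]
      by (simp add: algebra_simps flip: sum_subtractf) (simp flip: right_diff_distrib sum.distrib)
  qed
  have "(\<Sum>e\<in>UNIV. l a b e * bracket N (u @ e # m) c d v g)
      + (\<Sum>h\<in>UNIV. C h a b * bracket N (u @ map (\<pi> h) m) (\<pi> h c) (\<pi> h d) (map (\<pi> h) v) (h * g))
    = (\<Sum>e\<in>UNIV. l c d e * bracket N u a b (m @ e # v) g)
      + (\<Sum>k\<in>UNIV. C k c d * bracket N u a b (m @ map (\<pi> k) v) (k * g))"
  proof -
    let ?LL = "\<lambda>e x. l a b e * (l c d x * N (u @ e # m @ x # v) g)"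
    let ?LC = "\<lambda>e k. l a b e * (C k c d * N (u @ e # m @ map (\<pi> k) v) (k * g))"
    let ?CL = "\<lambda>h x. C h a b * (l c d x * N (u @ map (\<pi> h) m @ map (\<pi> h) (x # v)) (h * g))"
    let ?CC = "\<lambda>h k. C h a b * (C k c d * N (u @ map (\<pi> h) m @ map (\<pi> h) (map (\<pi> k) v)) (h * (k * g)))"
    have "(\<Sum>e\<in>UNIV. l a b e * bracket N (u @ e # m) c d v g)
      + (\<Sum>h\<in>UNIV. C h a b * bracket N (u @ map (\<pi> h) m) (\<pi> h c) (\<pi> h d) (map (\<pi> h) v) (h * g))
      = (\<Sum>e\<in>UNIV. \<Sum>x\<in>UNIV. ?LL e x) + (\<Sum>e\<in>UNIV. \<Sum>k\<in>UNIV. ?LC e k)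
      + (\<Sum>h\<in>UNIV. \<Sum>x\<in>UNIV. ?CL h x) + (\<Sum>h\<in>UNIV. \<Sum>k\<in>UNIV. ?CC h k)"
      unfolding bracket_translate
      by (simp add: bracket_def distrib_left sum_distrib_left sum.distrib)
    moreover have "(\<Sum>e\<in>UNIV. l c d e * bracket N u a b (m @ e # v) g)
      + (\<Sum>k\<in>UNIV. C k c d * bracket N u a b (m @ map (\<pi> k) v) (k * g))
      = (\<Sum>x\<in>UNIV. \<Sum>e\<in>UNIV. ?LL e x) + (\<Sum>x\<in>UNIV. \<Sum>h\<in>UNIV. ?CL h x)
      + (\<Sum>k\<in>UNIV. \<Sum>e\<in>UNIV. ?LC e k) + (\<Sum>k\<in>UNIV. \<Sum>h\<in>UNIV. ?CC h k)"
      by (simp add: bracket_def distrib_left sum_distrib_left sum.distrib mult.left_commute)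
    moreover have "(\<Sum>e\<in>UNIV. \<Sum>x\<in>UNIV. ?LL e x) = (\<Sum>x\<in>UNIV. \<Sum>e\<in>UNIV. ?LL e x)" by (rule sum.swap)
    moreover have "(\<Sum>e\<in>UNIV. \<Sum>k\<in>UNIV. ?LC e k) = (\<Sum>k\<in>UNIV. \<Sum>e\<in>UNIV. ?LC e k)" by (rule sum.swap)
    moreover have "(\<Sum>h\<in>UNIV. \<Sum>x\<in>UNIV. ?CL h x) = (\<Sum>x\<in>UNIV. \<Sum>h\<in>UNIV. ?CL h x)" by (rule sum.swap)
    moreover have "(\<Sum>h\<in>UNIV. \<Sum>k\<in>UNIV. ?CC h k) = (\<Sum>k\<in>UNIV. \<Sum>h\<in>UNIV. ?CC h k)" by (rule sum.swap)
    ultimately show ?thesis by simp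
  qed
  then show ?thesis unfolding left right .
qed

text \<open>
  The words \<open>abc\<close> and \<open>cba\<close> are connected by exchanging neighbours in two ways. The brackets collected
  on the two ways agree by the Jacobi identity.
\<close>

lemma overlapping_relations:
  assumes "\<And>n. n < length u + length v + 3 \<Longrightarrow> relation_at N n"
  shows "bracket N (u @ [c]) a b v g + bracket N u a c (b # v) g + bracket N (u @ [a]) b c v g =
    bracket N u b c (a # v) g + bracket N (u @ [b]) a c v g + bracket N u a b (c # v) g"
proof -
  \<comment> \<open>The effect of moving \<open>c\<close> across \<open>\<kappa>(a, b)\<close>: exchanging \<open>c\<close> with the vector \<open>\<kappa>\<^sup>L(a, b)\<close> produces
    \<open>Lf\<close> and \<open>Cf\<close>, exchanging it with the group elements in \<open>\<kappa>\<^sup>C(a, b)\<close> produces \<open>Mf\<close>.\<close>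
  define Lf where "Lf a b c = (\<Sum>d\<in>UNIV. l a b d * (\<Sum>e\<in>UNIV. l d c e * N (u @ e # v) g))" for a b c
  define Cf where "Cf a b c = (\<Sum>d\<in>UNIV. l a b d * (\<Sum>h\<in>UNIV. C h d c * N (u @ map (\<pi> h) v) (h * g)))" for a b c
  define Mf where "Mf a b c = (\<Sum>h\<in>UNIV. C h a b *
      (\<Sum>e\<in>UNIV. (of_bool (c = e) - of_bool (\<pi> h c = e)) * N (u @ e # map (\<pi> h) v) (h * g)))" for a b c
  have swap: "bracket N (u @ [c]) a b v g - bracket N u a b (c # v) g = - Lf a b c - Cf a b c + Mf a b c"
    for a b c
  proof -
    have "N (u @ d # c # v) g - N (u @ c # d # v) g = bracket N u d c v g" for d
      using relation_atD[OF assms, of "length u + length v + 2" u v] by simp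
    then have "(\<Sum>d\<in>UNIV. l a b d * N (u @ d # c # v) g) - (\<Sum>d\<in>UNIV. l a b d * N (u @ c # d # v) g)
        = (\<Sum>d\<in>UNIV. l a b d * bracket N u d c v g)"
      by (simp only: sum_subtractf[symmetric] right_diff_distrib[symmetric])
    also have "\<dots> = Lf a b c + Cf a b c"
      unfolding Lf_def Cf_def bracket_def by (simp only: distrib_left sum.distrib)
    finally have linear: "(\<Sum>d\<in>UNIV. l a b d * N (u @ d # c # v) g) - (\<Sum>d\<in>UNIV. l a b d * N (u @ c # d # v) g)
        = Lf a b c + Cf a b c" .
    have "(\<Sum>e\<in>UNIV. (of_bool (c = e) - of_bool (\<pi> h c = e)) * N (u @ e # map (\<pi> h) v) (h * g))
        = N (u @ c # map (\<pi> h) v) (h * g) - N (u @ \<pi> h c # map (\<pi> h) v) (h * g)" for h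
      by (simp add: left_diff_distrib sum_subtractf of_bool_def if_distrib[of "\<lambda>x. x * _"] cong: if_cong)
    then have "Mf a b c = (\<Sum>h\<in>UNIV. C h a b * N (u @ c # map (\<pi> h) v) (h * g))
        - (\<Sum>h\<in>UNIV. C h a b * N (u @ \<pi> h c # map (\<pi> h) v) (h * g))"
      unfolding Mf_def by (simp only: right_diff_distrib sum_subtractf)
    moreover have "(\<Sum>d\<in>UNIV. l a b d * N (u @ c # d # v) g) - (\<Sum>d\<in>UNIV. l a b d * N (u @ d # c # v) g)
        = - (Lf a b c + Cf a b c)"
      unfolding linear[symmetric] by simp
    ultimately show ?thesis
      by (simp add: bracket_def)
  qed
  have Lf: "Lf a b c = (\<Sum>e\<in>UNIV. \<Sum>d\<in>UNIV. - (l a b d * l c d e) * N (u @ e # v) g)" for a b c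
    unfolding Lf_def sum_distrib_left
    by (subst sum.swap) (intro sum.cong refl, subst l_skew[of _ c], simp)
  have linear: "Lf b c a + Lf c a b + Lf a b c = 0"
  proof -
    have "Lf b c a + Lf c a b + Lf a b c
      = - (\<Sum>e\<in>UNIV. (\<Sum>d\<in>UNIV. l b c d * l a d e + l c a d * l b d e + l a b d * l c d e) * N (u @ e # v) g)"
      unfolding Lf by (simp add: sum_distrib_right distrib_right sum.distrib sum_negf)
    then show ?thesis unfolding jacobi_linear by simp
  qed
  have Cf: "Cf a b c = (\<Sum>h\<in>UNIV. \<Sum>d\<in>UNIV. - (l a b d * C h c d) * N (u @ map (\<pi> h) v) (h * g))" for a b c
    unfolding Cf_def sum_distrib_left
    by (subst sum.swap) (intro sum.cong refl, subst C_skew[of _ _ c], simp)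
  have const_part: "Cf b c a + Cf c a b + Cf a b c = 0"
  proof -
    have "Cf b c a + Cf c a b + Cf a b c
      = - (\<Sum>h\<in>UNIV. (\<Sum>d\<in>UNIV. l b c d * C h a d + l c a d * C h b d + l a b d * C h c d) * N (u @ map (\<pi> h) v) (h * g))"
      unfolding Cf by (simp add: sum_distrib_right distrib_right sum.distrib sum_negf)
    then show ?thesis unfolding jacobi_constant by simp
  qed
  have mixed: "Mf b c a + Mf c a b + Mf a b c = 0"
    unfolding Mf_def sum_distrib_left sum.distrib[symmetric] mult.assoc[symmetric] distrib_right[symmetric] jacobi_mixed
    by simp
  have "bracket N (u @ [c]) a b v g - bracket N u a b (c # v) g
      + (bracket N (u @ [b]) c a v g - bracket N u c a (b # v) g)
      + (bracket N (u @ [a]) b c v g - bracket N u b c (a # v) g) =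
      - (Lf b c a + Lf c a b + Lf a b c) - (Cf b c a + Cf c a b + Cf a b c) + (Mf b c a + Mf c a b + Mf a b c)"
    unfolding swap by simp
  then have "bracket N (u @ [c]) a b v g - bracket N u a b (c # v) g
      + (bracket N (u @ [b]) c a v g - bracket N u c a (b # v) g)
      + (bracket N (u @ [a]) b c v g - bracket N u b c (a # v) g) = 0"
    unfolding linear const_part mixed by simp
  then show ?thesis
    unfolding bracket_skew[of N "u @ [b]" c a v g] bracket_skew[of N u c a "b # v" g] by (simp add: algebra_simps)
qed

text \<open>
  Sorting resolves one chosen descent of a word. If \<open>ab\<close> is another descent, the two either are disjoint
  or share a letter, and then the two lemmas above, together with the relations for words that
  are smaller in the weight or shorter, show that resolving \<open>ab\<close> first gives the same value.
\<close>

lemma relation_at_nf: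
  assumes f: "inj f" and less: "\<And>m. m < n \<Longrightarrow> relation_at (nf f s) m"
  shows "relation_at (nf f s) n"
proof -
  let ?N = "nf f s"
  have descents: "?N (u @ a # b # v) g = ?N (u @ b # a # v) g + bracket ?N u a b v g"
    if "length (u @ a # b # v) = n" "f b < f a" for u a b v g
    using that
  proof (induction "word_weight f (u @ a # b # v)" arbitrary: u a b v g rule: less_induct)
    case less
    define w where "w = u @ a # b # v"
    have lenw: "length w = n" using less(2) w_def by simp
    have IH: "?N (u' @ a' # b' # v') g = ?N (u' @ b' # a' # v') g + bracket ?N u' a' b' v' g"
      if "word_weight f (u' @ a' # b' # v') < word_weight f w" "length (u' @ a' # b' # v') = n" "f b' < f a'"
      for u' a' b' v' g
      using less(1) that w_def by blast
    obtain u' a' b' v' where w': "w = u' @ a' # b' # v'" "f b' < f a'"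
      and nf: "\<And>g. ?N w g = ?N (u' @ b' # a' # v') g + bracket ?N u' a' b' v' g"
      using nf_descent[of w f s] less(3) w_def by metis
    have lt: "word_weight f (u @ b # a # v) < word_weight f w" "word_weight f (u' @ b' # a' # v') < word_weight f w"
      using less(3) w' w_def word_weight_swap by metis+
    have disjoint: "?N (x @ b # a # m @ c # d # y) g + bracket ?N x a b (m @ c # d # y) g =
        ?N (x @ a # b # m @ d # c # y) g + bracket ?N (x @ a # b # m) c d y g"
      if w: "w = x @ a # b # m @ c # d # y" "f b < f a" "f d < f c" for x a b m c d y
    proof -
      have len: "length x + length m + length y + 4 = n" using lenw w by simp
      have 1: "word_weight f ((x @ b # a # m) @ c # d # y) < word_weight f w"
        using word_weight_swap[of f b a x] w(1,2) by simp
      have 2: "word_weight f (x @ a # b # m @ d # c # y) < word_weight f w"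
        using word_weight_swap[of f d c "x @ a # b # m"] w(1,3) by simp
      have "?N (x @ b # a # m @ c # d # y) g = ?N (x @ b # a # m @ d # c # y) g + bracket ?N (x @ b # a # m) c d y g"
        using IH[OF 1 _ w(3)] len by simp
      moreover have "?N (x @ a # b # m @ d # c # y) g = ?N (x @ b # a # m @ d # c # y) g + bracket ?N x a b (m @ d # c # y) g"
        using IH[OF 2 _ w(2)] len by simp
      moreover note disjoint_relations[of x m y ?N a b c d g] assms(2) len
      ultimately show ?thesis by (simp add: algebra_simps)
    qed
    have overlap: "?N (x @ b # a # c # y) g + bracket ?N x a b (c # y) g =
        ?N (x @ a # c # b # y) g + bracket ?N (x @ [a]) b c y g"
      if w: "w = x @ a # b # c # y" "f b < f a" "f c < f b" for x a b c y
    proof -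
      have len: "length x + length y + 3 = n" using lenw w by simp
      have 1: "word_weight f ((x @ [b]) @ a # c # y) < word_weight f w"
        using word_weight_swap[of f b a x "c # y"] w(1,2) by simp
      have 2: "word_weight f (x @ b # c # a # y) < word_weight f w"
        using word_weight_swap[of f c a "x @ [b]" y] w 1 by simp
      have 3: "word_weight f (x @ a # c # b # y) < word_weight f w"
        using word_weight_swap[of f c b "x @ [a]" y] w(1,3) by simp
      have 4: "word_weight f ((x @ [c]) @ a # b # y) < word_weight f w"
        using word_weight_swap[of f c a x "b # y"] w 3 by simp
      have "?N (x @ b # a # c # y) g = ?N (x @ c # b # a # y) g + bracket ?N x b c (a # y) g + bracket ?N (x @ [b]) a c y g"
        using IH[OF 1] IH[OF 2] len w by simp
      moreover have "?N (x @ a # c # b # y) g = ?N (x @ c # b # a # y) g + bracket ?N (x @ [c]) a b y g + bracket ?N x a c (b # y) g"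
        using IH[OF 3] IH[OF 4] len w by simp
      moreover note overlapping_relations[of x y ?N c a b g] assms(2) len
      ultimately show ?thesis by (simp add: algebra_simps)
    qed
    consider "u = u'" | m where "u' = u @ a # b # m" | "u' = u @ [a]" | m where "u = u' @ a' # b' # m" | "u = u' @ [a']"
    proof -
      have eq: "u @ a # b # v = u' @ a' # b' # v'" using w' w_def by simp
      then obtain z where "u = u' @ z \<and> z @ a # b # v = a' # b' # v' \<or> u @ z = u' \<and> a # b # v = z @ a' # b' # v'"
        using append_eq_append_conv2[of u "a # b # v" u' "a' # b' # v'"] by blast
      then show thesis
        using that by (cases z; cases "tl z") auto
    qed
    then show ?case
    proof cases
      case 1
      then show ?thesis using nf w' w_def by simp
    next
      case (2 m)
      then show ?thesis using nf[of g] disjoint[of u a b m a' b' v'] w' w_def less(3) by simp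
    next
      case 3
      then have "a' = b" "v = b' # v'" using w' w_def by simp_all
      then show ?thesis using 3 nf[of g] overlap[of u a b b' v'] w' w_def less(3) by simp
    next
      case (4 m)
      then show ?thesis using nf[of g] disjoint[of u' a' b' m a b v] w' w_def less(3) by simp
    next
      case 5
      then have "a = b'" "v' = b # v" using w' w_def by simp_all
      then show ?thesis using 5 nf[of g] overlap[of u' a' b' b v] w' w_def less(3) by simp
    qed
  qed
  show ?thesis
    unfolding relation_at_def
  proof (intro allI impI)
    fix u v :: "'b list" and a b g
    assume len: "length u + length v + 2 = n"
    consider "f b < f a" | "f a < f b" | "a = b"
      using f by (metis injD linorder_neqE_nat)
    then show "?N (u @ a # b # v) g = ?N (u @ b # a # v) g + bracket ?N u a b v g"
    proof cases
      case 1
      then show ?thesis using descents len by simp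
    next
      case 2
      then show ?thesis using descents[of u b a v g] len bracket_skew[of ?N u a b v g] by simp
    next
      case 3
      then show ?thesis by (simp add: bracket_same)
    qed
  qed
qed

text \<open>
  Linear functionals respecting the relations can be prescribed on symmetrized words of length \<open>m\<close>:
  the dual form of the linear independence of ordered monomials.
\<close>

theorem symmetric_functional_extends:
  assumes "\<And>u a b v g. s (u @ a # b # v) g = s (u @ b # a # v) g"
    and "\<And>w g. length w < m \<Longrightarrow> s w g = 0"
  obtains N where "\<And>w g. length w \<le> m \<Longrightarrow> N w g = s w g"
    and "\<And>u a b v g. N (u @ a # b # v) g = N (u @ b # a # v) g + bracket N u a b v g"
proof -
  obtain f :: "'b \<Rightarrow> nat" where f: "inj f"
    using finite_imp_inj_to_nat_seg[of "UNIV :: 'b set"] by auto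
  have "relation_at (nf f s) n" for n
    by (induction n rule: less_induct) (rule relation_at_nf[OF f])
  then have "nf f s (u @ a # b # v) g = nf f s (u @ b # a # v) g + bracket (nf f s) u a b v g" for u a b v g
    unfolding relation_at_def by blast
  with that[of "nf f s"] nf_initial[of s m _ f] assms show thesis by blast
qed

end

section \<open>Recognising an associated graded algebra\<close>

text \<open>
  A graded algebra given by the projections onto its homogeneous components. The last two axioms say
  that it is the direct sum of the components.
\<close>

locale graded_algebra = B: ring B for B :: "(complex, 'b) module" (structure) +
  fixes component :: "nat \<Rightarrow> 'b \<Rightarrow> 'b"
  assumes component_closed: "b \<in> carrier B \<Longrightarrow> component m b \<in> carrier B"
    and smult_mem: "b \<in> carrier B \<Longrightarrow> z \<odot>\<^bsub>B\<^esub> b \<in> carrier B"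
    and component_component: "b \<in> carrier B \<Longrightarrow> component m (component n b) = (if m = n then component m b else \<zero>\<^bsub>B\<^esub>)"
    and component_add: "b \<in> carrier B \<Longrightarrow> b' \<in> carrier B \<Longrightarrow> component m (b \<oplus>\<^bsub>B\<^esub> b') = component m b \<oplus>\<^bsub>B\<^esub> component m b'"
    and component_smult: "b \<in> carrier B \<Longrightarrow> component m (z \<odot>\<^bsub>B\<^esub> b) = z \<odot>\<^bsub>B\<^esub> component m b"
    and component_one: "component m \<one>\<^bsub>B\<^esub> = (if m = 0 then \<one>\<^bsub>B\<^esub> else \<zero>\<^bsub>B\<^esub>)"
    and component_mult: "b \<in> carrier B \<Longrightarrow> b' \<in> carrier B \<Longrightarrow>
      component m (b \<otimes>\<^bsub>B\<^esub> b') = (\<Oplus>\<^bsub>B\<^esub>i\<in>{..m}. component i b \<otimes>\<^bsub>B\<^esub> component (m - i) b')"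
    and component_finite: "b \<in> carrier B \<Longrightarrow> finite {m. component m b \<noteq> \<zero>\<^bsub>B\<^esub>}"
    and component_ext: "b \<in> carrier B \<Longrightarrow> b' \<in> carrier B \<Longrightarrow> (\<And>m. component m b = component m b') \<Longrightarrow> b = b'"
    and component_build: "finite {m. c m \<noteq> \<zero>\<^bsub>B\<^esub>} \<Longrightarrow> (\<And>m. c m \<in> carrier B) \<Longrightarrow> (\<And>m. component m (c m) = c m) \<Longrightarrow>
      \<exists>b\<in>carrier B. \<forall>m. component m b = c m"
begin

lemma component_zero [simp]: "component m \<zero>\<^bsub>B\<^esub> = \<zero>\<^bsub>B\<^esub>"
  using component_component[of "\<one>\<^bsub>B\<^esub>" m "Suc m"] component_one[of "Suc m"] by simp

end

text \<open>
  A compatible family of leading symbol maps \<open>s m\<close> from \<open>F m\<close> onto the component of degree \<open>m\<close>, with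
  kernel \<open>F (m - 1)\<close>. Such a family is the same as a graded isomorphism from the associated graded
  algebra of \<open>H\<close> to \<open>B\<close>.
\<close>

locale filtered_comparison = graded_algebra B component + H: ring H
  for B :: "(complex, 'b) module" and component and H :: "(complex, 'h) module" +
  fixes F :: "nat \<Rightarrow> 'h set" and s :: "nat \<Rightarrow> 'h \<Rightarrow> 'b"
  assumes F_closed: "F m \<subseteq> carrier H"
    and F_add: "x \<in> F m \<Longrightarrow> y \<in> F m \<Longrightarrow> x \<oplus>\<^bsub>H\<^esub> y \<in> F m"
    and F_uminus: "x \<in> F m \<Longrightarrow> \<ominus>\<^bsub>H\<^esub> x \<in> F m"
    and F_one: "\<one>\<^bsub>H\<^esub> \<in> F 0"
    and F_mono: "F m \<subseteq> F (Suc m)"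
    and F_mult: "x \<in> F i \<Longrightarrow> y \<in> F j \<Longrightarrow> x \<otimes>\<^bsub>H\<^esub> y \<in> F (i + j)"
    and F_smult: "x \<in> F m \<Longrightarrow> z \<odot>\<^bsub>H\<^esub> x \<in> F m"
    and s_closed: "x \<in> F m \<Longrightarrow> s m x \<in> carrier B"
    and s_component: "x \<in> F m \<Longrightarrow> component m (s m x) = s m x"
    and s_surj: "c \<in> carrier B \<Longrightarrow> component m c = c \<Longrightarrow> \<exists>x\<in>F m. s m x = c"
    and s_add: "x \<in> F m \<Longrightarrow> y \<in> F m \<Longrightarrow> s m (x \<oplus>\<^bsub>H\<^esub> y) = s m x \<oplus>\<^bsub>B\<^esub> s m y"
    and s_smult: "x \<in> F m \<Longrightarrow> s m (z \<odot>\<^bsub>H\<^esub> x) = z \<odot>\<^bsub>B\<^esub> s m x"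
    and s_mult: "x \<in> F i \<Longrightarrow> y \<in> F j \<Longrightarrow> s (i + j) (x \<otimes>\<^bsub>H\<^esub> y) = s i x \<otimes>\<^bsub>B\<^esub> s j y"
    and s_one: "s 0 \<one>\<^bsub>H\<^esub> = \<one>\<^bsub>B\<^esub>"
    and s_zero_iff: "x \<in> F m \<Longrightarrow> s m x = \<zero>\<^bsub>B\<^esub> \<longleftrightarrow> x \<in> filt_pred H F m"
begin

text \<open>
  The cosets of \<open>F (m - 1)\<close> in \<open>F m\<close> are the fibres of the symbol map, so the associated graded algebra
  can be handled without choosing representatives.
\<close>

definition fiber :: "nat \<Rightarrow> 'b \<Rightarrow> 'h set" where
  "fiber m c = {x \<in> F m. s m x = c}"

lemma F_zero: "\<zero>\<^bsub>H\<^esub> \<in> F m"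
proof -
  have "\<one>\<^bsub>H\<^esub> \<in> F m" using F_one F_mono by (induction m) auto
  then have "\<one>\<^bsub>H\<^esub> \<oplus>\<^bsub>H\<^esub> \<ominus>\<^bsub>H\<^esub> \<one>\<^bsub>H\<^esub> \<in> F m" using F_add F_uminus by blast
  then show ?thesis by (simp add: H.r_neg)
qed

lemma F_carrier [simp]: "x \<in> F m \<Longrightarrow> x \<in> carrier H"
  using F_closed by blast

lemma pred_subset: "filt_pred H F m \<subseteq> F m"
  using F_mono F_zero by (auto simp: filt_pred_def split: nat.splits)

lemma s_zero: "s m \<zero>\<^bsub>H\<^esub> = \<zero>\<^bsub>B\<^esub>"
  using s_add[OF F_zero[of m] F_zero[of m]] s_closed[OF F_zero[of m]]
  by (metis B.add.l_cancel_one H.l_zero H.zero_closed)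

lemma filt_pred_fiber: "filt_pred H F m = fiber m \<zero>\<^bsub>B\<^esub>"
  using s_zero_iff pred_subset by (auto simp: fiber_def)

lemma coset_fiber:
  assumes "a \<in> F m"
  shows "filt_pred H F m +>\<^bsub>H\<^esub> a = fiber m (s m a)"
proof (rule Set.set_eqI)
  fix x
  show "x \<in> filt_pred H F m +>\<^bsub>H\<^esub> a \<longleftrightarrow> x \<in> fiber m (s m a)"
  proof
    assume "x \<in> filt_pred H F m +>\<^bsub>H\<^esub> a"
    then obtain p where p: "p \<in> F m" "s m p = \<zero>\<^bsub>B\<^esub>" "x = p \<oplus>\<^bsub>H\<^esub> a"
      by (auto simp: a_r_coset_def' filt_pred_fiber fiber_def)
    then show "x \<in> fiber m (s m a)"
      using assms by (simp add: fiber_def F_add s_add s_closed)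
  next
    assume x: "x \<in> fiber m (s m a)"
    define p where "p = x \<oplus>\<^bsub>H\<^esub> \<ominus>\<^bsub>H\<^esub> a"
    have F: "x \<in> F m" "p \<in> F m" using x assms by (auto simp: fiber_def p_def F_add F_uminus)
    have "x = p \<oplus>\<^bsub>H\<^esub> a" using F assms by (simp add: p_def H.a_assoc H.l_neg)
    moreover from this have "s m x = s m p \<oplus>\<^bsub>B\<^esub> s m a" using s_add F assms by simp
    then have "s m p = \<zero>\<^bsub>B\<^esub>"
      using x s_closed[OF F(2)] s_closed[OF assms] by (simp add: fiber_def B.add.l_cancel_one')
    ultimately show "x \<in> filt_pred H F m +>\<^bsub>H\<^esub> a"
      using F by (auto simp: a_r_coset_def' filt_pred_fiber fiber_def)
  qed
qed

lemma fiber_nonempty: "c \<in> carrier B \<Longrightarrow> component m c = c \<Longrightarrow> fiber m c \<noteq> {}"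
  using s_surj by (auto simp: fiber_def)

lemma fiber_inject:
  "c \<in> carrier B \<Longrightarrow> component m c = c \<Longrightarrow> fiber m c = fiber m c' \<Longrightarrow> c = c'"
  using s_surj[of c m] by (auto simp: fiber_def)

text \<open>
  The inverse of the isomorphism that is to be constructed.
\<close>

definition graded_class :: "'b \<Rightarrow> nat \<Rightarrow> 'h set" where
  "graded_class b = (\<lambda>m. fiber m (component m b))"

abbreviation "gr \<equiv> assoc_graded H F"

lemma component_idem: "b \<in> carrier B \<Longrightarrow> component m (component m b) = component m b"
  by (simp add: component_component)

lemma graded_class_trivial_iff:
  "b \<in> carrier B \<Longrightarrow> graded_class b m = filt_pred H F m \<longleftrightarrow> component m b = \<zero>\<^bsub>B\<^esub>"
  using fiber_inject[of "component m b" m "\<zero>\<^bsub>B\<^esub>"]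
  by (auto simp: graded_class_def filt_pred_fiber component_closed component_idem)

lemma graded_class_inj: "inj_on graded_class (carrier B)"
proof (rule inj_onI)
  fix b b' assume b: "b \<in> carrier B" "b' \<in> carrier B" and eq: "graded_class b = graded_class b'"
  have "component m b = component m b'" for m
    using fun_cong[OF eq, of m] fiber_inject[of "component m b" m "component m b'"] b
    by (simp add: graded_class_def component_closed component_idem)
  then show "b = b'" using component_ext b by blast
qed

lemma carrier_gr: "carrier gr = graded_class ` carrier B"
proof (intro Set.set_eqI iffI)
  fix f assume f: "f \<in> carrier gr"
  have "\<exists>a\<in>F m. f m = fiber m (s m a)" for m
    using f coset_fiber by (fastforce simp: assoc_graded_def)
  then obtain a where a: "\<And>m. a m \<in> F m" "\<And>m. f m = fiber m (s m (a m))" by metis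
  have "s m (a m) = \<zero>\<^bsub>B\<^esub>" if "f m = filt_pred H F m" for m
    using that a fiber_inject[of "s m (a m)" m "\<zero>\<^bsub>B\<^esub>"] s_closed s_component by (auto simp: filt_pred_fiber)
  then have "{m. s m (a m) \<noteq> \<zero>\<^bsub>B\<^esub>} \<subseteq> {m. f m \<noteq> filt_pred H F m}" by blast
  moreover have "finite {m. f m \<noteq> filt_pred H F m}" using f by (simp add: assoc_graded_def)
  ultimately have "finite {m. s m (a m) \<noteq> \<zero>\<^bsub>B\<^esub>}" by (rule finite_subset)
  from component_build[OF this] a s_closed s_component
  obtain b where "b \<in> carrier B" "\<And>m. component m b = s m (a m)" by blast
  then show "f \<in> graded_class ` carrier B"
    using a(2) by (auto simp: graded_class_def intro!: image_eqI[of _ _ b])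
next
  fix f assume "f \<in> graded_class ` carrier B"
  then obtain b where b: "b \<in> carrier B" "f = graded_class b" by blast
  have "\<exists>a\<in>F m. f m = filt_pred H F m +>\<^bsub>H\<^esub> a" for m
    using s_surj[of "component m b" m] b by (metis graded_class_def coset_fiber component_closed component_idem)
  moreover have "finite {m. f m \<noteq> filt_pred H F m}"
    using component_finite[OF b(1)] graded_class_trivial_iff[OF b(1)] b(2) by simp
  ultimately show "f \<in> carrier gr" by (simp add: assoc_graded_def)
qed

lemma graded_class_add:
  assumes "b \<in> carrier B" "b' \<in> carrier B"
  shows "graded_class (b \<oplus>\<^bsub>B\<^esub> b') = graded_class b \<oplus>\<^bsub>gr\<^esub> graded_class b'"
proof
  fix m
  obtain y where y: "y \<in> F m" "s m y = component m b'"
    using s_surj[of "component m b'" m] assms component_closed component_idem by blast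
  show "graded_class (b \<oplus>\<^bsub>B\<^esub> b') m = (graded_class b \<oplus>\<^bsub>gr\<^esub> graded_class b') m"
  proof (intro Set.set_eqI iffI)
    fix x assume x: "x \<in> graded_class (b \<oplus>\<^bsub>B\<^esub> b') m"
    define p where "p = x \<oplus>\<^bsub>H\<^esub> \<ominus>\<^bsub>H\<^esub> y"
    have F: "x \<in> F m" "p \<in> F m" using x y by (auto simp: graded_class_def fiber_def p_def F_add F_uminus)
    have xp: "x = p \<oplus>\<^bsub>H\<^esub> y" using F y by (simp add: p_def H.a_assoc H.l_neg)
    then have "s m p \<oplus>\<^bsub>B\<^esub> component m b' = component m b \<oplus>\<^bsub>B\<^esub> component m b'"
      using s_add[OF F(2) y(1)] x y assms by (simp add: graded_class_def fiber_def component_add)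
    then have "s m p = component m b"
      using F s_closed assms component_closed by (metis B.add.right_cancel)
    then show "x \<in> (graded_class b \<oplus>\<^bsub>gr\<^esub> graded_class b') m"
      using xp F y by (auto simp: assoc_graded_def set_add_def' graded_class_def fiber_def)
  next
    fix x assume "x \<in> (graded_class b \<oplus>\<^bsub>gr\<^esub> graded_class b') m"
    then show "x \<in> graded_class (b \<oplus>\<^bsub>B\<^esub> b') m"
      using assms by (auto simp: assoc_graded_def set_add_def' graded_class_def fiber_def F_add s_add component_add)
  qed
qed

lemma graded_class_one: "graded_class \<one>\<^bsub>B\<^esub> = \<one>\<^bsub>gr\<^esub>"
proof
  fix m
  show "graded_class \<one>\<^bsub>B\<^esub> m = \<one>\<^bsub>gr\<^esub> m"
    by (cases "m = 0")
       (simp_all add: assoc_graded_def coset_fiber F_one F_zero s_one s_zero graded_class_def component_one)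
qed

lemma graded_class_smult:
  assumes "b \<in> carrier B"
  shows "graded_class (z \<odot>\<^bsub>B\<^esub> b) = z \<odot>\<^bsub>gr\<^esub> graded_class b"
proof
  fix m
  have "(\<Union>a\<in>fiber m (component m b). filt_pred H F m +>\<^bsub>H\<^esub> (z \<odot>\<^bsub>H\<^esub> a)) =
      (\<Union>a\<in>fiber m (component m b). fiber m (z \<odot>\<^bsub>B\<^esub> component m b))"
    by (intro SUP_cong refl) (auto simp: fiber_def coset_fiber F_smult s_smult)
  then show "graded_class (z \<odot>\<^bsub>B\<^esub> b) m = (z \<odot>\<^bsub>gr\<^esub> graded_class b) m"
    using fiber_nonempty[of "component m b" m] assms
    by (simp add: graded_class_def assoc_graded_def component_smult component_closed component_idem)
qed

text \<open>
  The product in the associated graded algebra is a union over all families of representatives; each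
  of them contributes the same coset because the symbols are multiplicative.
\<close>

lemma graded_class_mult:
  assumes "b \<in> carrier B" "b' \<in> carrier B"
  shows "graded_class (b \<otimes>\<^bsub>B\<^esub> b') = graded_class b \<otimes>\<^bsub>gr\<^esub> graded_class b'"
proof
  fix m
  let ?P = "Pi UNIV (graded_class b)" and ?Q = "Pi UNIV (graded_class b')"
  have coset: "filt_pred H F m +>\<^bsub>H\<^esub> (\<Oplus>\<^bsub>H\<^esub>i\<in>{..m}. x i \<otimes>\<^bsub>H\<^esub> y (m - i)) = graded_class (b \<otimes>\<^bsub>B\<^esub> b') m"
    if "x \<in> ?P" "y \<in> ?Q" for x y
  proof -
    have x: "x i \<in> F i" "s i (x i) = component i b" and y: "y i \<in> F i" "s i (y i) = component i b'" for i
      using that by (auto simp: Pi_iff graded_class_def fiber_def)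
    have factor: "x i \<otimes>\<^bsub>H\<^esub> y (m - i) \<in> F m" "s m (x i \<otimes>\<^bsub>H\<^esub> y (m - i)) = component i b \<otimes>\<^bsub>B\<^esub> component (m - i) b'"
      if "i \<le> m" for i
      using F_mult[OF x(1)[of i] y(1)[of "m - i"]] s_mult[OF x(1)[of i] y(1)[of "m - i"]] that x y by simp_all
    have sum: "(\<Oplus>\<^bsub>H\<^esub>i\<in>S. x i \<otimes>\<^bsub>H\<^esub> y (m - i)) \<in> F m \<and>
        s m (\<Oplus>\<^bsub>H\<^esub>i\<in>S. x i \<otimes>\<^bsub>H\<^esub> y (m - i)) = (\<Oplus>\<^bsub>B\<^esub>i\<in>S. component i b \<otimes>\<^bsub>B\<^esub> component (m - i) b')"
      if "finite S" "S \<subseteq> {..m}" for S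
      using that
    proof (induction S rule: finite_induct)
      case empty
      then show ?case by (simp add: F_zero s_zero)
    next
      case (insert j S)
      have "(\<lambda>i. x i \<otimes>\<^bsub>H\<^esub> y (m - i)) \<in> S \<rightarrow> carrier H" "x j \<otimes>\<^bsub>H\<^esub> y (m - j) \<in> carrier H"
        using F_carrier[OF x(1)] F_carrier[OF y(1)] by auto
      moreover have "(\<lambda>i. component i b \<otimes>\<^bsub>B\<^esub> component (m - i) b') \<in> S \<rightarrow> carrier B" "component j b \<otimes>\<^bsub>B\<^esub> component (m - j) b' \<in> carrier B"
        using assms component_closed by auto
      ultimately show ?case
        using insert factor[of j] by (simp add: F_add s_add)
    qed
    show ?thesis
      using sum[of "{..m}"] assms by (simp add: coset_fiber graded_class_def component_mult)
  qed
  have "?P \<noteq> {}" "?Q \<noteq> {}"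
    using fiber_nonempty assms by (auto simp: Pi_eq_empty graded_class_def component_closed component_idem)
  then have "(\<Union>x\<in>?P. \<Union>y\<in>?Q. filt_pred H F m +>\<^bsub>H\<^esub> (\<Oplus>\<^bsub>H\<^esub>i\<in>{..m}. x i \<otimes>\<^bsub>H\<^esub> y (m - i)))
      = graded_class (b \<otimes>\<^bsub>B\<^esub> b') m"
    using coset by (simp cong: SUP_cong)
  then show "graded_class (b \<otimes>\<^bsub>B\<^esub> b') m = (graded_class b \<otimes>\<^bsub>gr\<^esub> graded_class b') m"
    by (simp add: assoc_graded_def)
qed

theorem assoc_graded_iso:
  "\<exists>\<phi>\<in>algebra_iso gr B. \<forall>d. \<phi> ` assoc_graded_part H F d = {b \<in> carrier B. \<forall>m. m \<noteq> d \<longrightarrow> component m b = \<zero>\<^bsub>B\<^esub>}"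
proof (intro bexI allI)
  define \<phi> where "\<phi> = inv_into (carrier B) graded_class"
  have \<phi>: "\<phi> (graded_class b) = b" if "b \<in> carrier B" for b
    unfolding \<phi>_def using inv_into_f_f[OF graded_class_inj that] .
  have bij: "bij_betw \<phi> (carrier gr) (carrier B)"
    unfolding carrier_gr \<phi>_def by (rule bij_betw_inv_into) (simp add: bij_betw_def graded_class_inj)
  show "\<phi> \<in> algebra_iso gr B"
    unfolding algebra_iso_def ring_iso_def
    using bij
    by (auto intro!: ring_hom_memI simp: carrier_gr \<phi> smult_mem
        simp flip: graded_class_mult graded_class_add graded_class_one graded_class_smult)
  fix d
  have "assoc_graded_part H F d = graded_class ` {b \<in> carrier B. \<forall>m. m \<noteq> d \<longrightarrow> component m b = \<zero>\<^bsub>B\<^esub>}"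
    unfolding assoc_graded_part_def carrier_gr using graded_class_trivial_iff by auto
  then show "\<phi> ` assoc_graded_part H F d = {b \<in> carrier B. \<forall>m. m \<noteq> d \<longrightarrow> component m b = \<zero>\<^bsub>B\<^esub>}"
    by (auto simp: \<phi> image_iff)
qed

end

section \<open>Graded skew group algebras\<close>

definition part_of_degree :: "('m \<Rightarrow> nat) \<Rightarrow> nat \<Rightarrow> ('m \<Rightarrow>\<^sub>0 complex) \<Rightarrow> ('m \<Rightarrow>\<^sub>0 complex)" where
  "part_of_degree dg d p = Poly_Mapping.mapp (\<lambda>k v. v when dg k = d) p"

lemma lookup_part_of_degree:
  "Poly_Mapping.lookup (part_of_degree dg d p) k = (Poly_Mapping.lookup p k when dg k = d)"
  by (simp add: part_of_degree_def lookup_mapp in_keys_iff when_def)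

lemma part_of_degree_add: "part_of_degree dg d (p + q) = part_of_degree dg d p + part_of_degree dg d q"
  by (rule poly_mapping_eqI) (simp add: lookup_part_of_degree lookup_add when_add_distrib)

lemma part_of_degree_zero [simp]: "part_of_degree dg d 0 = 0"
  by (rule poly_mapping_eqI) (simp add: lookup_part_of_degree)

lemma part_of_degree_single:
  "part_of_degree dg d (Poly_Mapping.single k z) = (if dg k = d then Poly_Mapping.single k z else 0)"
  by (rule poly_mapping_eqI) (simp add: lookup_part_of_degree lookup_single when_def)

lemma part_of_degree_sum: "part_of_degree dg d (\<Sum>i\<in>S. p i) = (\<Sum>i\<in>S. part_of_degree dg d (p i))"
  by (induction S rule: infinite_finite_induct) (simp_all add: part_of_degree_add)

lemma part_of_degree_part:
  "part_of_degree dg d (part_of_degree dg e p) = (if d = e then part_of_degree dg d p else 0)"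
  by (rule poly_mapping_eqI) (simp add: lookup_part_of_degree when_def)

text \<open>
  Both sides are bilinear, so it is enough to multiply two basis elements.
\<close>

lemma part_of_degree_mult:
  fixes p q :: "'m::monoid_add \<Rightarrow>\<^sub>0 complex"
  assumes dg: "\<And>k k'. dg (k + k') = dg k + dg k'"
  shows "part_of_degree dg d (p * q) =
    (\<Sum>i\<le>d. part_of_degree dg i p * part_of_degree dg (d - i) q)"
proof (induction p rule: poly_mapping_induct)
  case (single k z)
  show ?case
  proof (induction q rule: poly_mapping_induct)
    case (single k' z')
    have "(\<Sum>i\<le>d. part_of_degree dg i (Poly_Mapping.single k z) * part_of_degree dg (d - i) (Poly_Mapping.single k' z'))
        = (\<Sum>i\<le>d. if i = dg k then if dg k' = d - i then Poly_Mapping.single (k + k') (z * z') else 0 else 0)"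
      by (intro sum.cong refl) (auto simp: part_of_degree_single mult_single)
    also have "\<dots> = (if dg k \<le> d then if dg k' = d - dg k then Poly_Mapping.single (k + k') (z * z') else 0 else 0)"
      by (subst sum.delta) auto
    also have "\<dots> = part_of_degree dg d (Poly_Mapping.single (k + k') (z * z'))"
      by (auto simp: part_of_degree_single dg)
    finally show ?case by (simp add: mult_single)
  qed (simp_all add: part_of_degree_add distrib_left sum.distrib)
qed (simp_all add: part_of_degree_add distrib_right sum.distrib)

lemma part_of_degree_push:
  assumes "\<And>k. dg' (f k) = dg k"
  shows "part_of_degree dg' d (push f p) = push f (part_of_degree dg d p)"
  by (induction p rule: poly_mapping_induct) (simp_all add: push_add part_of_degree_add part_of_degree_single assms)

locale graded_skew_action = skew_action act
  for act :: "'g::{finite,monoid_mult} \<Rightarrow> ('m::monoid_add \<Rightarrow>\<^sub>0 complex) \<Rightarrow> ('m \<Rightarrow>\<^sub>0 complex)" +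
  fixes dg :: "'m \<Rightarrow> nat"
  assumes deg_zero: "dg 0 = 0"
    and deg_add: "dg (k + k') = dg k + dg k'"
    and act_part: "part_of_degree dg d (act g p) = act g (part_of_degree dg d p)"
begin

definition component :: "nat \<Rightarrow> ('g \<Rightarrow> ('m \<Rightarrow>\<^sub>0 complex)) \<Rightarrow> ('g \<Rightarrow> ('m \<Rightarrow>\<^sub>0 complex))" where
  "component d p = (\<lambda>g. part_of_degree dg d (p g))"

lemma lookup_component: "Poly_Mapping.lookup (component d p g) k = (Poly_Mapping.lookup (p g) k when dg k = d)"
  by (simp add: component_def lookup_part_of_degree)

sublocale graded_algebra A component
proof
  show "component d (b \<otimes>\<^bsub>A\<^esub> b') = (\<Oplus>\<^bsub>A\<^esub>i\<in>{..d}. component i b \<otimes>\<^bsub>A\<^esub> component (d - i) b')" for d b b'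
  proof
    fix k
    have "component d (b \<otimes>\<^bsub>A\<^esub> b') k = (\<Sum>(g, h)\<in>{(g, h). g * h = k}. \<Sum>i\<le>d.
        part_of_degree dg i (b g) * act g (part_of_degree dg (d - i) (b' h)))"
      unfolding component_def mult_A part_of_degree_sum
      by (intro sum.cong refl) (auto simp: part_of_degree_mult[OF deg_add] act_part)
    also have "\<dots> = (\<Sum>i\<le>d. \<Sum>(g, h)\<in>{(g, h). g * h = k}.
        part_of_degree dg i (b g) * act g (part_of_degree dg (d - i) (b' h)))"
      by (simp only: case_prod_beta') (rule sum.swap)
    finally show "component d (b \<otimes>\<^bsub>A\<^esub> b') k = (\<Oplus>\<^bsub>A\<^esub>i\<in>{..d}. component i b \<otimes>\<^bsub>A\<^esub> component (d - i) b') k"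
      by (simp add: finsum_A mult_A component_def)
  qed
  show "component d \<one>\<^bsub>A\<^esub> = (if d = 0 then \<one>\<^bsub>A\<^esub> else \<zero>\<^bsub>A\<^esub>)" for d
    by (auto simp: component_def one_A zero_A fun_eq_iff deg_zero part_of_degree_single simp flip: single_one)
  show "component d (z \<odot>\<^bsub>A\<^esub> b) = z \<odot>\<^bsub>A\<^esub> component d b" for d z b
  proof
    fix g
    have "part_of_degree dg d (Poly_Mapping.single 0 z * p) = Poly_Mapping.single 0 z * part_of_degree dg d p" for p
      by (induction p rule: poly_mapping_induct)
         (simp_all add: distrib_left part_of_degree_add mult_single part_of_degree_single deg_add deg_zero)
    then show "component d (z \<odot>\<^bsub>A\<^esub> b) g = (z \<odot>\<^bsub>A\<^esub> component d b) g" by (simp add: component_def smult_A)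
  qed
  show "finite {d. component d b \<noteq> \<zero>\<^bsub>A\<^esub>}" for b
  proof (rule finite_subset)
    show "{d. component d b \<noteq> \<zero>\<^bsub>A\<^esub>} \<subseteq> (\<Union>g\<in>UNIV. dg ` Poly_Mapping.keys (b g))"
    proof
      fix d assume "d \<in> {d. component d b \<noteq> \<zero>\<^bsub>A\<^esub>}"
      then obtain g where "component d b g \<noteq> 0" by (auto simp: zero_A fun_eq_iff)
      then obtain k where "Poly_Mapping.lookup (component d b g) k \<noteq> 0" by (metis lookup_zero poly_mapping_eqI)
      then have "k \<in> Poly_Mapping.keys (b g)" "d = dg k"
        by (auto simp: lookup_component when_def in_keys_iff split: if_splits)
      then show "d \<in> (\<Union>g\<in>UNIV. dg ` Poly_Mapping.keys (b g))"
        by blast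
    qed
  qed simp
  show "b = b'" if "\<And>m. component m b = component m b'" for b b'
  proof (rule ext, rule poly_mapping_eqI)
    fix g k
    show "Poly_Mapping.lookup (b g) k = Poly_Mapping.lookup (b' g) k"
      using that[of "dg k"] lookup_component[of "dg k" b g k] lookup_component[of "dg k" b' g k] by simp
  qed
  show "\<exists>b\<in>carrier A. \<forall>m. component m b = c m"
    if fin: "finite {m. c m \<noteq> \<zero>\<^bsub>A\<^esub>}" and c: "\<And>m. component m (c m) = c m" for c
  proof (intro bexI allI)
    let ?b = "\<lambda>g. \<Sum>m\<in>{m. c m \<noteq> \<zero>\<^bsub>A\<^esub>}. c m g"
    fix d
    show "component d ?b = c d"
    proof
      fix g
      have "part_of_degree dg d (c m g) = (if m = d then c d g else 0)" for m
        using fun_cong[OF c[of m], of g] part_of_degree_part[of dg d m "c m g"] by (auto simp: component_def)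
      then have "component d ?b g = (\<Sum>m\<in>{m. c m \<noteq> \<zero>\<^bsub>A\<^esub>}. if m = d then c d g else 0)"
        by (simp add: component_def part_of_degree_sum)
      also have "\<dots> = c d g"
        using fin by (subst sum.delta) (auto simp: zero_A)
      finally show "component d ?b g = c d g" .
    qed
  qed simp
qed (auto simp: component_def part_of_degree_part part_of_degree_add add_A zero_A fun_eq_iff)

end

section \<open>Permutation representations\<close>

text \<open>
  The commutative image of a word; extended linearly, the projection of \<open>T(V)\<close> onto \<open>S(V)\<close>.
\<close>

definition monomial :: "'b tensor_word \<Rightarrow> ('b \<Rightarrow>\<^sub>0 nat)" where
  "monomial w = (\<Sum>b\<leftarrow>letters w. Poly_Mapping.single b 1)"

definition total_degree :: "('b::finite \<Rightarrow>\<^sub>0 nat) \<Rightarrow> nat" where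
  "total_degree m = (\<Sum>b\<in>UNIV. Poly_Mapping.lookup m b)"

definition map_word :: "('b \<Rightarrow> 'b) \<Rightarrow> 'b tensor_word \<Rightarrow> 'b tensor_word" where
  "map_word f w = TWord (map f (letters w))"

definition map_monomial :: "('b \<Rightarrow> 'b) \<Rightarrow> ('b::finite \<Rightarrow>\<^sub>0 nat) \<Rightarrow> ('b \<Rightarrow>\<^sub>0 nat)" where
  "map_monomial f m = (\<Sum>b\<in>UNIV. Poly_Mapping.single (f b) (Poly_Mapping.lookup m b))"

lemma letters_plus [simp]: "letters (u + v) = letters u @ letters v"
  by (simp add: plus_tensor_word_def)

lemma letters_zero [simp]: "letters 0 = []"
  by (simp add: zero_tensor_word_def)

lemma map_word_plus: "map_word f (u + v) = map_word f u + map_word f v"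
  by (simp add: map_word_def plus_tensor_word_def)

lemma map_word_zero [simp]: "map_word f 0 = 0"
  by (simp add: map_word_def zero_tensor_word_def)

lemma monomial_plus: "monomial (u + v) = monomial u + monomial v"
  by (simp add: monomial_def)

lemma map_monomial_plus: "map_monomial f (m + k) = map_monomial f m + map_monomial f k"
  by (simp add: map_monomial_def lookup_add single_add sum.distrib)

lemma map_monomial_zero [simp]: "map_monomial f 0 = 0"
  by (simp add: map_monomial_def)

lemma map_monomial_single: "map_monomial f (Poly_Mapping.single b k) = Poly_Mapping.single (f b) k"
proof -
  have "map_monomial f (Poly_Mapping.single b k) = (\<Sum>c\<in>UNIV. if c = b then Poly_Mapping.single (f b) k else 0)"
    unfolding map_monomial_def by (intro sum.cong refl) (auto simp: lookup_single when_def)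
  then show ?thesis by simp
qed

lemma total_degree_plus: "total_degree (m + k) = total_degree m + total_degree k"
  by (simp add: total_degree_def lookup_add sum.distrib)

lemma total_degree_zero [simp]: "total_degree 0 = 0"
  by (simp add: total_degree_def)

lemma total_degree_single [simp]: "total_degree (Poly_Mapping.single b k) = k"
  by (simp add: total_degree_def lookup_single when_def)

lemma total_degree_map_monomial: "total_degree (map_monomial f m) = total_degree m"
  by (induction m rule: poly_mapping_induct)
     (simp_all add: map_monomial_plus total_degree_plus map_monomial_single)

lemma total_degree_monomial: "total_degree (monomial w) = length (letters w)" for w :: "'b::finite tensor_word"
proof -
  have "total_degree (\<Sum>b\<leftarrow>bs. Poly_Mapping.single b 1) = length bs" for bs :: "'b list"
    by (induction bs) (simp_all add: total_degree_plus)
  then show ?thesis by (simp add: monomial_def)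
qed

lemma monomial_map_word: "monomial (map_word f w) = map_monomial f (monomial w)"
proof -
  have "(\<Sum>b\<leftarrow>map f bs. Poly_Mapping.single b 1) = map_monomial f (\<Sum>b\<leftarrow>bs. Poly_Mapping.single b 1)" for bs
    by (induction bs) (simp_all add: map_monomial_plus map_monomial_single)
  then show ?thesis by (simp add: monomial_def map_word_def)
qed

lemma monomial_surj: "\<exists>w. monomial w = m"
proof (induction m rule: poly_mapping_induct)
  case zero
  show ?case by (rule exI[of _ 0]) (simp add: monomial_def)
next
  case (single b k)
  have "(\<Sum>b\<leftarrow>replicate k b. Poly_Mapping.single b (1::nat)) = Poly_Mapping.single b k"
    by (induction k) (simp_all flip: single_add)
  then show ?case by (intro exI[of _ "TWord (replicate k b)"]) (simp add: monomial_def)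
next
  case (add p q)
  then show ?case by (metis monomial_plus)
qed

lemma lookup_monomial: "Poly_Mapping.lookup (monomial w) b = count (mset (letters w)) b"
proof -
  have "Poly_Mapping.lookup (\<Sum>b\<leftarrow>bs. Poly_Mapping.single b 1) b = count (mset bs) b" for bs
    by (induction bs) (auto simp: lookup_add lookup_single when_def)
  then show ?thesis by (simp add: monomial_def)
qed

lemma monomial_eq_iff: "monomial u = monomial v \<longleftrightarrow> mset (letters u) = mset (letters v)"
  by (metis lookup_monomial multiset_eqI poly_mapping_eqI)

lemma tensor_vec_axis: "tensor_vec (axis b z) = Poly_Mapping.single (TWord [b]) z"
proof -
  have "tensor_vec (axis b z) = (\<Sum>c\<in>UNIV. if c = b then Poly_Mapping.single (TWord [b]) z else 0)"
    unfolding tensor_vec_def by (intro sum.cong refl) (auto simp: axis_def)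
  then show ?thesis by simp
qed

lemma sym_vec_axis: "sym_vec (axis b z) = Poly_Mapping.single (Poly_Mapping.single b 1) z"
proof -
  have "sym_vec (axis b z) = (\<Sum>c\<in>UNIV. if c = b then Poly_Mapping.single (Poly_Mapping.single b 1) z else 0)"
    unfolding sym_vec_def by (intro sum.cong refl) (auto simp: axis_def)
  then show ?thesis by simp
qed

text \<open>
  For a permutation representation the action by automorphisms just renames letters; the same holds
  for monomials below.
\<close>

lemma tensor_act_permutation:
  assumes "\<And>b. \<rho> g (axis b 1) = axis (f b) 1"
  shows "tensor_act \<rho> g = push (map_word f)"
proof
  fix p
  have "prod_list (map (\<lambda>b. tensor_vec (\<rho> g (axis b 1))) bs) = Poly_Mapping.single (TWord (map f bs)) 1" for bs
    by (induction bs)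
       (simp_all add: assms tensor_vec_axis mult_single plus_tensor_word_def flip: zero_tensor_word_def single_one)
  then show "tensor_act \<rho> g p = push (map_word f) p"
    by (simp add: tensor_act_def push_def mult_single map_word_def)
qed

lemma sym_act_permutation:
  fixes \<rho> :: "'g \<Rightarrow> complex ^ 'b \<Rightarrow> complex ^ 'b::finite"
  assumes "\<And>b. \<rho> g (axis b 1) = axis (f b) 1"
  shows "sym_act \<rho> g = push (map_monomial f)"
proof
  fix p
  have power: "Poly_Mapping.single (Poly_Mapping.single b 1) 1 ^ k
      = (Poly_Mapping.single (Poly_Mapping.single b k) 1 :: 'b symmetric_algebra)" for b :: 'b and k
    by (induction k) (simp_all add: mult_single flip: single_add single_one)
  have "(\<Prod>b\<in>S. sym_vec (\<rho> g (axis b 1)) ^ Poly_Mapping.lookup m b) =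
      Poly_Mapping.single (\<Sum>b\<in>S. Poly_Mapping.single (f b) (Poly_Mapping.lookup m b)) 1" for m and S :: "'b set"
    by (induction S rule: infinite_finite_induct)
       (simp_all add: assms sym_vec_axis power[simplified] mult_single flip: single_one)
  then show "sym_act \<rho> g p = push (map_monomial f) p"
    by (simp add: sym_act_def push_def mult_single map_monomial_def)
qed

context permutation_action
begin

definition rep :: "'g \<Rightarrow> complex ^ 'b \<Rightarrow> complex ^ 'b" where
  "rep g v = (\<chi> b. v $ \<pi> (ginv g) b)"

lemma \<pi>_ginv [simp]: "\<pi> g (\<pi> (ginv g) b) = b" "\<pi> (ginv g) (\<pi> g b) = b"
  by (simp_all add: ginv \<pi>_one flip: \<pi>_mult)

lemma rep_axis: "rep g (axis b z) = axis (\<pi> g b) z"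
proof -
  have "\<pi> (ginv g) c = b \<longleftrightarrow> c = \<pi> g b" for c
    using \<pi>_ginv by metis
  then show ?thesis by (simp add: rep_def axis_def vec_eq_iff)
qed

lemma tensor_act_rep: "tensor_act rep g = push (map_word (\<pi> g))"
  by (rule tensor_act_permutation) (rule rep_axis)

lemma sym_act_rep: "sym_act rep g = push (map_monomial (\<pi> g))"
  by (rule sym_act_permutation) (rule rep_axis)

lemma map_word_mult: "map_word (\<pi> (g * h)) = (\<lambda>w. map_word (\<pi> g) (map_word (\<pi> h) w))"
  by (simp add: map_word_def \<pi>_mult fun_eq_iff)

lemma map_word_one: "map_word (\<pi> 1) = (\<lambda>w. w)"
proof
  show "map_word (\<pi> 1) w = w" for w
    by (cases w) (simp add: map_word_def \<pi>_one map_idI)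
qed

lemma map_monomial_mult: "map_monomial (\<pi> (g * h)) = (\<lambda>m. map_monomial (\<pi> g) (map_monomial (\<pi> h) m))"
proof
  fix m :: "'b \<Rightarrow>\<^sub>0 nat"
  obtain w where "m = monomial w" using monomial_surj by metis
  then show "map_monomial (\<pi> (g * h)) m = map_monomial (\<pi> g) (map_monomial (\<pi> h) m)"
    by (simp add: map_word_mult flip: monomial_map_word)
qed

lemma map_monomial_one: "map_monomial (\<pi> 1) = (\<lambda>m. m)"
proof
  fix m :: "'b \<Rightarrow>\<^sub>0 nat"
  obtain w where "m = monomial w" using monomial_surj by metis
  then show "map_monomial (\<pi> 1) m = m"
    by (simp add: map_word_one flip: monomial_map_word)
qed

sublocale T: graded_skew_action "tensor_act rep" "\<lambda>w. length (letters w)"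
proof unfold_locales
  show "part_of_degree (\<lambda>w. length (letters w)) d (tensor_act rep g p)
      = tensor_act rep g (part_of_degree (\<lambda>w. length (letters w)) d p)" for d g p
    unfolding tensor_act_rep by (rule part_of_degree_push) (simp add: map_word_def)
qed (simp_all add: tensor_act_rep push_add push_mult map_word_plus push_push map_word_mult map_word_one)

sublocale S: graded_skew_action "sym_act rep" total_degree
proof unfold_locales
  show "part_of_degree total_degree d (sym_act rep g p) = sym_act rep g (part_of_degree total_degree d p)" for d g p
    unfolding sym_act_rep by (rule part_of_degree_push) (rule total_degree_map_monomial)
qed (simp_all add: sym_act_rep push_add push_mult map_monomial_plus push_push map_monomial_mult map_monomial_one
       total_degree_plus)

end

section \<open>Quotients of complex algebras\<close>

text \<open>
  The records of complex algebras extend the ring operations of a library construction by a scalar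
  multiplication; this lemma transfers the ring axioms.
\<close>

lemma ring_cong:
  assumes "ring R" "carrier S = carrier R" "monoid.mult S = monoid.mult R" "one S = one R" "zero S = zero R" "add S = add R"
  shows "ring S"
proof -
  interpret R: ring R by (rule assms(1))
  note eqs = assms(2-)
  show ?thesis
  proof (rule ringI)
    show "abelian_group S"
    proof (rule abelian_groupI, unfold eqs)
      show "\<exists>y\<in>carrier R. y \<oplus>\<^bsub>R\<^esub> x = \<zero>\<^bsub>R\<^esub>" if "x \<in> carrier R" for x
        using R.l_neg[OF that] R.a_inv_closed[OF that] by blast
    qed (auto intro: R.a_assoc R.a_comm)
    show "monoid S"
      by (rule monoidI, unfold eqs) (auto intro: R.m_assoc)
  qed (unfold eqs, auto intro: R.l_distr R.r_distr)
qed

locale complex_algebra = ring A for A :: "(complex, 'a) module" (structure) +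
  assumes smult_closed [simp]: "a \<in> carrier A \<Longrightarrow> z \<odot>\<^bsub>A\<^esub> a \<in> carrier A"
    and smult_mult_left: "a \<in> carrier A \<Longrightarrow> b \<in> carrier A \<Longrightarrow> (z \<odot>\<^bsub>A\<^esub> a) \<otimes>\<^bsub>A\<^esub> b = z \<odot>\<^bsub>A\<^esub> (a \<otimes>\<^bsub>A\<^esub> b)"
    and smult_mult_right: "a \<in> carrier A \<Longrightarrow> b \<in> carrier A \<Longrightarrow> a \<otimes>\<^bsub>A\<^esub> (z \<odot>\<^bsub>A\<^esub> b) = z \<odot>\<^bsub>A\<^esub> (a \<otimes>\<^bsub>A\<^esub> b)"
begin

lemma smult_conv_mult: "a \<in> carrier A \<Longrightarrow> z \<odot>\<^bsub>A\<^esub> a = (z \<odot>\<^bsub>A\<^esub> \<one>\<^bsub>A\<^esub>) \<otimes>\<^bsub>A\<^esub> a"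
  by (simp add: smult_mult_left)

lemma smult_minus:
  assumes "a \<in> carrier A" "b \<in> carrier A"
  shows "z \<odot>\<^bsub>A\<^esub> (a \<ominus>\<^bsub>A\<^esub> b) = z \<odot>\<^bsub>A\<^esub> a \<ominus>\<^bsub>A\<^esub> z \<odot>\<^bsub>A\<^esub> b"
proof -
  have "z \<odot>\<^bsub>A\<^esub> (a \<ominus>\<^bsub>A\<^esub> b) = (z \<odot>\<^bsub>A\<^esub> \<one>\<^bsub>A\<^esub>) \<otimes>\<^bsub>A\<^esub> (a \<ominus>\<^bsub>A\<^esub> b)"
    using assms by (intro smult_conv_mult) simp
  also have "\<dots> = (z \<odot>\<^bsub>A\<^esub> \<one>\<^bsub>A\<^esub>) \<otimes>\<^bsub>A\<^esub> a \<ominus>\<^bsub>A\<^esub> (z \<odot>\<^bsub>A\<^esub> \<one>\<^bsub>A\<^esub>) \<otimes>\<^bsub>A\<^esub> b"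
    using assms by (simp add: a_minus_def r_distr r_minus)
  also have "\<dots> = z \<odot>\<^bsub>A\<^esub> a \<ominus>\<^bsub>A\<^esub> z \<odot>\<^bsub>A\<^esub> b"
    using assms by (simp only: smult_conv_mult[symmetric])
  finally show ?thesis .
qed

end

locale algebra_ideal = complex_algebra A + ideal I A for A :: "(complex, 'a) module" (structure) and I
begin

abbreviation "Q \<equiv> quotient_algebra A I"

lemma smult_ideal: "a \<in> I \<Longrightarrow> z \<odot>\<^bsub>A\<^esub> a \<in> I"
  by (subst smult_conv_mult) (auto intro: I_l_closed)

lemma coset_eq_iff: "a \<in> carrier A \<Longrightarrow> b \<in> carrier A \<Longrightarrow> I +>\<^bsub>A\<^esub> a = I +>\<^bsub>A\<^esub> b \<longleftrightarrow> a \<ominus>\<^bsub>A\<^esub> b \<in> I"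
  by (rule quotient_eq_iff_same_a_r_cos[OF is_ideal, symmetric])

text \<open>
  The scalar multiplication of the quotient is a union over the members of a coset.
\<close>

lemma coset_mem_iff: "a \<in> carrier A \<Longrightarrow> x \<in> I +>\<^bsub>A\<^esub> a \<longleftrightarrow> x \<in> carrier A \<and> x \<ominus>\<^bsub>A\<^esub> a \<in> I"
proof -
  assume a: "a \<in> carrier A"
  show ?thesis
  proof
    assume x: "x \<in> I +>\<^bsub>A\<^esub> a"
    then have "x \<in> carrier A" using a a_elemrcos_carrier by blast
    moreover have "I +>\<^bsub>A\<^esub> a = I +>\<^bsub>A\<^esub> x" using a_repr_independence'[OF x a] .
    ultimately show "x \<in> carrier A \<and> x \<ominus>\<^bsub>A\<^esub> a \<in> I" using a coset_eq_iff[of x a] by simp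
  next
    assume x: "x \<in> carrier A \<and> x \<ominus>\<^bsub>A\<^esub> a \<in> I"
    then have "I +>\<^bsub>A\<^esub> x = I +>\<^bsub>A\<^esub> a" using a coset_eq_iff by simp
    then show "x \<in> I +>\<^bsub>A\<^esub> a" using a_rcos_self[of x] x by simp
  qed
qed

lemma carrier_Q: "carrier Q = (\<lambda>a. I +>\<^bsub>A\<^esub> a) ` carrier A"
  by (auto simp: quotient_algebra_def FactRing_def A_RCOSETS_def')

lemma coset_closed [simp]: "a \<in> carrier A \<Longrightarrow> I +>\<^bsub>A\<^esub> a \<in> carrier Q"
  by (simp add: carrier_Q)

lemma add_Q: "a \<in> carrier A \<Longrightarrow> b \<in> carrier A \<Longrightarrow>
    (I +>\<^bsub>A\<^esub> a) \<oplus>\<^bsub>Q\<^esub> (I +>\<^bsub>A\<^esub> b) = I +>\<^bsub>A\<^esub> (a \<oplus>\<^bsub>A\<^esub> b)"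
  by (simp add: quotient_algebra_def FactRing_def a_rcos_sum)

lemma mult_Q: "a \<in> carrier A \<Longrightarrow> b \<in> carrier A \<Longrightarrow>
    (I +>\<^bsub>A\<^esub> a) \<otimes>\<^bsub>Q\<^esub> (I +>\<^bsub>A\<^esub> b) = I +>\<^bsub>A\<^esub> (a \<otimes>\<^bsub>A\<^esub> b)"
  by (simp add: quotient_algebra_def FactRing_def rcoset_mult_add)

lemma one_Q: "\<one>\<^bsub>Q\<^esub> = I +>\<^bsub>A\<^esub> \<one>\<^bsub>A\<^esub>"
  by (simp add: quotient_algebra_def FactRing_def)

lemma zero_Q: "\<zero>\<^bsub>Q\<^esub> = I"
  by (simp add: quotient_algebra_def FactRing_def)

lemma coset_zero: "a \<in> carrier A \<Longrightarrow> I +>\<^bsub>A\<^esub> a = I \<longleftrightarrow> a \<in> I"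
  using a_rcos_const[of a] a_rcos_self[of a] by auto

lemma smult_Q:
  assumes "a \<in> carrier A"
  shows "z \<odot>\<^bsub>Q\<^esub> (I +>\<^bsub>A\<^esub> a) = I +>\<^bsub>A\<^esub> (z \<odot>\<^bsub>A\<^esub> a)"
proof -
  have *: "I +>\<^bsub>A\<^esub> (z \<odot>\<^bsub>A\<^esub> x) = I +>\<^bsub>A\<^esub> (z \<odot>\<^bsub>A\<^esub> a)" if "x \<in> I +>\<^bsub>A\<^esub> a" for x
    using that assms coset_mem_iff[of a x] smult_ideal[of "x \<ominus>\<^bsub>A\<^esub> a" z]
    by (simp add: coset_eq_iff smult_minus)
  have "(\<Union>x\<in>I +>\<^bsub>A\<^esub> a. I +>\<^bsub>A\<^esub> (z \<odot>\<^bsub>A\<^esub> x)) = I +>\<^bsub>A\<^esub> (z \<odot>\<^bsub>A\<^esub> a)"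
    by (rule SUP_eq_const) (use a_rcos_self[OF assms] * in blast)+
  then show ?thesis by (simp add: quotient_algebra_def)
qed

lemma ring_Q: "ring Q"
  by (rule ring_cong[OF quotient_is_ring]) (simp_all add: quotient_algebra_def)

lemma uminus_Q:
  assumes "a \<in> carrier A"
  shows "\<ominus>\<^bsub>Q\<^esub> (I +>\<^bsub>A\<^esub> a) = I +>\<^bsub>A\<^esub> (\<ominus>\<^bsub>A\<^esub> a)"
proof -
  interpret Q: ring Q by (rule ring_Q)
  have "(I +>\<^bsub>A\<^esub> (\<ominus>\<^bsub>A\<^esub> a)) \<oplus>\<^bsub>Q\<^esub> (I +>\<^bsub>A\<^esub> a) = \<zero>\<^bsub>Q\<^esub>"
    using assms coset_zero[of "\<zero>\<^bsub>A\<^esub>"] by (simp add: add_Q l_neg zero_Q)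
  then show ?thesis by (rule Q.minus_equality) (simp_all add: assms)
qed

lemma complex_algebra_Q: "complex_algebra Q"
proof (intro complex_algebra.intro complex_algebra_axioms.intro ring_Q)
  fix X Y z assume "X \<in> carrier Q" "Y \<in> carrier Q"
  then obtain a b where ab: "a \<in> carrier A" "X = I +>\<^bsub>A\<^esub> a" "b \<in> carrier A" "Y = I +>\<^bsub>A\<^esub> b"
    unfolding carrier_Q by blast
  show "z \<odot>\<^bsub>Q\<^esub> X \<otimes>\<^bsub>Q\<^esub> Y = z \<odot>\<^bsub>Q\<^esub> (X \<otimes>\<^bsub>Q\<^esub> Y)" "X \<otimes>\<^bsub>Q\<^esub> (z \<odot>\<^bsub>Q\<^esub> Y) = z \<odot>\<^bsub>Q\<^esub> (X \<otimes>\<^bsub>Q\<^esub> Y)"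
    using ab by (simp_all add: smult_Q mult_Q smult_mult_left smult_mult_right)
next
  fix X z assume "X \<in> carrier Q"
  then obtain a where "a \<in> carrier A" "X = I +>\<^bsub>A\<^esub> a"
    unfolding carrier_Q by blast
  then show "z \<odot>\<^bsub>Q\<^esub> X \<in> carrier Q" by (simp add: smult_Q)
qed

end

context skew_action
begin

sublocale complex_algebra A
  by unfold_locales (simp_all add: smult_mult_A)

end

section \<open>Elementary tensors\<close>

context permutation_action
begin

text \<open>
  The basis element \<open>w \<otimes> g\<close> of \<open>T(V)#G\<close>.
\<close>

definition elem :: "'b list \<Rightarrow> 'g \<Rightarrow> 'g \<Rightarrow> 'b tensor_algebra" where
  "elem w g = (\<lambda>k. if k = g then Poly_Mapping.single (TWord w) 1 else 0)"

lemma elem_mult: "elem u g \<otimes>\<^bsub>T.A\<^esub> elem v h = elem (u @ map (\<pi> g) v) (g * h)"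
proof
  fix k
  have "(elem u g \<otimes>\<^bsub>T.A\<^esub> elem v h) k = (\<Sum>x\<in>UNIV. if x = g then \<Sum>y\<in>UNIV. if y = h then
      (if g * h = k then Poly_Mapping.single (TWord (u @ map (\<pi> g) v)) 1 else 0) else 0 else 0)"
    unfolding T.mult_A_sum
  proof (rule sum.cong[OF refl])
    fix x
    have "(if x * y = k then elem u g x * tensor_act rep x (elem v h y) else 0) =
        (if x = g then if y = h then
          (if g * h = k then Poly_Mapping.single (TWord (u @ map (\<pi> g) v)) 1 else 0) else 0 else 0)" for y
      by (simp add: elem_def tensor_act_rep mult_single map_word_def plus_tensor_word_def)
    then show "(\<Sum>y\<in>UNIV. if x * y = k then elem u g x * tensor_act rep x (elem v h y) else 0) =
        (if x = g then \<Sum>y\<in>UNIV. if y = h then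
          (if g * h = k then Poly_Mapping.single (TWord (u @ map (\<pi> g) v)) 1 else 0) else 0 else 0)"
      by simp
  qed
  then show "(elem u g \<otimes>\<^bsub>T.A\<^esub> elem v h) k = elem (u @ map (\<pi> g) v) (g * h) k"
    by (auto simp: elem_def)
qed

lemma elem_one: "\<one>\<^bsub>T.A\<^esub> = elem [] 1"
  by (auto simp: T.one_A elem_def single_one simp flip: zero_tensor_word_def)

text \<open>
  Induction along an expansion into basis elements. The predicate \<open>W\<close> carries information about the
  words that occur, such as a bound on their length, into the induction.
\<close>

lemma tensor_skew_induct [case_names keys zero elem add]:
  assumes keys: "\<And>g w. w \<in> Poly_Mapping.keys (p g) \<Longrightarrow> W (letters w)"
    and zero: "P \<zero>\<^bsub>T.A\<^esub>"
    and elem: "\<And>z w g. W w \<Longrightarrow> P (z \<odot>\<^bsub>T.A\<^esub> elem w g)"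
    and add: "\<And>p q. P p \<Longrightarrow> P q \<Longrightarrow> P (p \<oplus>\<^bsub>T.A\<^esub> q)"
  shows "P p"
proof -
  have inner: "P (\<lambda>k. if k = g then \<Sum>w\<in>X. Poly_Mapping.single w (Poly_Mapping.lookup (p g) w) else 0)"
    if "finite X" "X \<subseteq> Poly_Mapping.keys (p g)" for X g
    using that
  proof (induction X rule: finite_induct)
    case empty
    then show ?case using zero by (simp add: T.zero_A cong: if_cong)
  next
    case (insert w X)
    have "P (Poly_Mapping.lookup (p g) w \<odot>\<^bsub>T.A\<^esub> elem (letters w) g \<oplus>\<^bsub>T.A\<^esub>
        (\<lambda>k. if k = g then \<Sum>w\<in>X. Poly_Mapping.single w (Poly_Mapping.lookup (p g) w) else 0))"
      using insert by (intro add elem keys) auto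
    moreover have "Poly_Mapping.lookup (p g) w \<odot>\<^bsub>T.A\<^esub> elem (letters w) g \<oplus>\<^bsub>T.A\<^esub>
        (\<lambda>k. if k = g then \<Sum>w\<in>X. Poly_Mapping.single w (Poly_Mapping.lookup (p g) w) else 0)
      = (\<lambda>k. if k = g then \<Sum>w\<in>insert w X. Poly_Mapping.single w (Poly_Mapping.lookup (p g) w) else 0)"
      using insert by (auto simp: T.add_A T.smult_A elem_def mult_single)
    ultimately show ?case by simp
  qed
  have delta: "P (\<lambda>k. if k = g then p g else 0)" for g
    using inner[of "Poly_Mapping.keys (p g)" g] unfolding poly_mapping_sum_single[of "p g", symmetric] by simp
  have "P (\<lambda>k. if k \<in> G then p k else 0)" if "finite G" for G
    using that
  proof (induction G rule: finite_induct)
    case empty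
    then show ?case using zero by (simp add: T.zero_A)
  next
    case (insert g G)
    have "P ((\<lambda>k. if k = g then p g else 0) \<oplus>\<^bsub>T.A\<^esub> (\<lambda>k. if k \<in> G then p k else 0))"
      using insert delta by (intro add) auto
    moreover have "(\<lambda>k. if k = g then p g else 0) \<oplus>\<^bsub>T.A\<^esub> (\<lambda>k. if k \<in> G then p k else 0)
        = (\<lambda>k. if k \<in> insert g G then p k else 0)"
      using insert by (auto simp: T.add_A)
    ultimately show ?case by simp
  qed
  from this[of UNIV] show ?thesis by simp
qed

lemma tensor_skew_filt_iff: "p \<in> tensor_skew_filt m \<longleftrightarrow> (\<forall>g w. w \<in> Poly_Mapping.keys (p g) \<longrightarrow> length (letters w) \<le> m)"
  by (auto simp: tensor_skew_filt_def)

subsection \<open>Linear functionals\<close>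

definition functional :: "('b list \<Rightarrow> 'g \<Rightarrow> complex) \<Rightarrow> ('g \<Rightarrow> 'b tensor_algebra) \<Rightarrow> complex" where
  "functional N p = (\<Sum>g\<in>UNIV. lin (\<lambda>w. N (letters w) g) (p g))"

lemma functional_add: "functional N (p \<oplus>\<^bsub>T.A\<^esub> q) = functional N p + functional N q"
  by (simp add: functional_def T.add_A lin_add sum.distrib)

lemma functional_smult: "functional N (z \<odot>\<^bsub>T.A\<^esub> p) = z * functional N p"
  by (simp add: functional_def T.smult_A lin_scale sum_distrib_left)

lemma functional_zero: "functional N \<zero>\<^bsub>T.A\<^esub> = 0"
  by (simp add: functional_def T.zero_A)

lemma functional_elem: "functional N (elem w g) = N w g"
proof -
  have "functional N (elem w g) = (\<Sum>k\<in>UNIV. if k = g then N w g else 0)"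
    unfolding functional_def elem_def by (intro sum.cong refl) auto
  then show ?thesis by simp
qed

subsection \<open>Symmetrization\<close>

definition symmetrize :: "('g \<Rightarrow> 'b tensor_algebra) \<Rightarrow> ('g \<Rightarrow> 'b symmetric_algebra)" where
  "symmetrize p = (\<lambda>g. push monomial (p g))"

lemma symmetrize_add: "symmetrize (p \<oplus>\<^bsub>T.A\<^esub> q) = symmetrize p \<oplus>\<^bsub>S.A\<^esub> symmetrize q"
  by (simp add: symmetrize_def T.add_A S.add_A push_add)

lemma symmetrize_zero: "symmetrize \<zero>\<^bsub>T.A\<^esub> = \<zero>\<^bsub>S.A\<^esub>"
  by (simp add: symmetrize_def T.zero_A S.zero_A)

lemma monomial_zero [simp]: "monomial 0 = 0"
  by (simp add: monomial_def)

lemma symmetrize_smult: "symmetrize (z \<odot>\<^bsub>T.A\<^esub> p) = z \<odot>\<^bsub>S.A\<^esub> symmetrize p"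
  by (simp add: symmetrize_def T.smult_A S.smult_A push_mult monomial_plus)

lemma symmetrize_one: "symmetrize \<one>\<^bsub>T.A\<^esub> = \<one>\<^bsub>S.A\<^esub>"
  by (auto simp: symmetrize_def T.one_A S.one_A fun_eq_iff simp flip: single_one)

lemma symmetrize_mult: "symmetrize (p \<otimes>\<^bsub>T.A\<^esub> q) = symmetrize p \<otimes>\<^bsub>S.A\<^esub> symmetrize q"
proof
  fix k
  have "push monomial (push (map_word (\<pi> g)) r) = push (map_monomial (\<pi> g)) (push monomial r)" for g r
    by (simp add: push_push monomial_map_word)
  then show "symmetrize (p \<otimes>\<^bsub>T.A\<^esub> q) k = (symmetrize p \<otimes>\<^bsub>S.A\<^esub> symmetrize q) k"
    by (simp add: symmetrize_def T.mult_A S.mult_A push_sum push_mult monomial_plus tensor_act_rep sym_act_rep case_prod_beta')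
qed

lemma symmetrize_component: "symmetrize (T.component d p) = S.component d (symmetrize p)"
  unfolding symmetrize_def T.component_def S.component_def
  by (simp add: part_of_degree_push[of total_degree monomial "\<lambda>w. length (letters w)"] total_degree_monomial)

end

section \<open>The defining relations\<close>

lemma vec_axis_induct [case_names zero axis add]:
  fixes v :: "complex ^ 'b::finite"
  assumes "P 0" and "\<And>z a. P (z *s axis a 1)" and "\<And>u v. P u \<Longrightarrow> P v \<Longrightarrow> P (u + v)"
  shows "P v"
proof -
  have "P (\<Sum>a\<in>S. v $ a *s axis a 1)" for S :: "'b set"
    by (induction S rule: infinite_finite_induct) (auto intro: assms)
  from this[of UNIV] show ?thesis by (simp add: basis_expansion)
qed

lemma skew_bilinear_mem:
  fixes r :: "complex ^ 'b::finite \<Rightarrow> complex ^ 'b \<Rightarrow> 'a"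
  assumes zero: "\<And>v. r v 0 \<in> J"
    and add: "\<And>v w w'. r v w \<in> J \<Longrightarrow> r v w' \<in> J \<Longrightarrow> r v (w + w') \<in> J"
    and scale: "\<And>v w z. r v w \<in> J \<Longrightarrow> r v (z *s w) \<in> J"
    and skew: "\<And>v w. r v w \<in> J \<Longrightarrow> r w v \<in> J"
    and basis: "\<And>a b. r (axis a 1) (axis b 1) \<in> J"
  shows "r v w \<in> J"
proof -
  have "r (axis a 1) w \<in> J" for a w
    by (induction w rule: vec_axis_induct) (auto intro: zero add scale basis)
  then show ?thesis
    by (induction w rule: vec_axis_induct) (auto intro: zero add scale skew)
qed

lemma tensor_vec_add: "tensor_vec (u + v) = tensor_vec u + tensor_vec v"
  by (simp add: tensor_vec_def single_add sum.distrib)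

lemma tensor_vec_scale: "tensor_vec (z *s v) = Poly_Mapping.single 0 z * tensor_vec v"
  by (simp add: tensor_vec_def sum_distrib_left mult_single)

lemma tensor_vec_zero [simp]: "tensor_vec 0 = 0"
  by (simp add: tensor_vec_def)

lemma tensor_vec_uminus: "tensor_vec (- v) = - tensor_vec v"
  by (simp add: tensor_vec_def single_uminus sum_negf)

locale orbifold_cochains = permutation_action \<pi> ginv
  for \<pi> :: "'g::{finite,monoid_mult} \<Rightarrow> 'b::finite \<Rightarrow> 'b" and ginv +
  fixes \<kappa>L :: "('g, 'b) linear_cochain" and \<kappa>C :: "('g, 'b) constant_cochain"
  assumes linear_cochain: "linear_cochain \<kappa>L" and constant_cochain: "constant_cochain \<kappa>C"
    and supported: "supported_on_identity \<kappa>L"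
begin

abbreviation "A \<equiv> tensor_skew rep"
abbreviation "I \<equiv> orbifold_ideal rep \<kappa>L \<kappa>C"

definition l :: "'b \<Rightarrow> 'b \<Rightarrow> 'b \<Rightarrow> complex" where
  "l a b c = \<kappa>L 1 (axis a 1) (axis b 1) $ c"

definition C :: "'g \<Rightarrow> 'b \<Rightarrow> 'b \<Rightarrow> complex" where
  "C h a b = \<kappa>C h (axis a 1) (axis b 1)"

sublocale orbifold_structure \<pi> l C .

lemma \<kappa>L_simps:
  "\<kappa>L g u (v + w) = \<kappa>L g u v + \<kappa>L g u w" "\<kappa>L g u (z *s v) = z *s \<kappa>L g u v"
  "\<kappa>L g (u + v) w = \<kappa>L g u w + \<kappa>L g v w" "\<kappa>L g (z *s u) w = z *s \<kappa>L g u w"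
  "\<kappa>L g u 0 = 0" "\<kappa>L g 0 w = 0"
proof -
  have lin: "Vector_Spaces.linear (*s) (*s) (\<kappa>L g u)" and skew: "\<kappa>L g u v = - \<kappa>L g v u" for g u v
    using linear_cochain unfolding linear_cochain_def by blast+
  show add: "\<kappa>L g u (v + w) = \<kappa>L g u v + \<kappa>L g u w" and scale: "\<kappa>L g u (z *s v) = z *s \<kappa>L g u v" for u v w z
    using vec.linear_add[OF lin] vec.linear_scale[OF lin] by blast+
  show "\<kappa>L g (u + v) w = \<kappa>L g u w + \<kappa>L g v w" "\<kappa>L g (z *s u) w = z *s \<kappa>L g u w"
    unfolding skew[of g "u + v" w] skew[of g "z *s u" w] skew[of g u w] skew[of g v w] add scale
    by (simp_all add: vec_eq_iff)
  show "\<kappa>L g u 0 = 0" "\<kappa>L g 0 w = 0"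
    using vec.linear_0[OF lin] skew[of g 0 w] by simp_all
qed

lemma \<kappa>L_skew: "\<kappa>L g u v = - \<kappa>L g v u"
  using linear_cochain unfolding linear_cochain_def by blast

lemma \<kappa>C_skew: "\<kappa>C g u v = - \<kappa>C g v u"
  using constant_cochain unfolding constant_cochain_def by blast

lemma \<kappa>C_simps:
  "\<kappa>C g u (v + w) = \<kappa>C g u v + \<kappa>C g u w" "\<kappa>C g u (z *s v) = z * \<kappa>C g u v"
  "\<kappa>C g (u + v) w = \<kappa>C g u w + \<kappa>C g v w" "\<kappa>C g (z *s u) w = z * \<kappa>C g u w"
  "\<kappa>C g u 0 = 0" "\<kappa>C g 0 w = 0"
proof -
  have lin: "Vector_Spaces.linear (*s) (*) (\<kappa>C g u)" for g u
    using constant_cochain unfolding constant_cochain_def by blast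
  show add: "\<kappa>C g u (v + w) = \<kappa>C g u v + \<kappa>C g u w" and scale: "\<kappa>C g u (z *s v) = z * \<kappa>C g u v" for u v w z
    using Vector_Spaces.linear.axioms(3)[OF lin] by (simp_all add: module_hom_axioms_def module_hom_def)
  show "\<kappa>C g (u + v) w = \<kappa>C g u w + \<kappa>C g v w" "\<kappa>C g (z *s u) w = z * \<kappa>C g u w"
    unfolding \<kappa>C_skew[of g "u + v" w] \<kappa>C_skew[of g "z *s u" w] \<kappa>C_skew[of g u w] \<kappa>C_skew[of g v w] add scale
    by simp_all
  show "\<kappa>C g u 0 = 0" "\<kappa>C g 0 w = 0"
    using scale[where z = 0 and v = 0] \<kappa>C_skew[of g 0 w] by simp_all
qed

lemma \<kappa>L_off_identity: "g \<noteq> 1 \<Longrightarrow> \<kappa>L g u v = 0"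
  using supported by (simp add: supported_on_identity_def)

definition relator :: "complex ^ 'b \<Rightarrow> complex ^ 'b \<Rightarrow> 'g \<Rightarrow> 'b tensor_algebra" where
  "relator v w = skew_commutator rep v w \<ominus>\<^bsub>A\<^esub> linear_value \<kappa>L v w \<ominus>\<^bsub>A\<^esub> constant_value \<kappa>C v w"

lemma I_def: "I = Idl\<^bsub>A\<^esub> {relator v w | v w. True}"
  by (simp add: orbifold_ideal_def relator_def Let_def)

lemma skew_vec_mult: "skew_vec v \<otimes>\<^bsub>A\<^esub> skew_vec w = (\<lambda>k. if k = 1 then tensor_vec v * tensor_vec w else 0)"
proof
  fix k
  have "(skew_vec v \<otimes>\<^bsub>A\<^esub> skew_vec w) k = (\<Sum>x\<in>(UNIV::'g set). if x = 1 then \<Sum>y\<in>(UNIV::'g set). if y = 1 then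
      (if k = 1 then tensor_vec v * tensor_vec w else 0) else 0 else 0)"
    unfolding T.mult_A_sum
  proof (rule sum.cong[OF refl])
    fix x :: 'g
    have "(if x * y = k then skew_vec v x * tensor_act rep x (skew_vec w y) else 0) =
        (if x = 1 then if y = 1 then (if k = 1 then tensor_vec v * tensor_vec w else 0) else 0 else 0)" for y :: 'g
      by (auto simp: skew_vec_def T.act_one)
    then show "(\<Sum>y\<in>UNIV. if x * y = k then skew_vec v x * tensor_act rep x (skew_vec w y) else 0) =
        (if x = 1 then \<Sum>y\<in>(UNIV::'g set). if y = 1 then (if k = 1 then tensor_vec v * tensor_vec w else 0) else 0 else 0)"
      by simp
  qed
  then show "(skew_vec v \<otimes>\<^bsub>A\<^esub> skew_vec w) k = (if k = 1 then tensor_vec v * tensor_vec w else 0)"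
    by simp
qed

lemma skew_commutator_eq:
  "skew_commutator rep v w = (\<lambda>k. if k = 1 then tensor_vec v * tensor_vec w - tensor_vec w * tensor_vec v else 0)"
  by (auto simp: skew_commutator_def Let_def skew_vec_mult T.minus_A)

lemma relator_eq:
  "relator v w = (\<lambda>k. (if k = 1 then tensor_vec v * tensor_vec w - tensor_vec w * tensor_vec v else 0)
     - tensor_vec (\<kappa>L k v w) - Poly_Mapping.single 0 (\<kappa>C k v w))"
  by (simp add: relator_def skew_commutator_eq T.minus_A linear_value_def constant_value_def)

lemma relator_add: "relator v (w + w') = relator v w \<oplus>\<^bsub>A\<^esub> relator v w'"
  by (auto simp: relator_eq T.add_A tensor_vec_add \<kappa>L_simps \<kappa>C_simps single_add algebra_simps)

lemma relator_scale: "relator v (z *s w) = z \<odot>\<^bsub>A\<^esub> relator v w"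
proof -
  have "p * (Poly_Mapping.single 0 z * q) = Poly_Mapping.single 0 z * (p * q)" for p q :: "'b tensor_algebra"
    by (metis mult.assoc scalar_commute)
  then show ?thesis
    by (auto simp: relator_eq T.smult_A tensor_vec_scale \<kappa>L_simps \<kappa>C_simps right_diff_distrib mult_single mult.assoc)
qed

lemma relator_zero: "relator v 0 = \<zero>\<^bsub>A\<^esub>"
  by (auto simp: relator_eq T.zero_A \<kappa>L_simps \<kappa>C_simps)

lemma relator_skew: "relator w v = \<ominus>\<^bsub>A\<^esub> relator v w"
  unfolding relator_eq T.uminus_A \<kappa>L_skew[of _ w v] \<kappa>C_skew[of _ w v] tensor_vec_uminus
  by (auto simp: single_uminus)

lemma relator_mem:
  assumes "ideal J A" and basis: "\<And>a b. relator (axis a 1) (axis b 1) \<in> J"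
  shows "relator v w \<in> J"
proof -
  interpret J: algebra_ideal A J by (intro algebra_ideal.intro assms T.complex_algebra_axioms)
  show ?thesis
  proof (rule skew_bilinear_mem[where r = relator])
    show "relator v w \<in> J \<Longrightarrow> relator w v \<in> J" for v w
      by (simp add: relator_skew[of w v] J.a_inv_closed)
  qed (simp_all add: relator_zero relator_add relator_scale J.smult_ideal basis)
qed

lemma ideal_I: "ideal I A"
  unfolding I_def by (rule T.genideal_ideal) simp

sublocale I: algebra_ideal A I
  by (intro algebra_ideal.intro ideal_I T.complex_algebra_axioms)

lemma relator_in_I: "relator v w \<in> I"
  unfolding I_def by (rule subsetD[OF T.genideal_self]) auto

text \<open>
  Relators are bilinear and skew, hence those of pairs of basis vectors suffice.
\<close>

lemma I_minimal:
  assumes "ideal J A" and "\<And>a b. relator (axis a 1) (axis b 1) \<in> J"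
  shows "I \<subseteq> J"
  unfolding I_def by (rule T.genideal_minimal[OF assms(1)]) (use relator_mem[OF assms] in auto)

text \<open>
  The value of a functional on a relator in terms of structure constants. It is used for functionals of
  the form \<open>p \<mapsto> N (x p y)\<close>.
\<close>

lemma linear_map_relator:
  fixes \<Phi> :: "('g \<Rightarrow> 'b tensor_algebra) \<Rightarrow> complex"
  assumes add: "\<And>p q. \<Phi> (p \<oplus>\<^bsub>A\<^esub> q) = \<Phi> p + \<Phi> q" and smult: "\<And>z p. \<Phi> (z \<odot>\<^bsub>A\<^esub> p) = z * \<Phi> p"
  shows "\<Phi> (relator (axis a 1) (axis b 1)) = \<Phi> (elem [a, b] 1) - \<Phi> (elem [b, a] 1)
    - (\<Sum>c\<in>UNIV. l a b c * \<Phi> (elem [c] 1)) - (\<Sum>h\<in>UNIV. C h a b * \<Phi> (elem [] h))"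
proof -
  have zero: "\<Phi> \<zero>\<^bsub>A\<^esub> = 0"
    using add[of "\<zero>\<^bsub>A\<^esub>" "\<zero>\<^bsub>A\<^esub>"] by simp
  have sum: "\<Phi> (\<Oplus>\<^bsub>A\<^esub>i\<in>S. f i) = (\<Sum>i\<in>S. \<Phi> (f i))" if "finite S" for f and S :: "'i set"
    using that by (induction S rule: finite_induct) (simp_all add: zero add)
  have "elem [a, b] 1 = relator (axis a 1) (axis b 1) \<oplus>\<^bsub>A\<^esub> (elem [b, a] 1 \<oplus>\<^bsub>A\<^esub>
      ((\<Oplus>\<^bsub>A\<^esub>c\<in>UNIV. l a b c \<odot>\<^bsub>A\<^esub> elem [c] 1) \<oplus>\<^bsub>A\<^esub> (\<Oplus>\<^bsub>A\<^esub>h\<in>UNIV. C h a b \<odot>\<^bsub>A\<^esub> elem [] h)))"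
  proof
    fix k
    have "(\<Sum>c\<in>UNIV. Poly_Mapping.single 0 (l a b c) * elem [c] 1 k) = tensor_vec (\<kappa>L k (axis a 1) (axis b 1))"
      by (cases "k = 1") (simp_all add: elem_def mult_single tensor_vec_def l_def \<kappa>L_off_identity)
    moreover have "(\<Sum>h\<in>UNIV. Poly_Mapping.single 0 (C h a b) * elem [] h k) = Poly_Mapping.single 0 (C k a b)"
    proof -
      have "(\<Sum>h\<in>UNIV. Poly_Mapping.single 0 (C h a b) * elem [] h k) =
          (\<Sum>h\<in>UNIV. if h = k then Poly_Mapping.single 0 (C k a b) else 0)"
        by (intro sum.cong refl) (auto simp: elem_def mult_single simp flip: zero_tensor_word_def)
      then show ?thesis by simp
    qed
    ultimately show "elem [a, b] 1 k = (relator (axis a 1) (axis b 1) \<oplus>\<^bsub>A\<^esub> (elem [b, a] 1 \<oplus>\<^bsub>A\<^esub>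
      ((\<Oplus>\<^bsub>A\<^esub>c\<in>UNIV. l a b c \<odot>\<^bsub>A\<^esub> elem [c] 1) \<oplus>\<^bsub>A\<^esub> (\<Oplus>\<^bsub>A\<^esub>h\<in>UNIV. C h a b \<odot>\<^bsub>A\<^esub> elem [] h)))) k"
      by (auto simp: relator_eq T.add_A T.finsum_A T.smult_A C_def tensor_vec_axis mult_single
          plus_tensor_word_def elem_def[of "[_, _]"])
  qed
  then have "\<Phi> (elem [a, b] 1) = \<Phi> (relator (axis a 1) (axis b 1)) + (\<Phi> (elem [b, a] 1)
      + ((\<Sum>c\<in>UNIV. l a b c * \<Phi> (elem [c] 1)) + (\<Sum>h\<in>UNIV. C h a b * \<Phi> (elem [] h))))"
    by (simp add: add sum smult)
  then show ?thesis by simp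
qed

subsection \<open>The filtration by length\<close>

abbreviation "filt \<equiv> (tensor_skew_filt :: nat \<Rightarrow> ('g \<Rightarrow> 'b tensor_algebra) set)"

lemma filt_iff: "p \<in> filt m \<longleftrightarrow> (\<forall>d>m. T.component d p = \<zero>\<^bsub>A\<^esub>)"
proof
  assume p: "p \<in> filt m"
  show "\<forall>d>m. T.component d p = \<zero>\<^bsub>A\<^esub>"
  proof (intro allI impI ext poly_mapping_eqI)
    fix d g w assume "m < d"
    have "Poly_Mapping.lookup (p g) w = 0" if "length (letters w) = d"
    proof (rule ccontr)
      assume "Poly_Mapping.lookup (p g) w \<noteq> 0"
      then have "length (letters w) \<le> m" using p by (simp add: tensor_skew_filt_iff in_keys_iff)
      with that \<open>m < d\<close> show False by simp
    qed
    then show "Poly_Mapping.lookup (T.component d p g) w = Poly_Mapping.lookup (\<zero>\<^bsub>A\<^esub> g) w"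
      by (simp add: T.lookup_component T.zero_A when_def)
  qed
next
  assume *: "\<forall>d>m. T.component d p = \<zero>\<^bsub>A\<^esub>"
  show "p \<in> filt m"
    unfolding tensor_skew_filt_iff
  proof (intro allI impI)
    fix g w assume w: "w \<in> Poly_Mapping.keys (p g)"
    show "length (letters w) \<le> m"
    proof (rule ccontr)
      assume "\<not> length (letters w) \<le> m"
      then have "T.component (length (letters w)) p g = 0" using * by (simp add: T.zero_A)
      then show False
        using w T.lookup_component[of "length (letters w)" p g w] by (simp add: in_keys_iff)
    qed
  qed
qed

lemma filt_pred_iff: "p \<in> filt_pred A filt m \<longleftrightarrow> (\<forall>d\<ge>m. T.component d p = \<zero>\<^bsub>A\<^esub>)"
proof (cases m)
  case 0
  have "p = \<zero>\<^bsub>A\<^esub>" if "\<forall>d. T.component d p = \<zero>\<^bsub>A\<^esub>"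
    by (rule T.component_ext) (simp_all add: that)
  then show ?thesis using 0 by (auto simp: filt_pred_def)
next
  case (Suc k)
  then show ?thesis by (simp add: filt_pred_def filt_iff Suc_le_eq)
qed

lemma component_uminus: "T.component d (\<ominus>\<^bsub>A\<^esub> p) = \<ominus>\<^bsub>A\<^esub> T.component d p"
  using T.component_add[of p "\<ominus>\<^bsub>A\<^esub> p" d] T.component_zero[of d]
  by (intro T.minus_equality[symmetric]) (simp_all add: T.r_neg T.a_comm)

lemma component_smult: "T.component d (z \<odot>\<^bsub>A\<^esub> p) = z \<odot>\<^bsub>A\<^esub> T.component d p"
  by (simp add: T.component_smult)

lemma smult_zero: "z \<odot>\<^bsub>A\<^esub> \<zero>\<^bsub>A\<^esub> = \<zero>\<^bsub>A\<^esub>"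
  by (simp add: T.smult_A T.zero_A)

lemma filt_closed:
  "p \<in> filt m \<Longrightarrow> q \<in> filt m \<Longrightarrow> p \<oplus>\<^bsub>A\<^esub> q \<in> filt m"
  "p \<in> filt m \<Longrightarrow> \<ominus>\<^bsub>A\<^esub> p \<in> filt m"
  "p \<in> filt m \<Longrightarrow> z \<odot>\<^bsub>A\<^esub> p \<in> filt m"
  "\<zero>\<^bsub>A\<^esub> \<in> filt m"
  by (simp_all add: filt_iff T.component_add component_uminus component_smult smult_zero)

lemma filt_pred_closed:
  "p \<in> filt_pred A filt m \<Longrightarrow> q \<in> filt_pred A filt m \<Longrightarrow> p \<oplus>\<^bsub>A\<^esub> q \<in> filt_pred A filt m"
  "p \<in> filt_pred A filt m \<Longrightarrow> z \<odot>\<^bsub>A\<^esub> p \<in> filt_pred A filt m"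
  "\<zero>\<^bsub>A\<^esub> \<in> filt_pred A filt m"
  by (simp_all add: filt_pred_iff T.component_add component_uminus component_smult smult_zero)

lemma filt_mono: "m \<le> n \<Longrightarrow> filt m \<subseteq> filt n"
  by (auto simp: filt_iff)

lemma filt_mult:
  assumes "p \<in> filt m" "q \<in> filt n"
  shows "p \<otimes>\<^bsub>A\<^esub> q \<in> filt (m + n)"
  unfolding filt_iff
proof (intro allI impI)
  fix d assume d: "m + n < d"
  have "T.component i p \<otimes>\<^bsub>A\<^esub> T.component (d - i) q = \<zero>\<^bsub>A\<^esub>" for i
  proof (cases "m < i")
    case True
    then show ?thesis using assms(1) by (simp add: filt_iff)
  next
    case False
    then have "n < d - i" using d by simp
    then show ?thesis using assms(2) by (simp add: filt_iff)
  qed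
  then show "T.component d (p \<otimes>\<^bsub>A\<^esub> q) = \<zero>\<^bsub>A\<^esub>"
    by (simp add: T.component_mult T.finsum_A)
qed

lemma elem_filt: "elem w g \<in> filt m \<longleftrightarrow> length w \<le> m"
  by (auto simp: tensor_skew_filt_iff elem_def)

lemma linear_value_filt: "linear_value \<kappa>L v w \<in> filt 1"
proof -
  have *: "Poly_Mapping.keys (tensor_vec x) \<subseteq> (\<Union>b. {TWord [b]})" for x :: "complex ^ 'b"
    unfolding tensor_vec_def by (rule order.trans[OF keys_sum]) auto
  have "length (letters w') = 1" if "w' \<in> Poly_Mapping.keys (tensor_vec x)" for x :: "complex ^ 'b" and w'
    using subsetD[OF * that] by auto
  then show ?thesis by (simp add: tensor_skew_filt_iff linear_value_def)
qed

lemma constant_value_filt: "constant_value \<kappa>C v w \<in> filt 0"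
  by (auto simp: tensor_skew_filt_iff constant_value_def split: if_splits)

lemma minus_top_component:
  assumes "p \<in> filt m"
  shows "p \<ominus>\<^bsub>A\<^esub> T.component m p \<in> filt_pred A filt m"
  using assms
  by (auto simp: filt_pred_iff filt_iff a_minus_def T.component_add component_uminus T.component_component T.r_neg le_less)

lemma component_filt: "T.component m p \<in> filt m"
  by (simp add: filt_iff T.component_component)

end

section \<open>The conditions suffice: a Poincare-Birkhoff-Witt theorem\<close>

lemma lin_part_of_degree: "lin F (part_of_degree dg d p) = lin (\<lambda>w. if dg w = d then F w else 0) p"
  by (induction p rule: poly_mapping_induct)
     (simp_all add: lin_add part_of_degree_add part_of_degree_single)

lemma lin_cong: "(\<And>w. w \<in> Poly_Mapping.keys p \<Longrightarrow> F w = G w) \<Longrightarrow> lin F p = lin G p"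
  by (simp add: lin_def)

text \<open>
  Adjacent transpositions generate the symmetric group, in the form of a rule for words.
\<close>

lemma adjacent_swaps_generate:
  assumes trans: "\<And>u v w. R u v \<Longrightarrow> R v w \<Longrightarrow> R u w" and refl: "\<And>u. R u u"
    and swap: "\<And>u a b v. R (u @ a # b # v) (u @ b # a # v)"
    and "mset u = mset v"
  shows "R u v"
proof -
  have front: "R (p @ v1 @ a # v2) (p @ a # v1 @ v2)" for p v1 a v2
  proof (induction v1 arbitrary: p)
    case (Cons b v1)
    have "R (p @ (b # v1) @ a # v2) (p @ b # a # v1 @ v2)" using Cons[of "p @ [b]"] by simp
    then show ?case using swap[of p b a "v1 @ v2"] trans by fastforce
  qed (simp add: refl)
  have spread: "R (p @ a # v1 @ v2) (p @ v1 @ a # v2)" for p v1 a v2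
  proof (induction v1 arbitrary: p)
    case (Cons b v1)
    have "R (p @ b # a # v1 @ v2) (p @ (b # v1) @ a # v2)" using Cons[of "p @ [b]"] by simp
    then show ?case using swap[of p a b "v1 @ v2"] trans by fastforce
  qed (simp add: refl)
  have "R (p @ u) (p @ v)" for p
    using \<open>mset u = mset v\<close>
  proof (induction u arbitrary: p v)
    case (Cons a u)
    then have "a \<in> set v" by (metis list.set_intros(1) set_mset_mset)
    then obtain v1 v2 where v: "v = v1 @ a # v2" by (meson split_list)
    then have "mset u = mset (v1 @ v2)" using Cons.prems by simp
    then have "R (p @ a # u) (p @ a # v1 @ v2)" using Cons.IH[of "v1 @ v2" "p @ [a]"] by simp
    then show ?case using spread v trans by blast
  qed (simp add: refl)
  from this[of "[]"] show ?thesis by simp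
qed

locale lie_orbifold = orbifold_cochains \<pi> ginv \<kappa>L \<kappa>C
  for \<pi> :: "'g::{finite,monoid_mult} \<Rightarrow> 'b::finite \<Rightarrow> 'b" and ginv \<kappa>L \<kappa>C +
  assumes lie_structure: "lie_orbifold_structure \<pi> l C ginv"
begin

interpretation lie_orbifold_structure \<pi> l C ginv by (rule lie_structure)

text \<open>
  The elements \<open>p\<close> for which \<open>N\<close> vanishes on \<open>q p r\<close> for all \<open>q\<close> and \<open>r\<close> form an ideal. It contains the
  relators since \<open>N\<close> respects the relations at every place of every word.
\<close>

lemma functional_vanishes:
  assumes N: "\<And>u a b v g. N (u @ a # b # v) g = N (u @ b # a # v) g + bracket N u a b v g"
    and "p \<in> I"
  shows "functional N p = 0"
proof -
  define K where "K = {p. \<forall>q r. functional N (q \<otimes>\<^bsub>A\<^esub> p \<otimes>\<^bsub>A\<^esub> r) = 0}"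
  have "ideal K A"
  proof (rule idealI)
    show "subgroup K (add_monoid A)"
    proof (rule subgroup.intro)
      show "inv\<^bsub>add_monoid A\<^esub> p \<in> K" if "p \<in> K" for p
      proof -
        have "functional N (q \<otimes>\<^bsub>A\<^esub> (\<ominus>\<^bsub>A\<^esub> p) \<otimes>\<^bsub>A\<^esub> r) + functional N (q \<otimes>\<^bsub>A\<^esub> p \<otimes>\<^bsub>A\<^esub> r) = 0" for q r
          by (simp add: functional_zero T.l_minus T.r_minus T.l_neg flip: functional_add)
        then show ?thesis using that unfolding K_def a_inv_def[symmetric] by simp
      qed
    qed (auto simp: K_def T.l_distr T.r_distr functional_add functional_zero)
    show "x \<otimes>\<^bsub>A\<^esub> p \<in> K" "p \<otimes>\<^bsub>A\<^esub> x \<in> K" if "p \<in> K" for p x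
      using that by (simp_all add: K_def T.m_assoc) (simp add: T.m_assoc[symmetric])
  qed (rule T.ring_axioms)
  moreover have "relator (axis a 1) (axis b 1) \<in> K" for a b
    unfolding K_def
  proof (intro CollectI allI)
    fix q r
    let ?\<Phi> = "\<lambda>u g v h p. functional N (elem u g \<otimes>\<^bsub>A\<^esub> p \<otimes>\<^bsub>A\<^esub> elem v h)"
    have basis: "?\<Phi> u g v h (relator (axis a 1) (axis b 1)) = 0" for u g v h
    proof -
      have \<Phi>: "?\<Phi> u g v h (elem w k) = N (u @ map (\<pi> g) (w @ map (\<pi> k) v)) (g * (k * h))" for w k
      proof -
        have "\<pi> (g * k) = (\<lambda>x. \<pi> g (\<pi> k x))" by (rule ext) (rule \<pi>_mult)
        then show ?thesis by (simp add: elem_mult functional_elem mult.assoc comp_def)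
      qed
      have "?\<Phi> u g v h (relator (axis a 1) (axis b 1)) =
          ?\<Phi> u g v h (elem [a, b] 1) - ?\<Phi> u g v h (elem [b, a] 1)
          - (\<Sum>c\<in>UNIV. l a b c * ?\<Phi> u g v h (elem [c] 1)) - (\<Sum>k\<in>UNIV. C k a b * ?\<Phi> u g v h (elem [] k))"
        by (rule linear_map_relator)
           (simp_all add: T.r_distr T.l_distr functional_add T.smult_mult_left T.smult_mult_right functional_smult)
      also have "\<dots> = bracket N u (\<pi> g a) (\<pi> g b) (map (\<pi> g) v) (g * h)
          - (\<Sum>c\<in>UNIV. l a b c * N (u @ map (\<pi> g) (c # v)) (g * h))
          - (\<Sum>k\<in>UNIV. C k a b * N (u @ map (\<pi> g) (map (\<pi> k) v)) (g * (k * h)))"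
        unfolding \<Phi> using N[of u "\<pi> g a" "\<pi> g b" "map (\<pi> g) v" "g * h"]
        by (simp add: \<pi>_one map_idI[of v "\<pi> 1"])
      also have "\<dots> = 0" unfolding bracket_translate by simp
      finally show ?thesis .
    qed
    have "functional N (elem u g \<otimes>\<^bsub>A\<^esub> relator (axis a 1) (axis b 1) \<otimes>\<^bsub>A\<^esub> r) = 0" for u g
      by (induction r rule: tensor_skew_induct[where W = "\<lambda>_. True"])
         (simp_all add: functional_zero T.r_distr functional_add T.smult_mult_right functional_smult basis)
    then show "functional N (q \<otimes>\<^bsub>A\<^esub> relator (axis a 1) (axis b 1) \<otimes>\<^bsub>A\<^esub> r) = 0"
      by (induction q rule: tensor_skew_induct[where W = "\<lambda>_. True"])
         (simp_all add: functional_zero T.l_distr functional_add T.smult_mult_left functional_smult)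
  qed
  ultimately have "I \<subseteq> K" by (rule I_minimal)
  then have "functional N (\<one>\<^bsub>A\<^esub> \<otimes>\<^bsub>A\<^esub> p \<otimes>\<^bsub>A\<^esub> \<one>\<^bsub>A\<^esub>) = 0" using assms(2) unfolding K_def by blast
  then show ?thesis by simp
qed

text \<open>
  The coefficient of \<open>\<mu> \<otimes> g\<close> in the leading symbol is a functional on words of length \<open>m\<close> that does not
  depend on the order of the letters. It extends to a functional that vanishes on \<open>I\<close> and, because
  \<open>p\<close> has no words longer than \<open>m\<close>, still computes that coefficient on \<open>p\<close>.
\<close>

theorem leading_symbol_vanishes:
  assumes "p \<in> I" "p \<in> filt m"
  shows "symmetrize (T.component m p) = \<zero>\<^bsub>S.A\<^esub>"
proof (rule ext, rule poly_mapping_eqI)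
  fix g \<mu>
  \<comment> \<open>The functional that extracts the coefficient of \<open>\<mu> \<otimes> g\<close> of the image of the words of length \<open>m\<close>.\<close>
  define s where "s w h = (if length w = m then if monomial (TWord w) = \<mu> \<and> h = g then 1 else 0 else 0 :: complex)" for w :: "'b list" and h :: 'g
  have s_swap: "s (u @ a # b # v) h = s (u @ b # a # v) h" for u a b v h
  proof -
    have "monomial (TWord (u @ a # b # v)) = monomial (TWord (u @ b # a # v))"
      by (simp add: monomial_eq_iff)
    then show ?thesis by (simp add: s_def)
  qed
  have s_short: "s w h = 0" if "length w < m" for w h
    using that by (simp add: s_def)
  obtain N :: "'b list \<Rightarrow> 'g \<Rightarrow> complex" where N: "\<And>w h. length w \<le> m \<Longrightarrow> N w h = s w h"
    "\<And>u a b v g. N (u @ a # b # v) g = N (u @ b # a # v) g + bracket N u a b v g"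
    using symmetric_functional_extends[of s m, OF s_swap s_short] by blast
  have "0 = functional N p" using functional_vanishes[OF N(2) assms(1)] by simp
  also have "\<dots> = functional s p"
    unfolding functional_def using assms(2) N(1)
    by (intro sum.cong refl lin_cong) (auto simp: tensor_skew_filt_iff)
  also have "\<dots> = (\<Sum>h\<in>UNIV. if h = g then
      lin (\<lambda>w. if length (letters w) = m then if monomial w = \<mu> then 1 else 0 else 0) (p g) else 0)"
    unfolding functional_def
  proof (intro sum.cong refl)
    fix h
    show "lin (\<lambda>w. s (letters w) h) (p h) = (if h = g then
      lin (\<lambda>w. if length (letters w) = m then if monomial w = \<mu> then 1 else 0 else 0) (p g) else 0)"
      by (cases "h = g") (simp_all add: s_def lin_def cong: if_cong)
  qed
  also have "\<dots> = Poly_Mapping.lookup (symmetrize (T.component m p) g) \<mu>"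
    by (simp add: symmetrize_def T.component_def lookup_push lin_part_of_degree)
  finally show "Poly_Mapping.lookup (symmetrize (T.component m p) g) \<mu> = Poly_Mapping.lookup (\<zero>\<^bsub>S.A\<^esub> g) \<mu>"
    by (simp add: S.zero_A)
qed

end

context orbifold_cochains
begin

text \<open>
  The elements whose class in the quotient lies in the filtration piece before the \<open>m\<close>-th, so that they
  represent zero in degree \<open>m\<close> of the associated graded algebra.
\<close>

definition negligible :: "nat \<Rightarrow> ('g \<Rightarrow> 'b tensor_algebra) set" where
  "negligible m = {p. \<exists>i\<in>I. \<exists>q\<in>filt_pred A filt m. p = i \<oplus>\<^bsub>A\<^esub> q}"

lemma negligible_add: "p \<in> negligible m \<Longrightarrow> q \<in> negligible m \<Longrightarrow> p \<oplus>\<^bsub>A\<^esub> q \<in> negligible m"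
proof -
  assume "p \<in> negligible m" "q \<in> negligible m"
  then obtain i i' r r' where *: "i \<in> I" "i' \<in> I" "r \<in> filt_pred A filt m" "r' \<in> filt_pred A filt m"
    and pq: "p = i \<oplus>\<^bsub>A\<^esub> r" "q = i' \<oplus>\<^bsub>A\<^esub> r'"
    unfolding negligible_def by blast
  have "p \<oplus>\<^bsub>A\<^esub> q = (i \<oplus>\<^bsub>A\<^esub> i') \<oplus>\<^bsub>A\<^esub> (r \<oplus>\<^bsub>A\<^esub> r')"
    unfolding pq by (simp add: T.add_A algebra_simps)
  then show ?thesis
    using * filt_pred_closed(1) I.a_closed unfolding negligible_def by blast
qed

lemma negligible_smult: "p \<in> negligible m \<Longrightarrow> z \<odot>\<^bsub>A\<^esub> p \<in> negligible m"
proof -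
  assume "p \<in> negligible m"
  then obtain i r where *: "i \<in> I" "r \<in> filt_pred A filt m" and p: "p = i \<oplus>\<^bsub>A\<^esub> r"
    unfolding negligible_def by blast
  have "z \<odot>\<^bsub>A\<^esub> p = z \<odot>\<^bsub>A\<^esub> i \<oplus>\<^bsub>A\<^esub> z \<odot>\<^bsub>A\<^esub> r"
    unfolding p by (simp add: T.add_A T.smult_A distrib_left)
  then show ?thesis
    using * filt_pred_closed(2) I.smult_ideal unfolding negligible_def by blast
qed

lemma negligible_pred: "p \<in> filt_pred A filt m \<Longrightarrow> p \<in> negligible m"
  unfolding negligible_def using I.zero_closed by (force simp: T.add_A T.zero_A)

lemma negligible_I: "p \<in> I \<Longrightarrow> p \<in> negligible m"
  unfolding negligible_def using filt_pred_closed(3)[of m] by (force simp: T.add_A T.zero_A)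

text \<open>
  A commutator of two letters is a relator plus a term of degree at most one, and this remains true
  between \<open>u\<close> and \<open>v g\<close>.
\<close>

lemma swap_negligible: "elem (u @ a # b # v) g \<ominus>\<^bsub>A\<^esub> elem (u @ b # a # v) g \<in> negligible (length u + length v + 2)"
proof -
  let ?x = "elem u 1" and ?y = "elem v g"
  let ?L = "linear_value \<kappa>L (axis a 1) (axis b 1)" and ?K = "constant_value \<kappa>C (axis a 1) (axis b 1)"
  have comm: "skew_commutator rep (axis a 1) (axis b 1) = elem [a, b] 1 \<ominus>\<^bsub>A\<^esub> elem [b, a] 1"
    by (auto simp: skew_commutator_eq tensor_vec_axis mult_single plus_tensor_word_def elem_def T.minus_A)
  have "skew_commutator rep (axis a 1) (axis b 1) = relator (axis a 1) (axis b 1) \<oplus>\<^bsub>A\<^esub> (?L \<oplus>\<^bsub>A\<^esub> ?K)"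
    by (simp add: relator_def T.minus_A T.add_A)
  then have "?x \<otimes>\<^bsub>A\<^esub> skew_commutator rep (axis a 1) (axis b 1) \<otimes>\<^bsub>A\<^esub> ?y =
      ?x \<otimes>\<^bsub>A\<^esub> relator (axis a 1) (axis b 1) \<otimes>\<^bsub>A\<^esub> ?y
      \<oplus>\<^bsub>A\<^esub> ?x \<otimes>\<^bsub>A\<^esub> (?L \<oplus>\<^bsub>A\<^esub> ?K) \<otimes>\<^bsub>A\<^esub> ?y"
    by (simp add: T.r_distr T.l_distr)
  moreover have "?x \<otimes>\<^bsub>A\<^esub> skew_commutator rep (axis a 1) (axis b 1) \<otimes>\<^bsub>A\<^esub> ?y =
      elem (u @ a # b # v) g \<ominus>\<^bsub>A\<^esub> elem (u @ b # a # v) g"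
  proof -
    have "map (\<pi> 1) w = w" for w by (rule map_idI) (rule \<pi>_one)
    then show ?thesis
      unfolding comm a_minus_def by (simp add: T.r_distr T.l_distr T.r_minus T.l_minus elem_mult \<pi>_one)
  qed
  moreover have "?x \<otimes>\<^bsub>A\<^esub> relator (axis a 1) (axis b 1) \<otimes>\<^bsub>A\<^esub> ?y \<in> I"
    using relator_in_I by (intro I.I_l_closed I.I_r_closed) auto
  moreover have "?x \<otimes>\<^bsub>A\<^esub> (?L \<oplus>\<^bsub>A\<^esub> ?K) \<otimes>\<^bsub>A\<^esub> ?y \<in> filt_pred A filt (length u + length v + 2)"
  proof -
    have "?L \<oplus>\<^bsub>A\<^esub> ?K \<in> filt 1"
      using linear_value_filt constant_value_filt filt_mono[of 0 1] by (blast intro: filt_closed(1))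
    then have "?x \<otimes>\<^bsub>A\<^esub> (?L \<oplus>\<^bsub>A\<^esub> ?K) \<otimes>\<^bsub>A\<^esub> ?y \<in> filt (length u + 1 + length v)"
      by (intro filt_mult) (simp_all add: elem_filt)
    then show ?thesis by (simp add: filt_pred_def)
  qed
  ultimately show ?thesis unfolding negligible_def by auto
qed

lemma permuted_words_negligible:
  assumes "mset u = mset v" "length u = m"
  shows "elem u g \<ominus>\<^bsub>A\<^esub> elem v g \<in> negligible m"
proof -
  define R where "R u v \<longleftrightarrow> (length u = m \<longrightarrow> length v = m \<and> elem u g \<ominus>\<^bsub>A\<^esub> elem v g \<in> negligible m)" for u v
  have "R u v"
  proof (rule adjacent_swaps_generate[OF _ _ _ assms(1)])
    show "R u u" for u
      using negligible_pred[OF filt_pred_closed(3)] by (simp add: R_def a_minus_def T.r_neg)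
    show "R (u @ a # b # v) (u @ b # a # v)" for u a b v
      using swap_negligible[of u a b v g] by (auto simp: R_def)
    show "R u w" if "R u v" "R v w" for u v w
    proof -
      have "elem u g \<ominus>\<^bsub>A\<^esub> elem w g = (elem u g \<ominus>\<^bsub>A\<^esub> elem v g) \<oplus>\<^bsub>A\<^esub> (elem v g \<ominus>\<^bsub>A\<^esub> elem w g)"
        by (simp add: T.minus_A T.add_A)
      then show ?thesis using that negligible_add by (auto simp: R_def)
    qed
  qed
  then show ?thesis using assms(2) by (simp add: R_def)
qed

text \<open>
  Any choice of words representing the monomials gives a linear section \<open>lift\<close> of the projection onto
  \<open>S(V)#G\<close>.
\<close>

definition standard_word :: "('b \<Rightarrow>\<^sub>0 nat) \<Rightarrow> 'b tensor_word" where
  "standard_word \<mu> = (SOME w. monomial w = \<mu>)"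

lemma monomial_standard_word: "monomial (standard_word \<mu>) = \<mu>"
  unfolding standard_word_def by (rule someI_ex) (rule monomial_surj)

definition lift :: "('g \<Rightarrow> 'b symmetric_algebra) \<Rightarrow> 'g \<Rightarrow> 'b tensor_algebra" where
  "lift b = (\<lambda>g. push standard_word (b g))"

lemma symmetrize_lift: "symmetrize (lift b) = b"
  by (simp add: symmetrize_def lift_def push_push monomial_standard_word)

text \<open>
  Modulo \<open>I\<close> and shorter words, a word of length \<open>m\<close> depends only on its monomial. Hence an element with
  vanishing symbol is negligible, the converse of \<open>leading_symbol_vanishes\<close>.
\<close>

lemma lift_symmetrize_negligible:
  assumes "p \<in> filt m"
  shows "p \<ominus>\<^bsub>A\<^esub> lift (symmetrize p) \<in> negligible m"
proof (induction p rule: tensor_skew_induct[where W = "\<lambda>w. length w \<le> m"])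
  case (keys g w)
  then show ?case using assms by (simp add: tensor_skew_filt_iff)
next
  case zero
  have "lift (symmetrize \<zero>\<^bsub>A\<^esub>) = \<zero>\<^bsub>A\<^esub>" by (simp add: lift_def symmetrize_def T.zero_A)
  then show ?case using negligible_pred[OF filt_pred_closed(3)] by (simp add: a_minus_def T.r_neg)
next
  case (elem z w g)
  let ?v = "standard_word (monomial (TWord w))"
  have "lift (symmetrize (z \<odot>\<^bsub>A\<^esub> elem w g)) = z \<odot>\<^bsub>A\<^esub> elem (letters ?v) g"
    by (auto simp: lift_def symmetrize_def T.smult_A elem_def mult_single)
  then have eq: "z \<odot>\<^bsub>A\<^esub> elem w g \<ominus>\<^bsub>A\<^esub> lift (symmetrize (z \<odot>\<^bsub>A\<^esub> elem w g)) =
      z \<odot>\<^bsub>A\<^esub> (elem w g \<ominus>\<^bsub>A\<^esub> elem (letters ?v) g)"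
    by (simp add: T.smult_minus)
  have perm: "mset w = mset (letters ?v)"
    using monomial_standard_word[of "monomial (TWord w)"] by (simp add: monomial_eq_iff)
  have "elem w g \<ominus>\<^bsub>A\<^esub> elem (letters ?v) g \<in> negligible m"
  proof (cases "length w = m")
    case True
    then show ?thesis using permuted_words_negligible perm by blast
  next
    case False
    then obtain k where k: "m = Suc k" "length w \<le> k" using elem by (cases m) auto
    moreover have "length (letters ?v) = length w" using perm by (metis size_mset)
    ultimately show ?thesis
      by (intro negligible_pred) (simp add: filt_pred_def a_minus_def filt_closed elem_filt)
  qed
  then show ?case unfolding eq by (rule negligible_smult)
next
  case (add p q)
  have "p \<oplus>\<^bsub>A\<^esub> q \<ominus>\<^bsub>A\<^esub> lift (symmetrize (p \<oplus>\<^bsub>A\<^esub> q)) =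
      (p \<ominus>\<^bsub>A\<^esub> lift (symmetrize p)) \<oplus>\<^bsub>A\<^esub> (q \<ominus>\<^bsub>A\<^esub> lift (symmetrize q))"
    by (simp add: lift_def symmetrize_def T.add_A T.minus_A push_add algebra_simps)
  then show ?case using add negligible_add by simp
qed

lemma zero_symbol_negligible:
  assumes "p \<in> filt m" "symmetrize (T.component m p) = \<zero>\<^bsub>S.A\<^esub>"
  shows "p \<in> negligible m"
proof -
  have "lift \<zero>\<^bsub>S.A\<^esub> = \<zero>\<^bsub>A\<^esub>" by (simp add: lift_def S.zero_A T.zero_A)
  then have "T.component m p \<in> negligible m"
    using lift_symmetrize_negligible[OF component_filt, of m p] assms(2) by (simp add: T.minus_A T.zero_A)
  moreover have "p = (p \<ominus>\<^bsub>A\<^esub> T.component m p) \<oplus>\<^bsub>A\<^esub> T.component m p" by (simp add: T.minus_A T.add_A)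
  ultimately show ?thesis
    using negligible_add negligible_pred[OF minus_top_component[OF assms(1)]] by metis
qed

lemma sym_skew_part_iff: "b \<in> sym_skew_part d \<longleftrightarrow> (\<forall>m. m \<noteq> d \<longrightarrow> S.component m b = \<zero>\<^bsub>S.A\<^esub>)"
proof
  assume b: "b \<in> sym_skew_part d"
  show "\<forall>m. m \<noteq> d \<longrightarrow> S.component m b = \<zero>\<^bsub>S.A\<^esub>"
  proof (intro allI impI ext poly_mapping_eqI)
    fix m g \<mu> assume "m \<noteq> d"
    have "Poly_Mapping.lookup (b g) \<mu> = 0" if "total_degree \<mu> = m"
    proof (rule ccontr)
      assume "Poly_Mapping.lookup (b g) \<mu> \<noteq> 0"
      then have "total_degree \<mu> = d" using b by (simp add: sym_skew_part_def in_keys_iff total_degree_def)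
      with that \<open>m \<noteq> d\<close> show False by simp
    qed
    then show "Poly_Mapping.lookup (S.component m b g) \<mu> = Poly_Mapping.lookup (\<zero>\<^bsub>S.A\<^esub> g) \<mu>"
      by (simp add: S.lookup_component S.zero_A when_def)
  qed
next
  assume *: "\<forall>m. m \<noteq> d \<longrightarrow> S.component m b = \<zero>\<^bsub>S.A\<^esub>"
  show "b \<in> sym_skew_part d"
    unfolding sym_skew_part_def
  proof (intro CollectI allI ballI)
    fix g \<mu> assume \<mu>: "\<mu> \<in> Poly_Mapping.keys (b g)"
    show "(\<Sum>a\<in>UNIV. Poly_Mapping.lookup \<mu> a) = d"
    proof (rule ccontr)
      assume "(\<Sum>a\<in>UNIV. Poly_Mapping.lookup \<mu> a) \<noteq> d"
      then have "S.component (total_degree \<mu>) b g = 0" using * by (simp add: S.zero_A total_degree_def)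
      then show False
        using \<mu> S.lookup_component[of "total_degree \<mu>" b g \<mu>] by (simp add: in_keys_iff)
    qed
  qed
qed

end

context lie_orbifold
begin

abbreviation "H \<equiv> orbifold_algebra rep \<kappa>L \<kappa>C"
abbreviation "F \<equiv> orbifold_filt rep \<kappa>L \<kappa>C"

lemma H_eq: "H = quotient_algebra A I"
  by (simp add: orbifold_algebra_def)

text \<open>
  The leading symbol of a class, computed from an arbitrary representative of length at most \<open>m\<close>. Two
  representatives differ by an element of \<open>I\<close>, whose symbol vanishes.
\<close>

definition symbol :: "nat \<Rightarrow> ('g \<Rightarrow> 'b tensor_algebra) set \<Rightarrow> ('g \<Rightarrow> 'b symmetric_algebra)" where
  "symbol m X = symmetrize (T.component m (SOME p. p \<in> filt m \<and> X = I +>\<^bsub>A\<^esub> p))"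

lemma symbol:
  assumes "p \<in> filt m"
  shows "symbol m (I +>\<^bsub>A\<^esub> p) = symmetrize (T.component m p)"
proof -
  define p' where "p' = (SOME q. q \<in> filt m \<and> I +>\<^bsub>A\<^esub> p = I +>\<^bsub>A\<^esub> q)"
  have p': "p' \<in> filt m" "I +>\<^bsub>A\<^esub> p = I +>\<^bsub>A\<^esub> p'"
    using someI[of "\<lambda>q. q \<in> filt m \<and> I +>\<^bsub>A\<^esub> p = I +>\<^bsub>A\<^esub> q" p] assms by (auto simp: p'_def)
  then have "p \<ominus>\<^bsub>A\<^esub> p' \<in> I" using I.coset_eq_iff[of p p'] by simp
  moreover have "p \<ominus>\<^bsub>A\<^esub> p' \<in> filt m" using assms p' by (simp add: a_minus_def filt_closed)
  ultimately have "symmetrize (T.component m (p \<ominus>\<^bsub>A\<^esub> p')) = \<zero>\<^bsub>S.A\<^esub>" by (rule leading_symbol_vanishes)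
  moreover have "p = (p \<ominus>\<^bsub>A\<^esub> p') \<oplus>\<^bsub>A\<^esub> p'" by (simp add: T.minus_A T.add_A)
  then have "symmetrize (T.component m p) = symmetrize (T.component m (p \<ominus>\<^bsub>A\<^esub> p')) \<oplus>\<^bsub>S.A\<^esub> symmetrize (T.component m p')"
    by (metis T.component_add T.carrier_A UNIV_I symmetrize_add)
  ultimately show ?thesis unfolding symbol_def p'_def[symmetric] by simp
qed

lemma F_def: "F m = (\<lambda>p. I +>\<^bsub>A\<^esub> p) ` filt m"
  by (simp add: orbifold_filt_def)

lemma coset_filt_pred_iff:
  "I +>\<^bsub>A\<^esub> p \<in> filt_pred H F m \<longleftrightarrow> p \<in> negligible m"
proof -
  have "I +>\<^bsub>A\<^esub> p \<in> filt_pred H F m \<longleftrightarrow> (\<exists>q\<in>filt_pred A filt m. I +>\<^bsub>A\<^esub> p = I +>\<^bsub>A\<^esub> q)"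
  proof (cases m)
    case 0
    have "I +>\<^bsub>A\<^esub> \<zero>\<^bsub>A\<^esub> = I" using I.coset_zero[of "\<zero>\<^bsub>A\<^esub>"] by simp
    then show ?thesis using 0 by (simp add: filt_pred_def H_eq I.zero_Q)
  qed (auto simp: filt_pred_def F_def)
  also have "\<dots> \<longleftrightarrow> (\<exists>q\<in>filt_pred A filt m. p \<ominus>\<^bsub>A\<^esub> q \<in> I)"
    by (simp add: I.coset_eq_iff)
  also have "\<dots> \<longleftrightarrow> p \<in> negligible m"
  proof
    assume "\<exists>q\<in>filt_pred A filt m. p \<ominus>\<^bsub>A\<^esub> q \<in> I"
    then obtain q where "q \<in> filt_pred A filt m" "p \<ominus>\<^bsub>A\<^esub> q \<in> I" by blast
    moreover have "p = (p \<ominus>\<^bsub>A\<^esub> q) \<oplus>\<^bsub>A\<^esub> q" by (simp add: T.minus_A T.add_A)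
    ultimately show "p \<in> negligible m" unfolding negligible_def by blast
  next
    assume "p \<in> negligible m"
    then obtain i q where "i \<in> I" "q \<in> filt_pred A filt m" "p = i \<oplus>\<^bsub>A\<^esub> q" unfolding negligible_def by blast
    moreover from this have "p \<ominus>\<^bsub>A\<^esub> q = i" by (simp add: T.minus_A T.add_A)
    ultimately show "\<exists>q\<in>filt_pred A filt m. p \<ominus>\<^bsub>A\<^esub> q \<in> I" by metis
  qed
  finally show ?thesis .
qed

sublocale comparison: filtered_comparison S.A S.component H F symbol
proof (intro filtered_comparison.intro filtered_comparison_axioms.intro S.graded_algebra_axioms)
  show "ring H" unfolding H_eq by (rule I.ring_Q)
  note Q = I.add_Q I.mult_Q I.smult_Q I.uminus_Q
  show "F m \<subseteq> carrier H" for m by (auto simp: F_def H_eq)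
  show "\<one>\<^bsub>H\<^esub> \<in> F 0" by (simp add: F_def H_eq I.one_Q elem_one elem_filt)
  show "F m \<subseteq> F (Suc m)" for m using filt_mono[of m "Suc m"] by (auto simp: F_def)
  show "symbol 0 \<one>\<^bsub>H\<^esub> = \<one>\<^bsub>S.A\<^esub>"
    using symbol[of "\<one>\<^bsub>A\<^esub>" 0] T.component_one[of 0]
    by (simp add: H_eq I.one_Q symmetrize_one) (simp add: elem_one elem_filt)
  show "\<exists>x\<in>F m. symbol m x = c" if "S.component m c = c" for m c
  proof
    show "symbol m (I +>\<^bsub>A\<^esub> T.component m (lift c)) = c"
      using that by (simp add: symbol component_filt T.component_component symmetrize_component symmetrize_lift)
    show "I +>\<^bsub>A\<^esub> T.component m (lift c) \<in> F m" by (simp add: F_def component_filt)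
  qed
  fix x y m z i j
  show "symbol m x \<in> carrier S.A" by simp
  show "\<ominus>\<^bsub>H\<^esub> x \<in> F m" "z \<odot>\<^bsub>H\<^esub> x \<in> F m" "S.component m (symbol m x) = symbol m x"
    "symbol m (z \<odot>\<^bsub>H\<^esub> x) = z \<odot>\<^bsub>S.A\<^esub> symbol m x"
    "symbol m x = \<zero>\<^bsub>S.A\<^esub> \<longleftrightarrow> x \<in> filt_pred H F m"
    if x: "x \<in> F m"
  proof -
    obtain p where p: "p \<in> filt m" "x = I +>\<^bsub>A\<^esub> p" using x unfolding F_def by blast
    show "\<ominus>\<^bsub>H\<^esub> x \<in> F m" "z \<odot>\<^bsub>H\<^esub> x \<in> F m" using p by (simp_all add: H_eq F_def Q filt_closed)
    show "S.component m (symbol m x) = symbol m x"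
      using p by (simp add: symbol T.component_component flip: symmetrize_component)
    show "symbol m (z \<odot>\<^bsub>H\<^esub> x) = z \<odot>\<^bsub>S.A\<^esub> symbol m x"
      using p by (simp add: H_eq Q symbol filt_closed component_smult symmetrize_smult)
    have "symbol m x = \<zero>\<^bsub>S.A\<^esub>" if "p \<in> negligible m"
    proof -
      obtain i q where i: "i \<in> I" "q \<in> filt_pred A filt m" "p = i \<oplus>\<^bsub>A\<^esub> q"
        using \<open>p \<in> negligible m\<close> unfolding negligible_def by blast
      have q: "q \<in> filt m" "T.component m q = \<zero>\<^bsub>A\<^esub>" using i(2) by (simp_all add: filt_pred_iff filt_iff)
      have "i = p \<oplus>\<^bsub>A\<^esub> \<ominus>\<^bsub>A\<^esub> q" using i by (simp add: T.add_A T.uminus_A)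
      then have "i \<in> filt m" using p q by (simp add: filt_closed)
      then have "symmetrize (T.component m i) = \<zero>\<^bsub>S.A\<^esub>" using leading_symbol_vanishes i by blast
      then show ?thesis
        using p q i by (simp add: symbol T.component_add symmetrize_add symmetrize_zero)
    qed
    then show "symbol m x = \<zero>\<^bsub>S.A\<^esub> \<longleftrightarrow> x \<in> filt_pred H F m"
      using p zero_symbol_negligible by (auto simp: coset_filt_pred_iff symbol)
  qed
  show "x \<oplus>\<^bsub>H\<^esub> y \<in> F m" "symbol m (x \<oplus>\<^bsub>H\<^esub> y) = symbol m x \<oplus>\<^bsub>S.A\<^esub> symbol m y"
    if xy: "x \<in> F m" "y \<in> F m"
  proof -
    obtain p q where "p \<in> filt m" "x = I +>\<^bsub>A\<^esub> p" "q \<in> filt m" "y = I +>\<^bsub>A\<^esub> q"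
      using xy unfolding F_def by blast
    then show "x \<oplus>\<^bsub>H\<^esub> y \<in> F m" "symbol m (x \<oplus>\<^bsub>H\<^esub> y) = symbol m x \<oplus>\<^bsub>S.A\<^esub> symbol m y"
      by (simp_all add: H_eq F_def Q filt_closed symbol T.component_add symmetrize_add)
  qed
  show "x \<otimes>\<^bsub>H\<^esub> y \<in> F (i + j)" "symbol (i + j) (x \<otimes>\<^bsub>H\<^esub> y) = symbol i x \<otimes>\<^bsub>S.A\<^esub> symbol j y"
    if xy: "x \<in> F i" "y \<in> F j"
  proof -
    obtain p q where p: "p \<in> filt i" "x = I +>\<^bsub>A\<^esub> p" and q: "q \<in> filt j" "y = I +>\<^bsub>A\<^esub> q"
      using xy unfolding F_def by blast
    have "T.component k p \<otimes>\<^bsub>A\<^esub> T.component (i + j - k) q =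
        (if k = i then T.component i p \<otimes>\<^bsub>A\<^esub> T.component j q else \<zero>\<^bsub>A\<^esub>)" if "k \<le> i + j" for k
    proof -
      consider "k = i" | "i < k" | "j < i + j - k" using that by linarith
      then show ?thesis using p q by cases (auto simp: filt_iff)
    qed
    then have "T.component (i + j) (p \<otimes>\<^bsub>A\<^esub> q) =
        (\<Oplus>\<^bsub>A\<^esub>k\<in>{..i + j}. if k = i then T.component i p \<otimes>\<^bsub>A\<^esub> T.component j q else \<zero>\<^bsub>A\<^esub>)"
      by (simp add: T.component_mult T.finsum_A)
    also have "\<dots> = T.component i p \<otimes>\<^bsub>A\<^esub> T.component j q"
      by (subst T.add.finprod_singleton_swap) auto
    finally show "x \<otimes>\<^bsub>H\<^esub> y \<in> F (i + j)" "symbol (i + j) (x \<otimes>\<^bsub>H\<^esub> y) = symbol i x \<otimes>\<^bsub>S.A\<^esub> symbol j y"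
      using p q by (simp_all add: H_eq F_def Q filt_mult symbol symmetrize_mult)
  qed
qed

theorem drinfeld_orbifold: "drinfeld_orbifold rep \<kappa>L \<kappa>C"
proof -
  have "{b \<in> carrier S.A. \<forall>m. m \<noteq> d \<longrightarrow> S.component m b = \<zero>\<^bsub>S.A\<^esub>} = sym_skew_part d" for d
    by (auto simp: sym_skew_part_iff)
  then show ?thesis
    using comparison.assoc_graded_iso unfolding drinfeld_orbifold_def by simp
qed

end

section \<open>The conditions are necessary\<close>

lemma (in complex_algebra) smult_add:
  assumes "a \<in> carrier A" "b \<in> carrier A"
  shows "z \<odot>\<^bsub>A\<^esub> (a \<oplus>\<^bsub>A\<^esub> b) = z \<odot>\<^bsub>A\<^esub> a \<oplus>\<^bsub>A\<^esub> z \<odot>\<^bsub>A\<^esub> b"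
proof -
  have "z \<odot>\<^bsub>A\<^esub> (a \<oplus>\<^bsub>A\<^esub> b) = (z \<odot>\<^bsub>A\<^esub> \<one>\<^bsub>A\<^esub>) \<otimes>\<^bsub>A\<^esub> (a \<oplus>\<^bsub>A\<^esub> b)"
    using assms by (intro smult_conv_mult) simp
  also have "\<dots> = (z \<odot>\<^bsub>A\<^esub> \<one>\<^bsub>A\<^esub>) \<otimes>\<^bsub>A\<^esub> a \<oplus>\<^bsub>A\<^esub> (z \<odot>\<^bsub>A\<^esub> \<one>\<^bsub>A\<^esub>) \<otimes>\<^bsub>A\<^esub> b"
    using assms by (simp add: r_distr)
  also have "\<dots> = z \<odot>\<^bsub>A\<^esub> a \<oplus>\<^bsub>A\<^esub> z \<odot>\<^bsub>A\<^esub> b"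
    using assms by (simp only: smult_conv_mult[symmetric])
  finally show ?thesis .
qed

lemma lookup_scale: "Poly_Mapping.lookup (Poly_Mapping.single 0 z * p) m = z * Poly_Mapping.lookup p m"
  for p :: "'m::monoid_add \<Rightarrow>\<^sub>0 complex"
  unfolding lookup_conv_lin by (rule lin_scale)

context orbifold_cochains
begin

lemma \<kappa>L_expand: "\<kappa>L g u x = (\<Sum>d\<in>UNIV. x $ d *s \<kappa>L g u (axis d 1))"
proof -
  have "\<kappa>L g u (\<Sum>d\<in>S. x $ d *s axis d 1) = (\<Sum>d\<in>S. x $ d *s \<kappa>L g u (axis d 1))" for S :: "'b set"
    by (induction S rule: infinite_finite_induct) (simp_all add: \<kappa>L_simps)
  from this[of UNIV] show ?thesis by (simp add: basis_expansion)
qed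

lemma \<kappa>C_expand: "\<kappa>C g u x = (\<Sum>d\<in>UNIV. x $ d * \<kappa>C g u (axis d 1))"
proof -
  have "\<kappa>C g u (\<Sum>d\<in>S. x $ d *s axis d 1) = (\<Sum>d\<in>S. x $ d * \<kappa>C g u (axis d 1))" for S :: "'b set"
    by (induction S rule: infinite_finite_induct) (simp_all add: \<kappa>C_simps)
  from this[of UNIV] show ?thesis by (simp add: basis_expansion)
qed

text \<open>
  The structure constants satisfy the required conditions if the cochains satisfy the corresponding
  identities of vectors on the basis.
\<close>

lemma lie_orbifold_structureI:
  assumes inv_L: "\<And>g a b. \<kappa>L 1 (rep g (axis a 1)) (rep g (axis b 1)) = rep g (\<kappa>L 1 (axis a 1) (axis b 1))"
    and inv_C: "\<And>g h a b. \<kappa>C (g * h * ginv g) (rep g (axis a 1)) (rep g (axis b 1)) = \<kappa>C h (axis a 1) (axis b 1)"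
    and linear: "\<And>a b c. \<kappa>L 1 (axis a 1) (\<kappa>L 1 (axis b 1) (axis c 1)) + \<kappa>L 1 (axis b 1) (\<kappa>L 1 (axis c 1) (axis a 1))
      + \<kappa>L 1 (axis c 1) (\<kappa>L 1 (axis a 1) (axis b 1)) = 0"
    and const_part: "\<And>h a b c. \<kappa>C h (axis a 1) (\<kappa>L 1 (axis b 1) (axis c 1)) + \<kappa>C h (axis b 1) (\<kappa>L 1 (axis c 1) (axis a 1))
      + \<kappa>C h (axis c 1) (\<kappa>L 1 (axis a 1) (axis b 1)) = 0"
    and mixed: "\<And>h a b c. \<kappa>C h (axis b 1) (axis c 1) *s (axis a 1 - rep h (axis a 1))
      + \<kappa>C h (axis c 1) (axis a 1) *s (axis b 1 - rep h (axis b 1))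
      + \<kappa>C h (axis a 1) (axis b 1) *s (axis c 1 - rep h (axis c 1)) = 0"
  shows "lie_orbifold_structure \<pi> l C ginv"
proof
  show "l a b c = - l b a c" for a b c
    unfolding l_def \<kappa>L_skew[of 1 "axis a 1" "axis b 1"] by simp
  show "C h a b = - C h b a" for h a b
    unfolding C_def by (rule \<kappa>C_skew)
  show "l (\<pi> g a) (\<pi> g b) (\<pi> g c) = l a b c" for g a b c
    using inv_L[of g a b] by (simp add: l_def rep_axis) (simp add: rep_def)
  show "C (g * h * ginv g) (\<pi> g a) (\<pi> g b) = C h a b" for g h a b
    using inv_C[of g h a b] by (simp add: C_def rep_axis)
  show "(\<Sum>d\<in>UNIV. l b c d * l a d e + l c a d * l b d e + l a b d * l c d e) = 0" for a b c e
  proof -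
    have "\<kappa>L 1 (axis a 1) (\<kappa>L 1 (axis b 1) (axis c 1)) $ e = (\<Sum>d\<in>UNIV. l b c d * l a d e)" for a b c
      by (subst \<kappa>L_expand) (simp add: l_def)
    then show ?thesis
      using arg_cong[OF linear[of a b c], of "\<lambda>v. v $ e"] by (simp add: sum.distrib)
  qed
  show "(\<Sum>d\<in>UNIV. l b c d * C h a d + l c a d * C h b d + l a b d * C h c d) = 0" for h a b c
  proof -
    have "\<kappa>C h (axis a 1) (\<kappa>L 1 (axis b 1) (axis c 1)) = (\<Sum>d\<in>UNIV. l b c d * C h a d)" for a b c
      by (subst \<kappa>C_expand) (simp add: l_def C_def)
    then show ?thesis
      using const_part[of h a b c] by (simp add: sum.distrib)
  qed
  show "C h b c * (of_bool (a = e) - of_bool (\<pi> h a = e)) + C h c a * (of_bool (b = e) - of_bool (\<pi> h b = e))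
       + C h a b * (of_bool (c = e) - of_bool (\<pi> h c = e)) = 0" for h a b c e
  proof -
    have "axis x (1::complex) $ e = of_bool (x = e)" for x by (simp add: axis_def)
    then show ?thesis
      using arg_cong[OF mixed[of h b c a], of "\<lambda>v. v $ e"] by (simp add: C_def rep_axis)
  qed
qed

lemma H_ops:
  "(I +>\<^bsub>A\<^esub> p) \<oplus>\<^bsub>orbifold_algebra rep \<kappa>L \<kappa>C\<^esub> (I +>\<^bsub>A\<^esub> q) = I +>\<^bsub>A\<^esub> (p \<oplus>\<^bsub>A\<^esub> q)"
  "z \<odot>\<^bsub>orbifold_algebra rep \<kappa>L \<kappa>C\<^esub> (I +>\<^bsub>A\<^esub> p) = I +>\<^bsub>A\<^esub> (z \<odot>\<^bsub>A\<^esub> p)"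
  "\<ominus>\<^bsub>orbifold_algebra rep \<kappa>L \<kappa>C\<^esub> (I +>\<^bsub>A\<^esub> p) = I +>\<^bsub>A\<^esub> (\<ominus>\<^bsub>A\<^esub> p)"
  "I +>\<^bsub>A\<^esub> p \<in> carrier (orbifold_algebra rep \<kappa>L \<kappa>C)"
  "\<zero>\<^bsub>orbifold_algebra rep \<kappa>L \<kappa>C\<^esub> = I +>\<^bsub>A\<^esub> \<zero>\<^bsub>A\<^esub>"
  using I.coset_zero[of "\<zero>\<^bsub>A\<^esub>"]
  by (simp_all add: orbifold_algebra_def I.add_Q I.smult_Q I.uminus_Q I.zero_Q)

lemma filt_pred_H_eq: "filt_pred (orbifold_algebra rep \<kappa>L \<kappa>C) (orbifold_filt rep \<kappa>L \<kappa>C) m =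
    (\<lambda>p. I +>\<^bsub>A\<^esub> p) ` filt_pred A filt m"
  by (cases m) (simp_all add: filt_pred_def orbifold_filt_def H_ops)

lemma filt_pred_H_subgroup: "abelian_subgroup (filt_pred (orbifold_algebra rep \<kappa>L \<kappa>C) (orbifold_filt rep \<kappa>L \<kappa>C) m)
    (orbifold_algebra rep \<kappa>L \<kappa>C)"
  (is "abelian_subgroup ?P ?H")
proof -
  interpret H: ring ?H unfolding orbifold_algebra_def by (rule I.ring_Q)
  note P = filt_pred_H_eq[of m]
  have uminus: "\<ominus>\<^bsub>A\<^esub> p \<in> filt_pred A filt m" if "p \<in> filt_pred A filt m" for p
    using that by (simp add: filt_pred_iff component_uminus)
  have "subgroup ?P (add_monoid ?H)"
  proof (rule subgroup.intro)
    show "?P \<subseteq> carrier (add_monoid ?H)" by (auto simp: P H_ops)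
    show "x \<otimes>\<^bsub>add_monoid ?H\<^esub> y \<in> ?P" if "x \<in> ?P" "y \<in> ?P" for x y
      using that filt_pred_closed(1) by (auto simp: P H_ops)
    show "\<one>\<^bsub>add_monoid ?H\<^esub> \<in> ?P"
      unfolding P by (simp only: H_ops monoid.simps) (rule imageI, rule filt_pred_closed(3))
    show "inv\<^bsub>add_monoid ?H\<^esub> x \<in> ?P" if x: "x \<in> ?P" for x
    proof -
      obtain p where p: "p \<in> filt_pred A filt m" "x = I +>\<^bsub>A\<^esub> p" using x unfolding P by blast
      have "inv\<^bsub>add_monoid ?H\<^esub> x = I +>\<^bsub>A\<^esub> (\<ominus>\<^bsub>A\<^esub> p)"
        unfolding a_inv_def[symmetric] p(2) by (rule H_ops)
      then show ?thesis unfolding P using uminus[OF p(1)] by simp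
    qed
  qed
  then show ?thesis
    using H.abelian_group_axioms by (intro abelian_subgroupI3 additive_subgroup.intro)
qed

end

locale drinfeld_orbifold_cochains = orbifold_cochains \<pi> ginv \<kappa>L \<kappa>C
  for \<pi> :: "'g::{finite,monoid_mult} \<Rightarrow> 'b::finite \<Rightarrow> 'b" and ginv \<kappa>L \<kappa>C +
  assumes drinfeld: "drinfeld_orbifold rep \<kappa>L \<kappa>C"
begin

abbreviation "H \<equiv> orbifold_algebra rep \<kappa>L \<kappa>C"
abbreviation "F \<equiv> orbifold_filt rep \<kappa>L \<kappa>C"
abbreviation "gr \<equiv> assoc_graded H F"
abbreviation "P \<equiv> filt_pred H F"

lemma H_eq: "H = quotient_algebra A I"
  by (simp add: orbifold_algebra_def)

lemma F_def: "F m = (\<lambda>p. I +>\<^bsub>A\<^esub> p) ` filt m"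
  by (simp add: orbifold_filt_def)

lemmas P_eq = filt_pred_H_eq

interpretation H: complex_algebra H
  unfolding H_eq by (rule I.complex_algebra_Q)

interpretation P: abelian_subgroup "P m" H for m
  by (rule filt_pred_H_subgroup)

text \<open>
  The homogeneous element of degree \<open>d\<close> of the associated graded algebra that \<open>p\<close> represents.
\<close>

definition class_at :: "nat \<Rightarrow> ('g \<Rightarrow> 'b tensor_algebra) \<Rightarrow> nat \<Rightarrow> ('g \<Rightarrow> 'b tensor_algebra) set set" where
  "class_at d p = (\<lambda>m. if m = d then P m +>\<^bsub>H\<^esub> (I +>\<^bsub>A\<^esub> p) else P m)"

lemma coset_H [simp]: "I +>\<^bsub>A\<^esub> p \<in> carrier H"
  by (rule H_ops)

lemma P_coset_zero: "P m +>\<^bsub>H\<^esub> \<zero>\<^bsub>H\<^esub> = P m"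
  by (rule P.a_rcos_const) (rule P.zero_closed)

lemma class_at_part:
  assumes "p \<in> filt d"
  shows "class_at d p \<in> assoc_graded_part H F d"
proof -
  have "\<exists>a\<in>F m. class_at d p m = P m +>\<^bsub>H\<^esub> a" for m
  proof (cases "m = d")
    case True
    then show ?thesis using assms by (auto simp: class_at_def F_def)
  next
    case False
    have "\<zero>\<^bsub>H\<^esub> \<in> F m"
      using filt_closed(4) I.coset_zero[of "\<zero>\<^bsub>A\<^esub>"] by (force simp: F_def H_eq I.zero_Q)
    then show ?thesis using False P_coset_zero by (auto simp: class_at_def)
  qed
  moreover have "{m. class_at d p m \<noteq> P m} \<subseteq> {d}" by (auto simp: class_at_def)
  then have "finite {m. class_at d p m \<noteq> P m}" by (rule finite_subset) simp
  ultimately show ?thesis by (simp add: assoc_graded_part_def assoc_graded_def class_at_def)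
qed

lemma assoc_graded_part_class:
  assumes "f \<in> assoc_graded_part H F d"
  obtains p where "p \<in> filt d" "f = class_at d p"
proof -
  from assms have "\<exists>a\<in>F d. f d = P d +>\<^bsub>H\<^esub> a" and off: "\<And>m. m \<noteq> d \<Longrightarrow> f m = P m"
    by (auto simp: assoc_graded_part_def assoc_graded_def)
  then obtain p where "p \<in> filt d" "f d = P d +>\<^bsub>H\<^esub> (I +>\<^bsub>A\<^esub> p)" by (auto simp: F_def)
  with off show thesis by (intro that[of p] ext) (auto simp: class_at_def)
qed

lemma class_at_add: "class_at d (p \<oplus>\<^bsub>A\<^esub> q) = class_at d p \<oplus>\<^bsub>gr\<^esub> class_at d q"
proof
  fix m
  have "P m <+>\<^bsub>H\<^esub> P m = P m"
    using P.a_rcos_sum[of "\<zero>\<^bsub>H\<^esub>" "\<zero>\<^bsub>H\<^esub>" m] by (simp add: P_coset_zero)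
  then show "class_at d (p \<oplus>\<^bsub>A\<^esub> q) m = (class_at d p \<oplus>\<^bsub>gr\<^esub> class_at d q) m"
    using P.a_rcos_sum[of "I +>\<^bsub>A\<^esub> p" "I +>\<^bsub>A\<^esub> q" m]
    by (cases "m = d") (simp_all add: class_at_def assoc_graded_def H_ops)
qed

lemma class_at_smult: "class_at d (z \<odot>\<^bsub>A\<^esub> p) = z \<odot>\<^bsub>gr\<^esub> class_at d p"
proof
  fix m
  have P_smult: "z \<odot>\<^bsub>H\<^esub> x \<in> P m" if "x \<in> P m" for x
    using that filt_pred_closed(2) by (auto simp: P_eq H_ops)
  have coset: "P m +>\<^bsub>H\<^esub> (z \<odot>\<^bsub>H\<^esub> y) = P m +>\<^bsub>H\<^esub> (z \<odot>\<^bsub>H\<^esub> x)"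
    if "y \<in> P m +>\<^bsub>H\<^esub> x" "x \<in> carrier H" for x y
  proof -
    obtain r where r: "r \<in> P m" "y = r \<oplus>\<^bsub>H\<^esub> x" using \<open>y \<in> _\<close> by (auto simp: a_r_coset_def')
    have "r \<in> carrier H" using r(1) by (rule P.a_Hcarr)
    then have "z \<odot>\<^bsub>H\<^esub> y = z \<odot>\<^bsub>H\<^esub> r \<oplus>\<^bsub>H\<^esub> z \<odot>\<^bsub>H\<^esub> x"
      unfolding r(2) using that(2) by (rule H.smult_add)
    then show ?thesis
      using P.a_rcos_sum[of "z \<odot>\<^bsub>H\<^esub> r" "z \<odot>\<^bsub>H\<^esub> x" m] P.a_rcos_sum[of "\<zero>\<^bsub>H\<^esub>" "z \<odot>\<^bsub>H\<^esub> x" m]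
        P.a_rcos_const[OF P_smult[OF r(1)]] \<open>r \<in> carrier H\<close> that(2) by (simp add: P_coset_zero)
  qed
  have "(\<Union>y\<in>P m +>\<^bsub>H\<^esub> (I +>\<^bsub>A\<^esub> p). P m +>\<^bsub>H\<^esub> (z \<odot>\<^bsub>H\<^esub> y)) = P m +>\<^bsub>H\<^esub> (z \<odot>\<^bsub>H\<^esub> (I +>\<^bsub>A\<^esub> p))"
  proof (rule SUP_eq_const)
    show "P m +>\<^bsub>H\<^esub> (I +>\<^bsub>A\<^esub> p) \<noteq> {}" using P.a_rcos_self[OF coset_H, of p m] by blast
  qed (rule coset[OF _ coset_H])
  moreover have "(\<Union>y\<in>P m. P m +>\<^bsub>H\<^esub> (z \<odot>\<^bsub>H\<^esub> y)) = P m"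
  proof (rule SUP_eq_const)
    show "P m \<noteq> {}" using P.zero_closed[of m] by blast
  qed (rule P.a_rcos_const[OF P_smult])
  ultimately show "class_at d (z \<odot>\<^bsub>A\<^esub> p) m = (z \<odot>\<^bsub>gr\<^esub> class_at d p) m"
    by (cases "m = d") (simp_all add: class_at_def assoc_graded_def H_ops)
qed

lemma class_at_negligible:
  assumes "p \<in> negligible d"
  shows "class_at d p = class_at d \<zero>\<^bsub>A\<^esub>"
proof -
  obtain i q where iq: "i \<in> I" "q \<in> filt_pred A filt d" "p = i \<oplus>\<^bsub>A\<^esub> q"
    using assms unfolding negligible_def by blast
  have "i \<oplus>\<^bsub>A\<^esub> q \<ominus>\<^bsub>A\<^esub> q = i" by (simp add: T.minus_A T.add_A)
  then have "I +>\<^bsub>A\<^esub> p = I +>\<^bsub>A\<^esub> q" using iq I.coset_eq_iff[of p q] by simp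
  then have "I +>\<^bsub>A\<^esub> p \<in> P d" using iq by (auto simp: P_eq)
  moreover have "I +>\<^bsub>A\<^esub> \<zero>\<^bsub>A\<^esub> \<in> P d"
    unfolding P_eq by (rule imageI) (rule filt_pred_closed(3))
  ultimately show ?thesis by (simp add: class_at_def P.a_rcos_const fun_eq_iff)
qed

text \<open>
  A dimension count. Suppose that the elements \<open>e k\<close> span the words of length at most \<open>d\<close> modulo shorter
  ones, and that there are as many independent coordinates on the degree \<open>d\<close> part of \<open>S(V)#G\<close>. Send \<open>v\<close>
  to the coordinates of the image of the class of \<open>\<Sum>\<^sub>k v k \<cdot> e k\<close> under a graded isomorphism. This
  endomorphism of a finite-dimensional space is surjective because the \<open>e k\<close> span, hence it is
  injective, and so only the trivial combination of the \<open>e k\<close> can be negligible.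
\<close>

lemma negligible_of_low_degree:
  fixes e :: "'k::finite \<Rightarrow> 'g \<Rightarrow> 'b tensor_algebra"
    and coord :: "'k \<Rightarrow> ('g \<Rightarrow> 'b symmetric_algebra) \<Rightarrow> complex"
  assumes e: "\<And>k. e k \<in> filt d"
    and span: "\<And>p. p \<in> filt d \<Longrightarrow> \<exists>v. p \<ominus>\<^bsub>A\<^esub> (\<Oplus>\<^bsub>A\<^esub>k\<in>UNIV. v k \<odot>\<^bsub>A\<^esub> e k) \<in> filt_pred A filt d"
    and coord_add: "\<And>k b b'. coord k (b \<oplus>\<^bsub>S.A\<^esub> b') = coord k b + coord k b'"
    and coord_smult: "\<And>k z b. coord k (z \<odot>\<^bsub>S.A\<^esub> b) = z * coord k b"
    and coord_surj: "\<And>w. \<exists>b\<in>sym_skew_part d. \<forall>k. coord k b = w k"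
    and p: "p \<in> filt d" "p \<in> negligible d"
  shows "p \<in> filt_pred A filt d"
proof -
  obtain \<phi> where iso: "\<phi> \<in> algebra_iso gr S.A"
    and part: "\<phi> ` assoc_graded_part H F d = sym_skew_part d"
    using drinfeld unfolding drinfeld_orbifold_def by blast
  have \<phi>_add: "\<phi> (f \<oplus>\<^bsub>gr\<^esub> h) = \<phi> f \<oplus>\<^bsub>S.A\<^esub> \<phi> h" if "f \<in> carrier gr" "h \<in> carrier gr" for f h
    using iso that by (auto simp: algebra_iso_def ring_iso_def ring_hom_def)
  have \<phi>_smult: "\<phi> (z \<odot>\<^bsub>gr\<^esub> f) = z \<odot>\<^bsub>S.A\<^esub> \<phi> f" if "f \<in> carrier gr" for f z
    using iso that by (auto simp: algebra_iso_def)
  have gr: "class_at d q \<in> carrier gr" if "q \<in> filt d" for q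
    using class_at_part[OF that] by (simp add: assoc_graded_part_def)
  define E where "E v = (\<Oplus>\<^bsub>A\<^esub>k\<in>UNIV. v $ k \<odot>\<^bsub>A\<^esub> e k)" for v :: "complex ^ 'k"
  have E_filt: "E v \<in> filt d" for v
  proof -
    have "(\<Oplus>\<^bsub>A\<^esub>k\<in>S. v $ k \<odot>\<^bsub>A\<^esub> e k) \<in> filt d" if "finite S" for S
      using that by (induction S rule: finite_induct) (simp_all add: filt_closed e)
    then show ?thesis by (simp add: E_def)
  qed
  have E_add: "E (v + w) = E v \<oplus>\<^bsub>A\<^esub> E w" for v w
    by (simp add: E_def T.finsum_A T.add_A T.smult_A single_add distrib_right sum.distrib)
  have E_smult: "E (z *s v) = z \<odot>\<^bsub>A\<^esub> E v" for z v
    by (simp add: E_def T.finsum_A T.smult_A sum_distrib_left mult_single mult.assoc[symmetric])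
  define \<Lambda> where "\<Lambda> v = (\<chi> k. coord k (\<phi> (class_at d (E v))))" for v
  have "Vector_Spaces.linear (*s) (*s) \<Lambda>"
    by unfold_locales
      (simp_all add: \<Lambda>_def E_add E_smult class_at_add class_at_smult \<phi>_add \<phi>_smult gr E_filt coord_add coord_smult vec_eq_iff
        algebra_simps)
  moreover have "surj \<Lambda>"
  proof (rule surjI)
    fix w
    define v where "v = (SOME v. \<Lambda> v = w)"
    have "\<exists>v. \<Lambda> v = w"
    proof -
      obtain b where b: "b \<in> sym_skew_part d" "\<And>k. coord k b = w $ k" using coord_surj[of "\<lambda>k. w $ k"] by blast
      then obtain f where "f \<in> assoc_graded_part H F d" "b = \<phi> f" using part by blast
      then obtain q where q: "q \<in> filt d" "b = \<phi> (class_at d q)" using assoc_graded_part_class by metis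
      obtain v where v: "q \<ominus>\<^bsub>A\<^esub> (\<Oplus>\<^bsub>A\<^esub>k\<in>UNIV. v k \<odot>\<^bsub>A\<^esub> e k) \<in> filt_pred A filt d" using span[OF q(1)] by blast
      have "q \<ominus>\<^bsub>A\<^esub> E (\<chi> k. v k) \<in> negligible d"
        using v by (simp add: E_def negligible_pred)
      moreover have "q = E (\<chi> k. v k) \<oplus>\<^bsub>A\<^esub> (q \<ominus>\<^bsub>A\<^esub> E (\<chi> k. v k))" by (simp add: T.minus_A T.add_A)
      ultimately have "class_at d q = class_at d (E (\<chi> k. v k)) \<oplus>\<^bsub>gr\<^esub> class_at d \<zero>\<^bsub>A\<^esub>"
        by (metis class_at_add class_at_negligible)
      also have "\<dots> = class_at d (E (\<chi> k. v k))"
        by (simp add: flip: class_at_add)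
      finally show ?thesis using q b by (intro exI[of _ "\<chi> k. v k"]) (simp add: \<Lambda>_def vec_eq_iff)
    qed
    then show "\<Lambda> (SOME v. \<Lambda> v = w) = w" by (rule someI_ex)
  qed
  ultimately have inj: "inj \<Lambda>" by (rule vec.linear_surj_imp_inj)
  obtain v where v: "p \<ominus>\<^bsub>A\<^esub> (\<Oplus>\<^bsub>A\<^esub>k\<in>UNIV. v k \<odot>\<^bsub>A\<^esub> e k) \<in> filt_pred A filt d" using span[OF p(1)] by blast
  let ?v = "\<chi> k. v k"
  have r: "p \<ominus>\<^bsub>A\<^esub> E ?v \<in> filt_pred A filt d" using v by (simp add: E_def)
  have "E ?v = p \<oplus>\<^bsub>A\<^esub> ((- 1) \<odot>\<^bsub>A\<^esub> (p \<ominus>\<^bsub>A\<^esub> E ?v))"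
    by (simp add: T.add_A T.minus_A T.smult_A single_uminus)
  also have "\<dots> \<in> negligible d"
    by (intro negligible_add negligible_smult p negligible_pred r)
  finally have "class_at d (E ?v) = class_at d \<zero>\<^bsub>A\<^esub>" by (rule class_at_negligible)
  also have "\<zero>\<^bsub>A\<^esub> = E 0" by (simp add: E_def T.finsum_A T.smult_A T.zero_A)
  finally have "\<Lambda> ?v = \<Lambda> 0" by (simp add: \<Lambda>_def)
  then have "?v = 0" using inj by (simp add: inj_eq)
  then have "E ?v = \<zero>\<^bsub>A\<^esub>" by (simp add: E_def T.finsum_A T.smult_A T.zero_A)
  then show ?thesis using r by (simp add: T.minus_A T.zero_A)
qed

text \<open>
  The element \<open>\<Sum>\<^sub>k (X k + Y k) \<otimes> k\<close>; these are the elements of \<open>T(V)#G\<close> of length at most one.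
\<close>

definition low :: "('g \<Rightarrow> complex ^ 'b) \<Rightarrow> ('g \<Rightarrow> complex) \<Rightarrow> 'g \<Rightarrow> 'b tensor_algebra" where
  "low X Y = (\<lambda>k. tensor_vec (X k) + Poly_Mapping.single 0 (Y k))"

lemma lookup_tensor_vec:
  "Poly_Mapping.lookup (tensor_vec v) (TWord [c]) = v $ c" "Poly_Mapping.lookup (tensor_vec v) 0 = 0"
proof -
  have "Poly_Mapping.lookup (tensor_vec v) (TWord [c]) = (\<Sum>b\<in>UNIV. if b = c then v $ c else 0)"
    unfolding tensor_vec_def lookup_sum by (intro sum.cong refl) (auto simp: lookup_single when_def)
  then show "Poly_Mapping.lookup (tensor_vec v) (TWord [c]) = v $ c" by simp
  show "Poly_Mapping.lookup (tensor_vec v) 0 = 0"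
    unfolding tensor_vec_def lookup_sum zero_tensor_word_def
    by (intro sum.neutral ballI) (simp add: lookup_single when_def)
qed

lemma lookup_low:
  "Poly_Mapping.lookup (low X Y k) (TWord [c]) = X k $ c" "Poly_Mapping.lookup (low X Y k) 0 = Y k"
proof -
  have "TWord [c] \<noteq> 0" by (simp add: zero_tensor_word_def)
  then show "Poly_Mapping.lookup (low X Y k) (TWord [c]) = X k $ c" "Poly_Mapping.lookup (low X Y k) 0 = Y k"
    by (simp_all add: low_def lookup_add lookup_tensor_vec lookup_single when_def)
qed

lemma keys_low: "w \<in> Poly_Mapping.keys (low X Y k) \<Longrightarrow> w = 0 \<or> (\<exists>c. w = TWord [c])"
proof -
  assume w: "w \<in> Poly_Mapping.keys (low X Y k)"
  have "Poly_Mapping.keys (tensor_vec v) \<subseteq> (\<Union>c. {TWord [c]})" for v :: "complex ^ 'b"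
    unfolding tensor_vec_def by (rule order.trans[OF keys_sum]) auto
  then show ?thesis
    using w Poly_Mapping.keys_add[of "tensor_vec (X k)" "Poly_Mapping.single 0 (Y k)"]
    unfolding low_def by (auto split: if_splits)
qed

lemma low_filt: "low X Y \<in> filt 1"
  using keys_low by (fastforce simp: tensor_skew_filt_iff)

text \<open>
  The group elements span \<open>T(V)#G\<close> in degree zero, and \<open>S(V)#G\<close> as well.
\<close>

lemma I_degree_zero:
  assumes "p \<in> I" "p \<in> filt 0"
  shows "p = \<zero>\<^bsub>A\<^esub>"
proof -
  have "p \<in> filt_pred A filt 0"
  proof (rule negligible_of_low_degree[where e = "\<lambda>g. elem [] g" and coord = "\<lambda>g b. Poly_Mapping.lookup (b g) 0"])
    show "elem [] g \<in> filt 0" for g by (simp add: elem_filt)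
    show "\<exists>v. q \<ominus>\<^bsub>A\<^esub> (\<Oplus>\<^bsub>A\<^esub>g\<in>UNIV. v g \<odot>\<^bsub>A\<^esub> elem [] g) \<in> filt_pred A filt 0" if "q \<in> filt 0" for q
    proof
      have "(\<Oplus>\<^bsub>A\<^esub>g\<in>UNIV. Poly_Mapping.lookup (q g) 0 \<odot>\<^bsub>A\<^esub> elem [] g) = q"
      proof
        fix k
        have "(\<Sum>g\<in>UNIV. (Poly_Mapping.lookup (q g) 0 \<odot>\<^bsub>A\<^esub> elem [] g) k) =
            (\<Sum>g\<in>UNIV. if g = k then Poly_Mapping.single 0 (Poly_Mapping.lookup (q k) 0) else 0)"
          by (intro sum.cong refl) (auto simp: T.smult_A elem_def mult_single simp flip: zero_tensor_word_def)
        also have "\<dots> = Poly_Mapping.single 0 (Poly_Mapping.lookup (q k) 0)" by simp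
        also have "\<dots> = q k"
        proof (rule poly_mapping_eqI)
          fix w
          have "Poly_Mapping.lookup (q k) w = 0" if "w \<noteq> 0"
          proof (rule ccontr)
            assume "Poly_Mapping.lookup (q k) w \<noteq> 0"
            then have "letters w = []" using \<open>q \<in> filt 0\<close> by (simp add: tensor_skew_filt_iff in_keys_iff)
            then show False using \<open>w \<noteq> 0\<close> by (cases w) (simp add: zero_tensor_word_def)
          qed
          then show "Poly_Mapping.lookup (Poly_Mapping.single 0 (Poly_Mapping.lookup (q k) 0)) w = Poly_Mapping.lookup (q k) w"
            by (auto simp: lookup_single when_def)
        qed
        finally show "(\<Oplus>\<^bsub>A\<^esub>g\<in>UNIV. Poly_Mapping.lookup (q g) 0 \<odot>\<^bsub>A\<^esub> elem [] g) k = q k"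
          by (simp add: T.finsum_A)
      qed
      then show "q \<ominus>\<^bsub>A\<^esub> (\<Oplus>\<^bsub>A\<^esub>g\<in>UNIV. Poly_Mapping.lookup (q g) 0 \<odot>\<^bsub>A\<^esub> elem [] g) \<in> filt_pred A filt 0"
        using filt_pred_closed(3)[of 0] by (simp add: T.minus_A T.zero_A)
    qed
    show "\<exists>b\<in>sym_skew_part 0. \<forall>g. Poly_Mapping.lookup (b g) 0 = w g" for w :: "'g \<Rightarrow> complex"
      by (rule bexI[of _ "\<lambda>g. Poly_Mapping.single 0 (w g)"]) (auto simp: sym_skew_part_def)
    show "p \<in> filt 0" "p \<in> negligible 0" using assms negligible_I by auto
  qed (simp_all add: S.add_A S.smult_A lookup_add lookup_scale)
  then show ?thesis by (simp add: filt_pred_def)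
qed

lemma finsum_letters:
  "(\<Oplus>\<^bsub>A\<^esub>x\<in>UNIV. v x \<odot>\<^bsub>A\<^esub> elem [fst x] (snd x)) = low (\<lambda>g. \<chi> c. v (c, g)) (\<lambda>g. 0)"
proof
  fix k
  have "(\<Sum>x\<in>UNIV. (v x \<odot>\<^bsub>A\<^esub> elem [fst x] (snd x)) k) =
      (\<Sum>c\<in>UNIV. \<Sum>g\<in>UNIV. if g = k then Poly_Mapping.single (TWord [c]) (v (c, k)) else 0)"
    unfolding UNIV_Times_UNIV[symmetric] sum.cartesian_product
    by (intro sum.cong refl) (auto simp: T.smult_A elem_def mult_single)
  also have "\<dots> = tensor_vec (\<chi> c. v (c, k))"
    by (simp add: tensor_vec_def)
  finally show "(\<Oplus>\<^bsub>A\<^esub>x\<in>UNIV. v x \<odot>\<^bsub>A\<^esub> elem [fst x] (snd x)) k = low (\<lambda>g. \<chi> c. v (c, g)) (\<lambda>g. 0) k"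
    by (simp add: T.finsum_A low_def)
qed

text \<open>
  The letters times the group elements span degree one of \<open>T(V)#G\<close> and of \<open>S(V)#G\<close>. A negligible element
  of length one therefore has length zero, and the previous lemma applies.
\<close>

lemma I_degree_one:
  assumes "p \<in> I" "p \<in> filt 1"
  shows "p = \<zero>\<^bsub>A\<^esub>"
proof -
  have "p \<in> filt_pred A filt 1"
  proof (rule negligible_of_low_degree[where e = "\<lambda>x. elem [fst x] (snd x)"
        and coord = "\<lambda>x b. Poly_Mapping.lookup (b (snd x)) (Poly_Mapping.single (fst x) 1)"])
    show "elem [fst x] (snd x) \<in> filt 1" for x :: "'b \<times> 'g" by (simp add: elem_filt)
    show "\<exists>v. q \<ominus>\<^bsub>A\<^esub> (\<Oplus>\<^bsub>A\<^esub>x\<in>UNIV. v x \<odot>\<^bsub>A\<^esub> elem [fst x] (snd x)) \<in> filt_pred A filt 1"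
      if q: "q \<in> filt 1" for q
    proof
      define v where "v x = Poly_Mapping.lookup (q (snd x)) (TWord [fst x])" for x
      have "length (letters w) = 0" if w: "w \<in> Poly_Mapping.keys (q k - low (\<lambda>g. \<chi> c. v (c, g)) (\<lambda>g. 0) k)" for w k
      proof (rule ccontr)
        assume ne: "length (letters w) \<noteq> 0"
        have "length (letters w) \<le> 1"
        proof (cases "Poly_Mapping.lookup (q k) w = 0")
          case True
          then have "w \<in> Poly_Mapping.keys (low (\<lambda>g. \<chi> c. v (c, g)) (\<lambda>g. 0) k)"
            using w by (simp add: in_keys_iff lookup_minus)
          then show ?thesis using low_filt unfolding tensor_skew_filt_iff by blast
        next
          case False
          then show ?thesis using q by (simp add: tensor_skew_filt_iff in_keys_iff)
        qed
        then have "length (letters w) = 1" using ne by linarith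
        then obtain c where "w = TWord [c]" by (cases w) (auto simp: length_Suc_conv)
        then show False using w by (simp add: in_keys_iff lookup_minus lookup_low v_def)
      qed
      then show "q \<ominus>\<^bsub>A\<^esub> (\<Oplus>\<^bsub>A\<^esub>x\<in>UNIV. v x \<odot>\<^bsub>A\<^esub> elem [fst x] (snd x)) \<in> filt_pred A filt 1"
        unfolding finsum_letters by (simp add: filt_pred_def tensor_skew_filt_iff T.minus_A)
    qed
    show "\<exists>b\<in>sym_skew_part 1. \<forall>x. Poly_Mapping.lookup (b (snd x)) (Poly_Mapping.single (fst x) 1) = w x"
      for w :: "'b \<times> 'g \<Rightarrow> complex"
    proof (intro bexI allI)
      let ?b = "\<lambda>g. \<Sum>c\<in>UNIV. Poly_Mapping.single (Poly_Mapping.single c 1) (w (c, g)) :: 'b symmetric_algebra"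
      show "Poly_Mapping.lookup (?b (snd x)) (Poly_Mapping.single (fst x) 1) = w x" for x
      proof -
        have "Poly_Mapping.single c (1::nat) = Poly_Mapping.single (fst x) 1 \<longleftrightarrow> c = fst x" for c
          by (metis lookup_single_eq lookup_single_not_eq one_neq_zero)
        then have "Poly_Mapping.lookup (?b (snd x)) (Poly_Mapping.single (fst x) 1) =
            (\<Sum>c\<in>UNIV. if c = fst x then w x else 0)"
          unfolding lookup_sum by (intro sum.cong refl) (auto simp: lookup_single when_def)
        then show ?thesis by simp
      qed
      have "Poly_Mapping.keys (?b g) \<subseteq> (\<Union>c. {Poly_Mapping.single c 1})" for g
        by (rule order.trans[OF keys_sum]) auto
      moreover have "(\<Sum>b\<in>UNIV. Poly_Mapping.lookup (Poly_Mapping.single c (1::nat)) b) = 1" for c :: 'b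
        using total_degree_single[of c 1] by (simp add: total_degree_def)
      ultimately show "?b \<in> sym_skew_part 1"
        unfolding sym_skew_part_def by fastforce
    qed
    show "p \<in> filt 1" "p \<in> negligible 1" using assms negligible_I by auto
  qed (simp_all add: S.add_A S.smult_A lookup_add lookup_scale)
  then show ?thesis using I_degree_zero assms(1) by (simp add: filt_pred_def)
qed

lemma low_in_I:
  assumes "low X Y \<in> I"
  shows "X g = 0" "Y g = 0"
proof -
  have zero: "low X Y g = 0"
    using fun_cong[OF I_degree_one[OF assms low_filt], of g] by (simp add: T.zero_A)
  show "X g = 0" using lookup_low(1)[of X Y g] zero by (simp add: vec_eq_iff)
  show "Y g = 0" using lookup_low(2)[of X Y g] zero by simp
qed

lemma tensor_act_vec: "tensor_act rep g (tensor_vec v) = tensor_vec (rep g v)"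
proof (induction v rule: vec_axis_induct)
  case zero
  have "rep g 0 = 0" by (simp add: rep_def vec_eq_iff)
  then show ?case by simp
next
  case (axis z a)
  have "z *s axis a 1 = axis a z" by (simp add: vec_eq_iff axis_def)
  then show ?case by (simp add: tensor_vec_axis rep_axis tensor_act_rep map_word_def)
next
  case (add u v)
  have "rep g (u + v) = rep g u + rep g v" by (simp add: rep_def vec_eq_iff)
  then show ?case using add by (simp add: tensor_vec_add T.act_add)
qed

lemma elem_mult_left: "(elem [] g \<otimes>\<^bsub>A\<^esub> p) k = tensor_act rep g (p (ginv g * k))"
proof -
  have iff: "g * y = k \<longleftrightarrow> y = ginv g * k" for y using ginv by (metis mult.assoc mult_1_left)
  have "(elem [] g \<otimes>\<^bsub>A\<^esub> p) k = (\<Sum>x\<in>UNIV. if x = g then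
      \<Sum>y\<in>UNIV. if y = ginv g * k then tensor_act rep g (p (ginv g * k)) else 0 else 0)"
    unfolding T.mult_A_sum
    by (rule sum.cong[OF refl])
       (auto simp: elem_def iff simp flip: zero_tensor_word_def intro!: sum.cong cong: if_cong)
  then show ?thesis by simp
qed

lemma elem_mult_right: "(p \<otimes>\<^bsub>A\<^esub> elem [] g) k = p (k * ginv g)"
proof -
  have iff: "x * g = k \<longleftrightarrow> x = k * ginv g" for x using ginv by (metis mult.assoc mult_1_right)
  have act: "tensor_act rep x (elem [] g y) = (if y = g then 1 else 0)" for x y
    using T.act_scalar[of x 1] by (simp add: elem_def flip: zero_tensor_word_def)
  have "(p \<otimes>\<^bsub>A\<^esub> elem [] g) k = (\<Sum>x\<in>UNIV. \<Sum>y\<in>UNIV. if y = g then if x = k * ginv g then p (k * ginv g) else 0 else 0)"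
    unfolding T.mult_A_sum
    by (intro sum.cong refl) (auto simp: act iff)
  then show ?thesis by simp
qed

text \<open>
  Conjugating the relator of \<open>u\<close> and \<open>v\<close> by \<open>g\<close> and subtracting the relator of the moved vectors cancels
  the quadratic terms. The rest lies in \<open>I\<close> and has length at most one, so it vanishes.
\<close>

theorem invariance:
  "\<kappa>L 1 (rep g u) (rep g v) = rep g (\<kappa>L 1 u v)"
  "\<kappa>C (g * h * ginv g) (rep g u) (rep g v) = \<kappa>C h u v"
proof -
  let ?X = "\<lambda>k. \<kappa>L k (rep g u) (rep g v) - rep g (\<kappa>L (ginv g * k * g) u v)"
  let ?Y = "\<lambda>k. \<kappa>C k (rep g u) (rep g v) - \<kappa>C (ginv g * k * g) u v"
  have ginv_ginv: "ginv (ginv g) = g" using ginv by (metis mult.assoc mult_1_left mult_1_right)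
  have one: "ginv g * k * g = 1 \<longleftrightarrow> k = 1" for k
    using ginv by (metis mult.assoc mult_1_left mult_1_right)
  have minus: "tensor_act rep g (p - q) = tensor_act rep g p - tensor_act rep g q" for p q
    using T.act_add[of g "p - q" q] by (simp add: algebra_simps)
  have "elem [] g \<otimes>\<^bsub>A\<^esub> relator u v \<otimes>\<^bsub>A\<^esub> elem [] (ginv g) \<ominus>\<^bsub>A\<^esub> relator (rep g u) (rep g v) = low ?X ?Y"
  proof
    fix k
    show "(elem [] g \<otimes>\<^bsub>A\<^esub> relator u v \<otimes>\<^bsub>A\<^esub> elem [] (ginv g) \<ominus>\<^bsub>A\<^esub> relator (rep g u) (rep g v)) k = low ?X ?Y k"
      unfolding T.minus_A elem_mult_right elem_mult_left ginv_ginv relator_eq low_def mult.assoc[symmetric] one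
      by (simp add: minus T.act_mult T.act_scalar tensor_act_vec tensor_vec_uminus tensor_vec_add[of "_" "- _", simplified]
          single_diff)
  qed
  moreover have "elem [] g \<otimes>\<^bsub>A\<^esub> relator u v \<otimes>\<^bsub>A\<^esub> elem [] (ginv g) \<ominus>\<^bsub>A\<^esub> relator (rep g u) (rep g v) \<in> I"
    unfolding a_minus_def using relator_in_I
    by (intro I.a_closed I.a_inv_closed I.I_l_closed I.I_r_closed) auto
  ultimately have *: "low ?X ?Y \<in> I" by simp
  show "\<kappa>L 1 (rep g u) (rep g v) = rep g (\<kappa>L 1 u v)"
    using low_in_I(1)[OF *, of 1] by (simp add: ginv)
  have "ginv g * (g * h * ginv g) * g = h" using ginv by (metis mult.assoc mult_1_left mult_1_right)
  then show "\<kappa>C (g * h * ginv g) (rep g u) (rep g v) = \<kappa>C h u v"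
    using low_in_I(2)[OF *, of "g * h * ginv g"] by simp
qed

text \<open>
  The commutator of a vector with an element of length one that has its linear part at the identity:
  passing a group element \<open>k\<close> replaces \<open>u\<close> by its image under \<open>k\<close>.
\<close>

lemma commutator_low:
  assumes "\<And>k. k \<noteq> 1 \<Longrightarrow> X k = 0"
  shows "skew_vec u \<otimes>\<^bsub>A\<^esub> low X Y \<ominus>\<^bsub>A\<^esub> low X Y \<otimes>\<^bsub>A\<^esub> skew_vec u =
    skew_commutator rep u (X 1) \<oplus>\<^bsub>A\<^esub> low (\<lambda>k. Y k *s (u - rep k u)) (\<lambda>k. 0)"
proof
  fix k
  have "(skew_vec u \<otimes>\<^bsub>A\<^esub> low X Y) k = (\<Sum>x\<in>(UNIV::'g set). \<Sum>y\<in>(UNIV::'g set). if y = k then if x = 1 then tensor_vec u * low X Y k else 0 else 0)"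
    unfolding T.mult_A_sum by (intro sum.cong refl) (auto simp: skew_vec_def T.act_one)
  then have left: "(skew_vec u \<otimes>\<^bsub>A\<^esub> low X Y) k = tensor_vec u * low X Y k" by simp
  have "(low X Y \<otimes>\<^bsub>A\<^esub> skew_vec u) k = (\<Sum>x\<in>(UNIV::'g set). \<Sum>y\<in>(UNIV::'g set). if y = 1 then if x = k then low X Y k * tensor_vec (rep k u) else 0 else 0)"
    unfolding T.mult_A_sum by (intro sum.cong refl) (auto simp: skew_vec_def tensor_act_vec)
  then have right: "(low X Y \<otimes>\<^bsub>A\<^esub> skew_vec u) k = low X Y k * tensor_vec (rep k u)" by simp
  have rep1: "rep 1 u = u" using ginv(2)[of 1] by (simp add: rep_def vec_eq_iff \<pi>_one)
  have diff: "tensor_vec (v - w) = tensor_vec v - tensor_vec w" for v w :: "complex ^ 'b"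
    using tensor_vec_add[of "v - w" w] by simp
  show "(skew_vec u \<otimes>\<^bsub>A\<^esub> low X Y \<ominus>\<^bsub>A\<^esub> low X Y \<otimes>\<^bsub>A\<^esub> skew_vec u) k =
      (skew_commutator rep u (X 1) \<oplus>\<^bsub>A\<^esub> low (\<lambda>k. Y k *s (u - rep k u)) (\<lambda>k. 0)) k"
    unfolding T.minus_A T.add_A left right skew_commutator_eq
    using assms[of k] rep1
    by (auto simp: low_def tensor_vec_scale diff algebra_simps scalar_commute)
qed

text \<open>
  With \<open>r(v, w)\<close> for the relator, the cyclic sum of \<open>[u, r(v, w)] + r(u, \<kappa>\<^sup>L(v, w))\<close> lies in \<open>I\<close>. Its cubic
  terms cancel by the Jacobi identity for commutators, its quadratic terms by the choice of the second
  summand, and the rest, which has length at most one, vanishes. The three claims are its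
  coordinates.
\<close>

theorem jacobi:
  "\<kappa>L 1 u (\<kappa>L 1 v w) + \<kappa>L 1 v (\<kappa>L 1 w u) + \<kappa>L 1 w (\<kappa>L 1 u v) = 0"
  "\<kappa>C h u (\<kappa>L 1 v w) + \<kappa>C h v (\<kappa>L 1 w u) + \<kappa>C h w (\<kappa>L 1 u v) = 0"
  "\<kappa>C h v w *s (u - rep h u) + \<kappa>C h w u *s (v - rep h v) + \<kappa>C h u v *s (w - rep h w) = 0"
proof -
  let ?s = "skew_vec :: complex ^ 'b \<Rightarrow> 'g \<Rightarrow> 'b tensor_algebra"
  let ?X = "\<lambda>u v w k. \<kappa>L k u (\<kappa>L 1 v w) + \<kappa>C k v w *s (u - rep k u)"
  let ?Y = "\<lambda>u v w k. \<kappa>C k u (\<kappa>L 1 v w)"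
  have rel: "relator v w = skew_commutator rep v w \<ominus>\<^bsub>A\<^esub> low (\<lambda>k. \<kappa>L k v w) (\<lambda>k. \<kappa>C k v w)" for v w
    by (auto simp: relator_eq skew_commutator_eq T.minus_A low_def)
  have bracket: "?s u \<otimes>\<^bsub>A\<^esub> relator v w \<ominus>\<^bsub>A\<^esub> relator v w \<otimes>\<^bsub>A\<^esub> ?s u =
      (?s u \<otimes>\<^bsub>A\<^esub> skew_commutator rep v w \<ominus>\<^bsub>A\<^esub> skew_commutator rep v w \<otimes>\<^bsub>A\<^esub> ?s u)
      \<ominus>\<^bsub>A\<^esub> (relator u (\<kappa>L 1 v w) \<oplus>\<^bsub>A\<^esub> low (?X u v w) (?Y u v w))" for u v w
  proof -
    have "?s u \<otimes>\<^bsub>A\<^esub> relator v w \<ominus>\<^bsub>A\<^esub> relator v w \<otimes>\<^bsub>A\<^esub> ?s u =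
      (?s u \<otimes>\<^bsub>A\<^esub> skew_commutator rep v w \<ominus>\<^bsub>A\<^esub> skew_commutator rep v w \<otimes>\<^bsub>A\<^esub> ?s u)
      \<ominus>\<^bsub>A\<^esub> (?s u \<otimes>\<^bsub>A\<^esub> low (\<lambda>k. \<kappa>L k v w) (\<lambda>k. \<kappa>C k v w) \<ominus>\<^bsub>A\<^esub> low (\<lambda>k. \<kappa>L k v w) (\<lambda>k. \<kappa>C k v w) \<otimes>\<^bsub>A\<^esub> ?s u)"
      unfolding rel by (simp add: a_minus_def T.r_distr T.l_distr T.r_minus T.l_minus) (simp add: T.add_A T.uminus_A algebra_simps)
    also have "\<dots> = (?s u \<otimes>\<^bsub>A\<^esub> skew_commutator rep v w \<ominus>\<^bsub>A\<^esub> skew_commutator rep v w \<otimes>\<^bsub>A\<^esub> ?s u)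
      \<ominus>\<^bsub>A\<^esub> (relator u (\<kappa>L 1 v w) \<oplus>\<^bsub>A\<^esub> low (?X u v w) (?Y u v w))"
      by (subst commutator_low) (auto simp: \<kappa>L_off_identity rel T.minus_A T.add_A low_def tensor_vec_add)
    finally show ?thesis .
  qed
  define D where "D u v w = ?s u \<otimes>\<^bsub>A\<^esub> skew_commutator rep v w \<ominus>\<^bsub>A\<^esub> skew_commutator rep v w \<otimes>\<^bsub>A\<^esub> ?s u" for u v w
  define R where "R u v w = (?s u \<otimes>\<^bsub>A\<^esub> relator v w \<ominus>\<^bsub>A\<^esub> relator v w \<otimes>\<^bsub>A\<^esub> ?s u) \<oplus>\<^bsub>A\<^esub> relator u (\<kappa>L 1 v w)" for u v w
  have R: "R u v w \<in> I" for u v w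
    unfolding R_def a_minus_def using relator_in_I
    by (intro I.a_closed I.a_inv_closed I.I_l_closed I.I_r_closed) auto
  have D: "D u v w \<oplus>\<^bsub>A\<^esub> D v w u \<oplus>\<^bsub>A\<^esub> D w u v = \<zero>\<^bsub>A\<^esub>"
    unfolding D_def skew_commutator_def Let_def
    by (simp add: a_minus_def T.r_distr T.l_distr T.r_minus T.l_minus T.m_assoc)
       (simp add: T.add_A T.uminus_A T.zero_A algebra_simps)
  have low_eq: "low (?X u v w) (?Y u v w) = D u v w \<ominus>\<^bsub>A\<^esub> R u v w" for u v w
    unfolding R_def bracket D_def[symmetric] by (simp add: T.add_A T.minus_A algebra_simps)
  have low_add: "low X Y \<oplus>\<^bsub>A\<^esub> low X' Y' = low (\<lambda>k. X k + X' k) (\<lambda>k. Y k + Y' k)" for X X' Y Y'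
    by (simp add: low_def T.add_A tensor_vec_add single_add algebra_simps)
  have "low (\<lambda>k. ?X u v w k + ?X v w u k + ?X w u v k) (\<lambda>k. ?Y u v w k + ?Y v w u k + ?Y w u v k) =
      low (?X u v w) (?Y u v w) \<oplus>\<^bsub>A\<^esub> low (?X v w u) (?Y v w u) \<oplus>\<^bsub>A\<^esub> low (?X w u v) (?Y w u v)"
    by (simp add: low_add)
  also have "\<dots> = (D u v w \<oplus>\<^bsub>A\<^esub> D v w u \<oplus>\<^bsub>A\<^esub> D w u v) \<ominus>\<^bsub>A\<^esub> (R u v w \<oplus>\<^bsub>A\<^esub> R v w u \<oplus>\<^bsub>A\<^esub> R w u v)"
    unfolding low_eq by (simp add: T.add_A T.minus_A algebra_simps)
  also have "\<dots> \<in> I"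
    unfolding D a_minus_def by (intro I.a_closed I.a_inv_closed I.zero_closed R)
  finally have I: "low (\<lambda>k. ?X u v w k + ?X v w u k + ?X w u v k) (\<lambda>k. ?Y u v w k + ?Y v w u k + ?Y w u v k) \<in> I" .
  have rep1: "rep 1 x = x" for x using ginv(2)[of 1] by (simp add: rep_def vec_eq_iff \<pi>_one)
  show "\<kappa>L 1 u (\<kappa>L 1 v w) + \<kappa>L 1 v (\<kappa>L 1 w u) + \<kappa>L 1 w (\<kappa>L 1 u v) = 0"
    using low_in_I(1)[OF I, of 1] by (simp add: rep1)
  show "\<kappa>C h u (\<kappa>L 1 v w) + \<kappa>C h v (\<kappa>L 1 w u) + \<kappa>C h w (\<kappa>L 1 u v) = 0"
    using low_in_I(2)[OF I, of h] by simp
  show "\<kappa>C h v w *s (u - rep h u) + \<kappa>C h w u *s (v - rep h v) + \<kappa>C h u v *s (w - rep h w) = 0"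
    using low_in_I(1)[OF I, of h] by (cases "h = 1") (simp_all add: rep1 \<kappa>L_off_identity)
qed

end

context orbifold_cochains
begin

theorem drinfeld_orbifold_iff:
  "drinfeld_orbifold rep \<kappa>L \<kappa>C \<longleftrightarrow> lie_orbifold_structure \<pi> l C ginv"
proof
  assume "lie_orbifold_structure \<pi> l C ginv"
  then interpret lie_orbifold \<pi> ginv \<kappa>L \<kappa>C
    by (intro lie_orbifold.intro orbifold_cochains_axioms lie_orbifold_axioms.intro)
  show "drinfeld_orbifold rep \<kappa>L \<kappa>C" by (rule drinfeld_orbifold)
next
  assume "drinfeld_orbifold rep \<kappa>L \<kappa>C"
  then interpret drinfeld_orbifold_cochains \<pi> ginv \<kappa>L \<kappa>C
    by (intro drinfeld_orbifold_cochains.intro orbifold_cochains_axioms drinfeld_orbifold_cochains_axioms.intro)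
  show "lie_orbifold_structure \<pi> l C ginv"
    by (rule lie_orbifold_structureI) (rule invariance jacobi)+
qed

end

section \<open>Deformations over the polynomial ring\<close>

text \<open>
  Two quotient maps of one algebra with the same kernel have isomorphic targets.
\<close>

lemma algebra_iso_of_same_kernel:
  fixes P :: "(complex, 'p) module" and X :: "(complex, 'x) module" and Y :: "(complex, 'y) module"
  assumes P: "complex_algebra P"
    and f: "f \<in> ring_hom P X" "f ` carrier P = carrier X" "\<And>z p. p \<in> carrier P \<Longrightarrow> f (z \<odot>\<^bsub>P\<^esub> p) = z \<odot>\<^bsub>X\<^esub> f p"
    and g: "g \<in> ring_hom P Y" "g ` carrier P = carrier Y" "\<And>z p. p \<in> carrier P \<Longrightarrow> g (z \<odot>\<^bsub>P\<^esub> p) = z \<odot>\<^bsub>Y\<^esub> g p"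
    and kernel: "\<And>p q. p \<in> carrier P \<Longrightarrow> q \<in> carrier P \<Longrightarrow> f p = f q \<longleftrightarrow> g p = g q"
  shows "algebra_iso X Y \<noteq> {}"
proof -
  interpret P: complex_algebra P by (rule P)
  define \<Theta> where "\<Theta> x = g (inv_into (carrier P) f x)" for x
  have \<Theta>: "\<Theta> (f p) = g p" if "p \<in> carrier P" for p
  proof -
    have "f (inv_into (carrier P) f (f p)) = f p" "inv_into (carrier P) f (f p) \<in> carrier P"
      using that by (simp_all add: f_inv_into_f inv_into_into)
    then show ?thesis unfolding \<Theta>_def using kernel that by blast
  qed
  have X: "\<exists>p\<in>carrier P. x = f p" if "x \<in> carrier X" for x
    using that f(2) by blast
  have "\<Theta> \<in> ring_hom X Y"
  proof (rule ring_hom_memI)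
    fix x y assume "x \<in> carrier X" "y \<in> carrier X"
    then obtain p q where pq: "p \<in> carrier P" "q \<in> carrier P" "x = f p" "y = f q" using X by metis
    show "\<Theta> x \<in> carrier Y" using pq g(2) by (auto simp: \<Theta>)
    have "\<Theta> (f (p \<otimes>\<^bsub>P\<^esub> q)) = \<Theta> (f p) \<otimes>\<^bsub>Y\<^esub> \<Theta> (f q)" "\<Theta> (f (p \<oplus>\<^bsub>P\<^esub> q)) = \<Theta> (f p) \<oplus>\<^bsub>Y\<^esub> \<Theta> (f q)"
      using pq ring_hom_mult[OF g(1)] ring_hom_add[OF g(1)] by (simp_all add: \<Theta>)
    then show "\<Theta> (x \<otimes>\<^bsub>X\<^esub> y) = \<Theta> x \<otimes>\<^bsub>Y\<^esub> \<Theta> y" "\<Theta> (x \<oplus>\<^bsub>X\<^esub> y) = \<Theta> x \<oplus>\<^bsub>Y\<^esub> \<Theta> y"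
      using pq ring_hom_mult[OF f(1)] ring_hom_add[OF f(1)] by simp_all
  next
    show "\<Theta> \<one>\<^bsub>X\<^esub> = \<one>\<^bsub>Y\<^esub>"
      using \<Theta>[of "\<one>\<^bsub>P\<^esub>"] ring_hom_one[OF f(1)] ring_hom_one[OF g(1)] by simp
  qed
  moreover have "bij_betw \<Theta> (carrier X) (carrier Y)"
  proof (rule bij_betw_imageI)
    show "inj_on \<Theta> (carrier X)"
    proof (rule inj_onI)
      fix x y assume xy: "x \<in> carrier X" "y \<in> carrier X" "\<Theta> x = \<Theta> y"
      then obtain p q where "p \<in> carrier P" "q \<in> carrier P" "x = f p" "y = f q" using X by metis
      with xy show "x = y" using kernel by (simp add: \<Theta>)
    qed
    have "\<Theta> ` f ` carrier P = g ` carrier P"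
      using \<Theta> by (force simp: image_image)
    then show "\<Theta> ` carrier X = carrier Y" by (simp add: f g)
  qed
  moreover have "\<Theta> (z \<odot>\<^bsub>X\<^esub> x) = z \<odot>\<^bsub>Y\<^esub> \<Theta> x" if "x \<in> carrier X" for x z
  proof -
    obtain p where p: "p \<in> carrier P" "x = f p" using X \<open>x \<in> carrier X\<close> by blast
    then have "\<Theta> (z \<odot>\<^bsub>X\<^esub> x) = \<Theta> (f (z \<odot>\<^bsub>P\<^esub> p))" by (simp add: f)
    also have "\<dots> = z \<odot>\<^bsub>Y\<^esub> \<Theta> x" using p \<Theta>[of "z \<odot>\<^bsub>P\<^esub> p"] by (simp add: \<Theta> g)
    finally show ?thesis .
  qed
  ultimately have "\<Theta> \<in> algebra_iso X Y" unfolding algebra_iso_def ring_iso_def by blast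
  then show ?thesis by blast
qed

lemma (in ring_hom_ring) hom_minus:
  "x \<in> carrier R \<Longrightarrow> y \<in> carrier R \<Longrightarrow> h (x \<ominus>\<^bsub>R\<^esub> y) = h x \<ominus>\<^bsub>S\<^esub> h y"
  by (simp add: a_minus_def)

lemma (in ring_hom_ring) ideal_preimage:
  assumes "ideal J S"
  shows "ideal {x \<in> carrier R. h x \<in> J} R"
proof -
  interpret J: ideal J S by (rule assms)
  show ?thesis
  proof (rule idealI)
    show "subgroup {x \<in> carrier R. h x \<in> J} (add_monoid R)"
      by (rule subgroup.intro) (auto simp: J.a_closed J.zero_closed J.a_inv_closed simp flip: a_inv_def)
  qed (auto simp: J.I_l_closed J.I_r_closed R.ring_axioms)
qed

context complex_algebra
begin

abbreviation "P \<equiv> polynomial_algebra A"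

sublocale UP: UP_ring A "UP A"
  by unfold_locales

lemma P_simps [simp]:
  "carrier P = carrier (UP A)" "monoid.mult P = monoid.mult (UP A)" "one P = one (UP A)" "zero P = zero (UP A)" "add P = add (UP A)"
  by (simp_all add: polynomial_algebra_def)

lemma carrier_UP: "p \<in> carrier (UP A) \<longleftrightarrow> (\<forall>n. p n \<in> carrier A) \<and> (\<exists>n. bound \<zero>\<^bsub>A\<^esub> n p)"
  by (auto simp: UP_def up_def)

lemma ring_P: "ring P"
  by (rule ring_cong[OF UP.UP_ring]) simp_all

lemma add_P: "p \<in> carrier (UP A) \<Longrightarrow> q \<in> carrier (UP A) \<Longrightarrow> p \<oplus>\<^bsub>UP A\<^esub> q = (\<lambda>i. p i \<oplus>\<^bsub>A\<^esub> q i)"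
  by (simp add: UP_def)

lemma zero_P: "\<zero>\<^bsub>UP A\<^esub> = (\<lambda>i. \<zero>\<^bsub>A\<^esub>)"
  by (simp add: UP_def)

lemma mult_P: "p \<in> carrier (UP A) \<Longrightarrow> q \<in> carrier (UP A) \<Longrightarrow>
    p \<otimes>\<^bsub>UP A\<^esub> q = (\<lambda>n. \<Oplus>\<^bsub>A\<^esub>i\<in>{..n}. p i \<otimes>\<^bsub>A\<^esub> q (n - i))"
  by (simp add: UP_def)

lemma smult_P: "z \<odot>\<^bsub>P\<^esub> p = (\<lambda>i. z \<odot>\<^bsub>A\<^esub> p i)"
  by (simp add: polynomial_algebra_def)

lemma smult_zero: "z \<odot>\<^bsub>A\<^esub> \<zero>\<^bsub>A\<^esub> = \<zero>\<^bsub>A\<^esub>"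
  using smult_conv_mult[of "\<zero>\<^bsub>A\<^esub>" z] by simp

lemma smult_P_closed: "p \<in> carrier (UP A) \<Longrightarrow> (\<lambda>i. z \<odot>\<^bsub>A\<^esub> p i) \<in> carrier (UP A)"
proof -
  assume p: "p \<in> carrier (UP A)"
  then obtain n where "bound \<zero>\<^bsub>A\<^esub> n p" by (auto simp: carrier_UP)
  then have "bound \<zero>\<^bsub>A\<^esub> n (\<lambda>i. z \<odot>\<^bsub>A\<^esub> p i)" by (auto simp: bound_def smult_zero)
  then show ?thesis using p by (auto simp: carrier_UP)
qed

lemma smult_finsum:
  assumes "finite S" "f \<in> S \<rightarrow> carrier A"
  shows "z \<odot>\<^bsub>A\<^esub> (\<Oplus>\<^bsub>A\<^esub>i\<in>S. f i) = (\<Oplus>\<^bsub>A\<^esub>i\<in>S. z \<odot>\<^bsub>A\<^esub> f i)"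
  using assms by (induction S rule: finite_induct) (auto simp: smult_zero smult_add Pi_def)

lemma complex_algebra_P: "complex_algebra P"
proof (intro complex_algebra.intro complex_algebra_axioms.intro ring_P)
  fix p q z
  assume p: "p \<in> carrier P"
  then show "z \<odot>\<^bsub>P\<^esub> p \<in> carrier P" by (simp add: smult_P smult_P_closed)
  assume q: "q \<in> carrier P"
  have c: "p i \<in> carrier A" "q i \<in> carrier A" for i using p q by (auto simp: carrier_UP)
  show "z \<odot>\<^bsub>P\<^esub> p \<otimes>\<^bsub>P\<^esub> q = z \<odot>\<^bsub>P\<^esub> (p \<otimes>\<^bsub>P\<^esub> q)" "p \<otimes>\<^bsub>P\<^esub> (z \<odot>\<^bsub>P\<^esub> q) = z \<odot>\<^bsub>P\<^esub> (p \<otimes>\<^bsub>P\<^esub> q)"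
    using p q c by (simp_all add: smult_P mult_P smult_P_closed smult_finsum smult_mult_left smult_mult_right)
qed

lemma monom_closed: "a \<in> carrier A \<Longrightarrow> monom (UP A) a n \<in> carrier (UP A)"
  by simp

lemma monom_eq: "a \<in> carrier A \<Longrightarrow> monom (UP A) a n = (\<lambda>i. if i = n then a else \<zero>\<^bsub>A\<^esub>)"
  by (simp add: UP_def)

lemma uminus_P:
  assumes p: "p \<in> carrier (UP A)"
  shows "\<ominus>\<^bsub>P\<^esub> p = (\<lambda>i. \<ominus>\<^bsub>A\<^esub> p i)"
proof -
  interpret P: ring P by (rule ring_P)
  have c: "(\<lambda>i. \<ominus>\<^bsub>A\<^esub> p i) \<in> carrier (UP A)"
    using up_a_inv_closed[of p] p by (simp add: UP_def)
  have "p i \<in> carrier A" for i using p by (simp add: carrier_UP)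
  then have "(\<lambda>i. \<ominus>\<^bsub>A\<^esub> p i) \<oplus>\<^bsub>P\<^esub> p = \<zero>\<^bsub>P\<^esub>"
    using p c by (simp add: add_P zero_P l_neg)
  then show ?thesis by (rule P.minus_equality) (use p c in simp_all)
qed

lemma minus_P:
  assumes p: "p \<in> carrier (UP A)" and q: "q \<in> carrier (UP A)"
  shows "p \<ominus>\<^bsub>P\<^esub> q = (\<lambda>i. p i \<ominus>\<^bsub>A\<^esub> q i)"
proof -
  have "(\<lambda>i. \<ominus>\<^bsub>A\<^esub> q i) \<in> carrier (UP A)"
    using up_a_inv_closed[of q] q by (simp add: UP_def)
  then show ?thesis by (simp add: a_minus_def uminus_P q add_P p)
qed

lemma minus_P_closed [simp]:
  "p \<in> carrier (UP A) \<Longrightarrow> q \<in> carrier (UP A) \<Longrightarrow> p \<ominus>\<^bsub>P\<^esub> q \<in> carrier (UP A)"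
proof -
  interpret P: ring P by (rule ring_P)
  show "p \<in> carrier (UP A) \<Longrightarrow> q \<in> carrier (UP A) \<Longrightarrow> ?thesis"
    using P.minus_closed[of p q] by simp
qed

lemma uminus_P_closed [simp]: "p \<in> carrier (UP A) \<Longrightarrow> \<ominus>\<^bsub>P\<^esub> p \<in> carrier (UP A)"
proof -
  interpret P: ring P by (rule ring_P)
  show "p \<in> carrier (UP A) \<Longrightarrow> ?thesis"
    using P.a_inv_closed[of p] by simp
qed

lemma minus_zero_iff: "a \<in> carrier A \<Longrightarrow> b \<in> carrier A \<Longrightarrow> a \<ominus>\<^bsub>A\<^esub> b = \<zero>\<^bsub>A\<^esub> \<longleftrightarrow> a = b"
proof
  assume c: "a \<in> carrier A" "b \<in> carrier A" and "a \<ominus>\<^bsub>A\<^esub> b = \<zero>\<^bsub>A\<^esub>"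
  then have "\<ominus>\<^bsub>A\<^esub> (\<ominus>\<^bsub>A\<^esub> b) = a" by (intro minus_equality) (simp_all add: a_minus_def)
  then show "a = b" using c by simp
qed (simp add: a_minus_def r_neg)

subsection \<open>Evaluation at one\<close>

text \<open>
  The sum of all coefficients of a polynomial, which is its value at \<open>t = 1\<close>. The degree bound makes the
  sum finite; any other bound gives the same sum.
\<close>

definition coeff_sum :: "(nat \<Rightarrow> 'a) \<Rightarrow> 'a" where
  "coeff_sum p = (\<Oplus>\<^bsub>A\<^esub>i\<in>{..LEAST n. bound \<zero>\<^bsub>A\<^esub> n p}. p i)"

lemma coeff_sum:
  assumes p: "p \<in> carrier (UP A)" and n: "bound \<zero>\<^bsub>A\<^esub> n p"
  shows "coeff_sum p = (\<Oplus>\<^bsub>A\<^esub>i\<in>{..n}. p i)"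
proof -
  define m where "m = (LEAST n. bound \<zero>\<^bsub>A\<^esub> n p)"
  have m: "bound \<zero>\<^bsub>A\<^esub> m p" "m \<le> n"
    unfolding m_def using n by (rule LeastI, rule Least_le)
  have c: "p i \<in> carrier A" for i using p by (simp add: carrier_UP)
  have "(\<Oplus>\<^bsub>A\<^esub>i\<in>{..m}. p i) = (\<Oplus>\<^bsub>A\<^esub>i\<in>{..n}. p i)"
  proof (rule add.finprod_mono_neutral_cong_left)
    show "p i = \<zero>\<^bsub>A\<^esub>" if "i \<in> {..n} - {..m}" for i
      using that m(1) by (auto simp: bound_def)
  qed (use m(2) c in auto)
  then show ?thesis by (simp add: coeff_sum_def m_def)
qed

lemma coeff_sum_closed [simp]: "p \<in> carrier (UP A) \<Longrightarrow> coeff_sum p \<in> carrier A"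
  unfolding coeff_sum_def by (rule finsum_closed) (auto simp: carrier_UP)

lemma coeff_sum_add:
  assumes "p \<in> carrier (UP A)" "q \<in> carrier (UP A)"
  shows "coeff_sum (p \<oplus>\<^bsub>UP A\<^esub> q) = coeff_sum p \<oplus>\<^bsub>A\<^esub> coeff_sum q"
proof -
  obtain n m where nm: "bound \<zero>\<^bsub>A\<^esub> n p" "bound \<zero>\<^bsub>A\<^esub> m q" using assms by (auto simp: carrier_UP)
  have b: "bound \<zero>\<^bsub>A\<^esub> (n + m) p" "bound \<zero>\<^bsub>A\<^esub> (n + m) q" "bound \<zero>\<^bsub>A\<^esub> (n + m) (p \<oplus>\<^bsub>UP A\<^esub> q)"
    using nm assms by (auto simp: bound_def add_P)
  have "p i \<in> carrier A" "q i \<in> carrier A" for i using assms by (auto simp: carrier_UP)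
  moreover have "p \<oplus>\<^bsub>UP A\<^esub> q \<in> carrier (UP A)" using assms by simp
  ultimately show ?thesis
    using assms coeff_sum[OF _ b(1)] coeff_sum[OF _ b(2)] coeff_sum[OF _ b(3)]
    by (simp add: add_P finsum_addf Pi_def)
qed

lemma coeff_sum_mult:
  assumes "p \<in> carrier (UP A)" "q \<in> carrier (UP A)"
  shows "coeff_sum (p \<otimes>\<^bsub>UP A\<^esub> q) = coeff_sum p \<otimes>\<^bsub>A\<^esub> coeff_sum q"
proof -
  obtain n m where nm: "bound \<zero>\<^bsub>A\<^esub> n p" "bound \<zero>\<^bsub>A\<^esub> m q" using assms by (auto simp: carrier_UP)
  have c: "p i \<in> carrier A" "q i \<in> carrier A" for i using assms by (auto simp: carrier_UP)
  have bound: "bound \<zero>\<^bsub>A\<^esub> (n + m) (p \<otimes>\<^bsub>UP A\<^esub> q)"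
  proof
    fix k assume k: "n + m < k"
    have "p i \<otimes>\<^bsub>A\<^esub> q (k - i) = \<zero>\<^bsub>A\<^esub>" for i
    proof (cases "n < i")
      case True
      then show ?thesis using nm c by (simp add: bound_def)
    next
      case False
      then have "m < k - i" using k by simp
      then show ?thesis using nm c by (simp add: bound_def)
    qed
    then show "(p \<otimes>\<^bsub>UP A\<^esub> q) k = \<zero>\<^bsub>A\<^esub>" using assms by (simp add: mult_P)
  qed
  have "p \<otimes>\<^bsub>UP A\<^esub> q \<in> carrier (UP A)" using assms by simp
  from coeff_sum[OF this bound] show ?thesis
    using assms coeff_sum[OF _ nm(1)] coeff_sum[OF _ nm(2)] cauchy_product[OF nm] c by (simp add: mult_P Pi_def)
qed

lemma coeff_sum_monom: "a \<in> carrier A \<Longrightarrow> coeff_sum (monom (UP A) a n) = a"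
proof -
  assume a: "a \<in> carrier A"
  have "bound \<zero>\<^bsub>A\<^esub> n (monom (UP A) a n)" using a by (auto simp: monom_eq)
  from coeff_sum[OF monom_closed[OF a] this]
  have "coeff_sum (monom (UP A) a n) = (\<Oplus>\<^bsub>A\<^esub>i\<in>{..n}. if n = i then a else \<zero>\<^bsub>A\<^esub>)"
    using a by (simp add: monom_eq eq_commute cong: if_cong)
  also have "\<dots> = a" using a by (subst add.finprod_singleton) auto
  finally show ?thesis .
qed

lemma coeff_sum_smult:
  assumes "p \<in> carrier (UP A)"
  shows "coeff_sum (z \<odot>\<^bsub>P\<^esub> p) = z \<odot>\<^bsub>A\<^esub> coeff_sum p"
proof -
  obtain n where n: "bound \<zero>\<^bsub>A\<^esub> n p" using assms by (auto simp: carrier_UP)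
  then have "bound \<zero>\<^bsub>A\<^esub> n (\<lambda>i. z \<odot>\<^bsub>A\<^esub> p i)" by (auto simp: bound_def smult_zero)
  from coeff_sum[OF smult_P_closed[OF assms] this] show ?thesis
    using assms coeff_sum[OF _ n] by (simp add: smult_P smult_finsum carrier_UP Pi_def)
qed

lemma coeff_sum_hom: "coeff_sum \<in> ring_hom P A"
proof (rule ring_hom_memI)
  have "\<one>\<^bsub>UP A\<^esub> = monom (UP A) \<one>\<^bsub>A\<^esub> 0" by simp
  then show "coeff_sum \<one>\<^bsub>P\<^esub> = \<one>\<^bsub>A\<^esub>" using coeff_sum_monom[of "\<one>\<^bsub>A\<^esub>" 0] by simp
qed (simp_all add: coeff_sum_add coeff_sum_mult)

end

context orbifold_cochains
begin

abbreviation "P \<equiv> polynomial_algebra A"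

abbreviation mon :: "('g \<Rightarrow> 'b tensor_algebra) \<Rightarrow> nat \<Rightarrow> nat \<Rightarrow> 'g \<Rightarrow> 'b tensor_algebra" where
  "mon a n \<equiv> monom (UP A) a n"

definition relator_t :: "complex ^ 'b \<Rightarrow> complex ^ 'b \<Rightarrow> nat \<Rightarrow> 'g \<Rightarrow> 'b tensor_algebra" where
  "relator_t v w = mon (skew_commutator rep v w) 0 \<ominus>\<^bsub>P\<^esub> mon (linear_value \<kappa>L v w) 1
     \<ominus>\<^bsub>P\<^esub> mon (constant_value \<kappa>C v w) 2"

abbreviation "I_t B \<equiv> orbifold_ideal_t rep B \<kappa>L \<kappa>C"

lemma I_t_def: "I_t B = Idl\<^bsub>P\<^esub> {relator_t v w | v w. v \<in> B \<and> w \<in> B}"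
  by (simp add: orbifold_ideal_t_def relator_t_def Let_def)

interpretation P: complex_algebra P
  by (rule T.complex_algebra_P)

lemma mon_closed [simp]: "mon a n \<in> carrier (UP A)"
  by (rule T.monom_closed) simp

lemma relator_t_closed [simp]: "relator_t v w \<in> carrier (UP A)"
  unfolding relator_t_def by simp

lemma relator_t_eq: "relator_t v w = (\<lambda>i k.
    if i = 0 then if k = 1 then tensor_vec v * tensor_vec w - tensor_vec w * tensor_vec v else 0
    else if i = 1 then - tensor_vec (\<kappa>L k v w)
    else if i = 2 then - Poly_Mapping.single 0 (\<kappa>C k v w) else 0)"
  unfolding relator_t_def
  by (subst T.minus_P, simp, simp, subst T.minus_P, simp, simp)
     (auto simp: T.monom_eq T.minus_A T.zero_A skew_commutator_eq linear_value_def constant_value_def fun_eq_iff)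

lemma relator_t_add: "relator_t v (w + w') = relator_t v w \<oplus>\<^bsub>P\<^esub> relator_t v w'"
  by (simp add: T.add_P T.add_A)
     (auto simp: relator_t_eq tensor_vec_add \<kappa>L_simps \<kappa>C_simps single_add algebra_simps fun_eq_iff)

lemma relator_t_scale: "relator_t v (z *s w) = z \<odot>\<^bsub>P\<^esub> relator_t v w"
proof -
  have "p * (Poly_Mapping.single 0 z * q) = Poly_Mapping.single 0 z * (p * q)" for p q :: "'b tensor_algebra"
    by (metis mult.assoc scalar_commute)
  then show ?thesis
    by (auto simp: relator_t_eq T.smult_P T.smult_A tensor_vec_scale \<kappa>L_simps \<kappa>C_simps right_diff_distrib mult_single
        mult.assoc fun_eq_iff)
qed

lemma relator_t_zero: "relator_t v 0 = \<zero>\<^bsub>P\<^esub>"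
  by (auto simp: relator_t_eq T.zero_P T.zero_A \<kappa>L_simps \<kappa>C_simps fun_eq_iff)

lemma relator_t_skew: "relator_t w v = \<ominus>\<^bsub>P\<^esub> relator_t v w"
  unfolding T.uminus_P[OF relator_t_closed] T.uminus_A
  unfolding relator_t_eq \<kappa>L_skew[of _ w v] \<kappa>C_skew[of _ w v] tensor_vec_uminus
  by (auto simp: single_uminus fun_eq_iff)

lemma ideal_I_t: "ideal (I_t B) P"
  unfolding I_t_def by (rule P.genideal_ideal) auto

lemma relator_t_in_I_t:
  assumes "range (\<lambda>a. axis a 1) \<subseteq> B"
  shows "relator_t v w \<in> I_t B"
proof -
  interpret It: algebra_ideal P "I_t B" by (intro algebra_ideal.intro ideal_I_t P.complex_algebra_axioms)
  show ?thesis
  proof (rule skew_bilinear_mem[where r = relator_t])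
    show "relator_t (axis a 1) (axis b 1) \<in> I_t B" for a b
    proof -
      have "axis a 1 \<in> B" "axis b 1 \<in> B" using assms by blast+
      then show ?thesis unfolding I_t_def by (intro subsetD[OF P.genideal_self]) auto
    qed
    show "relator_t v w \<in> I_t B \<Longrightarrow> relator_t w v \<in> I_t B" for v w
      by (simp add: relator_t_skew[of w v] It.a_inv_closed)
    show "relator_t v 0 \<in> I_t B" for v
      using It.zero_closed by (simp add: relator_t_zero)
    show "relator_t v (w + w') \<in> I_t B" if "relator_t v w \<in> I_t B" "relator_t v w' \<in> I_t B" for v w w'
      using It.a_closed[OF that] by (simp add: relator_t_add)
    show "relator_t v (z *s w) \<in> I_t B" if "relator_t v w \<in> I_t B" for v w z
      unfolding relator_t_scale by (rule It.smult_ideal[OF that])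
  qed
qed

lemma I_t_basis:
  assumes "range (\<lambda>a. axis a 1) \<subseteq> B"
  shows "I_t B = I_t UNIV"
proof
  show "I_t B \<subseteq> I_t UNIV"
    unfolding I_t_def[of B] by (rule P.genideal_minimal[OF ideal_I_t]) (auto intro: relator_t_in_I_t)
  show "I_t UNIV \<subseteq> I_t B"
    unfolding I_t_def[of UNIV] by (rule P.genideal_minimal[OF ideal_I_t]) (auto intro: relator_t_in_I_t[OF assms])
qed

theorem orbifold_algebra_t_basis:
  "range (\<lambda>a. axis a 1) \<subseteq> B \<Longrightarrow> orbifold_algebra_t rep B \<kappa>L \<kappa>C = orbifold_algebra_t rep UNIV \<kappa>L \<kappa>C"
  by (simp only: orbifold_algebra_t_def I_t_basis[of B])

text \<open>
  Both algebras are quotients of \<open>T(V)#G[t]\<close>: by the relations over \<open>\<complex>[t]\<close> together with \<open>t - 1\<close>, and by the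
  kernel of evaluation at \<open>t = 1\<close> followed by the relations. Evaluation at \<open>1\<close> takes \<open>t - 1\<close> to
  zero and turns the relators over \<open>\<complex>[t]\<close> into relators; conversely, modulo \<open>t - 1\<close> a polynomial is
  congruent to the sum of its coefficients. So the kernels agree.
\<close>

theorem specialization_iso:
  assumes B: "range (\<lambda>a. axis a 1) \<subseteq> B"
  shows "algebra_iso (specialization rep B \<kappa>L \<kappa>C) (orbifold_algebra rep \<kappa>L \<kappa>C) \<noteq> {}"
proof -
  interpret It: algebra_ideal P "I_t B" by (intro algebra_ideal.intro ideal_I_t P.complex_algebra_axioms)
  define Ht where "Ht = orbifold_algebra_t rep B \<kappa>L \<kappa>C"
  have Ht: "Ht = quotient_algebra P (I_t B)" by (simp add: Ht_def orbifold_algebra_t_def)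
  interpret Ht: complex_algebra Ht unfolding Ht by (rule It.complex_algebra_Q)
  define \<tau> where "\<tau> = I_t B +>\<^bsub>P\<^esub> (mon \<one>\<^bsub>A\<^esub> 1 \<ominus>\<^bsub>P\<^esub> \<one>\<^bsub>P\<^esub>)"
  define J where "J = Idl\<^bsub>Ht\<^esub> {\<tau>}"
  have \<tau>: "\<tau> \<in> carrier Ht" unfolding Ht \<tau>_def by (rule It.coset_closed) simp
  have J: "ideal J Ht" unfolding J_def by (rule Ht.genideal_ideal) (use \<tau> in simp)
  interpret J: algebra_ideal Ht J by (intro algebra_ideal.intro J Ht.complex_algebra_axioms)
  define Sp where "Sp = quotient_algebra Ht J"
  have Sp: "specialization rep B \<kappa>L \<kappa>C = Sp"
    by (simp add: specialization_def Let_def Sp_def J_def Ht_def \<tau>_def)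
  interpret Sp: complex_algebra Sp unfolding Sp_def by (rule J.complex_algebra_Q)
  interpret K: complex_algebra "quotient_algebra A I" by (rule I.complex_algebra_Q)
  define f where "f p = J +>\<^bsub>Ht\<^esub> (I_t B +>\<^bsub>P\<^esub> p)" for p
  define g where "g p = I +>\<^bsub>A\<^esub> T.coeff_sum p" for p
  have Ht_ops: "I_t B +>\<^bsub>P\<^esub> p \<in> carrier Ht"
    "(I_t B +>\<^bsub>P\<^esub> p) \<oplus>\<^bsub>Ht\<^esub> (I_t B +>\<^bsub>P\<^esub> q) = I_t B +>\<^bsub>P\<^esub> (p \<oplus>\<^bsub>P\<^esub> q)"
    "(I_t B +>\<^bsub>P\<^esub> p) \<otimes>\<^bsub>Ht\<^esub> (I_t B +>\<^bsub>P\<^esub> q) = I_t B +>\<^bsub>P\<^esub> (p \<otimes>\<^bsub>P\<^esub> q)"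
    "z \<odot>\<^bsub>Ht\<^esub> (I_t B +>\<^bsub>P\<^esub> p) = I_t B +>\<^bsub>P\<^esub> (z \<odot>\<^bsub>P\<^esub> p)"
    if "p \<in> carrier P" "q \<in> carrier P" for p q z
    unfolding Ht
    by (rule It.coset_closed[OF that(1)], rule It.add_Q[OF that], rule It.mult_Q[OF that], rule It.smult_Q[OF that(1)])
  have f_hom: "f \<in> ring_hom P Sp"
  proof (rule ring_hom_memI)
    show "f \<one>\<^bsub>P\<^esub> = \<one>\<^bsub>Sp\<^esub>"
      unfolding f_def Sp_def J.one_Q by (simp add: Ht It.one_Q)
    fix p q assume pq: "p \<in> carrier P" "q \<in> carrier P"
    show "f p \<in> carrier Sp" "f (p \<oplus>\<^bsub>P\<^esub> q) = f p \<oplus>\<^bsub>Sp\<^esub> f q" "f (p \<otimes>\<^bsub>P\<^esub> q) = f p \<otimes>\<^bsub>Sp\<^esub> f q"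
      unfolding f_def Sp_def using Ht_ops[OF pq] Ht_ops(1)[OF pq(2) pq(1)] by (simp_all add: J.add_Q J.mult_Q)
  qed
  have f_smult: "f (z \<odot>\<^bsub>P\<^esub> p) = z \<odot>\<^bsub>Sp\<^esub> f p" if "p \<in> carrier P" for z p
    unfolding f_def Sp_def using Ht_ops[OF that that] by (simp add: J.smult_Q)
  have f_surj: "f ` carrier P = carrier Sp"
  proof -
    have "carrier Ht = (\<lambda>p. I_t B +>\<^bsub>P\<^esub> p) ` carrier P" unfolding Ht by (rule It.carrier_Q)
    then show ?thesis unfolding f_def Sp_def J.carrier_Q by (simp only: image_image)
  qed
  have g_hom: "g \<in> ring_hom P (quotient_algebra A I)"
  proof (rule ring_hom_memI)
    show "g \<one>\<^bsub>P\<^esub> = \<one>\<^bsub>quotient_algebra A I\<^esub>"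
      unfolding g_def I.one_Q using ring_hom_one[OF T.coeff_sum_hom] by simp
  qed (simp_all add: g_def I.add_Q I.mult_Q T.coeff_sum_add T.coeff_sum_mult)
  have g_smult: "g (z \<odot>\<^bsub>P\<^esub> p) = z \<odot>\<^bsub>quotient_algebra A I\<^esub> g p" if "p \<in> carrier P" for z p
    using that by (simp add: g_def T.coeff_sum_smult I.smult_Q)
  have g_surj: "g ` carrier P = carrier (quotient_algebra A I)"
  proof -
    have "I +>\<^bsub>A\<^esub> a \<in> g ` carrier P" for a
      by (rule image_eqI[of _ _ "mon a 0"]) (simp_all add: g_def T.coeff_sum_monom)
    then show ?thesis by (auto simp: g_def I.carrier_Q)
  qed
  interpret f: ring_hom_ring P Sp f
    by (intro ring_hom_ring.intro ring_hom_ring_axioms.intro f_hom P.ring_axioms Sp.ring_axioms)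
  interpret g: ring_hom_ring P "quotient_algebra A I" g
    by (intro ring_hom_ring.intro ring_hom_ring_axioms.intro g_hom P.ring_axioms K.ring_axioms)
  have g_zero_iff: "g p = \<zero>\<^bsub>quotient_algebra A I\<^esub> \<longleftrightarrow> T.coeff_sum p \<in> I" for p
    by (simp add: g_def I.zero_Q I.coset_zero)
  have f_zero_iff: "f p = \<zero>\<^bsub>Sp\<^esub> \<longleftrightarrow> I_t B +>\<^bsub>P\<^esub> p \<in> J" if "p \<in> carrier P" for p
    using J.coset_zero[OF Ht_ops(1)[OF that that]] by (simp add: f_def Sp_def J.zero_Q)
  have coeff_sum_minus: "T.coeff_sum (p \<ominus>\<^bsub>P\<^esub> q) = T.coeff_sum p \<ominus>\<^bsub>A\<^esub> T.coeff_sum q"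
    if "p \<in> carrier P" "q \<in> carrier P" for p q
  proof -
    interpret e: ring_hom_ring P A T.coeff_sum
      by (intro ring_hom_ring.intro ring_hom_ring_axioms.intro T.coeff_sum_hom P.ring_axioms T.ring_axioms)
    show ?thesis by (rule e.hom_minus[OF that])
  qed
  \<comment> \<open>relators of the deformation evaluate to relators\<close>
  have coeff_sum_relator: "T.coeff_sum (relator_t v w) = relator v w" for v w
    unfolding relator_t_def relator_def by (simp add: coeff_sum_minus T.coeff_sum_monom P.minus_closed[simplified])
  have "I_t B \<subseteq> {p \<in> carrier P. T.coeff_sum p \<in> I}"
  proof (subst I_t_def, rule P.genideal_minimal)
    interpret e: ring_hom_ring P A T.coeff_sum
      by (intro ring_hom_ring.intro ring_hom_ring_axioms.intro T.coeff_sum_hom P.ring_axioms T.ring_axioms)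
    show "ideal {p \<in> carrier P. T.coeff_sum p \<in> I} P" by (rule e.ideal_preimage[OF ideal_I])
  qed (auto simp: coeff_sum_relator relator_in_I)
  then have It_sum: "T.coeff_sum p \<in> I" if "p \<in> I_t B" for p using that by blast
  have J_sum: "T.coeff_sum p \<in> I" if p: "p \<in> carrier P" "I_t B +>\<^bsub>P\<^esub> p \<in> J" for p
  proof -
    define N where "N = {X \<in> carrier Ht. \<exists>q\<in>carrier P. X = I_t B +>\<^bsub>P\<^esub> q \<and> T.coeff_sum q \<in> I}"
    have N: "I_t B +>\<^bsub>P\<^esub> q \<in> N" if "q \<in> carrier P" "T.coeff_sum q \<in> I" for q
      unfolding N_def using Ht_ops(1)[OF that(1) that(1)] that by blast
    have "ideal N Ht"
    proof (rule idealI)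
      show "subgroup N (add_monoid Ht)"
      proof (rule subgroup.intro)
        show "N \<subseteq> carrier (add_monoid Ht)" by (auto simp: N_def)
        show "X \<otimes>\<^bsub>add_monoid Ht\<^esub> Y \<in> N" if "X \<in> N" "Y \<in> N" for X Y
        proof -
          obtain q r where q: "q \<in> carrier P" "X = I_t B +>\<^bsub>P\<^esub> q" "T.coeff_sum q \<in> I"
            and r: "r \<in> carrier P" "Y = I_t B +>\<^bsub>P\<^esub> r" "T.coeff_sum r \<in> I"
            using \<open>X \<in> N\<close> \<open>Y \<in> N\<close> unfolding N_def by blast
          have "X \<oplus>\<^bsub>Ht\<^esub> Y = I_t B +>\<^bsub>P\<^esub> (q \<oplus>\<^bsub>P\<^esub> r)" using q r Ht_ops by simp
          moreover have "T.coeff_sum (q \<oplus>\<^bsub>P\<^esub> r) \<in> I" using q r by (simp add: T.coeff_sum_add I.a_closed)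
          ultimately show ?thesis using N[OF P.a_closed[OF q(1) r(1)]] by simp
        qed
        have "T.coeff_sum \<zero>\<^bsub>P\<^esub> \<in> I"
          using T.coeff_sum_monom[of "\<zero>\<^bsub>A\<^esub>" 0] I.zero_closed by simp
        moreover have "\<zero>\<^bsub>Ht\<^esub> = I_t B +>\<^bsub>P\<^esub> \<zero>\<^bsub>P\<^esub>"
          unfolding Ht It.zero_Q using It.coset_zero[of "\<zero>\<^bsub>P\<^esub>"] It.zero_closed P.zero_closed by metis
        ultimately show "\<one>\<^bsub>add_monoid Ht\<^esub> \<in> N"
          using N[OF P.zero_closed] by simp
        show "inv\<^bsub>add_monoid Ht\<^esub> X \<in> N" if "X \<in> N" for X
        proof -
          obtain q where q: "q \<in> carrier P" "X = I_t B +>\<^bsub>P\<^esub> q" "T.coeff_sum q \<in> I"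
            using \<open>X \<in> N\<close> unfolding N_def by blast
          interpret e: ring_hom_ring P A T.coeff_sum
            by (intro ring_hom_ring.intro ring_hom_ring_axioms.intro T.coeff_sum_hom P.ring_axioms T.ring_axioms)
          have "\<ominus>\<^bsub>Ht\<^esub> X = I_t B +>\<^bsub>P\<^esub> (\<ominus>\<^bsub>P\<^esub> q)" unfolding Ht q(2) by (rule It.uminus_Q[OF q(1)])
          moreover have "T.coeff_sum (\<ominus>\<^bsub>P\<^esub> q) \<in> I" using e.hom_a_inv[OF q(1)] q(3) by (simp add: I.a_inv_closed)
          ultimately show ?thesis unfolding a_inv_def[symmetric] using N[OF P.a_inv_closed[OF q(1)]] by simp
        qed
      qed
      fix X Y assume X: "X \<in> N" and Y: "Y \<in> carrier Ht"
      obtain q where q: "q \<in> carrier P" "X = I_t B +>\<^bsub>P\<^esub> q" "T.coeff_sum q \<in> I"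
        using X unfolding N_def by blast
      obtain r where r: "r \<in> carrier P" "Y = I_t B +>\<^bsub>P\<^esub> r"
        using Y unfolding Ht It.carrier_Q by blast
      have "Y \<otimes>\<^bsub>Ht\<^esub> X = I_t B +>\<^bsub>P\<^esub> (r \<otimes>\<^bsub>P\<^esub> q)" "X \<otimes>\<^bsub>Ht\<^esub> Y = I_t B +>\<^bsub>P\<^esub> (q \<otimes>\<^bsub>P\<^esub> r)"
        using q r Ht_ops by simp_all
      moreover have "T.coeff_sum (r \<otimes>\<^bsub>P\<^esub> q) \<in> I" "T.coeff_sum (q \<otimes>\<^bsub>P\<^esub> r) \<in> I"
        using q r by (simp_all add: T.coeff_sum_mult I.I_l_closed I.I_r_closed)
      ultimately show "Y \<otimes>\<^bsub>Ht\<^esub> X \<in> N" "X \<otimes>\<^bsub>Ht\<^esub> Y \<in> N"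
        using N[OF P.m_closed[OF q(1) r(1)]] N[OF P.m_closed[OF r(1) q(1)]] by simp_all
    qed (rule Ht.ring_axioms)
    moreover have "\<tau> \<in> N"
    proof -
      have "T.coeff_sum (mon \<one>\<^bsub>A\<^esub> 1 \<ominus>\<^bsub>P\<^esub> \<one>\<^bsub>P\<^esub>) = \<zero>\<^bsub>A\<^esub>"
        using ring_hom_one[OF T.coeff_sum_hom] by (simp add: coeff_sum_minus T.coeff_sum_monom T.minus_A T.zero_A)
      then show ?thesis unfolding \<tau>_def by (intro N) (simp_all add: I.zero_closed)
    qed
    ultimately have "J \<subseteq> N" unfolding J_def by (intro Ht.genideal_minimal) auto
    then obtain q where q: "q \<in> carrier P" "I_t B +>\<^bsub>P\<^esub> p = I_t B +>\<^bsub>P\<^esub> q" "T.coeff_sum q \<in> I"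
      using p(2) unfolding N_def by blast
    then have "T.coeff_sum (p \<ominus>\<^bsub>P\<^esub> q) \<in> I" using It.coset_eq_iff[OF p(1) q(1)] It_sum by blast
    then have "T.coeff_sum p \<ominus>\<^bsub>A\<^esub> T.coeff_sum q \<in> I" using coeff_sum_minus p q by simp
    then have "(T.coeff_sum p \<ominus>\<^bsub>A\<^esub> T.coeff_sum q) \<oplus>\<^bsub>A\<^esub> T.coeff_sum q \<in> I" using q(3) by (rule I.a_closed)
    then show ?thesis by (simp add: T.minus_A T.add_A)
  qed
  have f_t: "f (mon \<one>\<^bsub>A\<^esub> 1) = \<one>\<^bsub>Sp\<^esub>"
  proof -
    have "\<tau> \<in> J" unfolding J_def by (rule subsetD[OF Ht.genideal_self]) (use \<tau> in auto)
    then have "f (mon \<one>\<^bsub>A\<^esub> 1 \<ominus>\<^bsub>P\<^esub> \<one>\<^bsub>P\<^esub>) = \<zero>\<^bsub>Sp\<^esub>" by (subst f_zero_iff) (simp_all add: \<tau>_def)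
    moreover have "mon \<one>\<^bsub>A\<^esub> 1 = (mon \<one>\<^bsub>A\<^esub> 1 \<ominus>\<^bsub>P\<^esub> \<one>\<^bsub>P\<^esub>) \<oplus>\<^bsub>P\<^esub> \<one>\<^bsub>P\<^esub>"
      by (subst P.minus_eq, subst P.a_assoc) (simp_all add: P.l_neg[simplified])
    ultimately show ?thesis
      using f.hom_add[of "mon \<one>\<^bsub>A\<^esub> 1 \<ominus>\<^bsub>P\<^esub> \<one>\<^bsub>P\<^esub>" "\<one>\<^bsub>P\<^esub>"] f.hom_one by simp
  qed
  have f_mon: "f (mon a n) = f (mon a 0)" for a n
  proof (induction n)
    case (Suc n)
    have "mon a (Suc n) = mon a n \<otimes>\<^bsub>P\<^esub> mon \<one>\<^bsub>A\<^esub> 1"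
      using T.UP.monom_mult[of a "\<one>\<^bsub>A\<^esub>" n 1] by simp
    then have "f (mon a (Suc n)) = f (mon a n) \<otimes>\<^bsub>Sp\<^esub> f (mon \<one>\<^bsub>A\<^esub> 1)"
      using f.hom_mult[of "mon a n" "mon \<one>\<^bsub>A\<^esub> 1"] by simp
    then show ?case using Suc f_t f.hom_closed[of "mon a n"] by simp
  qed simp
  have f_sum: "f p = f (mon (T.coeff_sum p) 0)" if "p \<in> carrier (UP A)" for p
  proof -
    have mon_add: "mon (a \<oplus>\<^bsub>A\<^esub> b) 0 = mon a 0 \<oplus>\<^bsub>P\<^esub> mon b 0" for a b
      by simp
    have "f p = f (mon (T.coeff_sum p) 0)" if "bound \<zero>\<^bsub>A\<^esub> n p" "p \<in> carrier (UP A)" for n p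
      using that
    proof (induction n arbitrary: p)
      case 0
      then have "p = mon (p 0) 0" by (auto simp: T.monom_eq bound_def)
      then show ?case using T.coeff_sum_monom[of "p 0" 0] by simp
    next
      case (Suc n)
      define q where "q = (\<lambda>i. if i \<le> n then p i else \<zero>\<^bsub>A\<^esub>)"
      have q: "bound \<zero>\<^bsub>A\<^esub> n q" by (auto simp: q_def)
      then have qc: "q \<in> carrier (UP A)" by (auto simp: T.carrier_UP)
      have "p i = \<zero>\<^bsub>A\<^esub>" if "Suc n < i" for i using Suc.prems(1) that by (auto simp: bound_def)
      then have p: "p = q \<oplus>\<^bsub>P\<^esub> mon (p (Suc n)) (Suc n)"
      proof -
        assume high: "\<And>i. Suc n < i \<Longrightarrow> p i = \<zero>\<^bsub>A\<^esub>"
        have "q \<oplus>\<^bsub>P\<^esub> mon (p (Suc n)) (Suc n) = (\<lambda>i. q i \<oplus>\<^bsub>A\<^esub> mon (p (Suc n)) (Suc n) i)"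
          using T.add_P[OF qc mon_closed] by simp
        moreover have "q i \<oplus>\<^bsub>A\<^esub> mon (p (Suc n)) (Suc n) i = p i" for i
          using high[of i] by (cases "i \<le> n"; cases "i = Suc n") (simp_all add: q_def T.monom_eq)
        ultimately show ?thesis by simp
      qed
      have "f p = f q \<oplus>\<^bsub>Sp\<^esub> f (mon (p (Suc n)) (Suc n))"
        using f.hom_add[of q "mon (p (Suc n)) (Suc n)"] p qc by simp
      also have "\<dots> = f (mon (T.coeff_sum q) 0) \<oplus>\<^bsub>Sp\<^esub> f (mon (p (Suc n)) 0)"
        using Suc.IH[OF q qc] f_mon by simp
      also have "\<dots> = f (mon (T.coeff_sum q \<oplus>\<^bsub>A\<^esub> p (Suc n)) 0)"
        unfolding mon_add by (subst f.hom_add) simp_all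
      also have "T.coeff_sum q \<oplus>\<^bsub>A\<^esub> p (Suc n) = T.coeff_sum p"
        using arg_cong[OF p, of T.coeff_sum] qc by (simp add: T.coeff_sum_add T.coeff_sum_monom)
      finally show ?case .
    qed
    then show ?thesis using that by (auto simp: T.carrier_UP)
  qed
  have I_zero: "f (mon a 0) = \<zero>\<^bsub>Sp\<^esub>" if "a \<in> I" for a
  proof -
    have hom: "(\<lambda>a. f (mon a 0)) \<in> ring_hom A Sp"
    proof (rule ring_hom_memI)
      show "f (mon \<one>\<^bsub>A\<^esub> 0) = \<one>\<^bsub>Sp\<^esub>" using f.hom_one by simp
      show "f (mon (a \<otimes>\<^bsub>A\<^esub> b) 0) = f (mon a 0) \<otimes>\<^bsub>Sp\<^esub> f (mon b 0)" for a b
        using T.UP.monom_mult[of a b 0 0] f.hom_mult[of "mon a 0" "mon b 0"] by simp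
      show "f (mon (a \<oplus>\<^bsub>A\<^esub> b) 0) = f (mon a 0) \<oplus>\<^bsub>Sp\<^esub> f (mon b 0)" for a b
        using T.UP.monom_add[of a b 0] f.hom_add[of "mon a 0" "mon b 0"] by simp
      show "f (mon a 0) \<in> carrier Sp" for a using f.hom_closed[of "mon a 0"] by simp
    qed
    interpret h: ring_hom_ring A Sp "\<lambda>a. f (mon a 0)"
      by (intro ring_hom_ring.intro ring_hom_ring_axioms.intro hom T.ring_axioms Sp.ring_axioms)
    have ker: "relator v w \<in> a_kernel A Sp (\<lambda>a. f (mon a 0))" for v w
    proof -
      have "f (relator_t v w) = \<zero>\<^bsub>Sp\<^esub>"
      proof (rule iffD2[OF f_zero_iff])
        show "relator_t v w \<in> carrier P" by simp
        have "I_t B +>\<^bsub>P\<^esub> relator_t v w = \<zero>\<^bsub>Ht\<^esub>"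
          unfolding Ht It.zero_Q by (rule It.a_rcos_const[OF relator_t_in_I_t[OF B]])
        then show "I_t B +>\<^bsub>P\<^esub> relator_t v w \<in> J" by (simp only: J.zero_closed)
      qed
      moreover have "f (relator_t v w) = f (mon (relator v w) 0)"
        using f_sum[OF relator_t_closed, of v w] unfolding coeff_sum_relator .
      ultimately have "f (mon (relator v w) 0) = \<zero>\<^bsub>Sp\<^esub>" by simp
      then show ?thesis unfolding a_kernel_def' by simp
    qed
    have "I \<subseteq> a_kernel A Sp (\<lambda>a. f (mon a 0))"
      by (rule I_minimal[OF h.kernel_is_ideal ker])
    with that have "a \<in> a_kernel A Sp (\<lambda>a. f (mon a 0))" by (rule rev_subsetD)
    then show ?thesis unfolding a_kernel_def' by simp
  qed
  have zero_iff: "f p = \<zero>\<^bsub>Sp\<^esub> \<longleftrightarrow> g p = \<zero>\<^bsub>quotient_algebra A I\<^esub>" if p: "p \<in> carrier P" for p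
  proof
    assume "f p = \<zero>\<^bsub>Sp\<^esub>"
    then have "I_t B +>\<^bsub>P\<^esub> p \<in> J" using f_zero_iff[OF p] by blast
    then have "T.coeff_sum p \<in> I" by (rule J_sum[OF p])
    then show "g p = \<zero>\<^bsub>quotient_algebra A I\<^esub>" by (rule iffD2[OF g_zero_iff])
  next
    assume "g p = \<zero>\<^bsub>quotient_algebra A I\<^esub>"
    then have "T.coeff_sum p \<in> I" by (rule iffD1[OF g_zero_iff])
    then have "f (mon (T.coeff_sum p) 0) = \<zero>\<^bsub>Sp\<^esub>" by (rule I_zero)
    then show "f p = \<zero>\<^bsub>Sp\<^esub>" using f_sum[of p] p by simp
  qed
  have same_kernel: "f p = f q \<longleftrightarrow> g p = g q" if pq: "p \<in> carrier P" "q \<in> carrier P" for p q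
  proof -
    have "f p = f q \<longleftrightarrow> f (p \<ominus>\<^bsub>P\<^esub> q) = \<zero>\<^bsub>Sp\<^esub>"
      unfolding f.hom_minus[OF pq] by (rule Sp.minus_zero_iff[symmetric]) (rule f.hom_closed pq)+
    also have "\<dots> \<longleftrightarrow> g (p \<ominus>\<^bsub>P\<^esub> q) = \<zero>\<^bsub>quotient_algebra A I\<^esub>"
      by (rule zero_iff) (rule P.minus_closed[OF pq])
    also have "\<dots> \<longleftrightarrow> g p = g q"
      unfolding g.hom_minus[OF pq] by (rule K.minus_zero_iff) (rule g.hom_closed pq)+
    finally show ?thesis .
  qed
  show ?thesis
    unfolding Sp orbifold_algebra_def
    by (rule algebra_iso_of_same_kernel[OF P.complex_algebra_axioms f_hom f_surj _ g_hom g_surj])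
       (fact f_smult g_smult same_kernel)+
qed

end

section \<open>The doubled permutation representation\<close>

instance Perm.perm :: (finite) finite
proof
  have "inj (Perm.apply :: 'a perm \<Rightarrow> 'a \<Rightarrow> 'a)"
    by (rule injI) (simp add: perm_eq_iff)
  then show "finite (UNIV :: 'a perm set)" by (rule finite_imageD[rotated]) simp
qed

abbreviation doubled :: "'n perm \<Rightarrow> 'n + 'n \<Rightarrow> 'n + 'n" where
  "doubled g \<equiv> map_sum (Perm.apply g) (Perm.apply g)"

lemma apply_inverse_cancel [simp]:
  "Perm.apply (inverse g) (Perm.apply g i) = i" "Perm.apply g (Perm.apply (inverse g) i) = i"
  by (simp_all add: apply_sequence)

interpretation doubled: permutation_action "doubled :: 'n::finite perm \<Rightarrow> _" inverse
  by unfold_locales (simp_all add: map_sum.id map_sum.compositionality apply_times sum.map_comp)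

lemma xy_components [simp]:
  "xb i $ Inl k = of_bool (i = k)" "xb i $ Inr k = 0" "yb i $ Inr k = of_bool (i = k)" "yb i $ Inl k = 0"
  "x_sum $ Inl k = 1" "x_sum $ Inr k = 0" "y_sum $ Inr k = 1" "y_sum $ Inl k = 0"
  by (simp_all add: xb_def yb_def axis_def x_sum_def y_sum_def)

lemma rep_doubled: "doubled.rep = (doubled_perm_rep :: 'n::finite perm \<Rightarrow> _)"
proof (intro ext, unfold vec_eq_iff, intro allI)
  fix g :: "'n perm" and v :: "complex ^ ('n + 'n)" and e
  have inj: "Perm.apply g i = k \<longleftrightarrow> i = Perm.apply (inverse g) k" for i k by auto
  show "doubled.rep g v $ e = doubled_perm_rep g v $ e"
    by (cases e) (simp_all add: doubled.rep_def doubled_perm_rep_def inj of_bool_def if_distrib[of "\<lambda>x. _ * x"]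
        cong: if_cong)
qed

lemma rep_xb [simp]: "doubled_perm_rep g (xb i) = xb (Perm.apply g i)"
  and rep_yb [simp]: "doubled_perm_rep g (yb i) = yb (Perm.apply g i)"
  unfolding xb_def yb_def rep_doubled[symmetric] by (simp_all add: doubled.rep_axis)

lemma rep_linear [simp]:
  "doubled_perm_rep g (u + v) = doubled_perm_rep g u + doubled_perm_rep g v"
  "doubled_perm_rep g (u - v) = doubled_perm_rep g u - doubled_perm_rep g v"
  "doubled_perm_rep g (- v) = - doubled_perm_rep g v"
  "doubled_perm_rep g (z *s v) = z *s doubled_perm_rep g v"
  by (simp_all add: rep_doubled[symmetric] doubled.rep_def vec_eq_iff)

lemma sum_apply: "(\<Sum>k\<in>UNIV. f (Perm.apply g k)) = (\<Sum>k\<in>UNIV. f k)"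
  by (rule sum.reindex_bij_betw) (simp add: bij_apply)

lemma rep_sums [simp]:
  fixes g :: "'n::finite perm"
  shows "doubled_perm_rep g x_sum = x_sum" "doubled_perm_rep g y_sum = y_sum"
proof -
  have sum: "doubled_perm_rep g (\<Sum>k\<in>UNIV. f k) = (\<Sum>k\<in>UNIV. doubled_perm_rep g (f k))"
    for f :: "'n \<Rightarrow> complex ^ ('n + 'n)"
    by (simp add: rep_doubled[symmetric] doubled.rep_def vec_eq_iff)
  show "doubled_perm_rep g x_sum = x_sum" "doubled_perm_rep g y_sum = y_sum"
    unfolding x_sum_def y_sum_def sum using sum_apply[of xb g] sum_apply[of yb g] by simp_all
qed

lemma xy_basis_eq: "xy_basis = range (\<lambda>e. axis e 1)"
  unfolding xy_basis_def xb_def yb_def by (auto simp: image_iff) (metis sum.exhaust)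

locale doubled_cochains =
  fixes \<kappa>L :: "('n::finite perm, 'n + 'n) linear_cochain" and \<kappa>C :: "('n perm, 'n + 'n) constant_cochain"
  assumes lin: "linear_cochain \<kappa>L" and const: "constant_cochain \<kappa>C" and supp: "supported_on_identity \<kappa>L"
begin

sublocale orbifold_cochains "doubled :: 'n perm \<Rightarrow> _" inverse \<kappa>L \<kappa>C
  by (intro orbifold_cochains.intro doubled.permutation_action_axioms orbifold_cochains_axioms.intro lin const supp)

lemma \<kappa>L_diff: "\<kappa>L g u (v - w) = \<kappa>L g u v - \<kappa>L g u w" "\<kappa>L g u (- w) = - \<kappa>L g u w"
  "\<kappa>L g (u - v) w = \<kappa>L g u w - \<kappa>L g v w" "\<kappa>L g (- v) w = - \<kappa>L g v w"
proof -
  have 1: "\<kappa>L g u (- w) = - \<kappa>L g u w" for u w using \<kappa>L_simps(2)[of g u "- 1" w] by (simp add: vec_eq_iff)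
  have 2: "\<kappa>L g (- v) w = - \<kappa>L g v w" for v w using \<kappa>L_simps(4)[of g "- 1" v w] by (simp add: vec_eq_iff)
  show "\<kappa>L g u (v - w) = \<kappa>L g u v - \<kappa>L g u w" using \<kappa>L_simps(1)[of g u v "- w"] 1 by simp
  show "\<kappa>L g (u - v) w = \<kappa>L g u w - \<kappa>L g v w" using \<kappa>L_simps(3)[of g u "- v" w] 2 by simp
qed (use \<kappa>L_simps(2)[of g u "- 1" w] \<kappa>L_simps(4)[of g "- 1" v w] in \<open>simp_all add: vec_eq_iff\<close>)

lemma \<kappa>C_diff: "\<kappa>C g u (v - w) = \<kappa>C g u v - \<kappa>C g u w" "\<kappa>C g u (- w) = - \<kappa>C g u w"
proof -
  have 1: "\<kappa>C g u (- w) = - \<kappa>C g u w" for u w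
  proof -
    have "(- 1) *s w = - w" by (simp add: vec_eq_iff)
    then show ?thesis using \<kappa>C_simps(2)[of g u "- 1" w] by simp
  qed
  show "\<kappa>C g u (- w) = - \<kappa>C g u w" by (rule 1)
  show "\<kappa>C g u (v - w) = \<kappa>C g u v - \<kappa>C g u w" using \<kappa>C_simps(1)[of g u v "- w"] 1 by simp
qed

lemma \<kappa>L_sum: "\<kappa>L g u (\<Sum>k\<in>S. f k) = (\<Sum>k\<in>S. \<kappa>L g u (f k))"
  by (induction S rule: infinite_finite_induct) (simp_all add: \<kappa>L_simps)

lemma \<kappa>C_sum: "\<kappa>C g u (\<Sum>k\<in>S. f k) = (\<Sum>k\<in>S. \<kappa>C g u (f k))"
  by (induction S rule: infinite_finite_induct) (simp_all add: \<kappa>C_simps)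

lemma \<kappa>L_same [simp]: "\<kappa>L g u u = 0"
  using \<kappa>L_skew[of g u u] by (simp add: vec_eq_iff)

lemma \<kappa>C_same [simp]: "\<kappa>C g u u = 0"
  using \<kappa>C_skew[of g u u] by simp

lemma drinfeld_iff: "drinfeld_orbifold doubled_perm_rep \<kappa>L \<kappa>C \<longleftrightarrow> lie_orbifold_structure doubled l C inverse"
  using drinfeld_orbifold_iff unfolding rep_doubled .

end

subsection \<open>The three kinds of group elements\<close>

text \<open>
  The scalar with \<open>x\<^sub>i - \<sigma> x\<^sub>i = sgn_at p q i \<cdot> (x\<^sub>p - x\<^sub>q)\<close> for the transposition \<open>\<sigma> = (p q)\<close>.
\<close>

definition sgn_at :: "'n \<Rightarrow> 'n \<Rightarrow> 'n \<Rightarrow> complex" where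
  "sgn_at p q i = of_bool (i = p) - of_bool (i = q)"

lemma swap_eq_iff:
  assumes "i \<noteq> k" "p \<noteq> q"
  shows "Perm.swap i k = Perm.swap p q \<longleftrightarrow> (i = p \<and> k = q) \<or> (i = q \<and> k = p)"
proof
  assume "Perm.swap i k = Perm.swap p q"
  then have "Transposition.transpose i k x = Transposition.transpose p q x" for x
    by (metis swap.rep_eq)
  from this[of i] this[of k] show "(i = p \<and> k = q) \<or> (i = q \<and> k = p)"
    using assms by (auto simp: Transposition.transpose_def split: if_splits)
qed (auto simp: swap_sym)

lemma swap_ne_one: "i \<noteq> k \<Longrightarrow> Perm.swap i k \<noteq> 1"
proof
  assume "i \<noteq> k" "Perm.swap i k = 1"
  then have "Perm.apply (Perm.swap i k) i = i" by simp
  then show False using \<open>i \<noteq> k\<close> by (simp add: swap.rep_eq)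
qed

text \<open>
  The values \<open>\<kappa>\<^sup>C\<^sub>g(x\<^sub>i, y\<^sub>j)\<close> prescribed in the theorem, for equal and for different indices.
\<close>

definition constant_form :: "complex \<Rightarrow> complex \<Rightarrow> complex \<Rightarrow> 'n::finite perm \<Rightarrow> 'n \<Rightarrow> 'n \<Rightarrow> complex" where
  "constant_form \<alpha> \<beta> c g i j =
    (if i = j then \<alpha> * grp 1 g + c * (\<Sum>k\<in>UNIV - {i}. grp (Perm.swap i k) g)
     else \<beta> * grp 1 g - c * grp (Perm.swap i j) g)"

lemma constant_form_one: "constant_form \<alpha> \<beta> c 1 i j = (if i = j then \<alpha> else \<beta>)"
proof -
  have "(\<Sum>k\<in>UNIV - {i}. grp (Perm.swap i k) (1 :: 'a perm)) = 0"
    by (intro sum.neutral) (use swap_ne_one[of i] in \<open>auto simp: grp_def\<close>)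
  moreover have "grp (Perm.swap i j) (1 :: 'a perm) = 0" if "i \<noteq> j"
    using swap_ne_one[OF that] by (auto simp: grp_def)
  moreover have "grp 1 (1 :: 'a perm) = 1" by (simp add: grp_def)
  ultimately show ?thesis by (auto simp: constant_form_def)
qed

text \<open>
  In terms of the vectors moved by a transposition, the two sums over transpositions in the theorem
  combine to a bilinear form of rank one.
\<close>

lemma constant_form_swap:
  assumes pq: "p \<noteq> q"
  shows "constant_form \<alpha> \<beta> c (Perm.swap p q) i j = c * (sgn_at p q i * sgn_at p q j)"
proof -
  have one: "grp 1 (Perm.swap p q) = 0" using swap_ne_one[OF pq] by (simp add: grp_def)
  have sum: "(\<Sum>k\<in>UNIV - {i}. grp (Perm.swap i k) (Perm.swap p q)) = of_bool (i = p) + of_bool (i = q)"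
  proof -
    have "(\<Sum>k\<in>UNIV - {i}. grp (Perm.swap i k) (Perm.swap p q)) =
        (\<Sum>k\<in>UNIV - {i}. (if k = q then of_bool (i = p) else 0) + (if k = p then of_bool (i = q) else 0))"
      by (intro sum.cong refl) (use pq in \<open>auto simp: grp_def swap_eq_iff eq_commute[of "Perm.swap p q"]\<close>)
    also have "\<dots> = of_bool (i = p) + of_bool (i = q)"
      using pq by (auto simp: sum.distrib)
    finally show ?thesis .
  qed
  show ?thesis
  proof (cases "i = j")
    case True
    then show ?thesis using one sum pq by (auto simp: constant_form_def sgn_at_def)
  next
    case False
    then have "grp (Perm.swap i j) (Perm.swap p q) = - (sgn_at p q i * sgn_at p q j)"
      using pq by (auto simp: grp_def eq_commute[of "Perm.swap p q"] swap_eq_iff sgn_at_def)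
    then show ?thesis using False one by (simp add: constant_form_def)
  qed
qed

lemma constant_form_other:
  assumes "g \<noteq> 1" "\<And>p q. p \<noteq> q \<Longrightarrow> g \<noteq> Perm.swap p q"
  shows "constant_form \<alpha> \<beta> c g i j = 0"
proof -
  have swap: "grp (Perm.swap i k) g = 0" if "k \<noteq> i" for k
    using assms(2)[of i k] that by (auto simp: grp_def)
  have "grp 1 g = 0" using assms(1) by (simp add: grp_def)
  moreover have "(\<Sum>k\<in>UNIV - {i}. grp (Perm.swap i k) g) = 0" using swap by (intro sum.neutral) auto
  moreover have "i \<noteq> j \<Longrightarrow> grp (Perm.swap i j) g = 0" using swap[of j] by auto
  ultimately show ?thesis unfolding constant_form_def by (cases "i = j") simp_all
qed

lemma group_element_cases:
  obtains "g = 1" | p q where "p \<noteq> q" "g = Perm.swap p q"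
    | "g \<noteq> 1" "\<And>p q. p \<noteq> q \<Longrightarrow> g \<noteq> Perm.swap p q"
  by blast

lemma conj_swap: "g * Perm.swap p q * inverse g = Perm.swap (Perm.apply g p) (Perm.apply g q)"
proof (rule perm_eqI)
  fix i
  have inj: "i = Perm.apply g k \<longleftrightarrow> Perm.apply (inverse g) i = k" for k by auto
  show "Perm.apply (g * Perm.swap p q * inverse g) i = Perm.apply (Perm.swap (Perm.apply g p) (Perm.apply g q)) i"
    by (auto simp: apply_times swap.rep_eq Transposition.transpose_def inj)
qed

lemma constant_form_invariant:
  "constant_form \<alpha> \<beta> c (g * h * inverse g) (Perm.apply g i) (Perm.apply g j) = constant_form \<alpha> \<beta> c h i j"
proof (cases h rule: group_element_cases)
  case 1
  then show ?thesis by (simp add: constant_form_one apply_inj)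
next
  case (2 p q)
  then have "Perm.apply g p \<noteq> Perm.apply g q" by (simp add: apply_inj)
  then show ?thesis using 2 by (simp add: conj_swap constant_form_swap sgn_at_def apply_inj)
next
  case 3
  have restore: "h = inverse g * (g * h * inverse g) * inverse (inverse g)" by (simp add: mult.assoc[symmetric]) (simp add: mult.assoc)
  have "g * h * inverse g \<noteq> 1"
    using 3(1) restore by auto
  moreover have "g * h * inverse g \<noteq> Perm.swap p q" if "p \<noteq> q" for p q
    using 3(2)[of "Perm.apply (inverse g) p" "Perm.apply (inverse g) q"] restore that
    by (metis conj_swap apply_inj)
  ultimately show ?thesis using 3 by (simp add: constant_form_other)
qed

section \<open>The cochains of the theorem\<close>

lemma lie_orbifold_cochainsD:
  assumes "lie_orbifold_cochains a b \<alpha> \<beta> c \<kappa>L \<kappa>C" and "i \<noteq> j"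
  shows "(\<lambda>g. \<kappa>L g (xb i) (xb j)) = at_one (a 1 *s (xb i - xb j) + b 1 *s (yb i - yb j))"
    and "(\<lambda>g. \<kappa>C g (xb i) (xb j)) = (\<lambda>g. 0)"
    and "(\<lambda>g. \<kappa>L g (yb i) (yb j)) = at_one (a 2 *s (xb i - xb j) + b 2 *s (yb i - yb j))"
    and "(\<lambda>g. \<kappa>C g (yb i) (yb j)) = (\<lambda>g. 0)"
    and "(\<lambda>g. \<kappa>L g (xb i) (yb i)) = at_one (a 3 *s xb i + a 4 *s x_sum + b 3 *s yb i + b 4 *s y_sum)"
    and "(\<lambda>g. \<kappa>C g (xb i) (yb i)) = (\<lambda>g. constant_form \<alpha> \<beta> c g i i)"
    and "(\<lambda>g. \<kappa>L g (xb i) (yb j)) =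
      at_one (a 5 *s xb i + a 6 *s xb j + a 7 *s x_sum + b 5 *s yb i + b 6 *s yb j + b 7 *s y_sum)"
    and "(\<lambda>g. \<kappa>C g (xb i) (yb j)) = (\<lambda>g. constant_form \<alpha> \<beta> c g i j)"
proof -
  have form: "(\<lambda>g. constant_form \<alpha> \<beta> c g i i) = (\<lambda>g. \<alpha> * grp 1 g + c * (\<Sum>k\<in>UNIV - {i}. grp (Perm.swap i k) g))"
    "(\<lambda>g. constant_form \<alpha> \<beta> c g i j) = (\<lambda>g. \<beta> * grp 1 g - c * grp (Perm.swap i j) g)"
    using assms(2) by (simp_all add: constant_form_def)
  note D = assms(1)[unfolded lie_orbifold_cochains_def, THEN spec, THEN spec, THEN mp, OF assms(2)]
  show "(\<lambda>g. \<kappa>L g (xb i) (xb j)) = at_one (a 1 *s (xb i - xb j) + b 1 *s (yb i - yb j))"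
    "(\<lambda>g. \<kappa>C g (xb i) (xb j)) = (\<lambda>g. 0)"
    "(\<lambda>g. \<kappa>L g (yb i) (yb j)) = at_one (a 2 *s (xb i - xb j) + b 2 *s (yb i - yb j))"
    "(\<lambda>g. \<kappa>C g (yb i) (yb j)) = (\<lambda>g. 0)"
    "(\<lambda>g. \<kappa>L g (xb i) (yb i)) = at_one (a 3 *s xb i + a 4 *s x_sum + b 3 *s yb i + b 4 *s y_sum)"
    "(\<lambda>g. \<kappa>C g (xb i) (yb i)) = (\<lambda>g. constant_form \<alpha> \<beta> c g i i)"
    "(\<lambda>g. \<kappa>L g (xb i) (yb j)) =
      at_one (a 5 *s xb i + a 6 *s xb j + a 7 *s x_sum + b 5 *s yb i + b 6 *s yb j + b 7 *s y_sum)"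
    "(\<lambda>g. \<kappa>C g (xb i) (yb j)) = (\<lambda>g. constant_form \<alpha> \<beta> c g i j)"
    using D unfolding form by - (elim conjE, assumption)+
qed

lemma exists_other_index:
  assumes "CARD('n::finite) \<ge> 2"
  shows "\<exists>k. k \<noteq> (i :: 'n)"
proof (rule ccontr)
  assume "\<not> ?thesis"
  then have "UNIV = {i}" by auto
  then have "CARD('n) = card {i}" by (rule arg_cong)
  with assms show False by simp
qed

text \<open>
  The theorem prescribes the cochains on pairs of basis vectors; a second index is needed because the
  values for equal indices are prescribed only next to a different index.
\<close>

lemma lie_orbifold_cochains_supported:
  fixes \<kappa>L :: "('n::finite perm, 'n + 'n) linear_cochain"
  assumes two: "CARD('n) \<ge> 2" and L: "linear_cochain \<kappa>L" and coch: "lie_orbifold_cochains a b \<alpha> \<beta> c \<kappa>L \<kappa>C"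
  shows "supported_on_identity \<kappa>L"
proof -
  have lin: "Vector_Spaces.linear (*s) (*s) (\<kappa>L g u)" and skew: "\<kappa>L g u v = - \<kappa>L g v u" for g u v
    using L unfolding linear_cochain_def by blast+
  have zero: "\<kappa>L g u 0 = 0" for g u by (rule vec.linear_0[OF lin])
  have same: "\<kappa>L g u u = 0" for g u using skew[of g u u] by (simp add: vec_eq_iff)
  have other: "\<exists>k. k \<noteq> i" for i :: 'n using two by (rule exists_other_index)
  have vanish: "\<kappa>L g u v = 0" if "(\<lambda>g. \<kappa>L g u v) = at_one w" "g \<noteq> 1" for g u v w
    using fun_cong[OF that(1), of g] that(2) by (simp add: at_one_def)
  note D = lie_orbifold_cochainsD[OF coch]
  have xx: "\<kappa>L g (xb i) (xb j) = 0" if "g \<noteq> 1" for g i j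
    using same vanish[OF D(1) that] by (cases "i = j") auto
  have yy: "\<kappa>L g (yb i) (yb j) = 0" if "g \<noteq> 1" for g i j
    using same vanish[OF D(3) that] by (cases "i = j") auto
  have xy: "\<kappa>L g (xb i) (yb j) = 0" if "g \<noteq> 1" for g i j
  proof (cases "i = j")
    case True
    obtain k where "i \<noteq> k" using other[of i] by metis
    then show ?thesis using vanish[OF D(5) that] True by blast
  qed (rule vanish[OF D(7) that])
  have basis: "\<kappa>L g (axis e 1) (axis e' 1) = 0" if "g \<noteq> 1" for g e e'
  proof (cases e; cases e')
    fix i j assume "e = Inr i" "e' = Inl j"
    then show ?thesis using xy[OF that, of j i] skew[of g "yb i" "xb j"] by (simp flip: xb_def yb_def)
  qed (use xx[OF that] yy[OF that] xy[OF that] in \<open>simp_all flip: xb_def yb_def\<close>)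
  have "\<kappa>L g u v \<in> {0}" if "g \<noteq> 1" for g u v
  proof (rule skew_bilinear_mem[where r = "\<kappa>L g"])
    show "\<kappa>L g v w \<in> {0} \<Longrightarrow> \<kappa>L g w v \<in> {0}" for v w using skew[of g w v] by simp
    show "\<kappa>L g v w \<in> {0} \<Longrightarrow> \<kappa>L g v w' \<in> {0} \<Longrightarrow> \<kappa>L g v (w + w') \<in> {0}" for v w w'
      using vec.linear_add[OF lin, of g v w w'] by simp
    show "\<kappa>L g v w \<in> {0} \<Longrightarrow> \<kappa>L g v (z *s w) \<in> {0}" for v w z
      using vec.linear_scale[OF lin, of g v z w] by simp
  qed (use basis[OF that] zero in auto)
  then show ?thesis by (auto simp: supported_on_identity_def fun_eq_iff)
qed

locale lie_cochains = doubled_cochains \<kappa>L \<kappa>C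
  for \<kappa>L :: "('n::finite perm, 'n + 'n) linear_cochain" and \<kappa>C +
  fixes a b :: "nat \<Rightarrow> complex" and \<alpha> \<beta> c :: complex
  assumes cochains: "lie_orbifold_cochains a b \<alpha> \<beta> c \<kappa>L \<kappa>C" and two: "CARD('n) \<ge> 2"
begin

definition \<gamma> :: "nat \<Rightarrow> complex" where
  "\<gamma> k = gammas (of_nat CARD('n)) a b \<alpha> \<beta> c ! (k - 1)"

text \<open>
  The polynomials are numbered from 1, the members of the list from 0.
\<close>

lemma \<gamma>_zero_iff: "(\<forall>x\<in>set (gammas (of_nat CARD('n)) a b \<alpha> \<beta> c). x = 0) \<longleftrightarrow> (\<forall>k\<in>{1..22}. \<gamma> k = 0)"
proof -
  have len: "length (gammas (of_nat CARD('n)) a b \<alpha> \<beta> c) = 22" by (simp add: gammas_def Let_def)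
  have "(\<forall>x\<in>set (gammas (of_nat CARD('n)) a b \<alpha> \<beta> c). x = 0) \<longleftrightarrow> (\<forall>i<22. \<gamma> (Suc i) = 0)"
    unfolding all_set_conv_all_nth len \<gamma>_def by simp
  also have "\<dots> \<longleftrightarrow> (\<forall>k\<in>{1..22}. \<gamma> k = 0)"
  proof (intro iffI ballI allI impI)
    fix k :: nat assume *: "\<forall>i<22. \<gamma> (Suc i) = 0" and k: "k \<in> {1..22}"
    from k have "k - 1 < 22" "Suc (k - 1) = k" by auto
    with * show "\<gamma> k = 0" by metis
  next
    fix i :: nat assume "\<forall>k\<in>{1..22}. \<gamma> k = 0" "i < 22"
    then show "\<gamma> (Suc i) = 0" by simp
  qed
  finally show ?thesis .
qed

lemma other_index: "\<exists>k. k \<noteq> i" for i :: 'n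
  using two by (rule exists_other_index)

lemma at_one_one: "(\<lambda>g. \<kappa>L g u v) = at_one w \<Longrightarrow> \<kappa>L 1 u v = w"
  using fun_cong[of "\<lambda>g. \<kappa>L g u v" "at_one w" 1] by (simp add: at_one_def)

lemmas cochainsD = lie_orbifold_cochainsD[OF cochains]

lemma \<kappa>L_xx: "\<kappa>L 1 (xb i) (xb j) = a 1 *s (xb i - xb j) + b 1 *s (yb i - yb j)"
proof (cases "i = j")
  case False
  then show ?thesis by (rule at_one_one[OF cochainsD(1)])
qed simp

lemma \<kappa>L_yy: "\<kappa>L 1 (yb i) (yb j) = a 2 *s (xb i - xb j) + b 2 *s (yb i - yb j)"
proof (cases "i = j")
  case False
  then show ?thesis by (rule at_one_one[OF cochainsD(3)])
qed simp

lemma \<kappa>L_xy: "\<kappa>L 1 (xb i) (yb j) =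
    a 5 *s xb i + a 6 *s xb j + a 7 *s x_sum + b 5 *s yb i + b 6 *s yb j + b 7 *s y_sum
    + of_bool (i = j) *s ((a 3 - a 5 - a 6) *s xb i + (a 4 - a 7) *s x_sum + (b 3 - b 5 - b 6) *s yb i + (b 4 - b 7) *s y_sum)"
proof (cases "i = j")
  case True
  obtain k where "i \<noteq> k" using other_index[of i] by metis
  then have "\<kappa>L 1 (xb i) (yb i) = a 3 *s xb i + a 4 *s x_sum + b 3 *s yb i + b 4 *s y_sum"
    by (rule at_one_one[OF cochainsD(5)])
  then show ?thesis using True by (simp add: vec_eq_iff algebra_simps)
next
  case False
  then have "\<kappa>L 1 (xb i) (yb j) = a 5 *s xb i + a 6 *s xb j + a 7 *s x_sum + b 5 *s yb i + b 6 *s yb j + b 7 *s y_sum"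
    by (rule at_one_one[OF cochainsD(7)])
  then show ?thesis using False by simp
qed

lemma \<kappa>C_xx: "\<kappa>C g (xb i) (xb j) = 0"
  using fun_cong[OF cochainsD(2), of i j g] by (cases "i = j") simp_all

lemma \<kappa>C_yy: "\<kappa>C g (yb i) (yb j) = 0"
  using fun_cong[OF cochainsD(4), of i j g] by (cases "i = j") simp_all

lemma \<kappa>C_xy: "\<kappa>C g (xb i) (yb j) = constant_form \<alpha> \<beta> c g i j"
proof (cases "i = j")
  case True
  obtain k where "i \<noteq> k" using other_index[of i] by metis
  then show ?thesis using fun_cong[OF cochainsD(6), of i k g] True by simp
qed (use fun_cong[OF cochainsD(8), of i j g] in simp)

lemma \<kappa>L_yx: "\<kappa>L 1 (yb j) (xb i) = - \<kappa>L 1 (xb i) (yb j)"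
  by (rule \<kappa>L_skew)

lemma \<kappa>L_sums:
  "\<kappa>L 1 (xb i) x_sum = a 1 *s (of_nat CARD('n) *s xb i - x_sum) + b 1 *s (of_nat CARD('n) *s yb i - y_sum)"
  "\<kappa>L 1 (yb i) y_sum = a 2 *s (of_nat CARD('n) *s xb i - x_sum) + b 2 *s (of_nat CARD('n) *s yb i - y_sum)"
  "\<kappa>L 1 (xb i) y_sum = (of_nat CARD('n) * a 5) *s xb i + (a 6 + of_nat CARD('n) * a 7) *s x_sum + (of_nat CARD('n) * b 5) *s yb i + (b 6 + of_nat CARD('n) * b 7) *s y_sum
    + ((a 3 - a 5 - a 6) *s xb i + (a 4 - a 7) *s x_sum + (b 3 - b 5 - b 6) *s yb i + (b 4 - b 7) *s y_sum)"
  "\<kappa>L 1 (yb i) x_sum = - ((of_nat CARD('n) * a 6) *s xb i + (a 5 + of_nat CARD('n) * a 7) *s x_sum + (of_nat CARD('n) * b 6) *s yb i + (b 5 + of_nat CARD('n) * b 7) *s y_sum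
    + ((a 3 - a 5 - a 6) *s xb i + (a 4 - a 7) *s x_sum + (b 3 - b 5 - b 6) *s yb i + (b 4 - b 7) *s y_sum))"
proof -
  have scale: "(\<Sum>k\<in>UNIV. z *s f k) = z *s (\<Sum>k\<in>UNIV. f k)" for z and f :: "'n \<Rightarrow> complex ^ ('n + 'n)"
    by (simp add: vec_eq_iff sum_distrib_left)
  have delta: "(\<Sum>k\<in>UNIV. of_bool (i = k) *s f k) = f i" "(\<Sum>k\<in>UNIV. of_bool (k = i) *s f k) = f i"
    for i and f :: "'n \<Rightarrow> complex ^ ('n + 'n)"
    by (simp_all add: vec_eq_iff of_bool_def if_distrib[of "\<lambda>x. x * _"] cong: if_cong)
  have sums: "(\<Sum>k\<in>UNIV. xb k) = (x_sum :: complex ^ ('n + 'n))" "(\<Sum>k\<in>UNIV. yb k) = (y_sum :: complex ^ ('n + 'n))"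
    by (simp_all add: x_sum_def y_sum_def)
  have "\<kappa>L 1 (xb i) x_sum = (\<Sum>k\<in>UNIV. \<kappa>L 1 (xb i) (xb k))" "\<kappa>L 1 (yb i) y_sum = (\<Sum>k\<in>UNIV. \<kappa>L 1 (yb i) (yb k))"
    "\<kappa>L 1 (xb i) y_sum = (\<Sum>k\<in>UNIV. \<kappa>L 1 (xb i) (yb k))" "\<kappa>L 1 (yb i) x_sum = (\<Sum>k\<in>UNIV. \<kappa>L 1 (yb i) (xb k))"
    by (simp_all add: x_sum_def y_sum_def \<kappa>L_sum)
  note * = this
  show "\<kappa>L 1 (xb i) x_sum = a 1 *s (of_nat CARD('n) *s xb i - x_sum) + b 1 *s (of_nat CARD('n) *s yb i - y_sum)"
    "\<kappa>L 1 (yb i) y_sum = a 2 *s (of_nat CARD('n) *s xb i - x_sum) + b 2 *s (of_nat CARD('n) *s yb i - y_sum)"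
    unfolding * \<kappa>L_xx \<kappa>L_yy sum.distrib scale sum_subtractf sums by (simp_all add: vec_eq_iff of_nat_index)
  show "\<kappa>L 1 (xb i) y_sum = (of_nat CARD('n) * a 5) *s xb i + (a 6 + of_nat CARD('n) * a 7) *s x_sum + (of_nat CARD('n) * b 5) *s yb i + (b 6 + of_nat CARD('n) * b 7) *s y_sum
    + ((a 3 - a 5 - a 6) *s xb i + (a 4 - a 7) *s x_sum + (b 3 - b 5 - b 6) *s yb i + (b 4 - b 7) *s y_sum)"
    unfolding * \<kappa>L_xy sum.distrib scale delta sums by (simp add: vec_eq_iff of_nat_index algebra_simps)
  show "\<kappa>L 1 (yb i) x_sum = - ((of_nat CARD('n) * a 6) *s xb i + (a 5 + of_nat CARD('n) * a 7) *s x_sum + (of_nat CARD('n) * b 6) *s yb i + (b 5 + of_nat CARD('n) * b 7) *s y_sum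
    + ((a 3 - a 5 - a 6) *s xb i + (a 4 - a 7) *s x_sum + (b 3 - b 5 - b 6) *s yb i + (b 4 - b 7) *s y_sum))"
    unfolding * \<kappa>L_yx \<kappa>L_xy sum_negf sum.distrib scale delta sums by (simp add: vec_eq_iff of_nat_index algebra_simps)
qed

abbreviation jac :: "complex ^ ('n + 'n) \<Rightarrow> complex ^ ('n + 'n) \<Rightarrow> complex ^ ('n + 'n) \<Rightarrow> complex ^ ('n + 'n)" where
  "jac u v w \<equiv> \<kappa>L 1 u (\<kappa>L 1 v w) + \<kappa>L 1 v (\<kappa>L 1 w u) + \<kappa>L 1 w (\<kappa>L 1 u v)"

lemmas \<gamma>_simps = \<gamma>_def gammas_def Let_def

text \<open>
  The Jacobi expression for \<open>\<kappa>\<^sup>L\<close> on triples of basis vectors, expanded in the basis and the sums of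
  basis vectors. Because of \<open>\<kappa>\<^sup>L(x\<^sub>i, y\<^sub>i)\<close> the case of a repeated index is separate.
\<close>

lemma jac_xxy:
  assumes "i \<noteq> j"
  shows "jac (xb i) (xb j) (yb i) =
    - (\<gamma> 10 *s xb i) - \<gamma> 9 *s xb j + \<gamma> 13 *s yb i - \<gamma> 12 *s yb j - \<gamma> 8 *s x_sum - \<gamma> 11 *s y_sum"
  using assms not_sym[OF assms]
  unfolding vec_eq_iff
  by (intro allI) (simp add: \<gamma>_simps \<kappa>L_xx \<kappa>L_yy \<kappa>L_xy \<kappa>L_yx \<kappa>L_sums \<kappa>L_simps \<kappa>L_diff, simp add: algebra_simps)

lemma jac_xxy_distinct:
  assumes "i \<noteq> j" "i \<noteq> k" "j \<noteq> k"
  shows "jac (xb i) (xb j) (yb k) = \<gamma> 1 *s (xb i - xb j) + \<gamma> 2 *s (yb i - yb j)"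
  using assms assms[THEN not_sym]
  unfolding vec_eq_iff
  by (intro allI) (simp add: \<gamma>_simps \<kappa>L_xx \<kappa>L_yy \<kappa>L_xy \<kappa>L_yx \<kappa>L_sums \<kappa>L_simps \<kappa>L_diff, simp add: algebra_simps)

lemma jac_yyx:
  assumes "i \<noteq> j"
  shows "jac (yb i) (yb j) (xb i) =
    - (\<gamma> 18 *s xb i) - \<gamma> 17 *s xb j - \<gamma> 21 *s yb i - \<gamma> 20 *s yb j - \<gamma> 16 *s x_sum - \<gamma> 19 *s y_sum"
  using assms not_sym[OF assms]
  unfolding vec_eq_iff
  by (intro allI) (simp add: \<gamma>_simps \<kappa>L_xx \<kappa>L_yy \<kappa>L_xy \<kappa>L_yx \<kappa>L_sums \<kappa>L_simps \<kappa>L_diff, simp add: algebra_simps)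

lemma jac_yyx_distinct:
  assumes "i \<noteq> j" "i \<noteq> k" "j \<noteq> k"
  shows "jac (yb i) (yb j) (xb k) = \<gamma> 4 *s (xb i - xb j) + \<gamma> 5 *s (yb i - yb j)"
  using assms assms[THEN not_sym]
  unfolding vec_eq_iff
  by (intro allI) (simp add: \<gamma>_simps \<kappa>L_xx \<kappa>L_yy \<kappa>L_xy \<kappa>L_yx \<kappa>L_sums \<kappa>L_simps \<kappa>L_diff, simp add: algebra_simps)

lemma jac_xxx:
  assumes "i \<noteq> j" "i \<noteq> k" "j \<noteq> k"
  shows "jac (xb i) (xb j) (xb k) = 0"
  using assms assms[THEN not_sym]
  unfolding vec_eq_iff
  by (intro allI) (simp add: \<kappa>L_xx \<kappa>L_yy \<kappa>L_xy \<kappa>L_yx \<kappa>L_sums \<kappa>L_simps \<kappa>L_diff, simp add: algebra_simps)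

lemma jac_yyy:
  assumes "i \<noteq> j" "i \<noteq> k" "j \<noteq> k"
  shows "jac (yb i) (yb j) (yb k) = 0"
  using assms assms[THEN not_sym]
  unfolding vec_eq_iff
  by (intro allI) (simp add: \<kappa>L_xx \<kappa>L_yy \<kappa>L_xy \<kappa>L_yx \<kappa>L_sums \<kappa>L_simps \<kappa>L_diff, simp add: algebra_simps)

end

lemma moved_by_swap:
  assumes "p \<noteq> q"
  shows "xb i - xb (Perm.apply (Perm.swap p q) i) = sgn_at p q i *s (xb p - xb q)"
    and "yb i - yb (Perm.apply (Perm.swap p q) i) = sgn_at p q i *s (yb p - yb q)"
  using assms by (auto simp: swap.rep_eq Transposition.transpose_def sgn_at_def vec_eq_iff)

context lie_cochains
begin

lemma \<kappa>C_yx: "\<kappa>C g (yb j) (xb i) = - \<kappa>C g (xb i) (yb j)"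
  by (rule \<kappa>C_skew)

text \<open>
  The value of \<open>\<kappa>\<^sup>C\<^sub>g(x\<^sub>i, y\<^sub>1 + \<dots> + y\<^sub>n)\<close>. The contributions of transpositions to it cancel.
\<close>

definition row_sum :: "'n perm \<Rightarrow> complex" where
  "row_sum g = (if g = 1 then \<alpha> + (of_nat CARD('n) - 1) * \<beta> else 0)"

lemma sum_sgn_at: "p \<noteq> q \<Longrightarrow> (\<Sum>k\<in>(UNIV :: 'n set). sgn_at p q k) = 0"
  by (simp add: sgn_at_def sum_subtractf)

lemma sum_constant_form: "(\<Sum>k\<in>UNIV. constant_form \<alpha> \<beta> c g i k) = row_sum g" "(\<Sum>k\<in>UNIV. constant_form \<alpha> \<beta> c g k i) = row_sum g"
  for g :: "'n perm"
proof -
  have "(\<Sum>k\<in>UNIV. constant_form \<alpha> \<beta> c g i k) = row_sum g \<and> (\<Sum>k\<in>UNIV. constant_form \<alpha> \<beta> c g k i) = row_sum g"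
  proof (cases g rule: group_element_cases)
    case 1
    have "(\<Sum>k\<in>(UNIV :: 'n set). if i = k then \<alpha> else \<beta>) = (\<Sum>k\<in>(UNIV :: 'n set). \<beta> + (if k = i then \<alpha> - \<beta> else 0))"
      "(\<Sum>k\<in>(UNIV :: 'n set). if k = i then \<alpha> else \<beta>) = (\<Sum>k\<in>(UNIV :: 'n set). \<beta> + (if k = i then \<alpha> - \<beta> else 0))"
      by (intro sum.cong refl; simp)+
    then show ?thesis using 1 by (simp add: constant_form_one row_sum_def sum.distrib algebra_simps)
  next
    case (2 p q)
    have "row_sum g = 0" using 2 swap_ne_one[of p q] by (simp add: row_sum_def)
    then show ?thesis
      using 2 sum_sgn_at[of p q]
      by (simp add: constant_form_swap flip: sum_distrib_left sum_distrib_right)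
  next
    case 3
    then show ?thesis by (simp add: constant_form_other row_sum_def)
  qed
  then show "(\<Sum>k\<in>UNIV. constant_form \<alpha> \<beta> c g i k) = row_sum g" "(\<Sum>k\<in>UNIV. constant_form \<alpha> \<beta> c g k i) = row_sum g"
    by simp_all
qed

lemma \<kappa>C_sums:
  "\<kappa>C g (xb i) x_sum = 0" "\<kappa>C g (yb i) y_sum = 0" "\<kappa>C g (xb i) y_sum = row_sum g" "\<kappa>C g (yb i) x_sum = - row_sum g"
  unfolding x_sum_def y_sum_def \<kappa>C_sum \<kappa>C_xx \<kappa>C_yy \<kappa>C_yx \<kappa>C_xy sum_negf sum_constant_form by simp_all

abbreviation jac_const :: "'n perm \<Rightarrow> complex ^ ('n + 'n) \<Rightarrow> complex ^ ('n + 'n) \<Rightarrow> complex ^ ('n + 'n) \<Rightarrow> complex" where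
  "jac_const h u v w \<equiv> \<kappa>C h u (\<kappa>L 1 v w) + \<kappa>C h v (\<kappa>L 1 w u) + \<kappa>C h w (\<kappa>L 1 u v)"

lemmas jac_const_simps = \<kappa>L_xx \<kappa>L_yy \<kappa>L_xy \<kappa>L_yx \<kappa>C_xx \<kappa>C_yy \<kappa>C_xy \<kappa>C_yx \<kappa>C_sums \<kappa>C_simps \<kappa>C_diff

lemma jac_const_identity:
  assumes "i \<noteq> j"
  shows "jac_const 1 (xb i) (xb j) (yb i) = - \<gamma> 7" "jac_const 1 (yb i) (yb j) (xb i) = - \<gamma> 15"
  using assms assms[THEN not_sym]
  by (simp add: \<gamma>_simps jac_const_simps constant_form_one row_sum_def, simp add: algebra_simps)+

lemma jac_const_identity_distinct:
  assumes "i \<noteq> j" "i \<noteq> k" "j \<noteq> k"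
  shows "jac_const 1 (xb i) (xb j) (yb k) = 0" "jac_const 1 (yb i) (yb j) (xb k) = 0"
  using assms assms[THEN not_sym]
  by (simp add: jac_const_simps constant_form_one row_sum_def, (simp add: algebra_simps)?)+

lemma row_sum_swap: "p \<noteq> q \<Longrightarrow> row_sum (Perm.swap p q) = 0"
  using swap_ne_one[of p q] by (simp add: row_sum_def)

lemma jac_const_swap:
  assumes "i \<noteq> j" "p \<noteq> q"
  shows "jac_const (Perm.swap p q) (xb i) (xb j) (yb i) =
      (\<gamma> 14 + \<gamma> 3) * (sgn_at p q i * sgn_at p q j) + \<gamma> 3 * (sgn_at p q i * sgn_at p q i)"
    and "jac_const (Perm.swap p q) (yb i) (yb j) (xb i) =
      (\<gamma> 6 - \<gamma> 22) * (sgn_at p q i * sgn_at p q j) + \<gamma> 6 * (sgn_at p q i * sgn_at p q i)"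
  using assms assms[THEN not_sym]
  by (simp add: \<gamma>_simps jac_const_simps constant_form_swap row_sum_swap, simp add: algebra_simps)+

lemma jac_const_swap_distinct:
  assumes "i \<noteq> j" "i \<noteq> k" "j \<noteq> k" "p \<noteq> q"
  shows "jac_const (Perm.swap p q) (xb i) (xb j) (yb k) =
      \<gamma> 3 * (sgn_at p q i * sgn_at p q k - sgn_at p q j * sgn_at p q k)"
    and "jac_const (Perm.swap p q) (yb i) (yb j) (xb k) =
      \<gamma> 6 * (sgn_at p q i * sgn_at p q k - sgn_at p q j * sgn_at p q k)"
  using assms assms[THEN not_sym]
  by (simp add: \<gamma>_simps jac_const_simps constant_form_swap row_sum_swap, simp add: algebra_simps)+

lemma jac_const_same_kind:
  assumes "i \<noteq> j" "i \<noteq> k" "j \<noteq> k"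
  shows "jac_const h (xb i) (xb j) (xb k) = 0" "jac_const h (yb i) (yb j) (yb k) = 0"
proof -
  have sym: "constant_form \<alpha> \<beta> c h i j = constant_form \<alpha> \<beta> c h j i" for i j
    by (simp add: constant_form_def swap_sym)
  show "jac_const h (xb i) (xb j) (xb k) = 0" "jac_const h (yb i) (yb j) (yb k) = 0"
    using sym[of i j] sym[of i k] sym[of j k]
    by (simp_all add: jac_const_simps algebra_simps)
qed

lemma jac_const_other:
  assumes "h \<noteq> 1" "\<And>p q. p \<noteq> q \<Longrightarrow> h \<noteq> Perm.swap p q"
  shows "\<kappa>C h u v = 0"
proof -
  have basis: "\<kappa>C h (axis e 1) (axis e' 1) = 0" for e e'
    using assms
    by (cases e; cases e') (simp_all add: \<kappa>C_xx \<kappa>C_yy \<kappa>C_xy \<kappa>C_yx constant_form_other flip: xb_def yb_def)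
  have "\<kappa>C h u v \<in> {0}"
  proof (rule skew_bilinear_mem[where r = "\<kappa>C h"])
    show "\<kappa>C h v w \<in> {0} \<Longrightarrow> \<kappa>C h w v \<in> {0}" for v w using \<kappa>C_skew[of h w v] by simp
  qed (simp_all add: \<kappa>C_simps basis)
  then show ?thesis by simp
qed

abbreviation mixed :: "'n perm \<Rightarrow> complex ^ ('n + 'n) \<Rightarrow> complex ^ ('n + 'n) \<Rightarrow> complex ^ ('n + 'n) \<Rightarrow> complex ^ ('n + 'n)" where
  "mixed h u v w \<equiv> \<kappa>C h v w *s (u - doubled_perm_rep h u) + \<kappa>C h w u *s (v - doubled_perm_rep h v)
     + \<kappa>C h u v *s (w - doubled_perm_rep h w)"

text \<open>
  A transposition moves every \<open>x\<^sub>i\<close> by a multiple of one vector, with the coefficients that also describe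
  \<open>\<kappa>\<^sup>C\<close>; so the summands cancel in pairs.
\<close>

lemma mixed_vanishes:
  "mixed h (xb i) (xb j) (yb k) = 0" "mixed h (yb i) (yb j) (xb k) = 0"
  "mixed h (xb i) (xb j) (xb k) = 0" "mixed h (yb i) (yb j) (yb k) = 0"
proof -
  show "mixed h (xb i) (xb j) (xb k) = 0" "mixed h (yb i) (yb j) (yb k) = 0"
    by (simp_all add: \<kappa>C_xx \<kappa>C_yy)
  have "mixed h (xb i) (xb j) (yb k) = 0 \<and> mixed h (yb i) (yb j) (xb k) = 0"
  proof (cases h rule: group_element_cases)
    case (2 p q)
    then show ?thesis
      by (simp add: \<kappa>C_xx \<kappa>C_yy \<kappa>C_yx \<kappa>C_xy moved_by_swap constant_form_swap vec_eq_iff)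
  next
    case 3
    then show ?thesis by (simp add: jac_const_other)
  qed simp
  then show "mixed h (xb i) (xb j) (yb k) = 0" "mixed h (yb i) (yb j) (xb k) = 0" by auto
qed

text \<open>
  An alternating condition on triples of basis vectors has to be checked for few types of triples.
\<close>

lemma reduce_triples:
  fixes P :: "'n + 'n \<Rightarrow> 'n + 'n \<Rightarrow> 'n + 'n \<Rightarrow> bool"
  assumes swap: "\<And>u v w. P u v w \<Longrightarrow> P v u w" and cyc: "\<And>u v w. P u v w \<Longrightarrow> P v w u" and same: "\<And>u w. P u u w"
    and xxx: "\<And>i j k. i \<noteq> j \<Longrightarrow> i \<noteq> k \<Longrightarrow> j \<noteq> k \<Longrightarrow> P (Inl i) (Inl j) (Inl k)"
    and yyy: "\<And>i j k. i \<noteq> j \<Longrightarrow> i \<noteq> k \<Longrightarrow> j \<noteq> k \<Longrightarrow> P (Inr i) (Inr j) (Inr k)"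
    and xxy: "\<And>i j. i \<noteq> j \<Longrightarrow> P (Inl i) (Inl j) (Inr i)"
    and xxy': "\<And>i j k. i \<noteq> j \<Longrightarrow> i \<noteq> k \<Longrightarrow> j \<noteq> k \<Longrightarrow> P (Inl i) (Inl j) (Inr k)"
    and yyx: "\<And>i j. i \<noteq> j \<Longrightarrow> P (Inr i) (Inr j) (Inl i)"
    and yyx': "\<And>i j k. i \<noteq> j \<Longrightarrow> i \<noteq> k \<Longrightarrow> j \<noteq> k \<Longrightarrow> P (Inr i) (Inr j) (Inl k)"
  shows "P u v w"
proof -
  note same_cyc = same cyc[OF same] cyc[OF cyc[OF same]]
  have xxx: "P (Inl i) (Inl j) (Inl k)" and yyy: "P (Inr i) (Inr j) (Inr k)" for i j k
    using xxx[of i j k] yyy[of i j k] same_cyc by (cases "i = j"; cases "i = k"; cases "j = k"; simp)+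
  have xxy: "P (Inl i) (Inl j) (Inr k)" for i j k
    using xxy[of i j] xxy[of j i] xxy' same swap by (cases "i = j"; cases "i = k"; cases "j = k") auto
  have yyx: "P (Inr i) (Inr j) (Inl k)" for i j k
    using yyx[of i j] yyx[of j i] yyx' same swap by (cases "i = j"; cases "i = k"; cases "j = k") auto
  show ?thesis
    using xxx yyy xxy cyc[OF xxy] cyc[OF cyc[OF xxy]] yyx cyc[OF yyx] cyc[OF cyc[OF yyx]]
    by (cases u; cases v; cases w) simp_all
qed

text \<open>
  In the expansions above, the vectors \<open>x\<^sub>i\<close>, \<open>x\<^sub>j\<close> and the sum of all \<open>x\<^sub>k\<close> are linearly independent if
  there is an index besides \<open>i\<close> and \<open>j\<close>, and the same holds for \<open>y\<close>. Hence each coefficient has to vanish.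
  The polynomials with the factor \<open>c\<close> come from the components at transpositions.
\<close>

lemma jacobi_iff:
  assumes three: "CARD('n) \<ge> 3"
  shows "lie_orbifold_structure doubled l C inverse \<longleftrightarrow> (\<forall>k\<in>{1..22}. \<gamma> k = 0)"
proof
  assume "\<forall>k\<in>{1..22}. \<gamma> k = 0"
  then have \<gamma>: "\<gamma> k = 0" if "1 \<le> k" "k \<le> 22" for k using that by simp
  define P where "P e e' e'' \<longleftrightarrow> jac (axis e 1) (axis e' 1) (axis e'' 1) = 0
    \<and> (\<forall>h. jac_const h (axis e 1) (axis e' 1) (axis e'' 1) = 0) \<and> (\<forall>h. mixed h (axis e 1) (axis e' 1) (axis e'' 1) = 0)"
    for e e' e'' :: "'n + 'n"
  have const_zero: "jac_const h (xb i) (xb j) (yb i) = 0 \<and> jac_const h (yb i) (yb j) (xb i) = 0" if "i \<noteq> j" for h i j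
    by (cases h rule: group_element_cases)
       (use that in \<open>simp_all add: jac_const_identity jac_const_swap jac_const_other \<gamma>\<close>)
  have const_zero': "jac_const h (xb i) (xb j) (yb k) = 0 \<and> jac_const h (yb i) (yb j) (xb k) = 0"
    if "i \<noteq> j" "i \<noteq> k" "j \<noteq> k" for h i j k
    by (cases h rule: group_element_cases)
       (use that in \<open>simp_all add: jac_const_identity_distinct jac_const_swap_distinct jac_const_other \<gamma>\<close>)
  have P: "P u v w" for u v w
  proof (rule reduce_triples)
    show "P v w u" if "P u v w" for u v w
      using that unfolding P_def by (simp add: algebra_simps)
    show "P v u w" if "P u v w" for u v w
    proof -
      have neg: "jac (axis v 1) (axis u 1) (axis w 1) = - jac (axis u 1) (axis v 1) (axis w 1)"
        "jac_const h (axis v 1) (axis u 1) (axis w 1) = - jac_const h (axis u 1) (axis v 1) (axis w 1)"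
        "mixed h (axis v 1) (axis u 1) (axis w 1) = - mixed h (axis u 1) (axis v 1) (axis w 1)" for h
        unfolding \<kappa>L_skew[of 1 "axis u 1" "axis w 1"] \<kappa>L_skew[of 1 "axis w 1" "axis v 1"] \<kappa>L_skew[of 1 "axis v 1" "axis u 1"]
          \<kappa>C_skew[of h "axis u 1" "axis w 1"] \<kappa>C_skew[of h "axis w 1" "axis v 1"] \<kappa>C_skew[of h "axis v 1" "axis u 1"]
        by (simp_all add: \<kappa>L_diff \<kappa>C_diff algebra_simps)
      show ?thesis using that unfolding P_def neg by simp
    qed
    show "P u u w" for u w
      using \<kappa>L_skew[of 1 "axis u 1" "axis w 1"] \<kappa>C_skew[of _ "axis u 1" "axis w 1"]
      unfolding P_def by (simp add: \<kappa>L_diff \<kappa>C_diff \<kappa>L_simps \<kappa>C_simps)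
  qed (use const_zero const_zero' in \<open>simp_all add: P_def jac_xxx jac_yyy jac_xxy jac_xxy_distinct jac_yyx jac_yyx_distinct
        jac_const_same_kind mixed_vanishes[unfolded rep_xb rep_yb] \<gamma> flip: xb_def yb_def\<close>)
  show "lie_orbifold_structure doubled l C inverse"
  proof (rule lie_orbifold_structureI, unfold rep_doubled)
    fix g h e e' e''
    have cases: "\<exists>i. axis e (1::complex) = xb i \<or> axis e 1 = yb i" for e :: "'n + 'n"
      by (cases e) (auto simp: xb_def yb_def)
    show "\<kappa>L 1 (doubled_perm_rep g (axis e 1)) (doubled_perm_rep g (axis e' 1)) = doubled_perm_rep g (\<kappa>L 1 (axis e 1) (axis e' 1))"
      using cases[of e] cases[of e'] by (auto simp: \<kappa>L_xx \<kappa>L_yy \<kappa>L_xy \<kappa>L_yx apply_inj)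
    show "\<kappa>C (g * h * inverse g) (doubled_perm_rep g (axis e 1)) (doubled_perm_rep g (axis e' 1)) = \<kappa>C h (axis e 1) (axis e' 1)"
      using cases[of e] cases[of e'] by (auto simp: \<kappa>C_xx \<kappa>C_yy \<kappa>C_xy \<kappa>C_yx constant_form_invariant)
    show "jac (axis e 1) (axis e' 1) (axis e'' 1) = 0" "jac_const h (axis e 1) (axis e' 1) (axis e'' 1) = 0"
      "mixed h (axis e 1) (axis e' 1) (axis e'' 1) = 0"
      using P[of e e' e''] unfolding P_def by auto
  qed
next
  assume "lie_orbifold_structure doubled l C inverse"
  then have "drinfeld_orbifold doubled.rep \<kappa>L \<kappa>C" using drinfeld_orbifold_iff by blast
  then interpret D: drinfeld_orbifold_cochains "doubled :: 'n perm \<Rightarrow> _" inverse \<kappa>L \<kappa>C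
    by (intro drinfeld_orbifold_cochains.intro orbifold_cochains_axioms drinfeld_orbifold_cochains_axioms.intro)
  obtain S :: "'n set" where "card S = 3" using three by (metis obtain_subset_with_card_n)
  then obtain i j k :: 'n where ijk: "i \<noteq> j" "i \<noteq> k" "j \<noteq> k" by (auto simp: card_Suc_eq numeral_3_eq_3)
  have jac: "jac u v w = 0" and jac_const: "jac_const h u v w = 0" for h u v w
    by (rule D.jacobi)+
  have comp: "u = 0 \<Longrightarrow> u $ e = 0" for u :: "complex ^ ('n + 'n)" and e by simp
  note ne = ijk ijk[THEN not_sym]
  have "\<gamma> 1 = 0" "\<gamma> 2 = 0"
    using comp[OF jac[of "xb i" "xb j" "yb k"], of "Inl i"] comp[OF jac[of "xb i" "xb j" "yb k"], of "Inr i"] ne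
    unfolding jac_xxy_distinct[OF ijk] by simp_all
  moreover have "\<gamma> 4 = 0" "\<gamma> 5 = 0"
    using comp[OF jac[of "yb i" "yb j" "xb k"], of "Inl i"] comp[OF jac[of "yb i" "yb j" "xb k"], of "Inr i"] ne
    unfolding jac_yyx_distinct[OF ijk] by simp_all
  moreover have "\<gamma> 8 = 0" "\<gamma> 11 = 0" "\<gamma> 10 = 0" "\<gamma> 9 = 0" "\<gamma> 13 = 0" "\<gamma> 12 = 0"
    using comp[OF jac[of "xb i" "xb j" "yb i"], of "Inl k"] comp[OF jac[of "xb i" "xb j" "yb i"], of "Inr k"]
      comp[OF jac[of "xb i" "xb j" "yb i"], of "Inl i"] comp[OF jac[of "xb i" "xb j" "yb i"], of "Inl j"]
      comp[OF jac[of "xb i" "xb j" "yb i"], of "Inr i"] comp[OF jac[of "xb i" "xb j" "yb i"], of "Inr j"] ne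
    unfolding jac_xxy[OF ijk(1)] by simp_all
  moreover have "\<gamma> 16 = 0" "\<gamma> 19 = 0" "\<gamma> 18 = 0" "\<gamma> 17 = 0" "\<gamma> 21 = 0" "\<gamma> 20 = 0"
    using comp[OF jac[of "yb i" "yb j" "xb i"], of "Inl k"] comp[OF jac[of "yb i" "yb j" "xb i"], of "Inr k"]
      comp[OF jac[of "yb i" "yb j" "xb i"], of "Inl i"] comp[OF jac[of "yb i" "yb j" "xb i"], of "Inl j"]
      comp[OF jac[of "yb i" "yb j" "xb i"], of "Inr i"] comp[OF jac[of "yb i" "yb j" "xb i"], of "Inr j"] ne
    unfolding jac_yyx[OF ijk(1)] by simp_all
  moreover have "\<gamma> 7 = 0" "\<gamma> 15 = 0"
    using jac_const_identity[OF ijk(1)] jac_const[of 1] by simp_all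
  moreover have "\<gamma> 3 = 0" "\<gamma> 6 = 0"
    \<comment> \<open>For three different indices \<open>\<gamma>\<^sub>3\<close> and \<open>\<gamma>\<^sub>6\<close> stand alone.\<close>
    using jac_const_swap_distinct[OF ijk ijk(2)] jac_const[of "Perm.swap i k"] ne by (simp_all add: sgn_at_def)
  moreover from this have "\<gamma> 14 = 0" "\<gamma> 22 = 0"
    using jac_const_swap[OF ijk(1) ijk(1)] jac_const[of "Perm.swap i j"] ne by (simp_all add: sgn_at_def)
  ultimately show "\<forall>k\<in>{1..22}. \<gamma> k = 0" by (simp add: eval_nat_numeral atLeastAtMostSuc_conv)
qed

end

section \<open>Which cochains occur\<close>

text \<open>
  The values are corrected one point at a time by a transposition that fixes the values which are already
  right.
\<close>

lemma permutation_extending: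
  assumes "inj_on f S"
  shows "\<exists>g :: 'n::finite perm. \<forall>x\<in>S. Perm.apply g x = f x"
  using finite[of S] assms
proof (induction S rule: finite_induct)
  case (insert x S)
  then obtain g :: "'n perm" where g: "\<forall>y\<in>S. Perm.apply g y = f y" by auto
  have "Perm.apply (Perm.swap (Perm.apply g x) (f x) * g) y = f y" if "y \<in> insert x S" for y
  proof (cases "y = x")
    case False
    with that insert.prems insert.hyps(2) have "f y \<noteq> f x" "Perm.apply g y = f y" "Perm.apply g y \<noteq> Perm.apply g x"
      using g by (auto simp: apply_inj inj_on_def)
    then show ?thesis by (simp add: apply_times swap.rep_eq Transposition.transpose_def)
  qed (simp add: apply_times swap.rep_eq)
  then show ?case by blast
qed simp

lemma permutation_of_triple:
  assumes "i = j \<longleftrightarrow> i' = j'" "i = k \<longleftrightarrow> i' = k'" "j = k \<longleftrightarrow> j' = k'"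
  obtains g :: "'n::finite perm" where "Perm.apply g i = i'" "Perm.apply g j = j'" "Perm.apply g k = k'"
proof -
  define f where "f x = (if x = i then i' else if x = j then j' else k')" for x
  have f: "f i = i'" "f j = j'" "f k = k'" using assms by (auto simp: f_def)
  have "inj_on f {i, j, k}" using assms by (auto simp: f_def inj_on_def)
  from permutation_extending[OF this] obtain g :: "'n perm" where "\<forall>x\<in>{i, j, k}. Perm.apply g x = f x" ..
  with f show ?thesis using that[of g] by simp
qed

lemma three_indices:
  assumes "CARD('n::finite) \<ge> 3"
  obtains i j k :: "'n::finite" where "i \<noteq> j" "i \<noteq> k" "j \<noteq> k"
proof -
  obtain S :: "'n set" where "card S = 3" using assms by (metis obtain_subset_with_card_n)
  then show ?thesis using that by (auto simp: card_Suc_eq numeral_3_eq_3)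
qed

text \<open>
  Since any triple of indices can be moved to any other triple with the same coincidences, an invariant
  function has only finitely many values, which the following lemmas list.
\<close>

locale permutation_invariant =
  fixes f :: "'n::finite \<Rightarrow> 'n \<Rightarrow> 'n \<Rightarrow> complex"
  assumes invariant: "f (Perm.apply g i) (Perm.apply g j) (Perm.apply g k) = f i j k"
begin

lemma same_pattern:
  assumes "i = j \<longleftrightarrow> i' = j'" "i = k \<longleftrightarrow> i' = k'" "j = k \<longleftrightarrow> j' = k'"
  shows "f i j k = f i' j' k'"
  using invariant permutation_of_triple[OF assms] by metis

lemma diagonal_form:
  assumes "i0 \<noteq> (j0 :: 'n)"
  shows "\<exists>p q. \<forall>i k. f i i k = p * of_bool (k = i) + q"
proof (intro exI allI)
  fix i k
  show "f i i k = (f i0 i0 i0 - f i0 i0 j0) * of_bool (k = i) + f i0 i0 j0"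
    using same_pattern[of i i i0 i0 k i0] same_pattern[of i i i0 i0 k j0] assms by (cases "k = i") auto
qed

lemma off_diagonal_form:
  assumes "i0 \<noteq> (j0 :: 'n)" "i0 \<noteq> k0" "j0 \<noteq> k0"
  shows "\<exists>p q r. \<forall>i j k. i \<noteq> j \<longrightarrow> f i j k = p * of_bool (k = i) + q * of_bool (k = j) + r"
proof (intro exI allI impI)
  fix i j k :: 'n assume "i \<noteq> j"
  then show "f i j k = (f i0 j0 i0 - f i0 j0 k0) * of_bool (k = i) + (f i0 j0 j0 - f i0 j0 k0) * of_bool (k = j) + f i0 j0 k0"
    using same_pattern[of i j i0 j0 k i0] same_pattern[of i j i0 j0 k j0] same_pattern[of i j i0 j0 k k0] assms
    by (cases "k = i"; cases "k = j") auto
qed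

lemma skew_form:
  assumes ne: "i0 \<noteq> (j0 :: 'n)" and skew: "\<And>i j k. f i j k = - f j i k"
  shows "\<exists>p. \<forall>i j k. i \<noteq> j \<longrightarrow> f i j k = p * (of_bool (k = i) - of_bool (k = j))"
proof (intro exI allI impI)
  fix i j k :: 'n assume "i \<noteq> j"
  consider "k = i" | "k = j" | "k \<noteq> i" "k \<noteq> j" by blast
  then show "f i j k = f i0 j0 i0 * (of_bool (k = i) - of_bool (k = j))"
  proof cases
    case 1
    then show ?thesis using same_pattern[of i j i0 j0 k i0] ne \<open>i \<noteq> j\<close> by simp
  next
    case 2
    then show ?thesis using same_pattern[of j i i0 j0 k i0] skew[of i j k] ne \<open>i \<noteq> j\<close> by simp
  next
    case 3
    then have "f i j k = f j i k" using \<open>i \<noteq> j\<close> by (intro same_pattern) auto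
    then show ?thesis using 3 skew[of i j k] by simp
  qed
qed

end

locale drinfeld_doubled = doubled_cochains \<kappa>L \<kappa>C
  for \<kappa>L :: "('n::finite perm, 'n + 'n) linear_cochain" and \<kappa>C +
  assumes drinfeld: "drinfeld_orbifold doubled_perm_rep \<kappa>L \<kappa>C" and three: "CARD('n) \<ge> 3"
begin

sublocale D: drinfeld_orbifold_cochains "doubled :: 'n perm \<Rightarrow> _" inverse \<kappa>L \<kappa>C
  by (intro drinfeld_orbifold_cochains.intro orbifold_cochains_axioms drinfeld_orbifold_cochains_axioms.intro)
     (use drinfeld in \<open>simp only: rep_doubled\<close>)

lemmas invariance = D.invariance[unfolded rep_doubled]
lemmas mixed_jacobi = D.jacobi(3)[unfolded rep_doubled]

lemma rep_component:
  "doubled_perm_rep g v $ Inl (Perm.apply g k) = v $ Inl k" "doubled_perm_rep g v $ Inr (Perm.apply g k) = v $ Inr k"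
  by (simp_all flip: rep_doubled add: doubled.rep_def)

lemma \<kappa>L_invariant:
  "permutation_invariant (\<lambda>i j k. \<kappa>L 1 (xb i) (xb j) $ Inl k)" "permutation_invariant (\<lambda>i j k. \<kappa>L 1 (xb i) (xb j) $ Inr k)"
  "permutation_invariant (\<lambda>i j k. \<kappa>L 1 (yb i) (yb j) $ Inl k)" "permutation_invariant (\<lambda>i j k. \<kappa>L 1 (yb i) (yb j) $ Inr k)"
  "permutation_invariant (\<lambda>i j k. \<kappa>L 1 (xb i) (yb j) $ Inl k)" "permutation_invariant (\<lambda>i j k. \<kappa>L 1 (xb i) (yb j) $ Inr k)"
  by (unfold_locales, simp add: invariance rep_component flip: rep_xb rep_yb)+

lemma linear_part:
  obtains a b :: "nat \<Rightarrow> complex" where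
    "\<And>i j. i \<noteq> j \<Longrightarrow> \<kappa>L 1 (xb i) (xb j) = a 1 *s (xb i - xb j) + b 1 *s (yb i - yb j)"
    "\<And>i j. i \<noteq> j \<Longrightarrow> \<kappa>L 1 (yb i) (yb j) = a 2 *s (xb i - xb j) + b 2 *s (yb i - yb j)"
    "\<And>i. \<kappa>L 1 (xb i) (yb i) = a 3 *s xb i + a 4 *s x_sum + b 3 *s yb i + b 4 *s y_sum"
    "\<And>i j. i \<noteq> j \<Longrightarrow> \<kappa>L 1 (xb i) (yb j) =
      a 5 *s xb i + a 6 *s xb j + a 7 *s x_sum + b 5 *s yb i + b 6 *s yb j + b 7 *s y_sum"
proof -
  obtain i0 j0 k0 :: 'n where ne: "i0 \<noteq> j0" "i0 \<noteq> k0" "j0 \<noteq> k0" using three by (rule three_indices)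
  have skew: "\<kappa>L 1 u v $ e = - (\<kappa>L 1 v u $ e)" for u v e
    by (subst \<kappa>L_skew) simp
  obtain a1 where a1: "i \<noteq> j \<Longrightarrow> \<kappa>L 1 (xb i) (xb j) $ Inl k = a1 * (of_bool (k = i) - of_bool (k = j))" for i j k
    using permutation_invariant.skew_form[OF \<kappa>L_invariant(1) ne(1) skew] by blast
  obtain b1 where b1: "i \<noteq> j \<Longrightarrow> \<kappa>L 1 (xb i) (xb j) $ Inr k = b1 * (of_bool (k = i) - of_bool (k = j))" for i j k
    using permutation_invariant.skew_form[OF \<kappa>L_invariant(2) ne(1) skew] by blast
  obtain a2 where a2: "i \<noteq> j \<Longrightarrow> \<kappa>L 1 (yb i) (yb j) $ Inl k = a2 * (of_bool (k = i) - of_bool (k = j))" for i j k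
    using permutation_invariant.skew_form[OF \<kappa>L_invariant(3) ne(1) skew] by blast
  obtain b2 where b2: "i \<noteq> j \<Longrightarrow> \<kappa>L 1 (yb i) (yb j) $ Inr k = b2 * (of_bool (k = i) - of_bool (k = j))" for i j k
    using permutation_invariant.skew_form[OF \<kappa>L_invariant(4) ne(1) skew] by blast
  obtain a3 a4 where a34: "\<kappa>L 1 (xb i) (yb i) $ Inl k = a3 * of_bool (k = i) + a4" for i k
    using permutation_invariant.diagonal_form[OF \<kappa>L_invariant(5) ne(1)] by blast
  obtain b3 b4 where b34: "\<kappa>L 1 (xb i) (yb i) $ Inr k = b3 * of_bool (k = i) + b4" for i k
    using permutation_invariant.diagonal_form[OF \<kappa>L_invariant(6) ne(1)] by blast
  obtain a5 a6 a7 where a567: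
    "i \<noteq> j \<Longrightarrow> \<kappa>L 1 (xb i) (yb j) $ Inl k = a5 * of_bool (k = i) + a6 * of_bool (k = j) + a7" for i j k
    using permutation_invariant.off_diagonal_form[OF \<kappa>L_invariant(5) ne] by blast
  obtain b5 b6 b7 where b567:
    "i \<noteq> j \<Longrightarrow> \<kappa>L 1 (xb i) (yb j) $ Inr k = b5 * of_bool (k = i) + b6 * of_bool (k = j) + b7" for i j k
    using permutation_invariant.off_diagonal_form[OF \<kappa>L_invariant(6) ne] by blast
  have eqI: "v = w" if "\<And>k. v $ Inl k = w $ Inl k" "\<And>k. v $ Inr k = w $ Inr k" for v w :: "complex ^ ('n + 'n)"
    unfolding vec_eq_iff using that by (metis sum.exhaust)
  show ?thesis
    by (rule that[of "(!) [0, a1, a2, a3, a4, a5, a6, a7]" "(!) [0, b1, b2, b3, b4, b5, b6, b7]"]; rule eqI)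
       (simp_all add: a1 b1 a2 b2 a34 b34 a567 b567 of_bool_def)
qed

text \<open>
  At the identity, exchanging \<open>i\<close> and \<open>j\<close> shows that the value equals its negative. At \<open>h \<noteq> 1\<close> the
  identity for \<open>x\<^sub>i\<close>, \<open>x\<^sub>j\<close> and a vector \<open>y\<^sub>m\<close> moved by \<open>h\<close> has no other term in the direction of \<open>y\<^sub>m\<close>.
\<close>

lemma \<kappa>C_same_kind: "\<kappa>C h (xb i) (xb j) = 0" "\<kappa>C h (yb i) (yb j) = 0"
proof -
  have "\<kappa>C h (xb i) (xb j) = 0 \<and> \<kappa>C h (yb i) (yb j) = 0"
  proof (cases "h = 1")
    case True
    obtain g :: "'n perm" where g: "Perm.apply g i = j" "Perm.apply g j = i"
      using permutation_of_triple[of i j j i j i] by metis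
    have "\<kappa>C 1 (xb j) (xb i) = \<kappa>C 1 (xb i) (xb j)" "\<kappa>C 1 (yb j) (yb i) = \<kappa>C 1 (yb i) (yb j)"
      using invariance(2)[of g 1 "xb i" "xb j"] invariance(2)[of g 1 "yb i" "yb j"] g by simp_all
    then show ?thesis
      using \<kappa>C_skew[of 1 "xb i" "xb j"] \<kappa>C_skew[of 1 "yb i" "yb j"] True by simp
  next
    case False
    then obtain m where m: "Perm.apply h m \<noteq> m" by (metis apply_one perm_eqI id_apply)
    have "(\<kappa>C h (xb j) (yb m) *s (xb i - xb (Perm.apply h i)) + \<kappa>C h (yb m) (xb i) *s (xb j - xb (Perm.apply h j))
        + \<kappa>C h (xb i) (xb j) *s (yb m - yb (Perm.apply h m))) $ Inr m = 0"
      using mixed_jacobi[of h "xb j" "yb m" "xb i"] by simp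
    moreover have "(\<kappa>C h (yb j) (xb m) *s (yb i - yb (Perm.apply h i)) + \<kappa>C h (xb m) (yb i) *s (yb j - yb (Perm.apply h j))
        + \<kappa>C h (yb i) (yb j) *s (xb m - xb (Perm.apply h m))) $ Inl m = 0"
      using mixed_jacobi[of h "yb j" "xb m" "yb i"] by simp
    ultimately show ?thesis using m m[symmetric] by simp
  qed
  then show "\<kappa>C h (xb i) (xb j) = 0" "\<kappa>C h (yb i) (yb j) = 0" by simp_all
qed

text \<open>
  The mixed identity for \<open>x\<^sub>i\<close>, \<open>x\<^sub>m\<close>, \<open>y\<^sub>j\<close> has only two terms left, and so has the one for \<open>y\<^sub>j\<close>, \<open>y\<^sub>m\<close>,
  \<open>x\<^sub>i\<close>.
\<close>

lemma \<kappa>C_proportional: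
  "\<kappa>C h (xb m) (yb j) *s (xb i - xb (Perm.apply h i)) = \<kappa>C h (xb i) (yb j) *s (xb m - xb (Perm.apply h m))"
  "\<kappa>C h (xb i) (yb m) *s (yb j - yb (Perm.apply h j)) = \<kappa>C h (xb i) (yb j) *s (yb m - yb (Perm.apply h m))"
proof -
  have neg: "(- z) *s v = - (z *s v)" for z and v :: "complex ^ ('n + 'n)" by (simp add: vec_eq_iff)
  show "\<kappa>C h (xb m) (yb j) *s (xb i - xb (Perm.apply h i)) = \<kappa>C h (xb i) (yb j) *s (xb m - xb (Perm.apply h m))"
    using mixed_jacobi[of h "xb m" "yb j" "xb i"]
    unfolding \<kappa>C_skew[of h "yb j" "xb i"] by (simp add: \<kappa>C_same_kind neg)
  show "\<kappa>C h (xb i) (yb m) *s (yb j - yb (Perm.apply h j)) = \<kappa>C h (xb i) (yb j) *s (yb m - yb (Perm.apply h m))"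
    using mixed_jacobi[of h "yb m" "xb i" "yb j"]
    unfolding \<kappa>C_skew[of h "yb m" "xb i"] by (simp add: \<kappa>C_same_kind neg)
qed

text \<open>
  If \<open>h\<close> is neither the identity nor a transposition, it moves some \<open>m\<close> such that \<open>x\<^sub>m\<close> does not occur in
  \<open>x\<^sub>i - h x\<^sub>i\<close>. The first proportionality then leaves the value as a coefficient of \<open>x\<^sub>m\<close>.
\<close>

lemma \<kappa>C_other:
  assumes h: "h \<noteq> 1" "\<And>p q. p \<noteq> q \<Longrightarrow> h \<noteq> Perm.swap p q"
  shows "\<kappa>C h (xb i) (yb j) = 0"
proof -
  have "\<exists>m. Perm.apply h m \<noteq> m \<and> (Perm.apply h i \<noteq> i \<longrightarrow> m \<noteq> i \<and> m \<noteq> Perm.apply h i)"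
  proof (cases "Perm.apply h i = i")
    case True
    then show ?thesis using h(1) by (metis apply_one perm_eqI id_apply)
  next
    case False
    show ?thesis
    proof (rule ccontr)
      assume "\<not> ?thesis"
      with False have fixed: "Perm.apply h m = m" if "m \<noteq> i" "m \<noteq> Perm.apply h i" for m using that by blast
      have "Perm.apply h (Perm.apply h i) = i"
        using fixed[of "Perm.apply h (Perm.apply h i)"] False by (auto simp: apply_inj)
      then have "h = Perm.swap i (Perm.apply h i)"
        by (intro perm_eqI) (use fixed in \<open>auto simp: swap.rep_eq Transposition.transpose_def\<close>)
      with h(2) False show False by metis
    qed
  qed
  then obtain m where m: "Perm.apply h m \<noteq> m" "Perm.apply h i \<noteq> i \<Longrightarrow> m \<noteq> i \<and> m \<noteq> Perm.apply h i" by blast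
  have "(\<kappa>C h (xb m) (yb j) *s (xb i - xb (Perm.apply h i))) $ Inl m = (\<kappa>C h (xb i) (yb j) *s (xb m - xb (Perm.apply h m))) $ Inl m"
    by (simp only: \<kappa>C_proportional(1))
  then show ?thesis using m m(1)[symmetric] by (cases "Perm.apply h i = i") auto
qed

text \<open>
  For a transposition both proportionalities have the moved vectors on a common line.
\<close>

lemma \<kappa>C_swap:
  assumes "p \<noteq> q"
  shows "\<kappa>C (Perm.swap p q) (xb i) (yb j) = \<kappa>C (Perm.swap p q) (xb p) (yb p) * (sgn_at p q i * sgn_at p q j)"
proof -
  have "\<kappa>C (Perm.swap p q) (xb i) (yb j) = \<kappa>C (Perm.swap p q) (xb p) (yb j) * sgn_at p q i" for i j
    using arg_cong[OF \<kappa>C_proportional(1)[of "Perm.swap p q" p j i], of "\<lambda>v. v $ Inl p"] assms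
    by (simp add: moved_by_swap sgn_at_def)
  moreover have "\<kappa>C (Perm.swap p q) (xb i) (yb j) = \<kappa>C (Perm.swap p q) (xb i) (yb p) * sgn_at p q j" for i j
    using arg_cong[OF \<kappa>C_proportional(2)[of "Perm.swap p q" i p j], of "\<lambda>v. v $ Inr p"] assms
    by (simp add: moved_by_swap sgn_at_def)
  ultimately show ?thesis by (metis mult.assoc mult.commute)
qed

lemma constant_part:
  obtains \<alpha> \<beta> c where "\<And>g i j. \<kappa>C g (xb i) (yb j) = constant_form \<alpha> \<beta> c g i j"
proof -
  obtain i0 j0 k0 :: 'n where ne: "i0 \<noteq> j0" "i0 \<noteq> k0" "j0 \<noteq> k0" using three by (rule three_indices)
  have one: "\<kappa>C 1 (xb i) (yb j) = \<kappa>C 1 (xb i') (yb j')" if ij: "i = j \<longleftrightarrow> i' = j'" for i j i' j'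
  proof -
    obtain g :: "'n perm" where "Perm.apply g i = i'" "Perm.apply g j = j'"
      using permutation_of_triple[of i j i' j' j j'] ij by metis
    then show ?thesis using invariance(2)[of g 1 "xb i" "yb j"] by simp
  qed
  have swap: "\<kappa>C (Perm.swap p q) (xb p) (yb p) = \<kappa>C (Perm.swap i0 j0) (xb i0) (yb i0)" if pq: "p \<noteq> q" for p q
  proof -
    obtain g :: "'n perm" where "Perm.apply g i0 = p" "Perm.apply g j0 = q"
      using permutation_of_triple[of i0 j0 p q j0 q] pq ne by metis
    then show ?thesis using invariance(2)[of g "Perm.swap i0 j0" "xb i0" "yb i0"] by (simp add: conj_swap)
  qed
  have "\<kappa>C g (xb i) (yb j) =
      constant_form (\<kappa>C 1 (xb i0) (yb i0)) (\<kappa>C 1 (xb i0) (yb j0)) (\<kappa>C (Perm.swap i0 j0) (xb i0) (yb i0)) g i j" for g i j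
  proof (cases g rule: group_element_cases)
    case 1
    then show ?thesis using one[of i j i0 i0] one[of i j i0 j0] ne by (simp add: constant_form_one)
  next
    case (2 p q)
    then show ?thesis by (simp add: constant_form_swap \<kappa>C_swap[of p q i j] swap)
  next
    case 3
    then show ?thesis by (simp add: constant_form_other \<kappa>C_other)
  qed
  then show ?thesis by (rule that)
qed

theorem cochain_form: "\<exists>a b \<alpha> \<beta> c. lie_orbifold_cochains a b \<alpha> \<beta> c \<kappa>L \<kappa>C"
proof (rule linear_part)
  fix a b :: "nat \<Rightarrow> complex"
  assume L:
    "\<And>i j. i \<noteq> j \<Longrightarrow> \<kappa>L 1 (xb i) (xb j) = a 1 *s (xb i - xb j) + b 1 *s (yb i - yb j)"
    "\<And>i j. i \<noteq> j \<Longrightarrow> \<kappa>L 1 (yb i) (yb j) = a 2 *s (xb i - xb j) + b 2 *s (yb i - yb j)"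
    "\<And>i. \<kappa>L 1 (xb i) (yb i) = a 3 *s xb i + a 4 *s x_sum + b 3 *s yb i + b 4 *s y_sum"
    "\<And>i j. i \<noteq> j \<Longrightarrow> \<kappa>L 1 (xb i) (yb j) =
      a 5 *s xb i + a 6 *s xb j + a 7 *s x_sum + b 5 *s yb i + b 6 *s yb j + b 7 *s y_sum"
  obtain \<alpha> \<beta> c where C: "\<And>g i j. \<kappa>C g (xb i) (yb j) = constant_form \<alpha> \<beta> c g i j"
    using constant_part by blast
  have at_one: "(\<lambda>g. \<kappa>L g u v) = at_one (\<kappa>L 1 u v)" for u v
    by (auto simp: at_one_def \<kappa>L_off_identity)
  have "lie_orbifold_cochains a b \<alpha> \<beta> c \<kappa>L \<kappa>C"
    unfolding lie_orbifold_cochains_def at_one C \<kappa>C_same_kind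
    by (intro allI impI conjI refl arg_cong[of _ _ at_one] L; simp add: constant_form_def)
  then show ?thesis by blast
qed

end

section \<open>The classification\<close>

theorem theorem7p1:
  assumes "CARD('n::finite) \<ge> 3"
  shows
    "(\<forall>a b \<alpha> \<beta> c.
        \<forall>(\<kappa>L :: ('n perm, 'n + 'n) linear_cochain) (\<kappa>C :: ('n perm, 'n + 'n) constant_cochain).
          (\<forall>\<gamma> \<in> set (gammas (of_nat CARD('n)) a b \<alpha> \<beta> c). \<gamma> = 0) \<and>
          linear_cochain \<kappa>L \<and> constant_cochain \<kappa>C \<and> lie_orbifold_cochains a b \<alpha> \<beta> c \<kappa>L \<kappa>C
          \<longrightarrow>
          lie_orbifold_over_t doubled_perm_rep \<kappa>L \<kappa>C
            (orbifold_algebra_t doubled_perm_rep xy_basis \<kappa>L \<kappa>C) \<and>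
          algebra_iso (specialization doubled_perm_rep xy_basis \<kappa>L \<kappa>C)
            (orbifold_algebra doubled_perm_rep \<kappa>L \<kappa>C) \<noteq> {}) \<and>
     (\<forall>(\<kappa>L :: ('n perm, 'n + 'n) linear_cochain) (\<kappa>C :: ('n perm, 'n + 'n) constant_cochain).
        linear_cochain \<kappa>L \<and> constant_cochain \<kappa>C
        \<longrightarrow>
        (drinfeld_orbifold doubled_perm_rep \<kappa>L \<kappa>C \<and> supported_on_identity \<kappa>L \<longleftrightarrow>
         (\<exists>a b \<alpha> \<beta> c.
            (\<forall>\<gamma> \<in> set (gammas (of_nat CARD('n)) a b \<alpha> \<beta> c). \<gamma> = 0) \<and>
            lie_orbifold_cochains a b \<alpha> \<beta> c \<kappa>L \<kappa>C)))"
proof -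
  have two: "CARD('n) \<ge> 2" using assms by simp
  have equations: "supported_on_identity \<kappa>L \<and> (drinfeld_orbifold doubled_perm_rep \<kappa>L \<kappa>C \<longleftrightarrow>
      (\<forall>\<gamma> \<in> set (gammas (of_nat CARD('n)) a b \<alpha> \<beta> c). \<gamma> = 0))"
    if "linear_cochain \<kappa>L" "constant_cochain \<kappa>C" "lie_orbifold_cochains a b \<alpha> \<beta> c \<kappa>L \<kappa>C"
    for a b \<alpha> \<beta> c and \<kappa>L :: "('n perm, 'n + 'n) linear_cochain" and \<kappa>C :: "('n perm, 'n + 'n) constant_cochain"
  proof -
    have supp: "supported_on_identity \<kappa>L" by (rule lie_orbifold_cochains_supported[OF two that(1) that(3)])
    interpret lie_cochains \<kappa>L \<kappa>C a b \<alpha> \<beta> c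
      by unfold_locales (fact that supp two)+
    show ?thesis using supp drinfeld_iff jacobi_iff[OF assms] \<gamma>_zero_iff by simp
  qed
  have algebras: "orbifold_algebra_t doubled_perm_rep xy_basis \<kappa>L \<kappa>C = orbifold_algebra_t doubled_perm_rep UNIV \<kappa>L \<kappa>C \<and>
      algebra_iso (specialization doubled_perm_rep xy_basis \<kappa>L \<kappa>C) (orbifold_algebra doubled_perm_rep \<kappa>L \<kappa>C) \<noteq> {}"
    if "linear_cochain \<kappa>L" "constant_cochain \<kappa>C" "supported_on_identity \<kappa>L"
    for \<kappa>L :: "('n perm, 'n + 'n) linear_cochain" and \<kappa>C :: "('n perm, 'n + 'n) constant_cochain"
  proof -
    interpret doubled_cochains \<kappa>L \<kappa>C by unfold_locales (fact that)+
    show ?thesis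
      using orbifold_algebra_t_basis[of xy_basis] specialization_iso[of xy_basis] by (simp add: xy_basis_eq rep_doubled)
  qed
  have form: "\<exists>a b \<alpha> \<beta> c. lie_orbifold_cochains a b \<alpha> \<beta> c \<kappa>L \<kappa>C"
    if "linear_cochain \<kappa>L" "constant_cochain \<kappa>C" "supported_on_identity \<kappa>L" "drinfeld_orbifold doubled_perm_rep \<kappa>L \<kappa>C"
    for \<kappa>L :: "('n perm, 'n + 'n) linear_cochain" and \<kappa>C :: "('n perm, 'n + 'n) constant_cochain"
  proof -
    interpret drinfeld_doubled \<kappa>L \<kappa>C by unfold_locales (fact that assms)+
    show ?thesis by (rule cochain_form)
  qed
  show ?thesis
  proof (intro conjI allI impI)
    fix a b \<alpha> \<beta> c and \<kappa>L :: "('n perm, 'n + 'n) linear_cochain" and \<kappa>C :: "('n perm, 'n + 'n) constant_cochain"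
    assume *: "(\<forall>\<gamma> \<in> set (gammas (of_nat CARD('n)) a b \<alpha> \<beta> c). \<gamma> = 0) \<and>
      linear_cochain \<kappa>L \<and> constant_cochain \<kappa>C \<and> lie_orbifold_cochains a b \<alpha> \<beta> c \<kappa>L \<kappa>C"
    then have "supported_on_identity \<kappa>L" "drinfeld_orbifold doubled_perm_rep \<kappa>L \<kappa>C" using equations by blast+
    with * algebras show "lie_orbifold_over_t doubled_perm_rep \<kappa>L \<kappa>C (orbifold_algebra_t doubled_perm_rep xy_basis \<kappa>L \<kappa>C)"
      "algebra_iso (specialization doubled_perm_rep xy_basis \<kappa>L \<kappa>C) (orbifold_algebra doubled_perm_rep \<kappa>L \<kappa>C) \<noteq> {}"
      unfolding lie_orbifold_over_t_def by blast+
  next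
    fix \<kappa>L :: "('n perm, 'n + 'n) linear_cochain" and \<kappa>C :: "('n perm, 'n + 'n) constant_cochain"
    assume "linear_cochain \<kappa>L \<and> constant_cochain \<kappa>C"
    then show "drinfeld_orbifold doubled_perm_rep \<kappa>L \<kappa>C \<and> supported_on_identity \<kappa>L \<longleftrightarrow>
         (\<exists>a b \<alpha> \<beta> c. (\<forall>\<gamma> \<in> set (gammas (of_nat CARD('n)) a b \<alpha> \<beta> c). \<gamma> = 0) \<and>
            lie_orbifold_cochains a b \<alpha> \<beta> c \<kappa>L \<kappa>C)"
      using equations[of \<kappa>L \<kappa>C] form[of \<kappa>L \<kappa>C] by (blast | meson | metis)
  qed
qed

end
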